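(* Let $A\in L^3(\mathbb{R}^3;\mathbb{R}^3)$, let $3/2<p<\infty$, and let $\psi\in L^p(\mathbb{R}^3;\mathbb{C}^2)$ satisfy $\sigma\cdot(-i\nabla-A)\psi=0$ in $\mathbb{R}^3$ in the sense of distributions. Then $\psi\in H^1(\mathbb{R}^3;\mathbb{C}^2)$, also $|\psi|\in H^1(\mathbb{R}^3)$, and moreover, almost everywhere in $\mathbb{R}^3$, $$\bigl|\nabla|\psi|\bigr|^2\ \le\ \frac23\,\bigl|(-i\nabla-A)\psi\bigr|^2 .$$
   Context: $\sigma=(\sigma_1,\sigma_2,\sigma_3)$ is the vector of Pauli matrices $\sigma_1=\begin{pmatrix}0&1\\1&0\end{pmatrix}$, $\sigma_2=\begin{pmatrix}0&-i\\i&0\end{pmatrix}$, $\sigma_3=\begin{pmatrix}1&0\\0&-1\end{pmatrix}$, and $\sigma\cdot(-i\nabla-A)\psi=\sum_j\sigma_j(-i\partial_j\psi-A_j\psi)$. $|\psi(x)|$ is the norm in $\mathbb{C}^2$, and $|(-i\nabla-A)\psi|^2=\sum_{j=1}^3|(-i\partial_j-A_j)\psi|^2$. *)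

theory Defs
  imports "HOL-Analysis.Analysis"
begin

definition partial_deriv :: "'n::finite \<Rightarrow> (real^'n \<Rightarrow> real) \<Rightarrow> real^'n \<Rightarrow> real" where
  "partial_deriv j f x = frechet_derivative f (at x) (axis j 1)"

primrec C_k :: "nat \<Rightarrow> (real^'n::finite \<Rightarrow> real) \<Rightarrow> bool" where
  "C_k 0 f \<longleftrightarrow> continuous_on UNIV f"
| "C_k (Suc k) f \<longleftrightarrow>
     (\<forall>x. f differentiable (at x)) \<and> (\<forall>j. C_k k (partial_deriv j f))"

(* Real-valued test functions suffice: every complex-valued test function is u + iv with
   u and v real-valued test functions, so a complex-linear distribution is determined by its
   values on real ones.  This lets real-, complex- and vector-valued distributions be
   treated uniformly, as maps from test functions to the target space. *)
definition test_functions :: "(real^'n::finite \<Rightarrow> real) set" where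
  "test_functions = {\<phi>. (\<forall>k. C_k k \<phi>) \<and> compact (closure {x. \<phi> x \<noteq> 0})}"

definition locally_integrable :: "(real^'n::finite \<Rightarrow> 'b::euclidean_space) \<Rightarrow> bool" where
  "locally_integrable f \<longleftrightarrow> (\<forall>K. compact K \<longrightarrow> set_integrable lebesgue K f)"

definition in_Lp :: "real \<Rightarrow> (real^'n::finite \<Rightarrow> 'b::euclidean_space) \<Rightarrow> bool" where
  "in_Lp p f \<longleftrightarrow>
     f \<in> borel_measurable lebesgue \<and> integrable lebesgue (\<lambda>x. norm (f x) powr p)"

(* Meaningful for locally integrable f only; otherwise the Bochner integral may be the
   junk value 0. *)
definition distr_of ::
  "(real^'n::finite \<Rightarrow> 'b::euclidean_space) \<Rightarrow> (real^'n \<Rightarrow> real) \<Rightarrow> 'b" where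
  "distr_of f \<phi> = (LINT x|lebesgue. \<phi> x *\<^sub>R f x)"

definition distr_deriv ::
  "'n::finite \<Rightarrow> ((real^'n \<Rightarrow> real) \<Rightarrow> 'b::euclidean_space) \<Rightarrow> (real^'n \<Rightarrow> real) \<Rightarrow> 'b" where
  "distr_deriv j T \<phi> = - T (partial_deriv j \<phi>)"

definition has_weak_gradient ::
  "(real^'n::finite \<Rightarrow> 'b::euclidean_space) \<Rightarrow> (real^'n \<Rightarrow> 'b^'n) \<Rightarrow> bool" where
  "has_weak_gradient f g \<longleftrightarrow> locally_integrable f \<and> locally_integrable g \<and>
     (\<forall>j. \<forall>\<phi>\<in>test_functions. distr_deriv j (distr_of f) \<phi> = distr_of (\<lambda>x. g x $ j) \<phi>)"

definition in_H1 :: "(real^'n::finite \<Rightarrow> 'b::euclidean_space) \<Rightarrow> bool" where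
  "in_H1 f \<longleftrightarrow> in_Lp 2 f \<and> (\<exists>g. has_weak_gradient f g \<and> in_Lp 2 g)"

definition pauli :: "complex^2^2^3" where
  "pauli = vector [vector [vector [0, 1], vector [1, 0]],
                   vector [vector [0, -\<i>], vector [\<i>, 0]],
                   vector [vector [1, 0], vector [0, -1]]]"

(* The distribution sum_j pauli_j (-i d_j psi - A_j psi), evaluated at the test function phi.
   The products A_j psi are assumed locally integrable; by Hoelder this holds for A in L^3
   and psi in L^p with p >= 3/2. *)
definition pauli_dirac ::
  "(real^3 \<Rightarrow> real^3) \<Rightarrow> (real^3 \<Rightarrow> complex^2) \<Rightarrow> (real^3 \<Rightarrow> real) \<Rightarrow> complex^2" where
  "pauli_dirac A \<psi> \<phi> =
     (\<Sum>j\<in>UNIV. (pauli $ j) *v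
        ((-\<i>) *s distr_deriv j (distr_of \<psi>) \<phi> - distr_of (\<lambda>x. A x $ j *\<^sub>R \<psi> x) \<phi>))"

end

theory Submission
  imports Defs
begin

text \<open>
  The functions $k_l(x) = x_l \, \theta(|x|^2) / |x|^3$, where \<open>\<theta>\<close> is a smooth step vanishing near 0,
  satisfy $|k_l| \le |x|^{-2}$ and $\partial_j k_l = \partial_l k_j$, and their divergence is a nonnegative
  bump function. Testing the equation with dilations of $k_l$ therefore represents a mollification of
  \<open>\<psi>\<close>, and in the limit $|\psi| \le c \, |x|^{-2} * (|A| |\psi|)$ almost everywhere. Write $A$ as a
  part that is small in $L^3$ plus a bounded part supported on a set of finite measure. By the
  Hardy--Littlewood--Sobolev inequality the first part contributes a contraction, both in $L^p$ and in
  $L^s$, and the second part maps $L^p$ into $L^s$; this bootstraps \<open>\<psi>\<close> from $L^p$ to $L^2$ and then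
  to $L^6$, so that $\sigma \cdot A \psi \in L^2$. For mollifications $v$ of \<open>\<psi>\<close> the Clifford
  relations give $\|\nabla v\|_2 = \|\sigma \cdot \nabla v\|_2$, because the mixed terms are null Lagrangians,
  hence their gradients are Cauchy in $L^2$ and $\psi \in H^1$; the modulus is treated
  through $(|\psi|^2 + \varepsilon^2)^{1/2}$. Finally \<open>\<nabla>|\<psi>|\<close> pairs $v = (\nabla - iA) \psi$, which lies in the kernel
  of $w \mapsto \sum_j \sigma_j w_j$, with $e \otimes \psi / |\psi|$ for unit vectors $e$. Projecting
  $e \otimes \psi / |\psi|$ onto that kernel leaves squared norm $1 - 1/3$, which is the constant $2/3$.
\<close>

subsection \<open>Smooth functions and test functions\<close>

text \<open>The class L^3 is scale critical: multiplication by |A| maps L^s to L^q with 1/q = 1/s +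
  1/3, and convolution with |x|^(-2) maps L^q exactly back to L^s. Iterating the integral inequality
  therefore gains no exponent, and smallness of a part of A has to replace such a gain. The
  restriction p > 3/2 says q > 1 for s = p, the endpoint excluded by the Hardy--Littlewood--Sobolev
  inequality. For the same reason \<psi> cannot be compared with a solution that is already known to
  be regular: the approximations are kept in L^s while their errors are measured in L^p, the only
  space in which \<psi> is known to lie. The exponent 6 is dictated by 1/2 = 1/3 + 1/6, and L^2 is
  the space in which the Clifford relations control a full gradient by an identity. In 2/3 = 1 - 1/3
  the number 3 counts the matrices: the map w -> \<Sum>j. \<sigma>_j w_j composed with its adjoint
  is 3 times the identity.\<close>

lemma partial_derivI: "(f has_derivative f') (at x) \<Longrightarrow> partial_deriv j f x = f' (axis j 1)"
  unfolding partial_deriv_def using frechet_derivative_at by metis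

lemma partial_deriv_eqI: "(\<And>x. (f has_derivative f' x) (at x)) \<Longrightarrow> partial_deriv j f = (\<lambda>x. f' x (axis j 1))"
  by (rule ext) (rule partial_derivI)

lemma has_derivative_frechet: "f differentiable (at x) \<Longrightarrow> (f has_derivative frechet_derivative f (at x)) (at x)"
  by (simp add: frechet_derivative_works)

lemma C_k_SucD: "C_k (Suc k) f \<Longrightarrow> C_k k f"
proof (induction k arbitrary: f)
  case 0
  then show ?case
    by (auto intro!: continuous_at_imp_continuous_on differentiable_imp_continuous_within)
qed auto

lemma C_k_const: "C_k k (\<lambda>x. c)"
proof (induction k arbitrary: c)
  case (Suc k)
  have "partial_deriv j (\<lambda>x. c) = (\<lambda>x. 0)" for j :: 'a
    by (subst partial_deriv_eqI[where f'="\<lambda>_ _. 0"]) auto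
  then show ?case using Suc by simp
qed simp

lemma C_k_add: "C_k k f \<Longrightarrow> C_k k g \<Longrightarrow> C_k k (\<lambda>x. f x + g x)"
proof (induction k arbitrary: f g)
  case 0 then show ?case by (simp add: continuous_on_add continuous_on_mult)
next
  case (Suc k)
  then have d: "f differentiable (at x)" "g differentiable (at x)" for x by auto
  have "partial_deriv j (\<lambda>x. f x + g x) = (\<lambda>x. partial_deriv j f x + partial_deriv j g x)" for j
    unfolding partial_deriv_def[of _ f] partial_deriv_def[of _ g]
    by (subst partial_deriv_eqI[where f'="\<lambda>x h. frechet_derivative f (at x) h + frechet_derivative g (at x) h"])
       (auto intro!: derivative_eq_intros has_derivative_frechet d)
  then show ?case using Suc d by (auto)
qed

lemma C_k_mult: "C_k k f \<Longrightarrow> C_k k g \<Longrightarrow> C_k k (\<lambda>x. f x * g x)"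
proof (induction k arbitrary: f g)
  case 0 then show ?case by (simp add: continuous_on_add continuous_on_mult)
next
  case (Suc k)
  then have d: "f differentiable (at x)" "g differentiable (at x)" for x by auto
  have "partial_deriv j (\<lambda>x. f x * g x) = (\<lambda>x. f x * partial_deriv j g x + partial_deriv j f x * g x)" for j
    unfolding partial_deriv_def[of _ f] partial_deriv_def[of _ g]
    by (subst partial_deriv_eqI[where f'="\<lambda>x h. f x * frechet_derivative g (at x) h + frechet_derivative f (at x) h * g x"])
       (auto intro!: derivative_eq_intros has_derivative_frechet d)
  then show ?case using Suc d C_k_SucD[of k f] C_k_SucD[of k g] by (auto intro!: C_k_add)
qed

lemma C_k_sum: "(\<And>i. i \<in> I \<Longrightarrow> C_k k (f i)) \<Longrightarrow> C_k k (\<lambda>x. \<Sum>i\<in>I. f i x)"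
  by (induction I rule: infinite_finite_induct) (auto intro: C_k_const C_k_add)

lemma partial_deriv_coord: "partial_deriv j (\<lambda>x. x $ i) = (\<lambda>x. if i = j then 1 else 0)"
  by (subst partial_deriv_eqI[where f'="\<lambda>_ h. h $ i"])
     (auto intro!: bounded_linear_imp_has_derivative bounded_linear_vec_nth simp: axis_def)

lemma C_k_coord: "C_k k (\<lambda>x. x $ i)"
proof (cases k)
  case (Suc m)
  have "(\<lambda>x::real^'a. x $ i) differentiable (at x)" for x
    using bounded_linear_imp_has_derivative[OF bounded_linear_vec_nth] by (auto simp: differentiable_def)
  then show ?thesis using Suc by (auto simp: partial_deriv_coord intro: C_k_const)
qed (auto intro!: continuous_intros)

text \<open>Real exponents cover reciprocals (a = -1) and |x|^(-3), as a power of |x|^2, at once.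
  The induction generalises a because differentiation lowers it by one.\<close>

lemma C_k_powr:
  assumes "C_k k f" "\<And>x. f x > 0"
  shows "C_k k (\<lambda>x. f x powr a)"
  using assms(1)
proof (induction k arbitrary: a)
  case 0 then show ?case using assms(2) by (auto intro!: continuous_intros simp: less_imp_neq[symmetric])
next
  case (Suc k)
  then have d: "f differentiable (at x)" for x by auto
  have D: "((\<lambda>x. f x powr a) has_derivative (\<lambda>h. a * f x powr (a - 1) * frechet_derivative f (at x) h)) (at x)" for x
    using assms(2)[of x] has_derivative_frechet[OF d[of x]]
    by (auto intro!: derivative_eq_intros simp: powr_diff field_simps)
  have "partial_deriv j (\<lambda>x. f x powr a) = (\<lambda>x. a * f x powr (a - 1) * partial_deriv j f x)" for j
    unfolding partial_deriv_def[of _ f] by (rule partial_deriv_eqI[OF D])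
  moreover have "(\<lambda>x. f x powr a) differentiable (at x)" for x
    using D by (auto simp: differentiable_def)
  ultimately show ?case using Suc C_k_SucD[of k f] by (auto intro!: C_k_mult C_k_const)
qed

text \<open>The powers in the denominator make the family closed under differentiation.\<close>

definition flat :: "nat \<Rightarrow> real \<Rightarrow> real" where
  "flat n t = (if t > 0 then exp (- (1 / t)) / t ^ n else 0)"

lemma flat_nonneg: "flat n t \<ge> 0" by (simp add: flat_def)

lemma flat_pos: "t > 0 \<Longrightarrow> flat n t > 0" by (simp add: flat_def)

lemma flat_zero: "t \<le> 0 \<Longrightarrow> flat n t = 0" by (simp add: flat_def)

lemma flat_0_le_1: "flat 0 t \<le> 1" by (simp add: flat_def)

text \<open>From (1 + x/N)^N \<le> exp x with x = 1/t and N = n + 2 comes exp(-1/t) \<le> (N t)^N;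
  dividing by t^n leaves N^N t^2. The two surplus powers are what gives \<open>flat n\<close> a
  vanishing derivative at 0.\<close>

lemma flat_quadratic: "flat n t \<le> real (n + 2) ^ (n + 2) * t\<^sup>2"
proof (cases "t > 0")
  case True
  let ?N = "n + 2"
  have "(1 / (t * real ?N)) ^ ?N \<le> (1 + (1 / t) / real ?N) ^ ?N"
    using True by (intro power_mono) (auto simp: field_simps)
  also have "\<dots> \<le> exp (1 / t)"
    using True by (intro exp_ge_one_plus_x_over_n_power_n) (auto intro: order_trans[of _ 0])
  finally have "(1 / (t * real ?N)) ^ ?N \<le> exp (1/t)" .
  then have "inverse (exp (1/t)) \<le> inverse ((1 / (t * real ?N)) ^ ?N)"
    using True by (intro le_imp_inverse_le) (auto simp: mult_pos_pos)
  then have "exp (- (1/t)) \<le> (t * real ?N) ^ ?N"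
    by (simp only: exp_minus inverse_eq_divide power_divide power_one divide_divide_eq_right mult_1 div_by_1)
  then have "exp (- (1/t)) / t ^ n \<le> (t * real ?N) ^ ?N / t ^ n"
    using True by (intro divide_right_mono) auto
  also have "\<dots> = real ?N ^ ?N * t\<^sup>2"
    using True by (simp only: power_mult_distrib power_add) (simp add: field_simps)
  finally show ?thesis using True by (simp add: flat_def)
qed (simp add: flat_def)

text \<open>Differentiating exp(-1/t) t^(-n) raises the negative power by 2 through the exponential
  and by 1 through the denominator. At t = 0 the claimed value is 0, since every \<open>flat\<close>
  vanishes there, and the quadratic bound makes the difference quotient O(|h|).\<close>

lemma flat_has_derivative:
  "(flat n has_real_derivative (flat (n + 2) t - real n * flat (n + 1) t)) (at t)"
proof -
  consider "t > 0" | "t < 0" | "t = 0" by linarith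
  then show ?thesis
  proof cases
    case 1
    have "((\<lambda>t. exp (- (1 / t)) / t ^ n) has_real_derivative (flat (n + 2) t - real n * flat (n + 1) t)) (at t)"
    proof -
      have "((\<lambda>t. exp (- (1 / t)) / t ^ n) has_real_derivative
          (exp (- (1 / t)) * (1 / t\<^sup>2) * t ^ n - exp (- (1 / t)) * (real n * t ^ (n - 1))) / (t ^ n * t ^ n)) (at t)"
        using 1 by (auto intro!: derivative_eq_intros simp: field_simps power2_eq_square)
      moreover have "(exp (- (1 / t)) * (1 / t\<^sup>2) * t ^ n - exp (- (1 / t)) * (real n * t ^ (n - 1))) / (t ^ n * t ^ n)
          = flat (n + 2) t - real n * flat (n + 1) t"
        using 1 by (cases n) (simp_all add: flat_def divide_simps power2_eq_square, simp add: algebra_simps)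
      ultimately show ?thesis by simp
    qed
    moreover have "\<forall>\<^sub>F s in nhds t. exp (- (1 / s)) / s ^ n = flat n s"
      using 1 eventually_nhds_in_open[of "{0<..}" t] by (auto elim!: eventually_mono simp: flat_def)
    ultimately show ?thesis by (subst DERIV_cong_ev[OF refl _ refl, symmetric]) auto
  next
    case 2
    have "\<forall>\<^sub>F s in nhds t. 0 = flat n s"
      using 2 eventually_nhds_in_open[of "{..<0}" t] by (auto elim!: eventually_mono simp: flat_def)
    moreover have "((\<lambda>t::real. 0::real) has_real_derivative (flat (n + 2) t - real n * flat (n + 1) t)) (at t)"
      using 2 by (simp add: flat_zero)
    ultimately show ?thesis by (subst DERIV_cong_ev[OF refl _ refl, symmetric]) auto
  next
    case 3
    define C where "C = real (n + 2) ^ (n + 2)"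
    have *: "norm (flat n h / h) \<le> C * \<bar>h\<bar>" for h
    proof (cases "h = 0")
      case False
      have "flat n h \<le> C * (\<bar>h\<bar> * \<bar>h\<bar>)"
        using flat_quadratic[of n h] by (simp add: C_def power2_eq_square)
      then have "flat n h / \<bar>h\<bar> \<le> C * \<bar>h\<bar>" using False by (simp add: pos_divide_le_eq mult.assoc)
      then show ?thesis using flat_nonneg[of n h] by simp
    qed simp
    have "((\<lambda>h. flat n h / h) \<longlongrightarrow> 0) (at 0)"
    proof (rule Lim_null_comparison)
      show "\<forall>\<^sub>F h in at 0. norm (flat n h / h) \<le> C * \<bar>h\<bar>"
        by (intro always_eventually allI) (rule *)
      show "((\<lambda>h. C * \<bar>h\<bar>) \<longlongrightarrow> 0) (at 0)" by (auto intro!: tendsto_eq_intros)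
    qed
    then show ?thesis using 3 by (simp add: DERIV_def flat_zero)
  qed
qed

lemma continuous_on_flat: "continuous_on UNIV (flat n)"
  using flat_has_derivative by (meson DERIV_isCont continuous_at_imp_continuous_on)

lemma has_derivative_flat:
  assumes "(f has_derivative f') (at x)"
  shows "((\<lambda>x. flat n (f x)) has_derivative (\<lambda>h. (flat (n + 2) (f x) - real n * flat (n + 1) (f x)) * f' h)) (at x)"
  using has_derivative_compose[OF assms, of "flat n", OF has_field_derivative_imp_has_derivative[OF flat_has_derivative]]
  by simp

lemma C_k_flat: "C_k k f \<Longrightarrow> C_k k (\<lambda>x. flat n (f x))"
proof (induction k arbitrary: n)
  case 0 then show ?case using continuous_on_compose2[OF continuous_on_flat, of UNIV f n] by auto
next
  case (Suc k)
  then have d: "f differentiable (at x)" for x by auto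
  note D = has_derivative_flat[OF has_derivative_frechet[OF d], of n]
  have "partial_deriv j (\<lambda>x. flat n (f x)) =
      (\<lambda>x. (flat (n + 2) (f x) + (- real n) * flat (n + 1) (f x)) * partial_deriv j f x)" for j
    unfolding partial_deriv_def[of _ f] by (subst partial_deriv_eqI[OF D]) simp
  moreover have "(\<lambda>x. flat n (f x)) differentiable (at x)" for x
    using D by (auto simp: differentiable_def)
  ultimately show ?case using Suc C_k_SucD[of k f]
    by (simp only: C_k.simps) (intro conjI allI C_k_mult C_k_add C_k_const; simp)
qed

text \<open>One form serves dilations (a = 0) and the reflection y -> x - y (c = -1), which turns a
  convolution kernel into a test function of y.\<close>

lemma partial_deriv_affine:
  fixes f :: "real^'n::finite \<Rightarrow> real"
  assumes "\<And>x. f differentiable (at x)"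
  shows "partial_deriv j (\<lambda>y. f (a + c *\<^sub>R y)) = (\<lambda>y. c * partial_deriv j f (a + c *\<^sub>R y))"
    and "(\<lambda>y. f (a + c *\<^sub>R y)) differentiable (at y)"
proof -
  have D: "((\<lambda>y. f (a + c *\<^sub>R y)) has_derivative (\<lambda>h. frechet_derivative f (at (a + c *\<^sub>R x)) (c *\<^sub>R h))) (at x)" for x
    by (rule has_derivative_compose[of "\<lambda>y. a + c *\<^sub>R y" _ x UNIV f])
       (auto intro!: derivative_eq_intros has_derivative_frechet assms)
  then show "(\<lambda>y. f (a + c *\<^sub>R y)) differentiable (at y)" by (auto simp: differentiable_def)
  have "linear (frechet_derivative f (at x))" for x
    using assms[of x] linear_frechet_derivative by blast
  then show "partial_deriv j (\<lambda>y. f (a + c *\<^sub>R y)) = (\<lambda>y. c * partial_deriv j f (a + c *\<^sub>R y))"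
    unfolding partial_deriv_def[of _ f]
    by (subst partial_deriv_eqI[OF D]) (auto simp: linear_scale)
qed

lemma C_k_affine: "C_k k f \<Longrightarrow> C_k k (\<lambda>y. f (a + c *\<^sub>R y))"
proof (induction k arbitrary: f)
  case 0 then show ?case by (auto intro!: continuous_intros continuous_on_compose2[of UNIV f])
next
  case (Suc k)
  then have d: "f differentiable (at x)" for x by auto
  show ?case
    using Suc partial_deriv_affine[OF d] by (auto intro!: C_k_mult[OF C_k_const])
qed

section \<open>Smooth functions with compact support\<close>

abbreviation smooth :: "(real^'n::finite \<Rightarrow> real) \<Rightarrow> bool" where "smooth f \<equiv> \<forall>k. C_k k f"

lemma smooth_differentiable: "smooth f \<Longrightarrow> f differentiable (at x)"
  by (metis C_k.simps(2))

lemma smooth_partial: "smooth f \<Longrightarrow> smooth (partial_deriv j f)"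
  by (metis C_k.simps(2))

lemma smooth_continuous: "smooth f \<Longrightarrow> continuous_on UNIV f"
  by (metis C_k.simps(1))

lemma smooth_inner_self: "smooth (\<lambda>x. x \<bullet> x)"
  unfolding inner_vec_def inner_real_def by (auto intro!: C_k_sum C_k_mult C_k_coord)

lemma partial_deriv_mult:
  assumes "smooth f" "smooth g"
  shows "partial_deriv j (\<lambda>x. f x * g x) = (\<lambda>x. f x * partial_deriv j g x + partial_deriv j f x * g x)"
  unfolding partial_deriv_def[of _ f] partial_deriv_def[of _ g]
  by (subst partial_deriv_eqI[where f'="\<lambda>x h. f x * frechet_derivative g (at x) h + frechet_derivative f (at x) h * g x"])
     (auto intro!: derivative_eq_intros has_derivative_frechet smooth_differentiable assms)

lemma test_functionI: "smooth f \<Longrightarrow> (\<And>x. norm x > R \<Longrightarrow> f x = 0) \<Longrightarrow> f \<in> test_functions"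
proof -
  assume f: "smooth f" "\<And>x. norm x > R \<Longrightarrow> f x = 0"
  have "{x. f x \<noteq> 0} \<subseteq> cball 0 R" using f(2) by (auto simp: not_less[symmetric])
  then have "bounded {x. f x \<noteq> 0}" using bounded_cball bounded_subset by blast
  then show ?thesis using f by (auto simp: test_functions_def compact_closure)
qed

lemma test_smooth: "f \<in> test_functions \<Longrightarrow> smooth f" by (simp add: test_functions_def)

lemma test_support:
  assumes "f \<in> test_functions" obtains R where "R > 0" "\<And>x. norm x > R \<Longrightarrow> f x = 0"
proof -
  have "bounded {x. f x \<noteq> 0}"
    using assms by (auto simp: test_functions_def intro: bounded_closure bounded_subset[OF compact_imp_bounded] closure_subset)
  then obtain R where "R > 0" "\<forall>x\<in>{x. f x \<noteq> 0}. norm x \<le> R" by (auto simp: bounded_pos)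
  then show thesis by (intro that[of R]) force+
qed

lemma partial_deriv_zero_outside:
  fixes f :: "real^'n::finite \<Rightarrow> real"
  assumes "\<And>x. norm x > R \<Longrightarrow> f x = 0" "norm x > R"
  shows "partial_deriv j f x = 0"
proof -
  have o: "open {x::real^'n. norm x > R}" by (intro open_Collect_less continuous_intros)
  have "((\<lambda>x. 0) has_derivative (\<lambda>_. 0)) (at x)" by simp
  then have "(f has_derivative (\<lambda>_. 0)) (at x)"
    by (rule has_derivative_transform_within_open[OF _ o]) (use assms in auto)
  then show ?thesis by (simp add: partial_derivI)
qed

lemma test_partial: "f \<in> test_functions \<Longrightarrow> partial_deriv j f \<in> test_functions"
  by (metis test_support partial_deriv_zero_outside test_functionI smooth_partial test_smooth)

lemma test_mult: "f \<in> test_functions \<Longrightarrow> smooth g \<Longrightarrow> (\<lambda>x. f x * g x) \<in> test_functions"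
proof -
  assume f: "f \<in> test_functions" and g: "smooth g"
  obtain R where R: "\<And>x. norm x > R \<Longrightarrow> f x = 0" by (meson f test_support)
  have "smooth (\<lambda>x. f x * g x)" using test_smooth[OF f] g by (simp add: C_k_mult)
  then show "(\<lambda>x. f x * g x) \<in> test_functions" by (rule test_functionI[of _ R]) (simp add: R)
qed

lemma test_cmult: "f \<in> test_functions \<Longrightarrow> (\<lambda>x. c * f x) \<in> test_functions"
  using test_mult[of f "\<lambda>_. c"] C_k_const by (auto simp: mult.commute)

lemma test_diff: "f \<in> test_functions \<Longrightarrow> g \<in> test_functions \<Longrightarrow> (\<lambda>x. f x - g x) \<in> test_functions"
proof -
  assume f: "f \<in> test_functions" "g \<in> test_functions"
  obtain R S where R: "\<And>x. norm x > R \<Longrightarrow> f x = 0" "\<And>x. norm x > S \<Longrightarrow> g x = 0"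
    by (meson f test_support)
  have "smooth (\<lambda>x. f x + (-1) * g x)"
    using test_smooth[OF f(1)] test_smooth[OF f(2)] by (intro allI C_k_add C_k_mult[OF C_k_const]) auto
  then have "smooth (\<lambda>x. f x - g x)" by simp
  then show ?thesis by (intro test_functionI[of _ "max R S"]) (auto simp: R)
qed

lemma test_affine:
  assumes "f \<in> test_functions" "c \<noteq> 0"
  shows "(\<lambda>y. f (a + c *\<^sub>R y)) \<in> test_functions"
proof -
  obtain R where R: "\<And>x. norm x > R \<Longrightarrow> f x = 0" by (meson assms test_support)
  show ?thesis
  proof (rule test_functionI[of _ "(R + norm a) / \<bar>c\<bar>"])
    show "smooth (\<lambda>y. f (a + c *\<^sub>R y))" using assms by (auto intro!: C_k_affine simp: test_smooth)
    fix y :: "real^'a" assume "norm y > (R + norm a) / \<bar>c\<bar>"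
    then have "norm (c *\<^sub>R y) > R + norm a" using assms by (simp add: divide_less_eq mult.commute)
    moreover have "norm (c *\<^sub>R y) \<le> norm (a + c *\<^sub>R y) + norm a"
      by (metis add.commute add_diff_cancel_left' norm_triangle_ineq4)
    ultimately show "f (a + c *\<^sub>R y) = 0" by (intro R) linarith
  qed
qed

lemma test_bounded:
  assumes "f \<in> test_functions" obtains M where "M > 0" "\<And>x. \<bar>f x\<bar> \<le> M"
proof -
  obtain R where R: "\<And>x. norm x > R \<Longrightarrow> f x = 0" by (meson assms test_support)
  have "compact (f ` cball 0 R)"
    using assms by (intro compact_continuous_image) (auto intro: continuous_on_subset[OF smooth_continuous[OF test_smooth]])
  then obtain M where M: "M > 0" "\<forall>y\<in>f ` cball 0 R. norm y \<le> M"
    using compact_imp_bounded bounded_pos by blast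
  show thesis
  proof (rule that[OF M(1)])
    show "\<bar>f x\<bar> \<le> M" for x using M R[of x] by (cases "norm x > R") auto
  qed
qed

text \<open>Bridge to derivatives along coordinate lines: mollified functions take values in a
  vector space, where \<open>partial_deriv\<close> is not defined, and they are differentiated only
  in this one-dimensional sense.\<close>

lemma has_vector_derivative_partial:
  fixes f :: "real^'n::finite \<Rightarrow> real"
  assumes "f differentiable (at x)"
  shows "((\<lambda>t. f (x + t *\<^sub>R axis j 1)) has_vector_derivative partial_deriv j f x) (at 0)"
proof -
  have "((\<lambda>t::real. f (x + t *\<^sub>R axis j 1)) has_derivative (\<lambda>t. frechet_derivative f (at x) (t *\<^sub>R axis j 1))) (at 0)"
    by (rule has_derivative_compose[of "\<lambda>t. x + t *\<^sub>R axis j 1" "\<lambda>t. t *\<^sub>R axis j 1" 0 UNIV f])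
       (use has_derivative_frechet[OF assms] in \<open>auto intro!: derivative_eq_intros\<close>)
  then show ?thesis
    using linear_frechet_derivative[OF assms]
    by (simp add: has_vector_derivative_def partial_deriv_def linear_scale)
qed

subsection \<open>A regularisation of the gradient of the Newton potential\<close>

text \<open>A step in the variable s = |x|^2, equal to 0 for s \<le> 1 and to 1 for s \<ge> 2. The
  denominator is positive because s > 1 or s < 2.\<close>

definition smooth_step :: "real \<Rightarrow> real" where
  "smooth_step s = flat 0 (s - 1) / (flat 0 (s - 1) + flat 0 (2 - s))"

text \<open>The quotient rule after cancellation. The derivative of \<open>flat 0 (2 - s)\<close> is
  \<open>- flat 2 (2 - s)\<close>, so both remaining summands are nonnegative.\<close>

definition smooth_step_deriv :: "real \<Rightarrow> real" where
  "smooth_step_deriv s = (flat 2 (s - 1) * flat 0 (2 - s) + flat 0 (s - 1) * flat 2 (2 - s))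
     / (flat 0 (s - 1) + flat 0 (2 - s))\<^sup>2"

lemma smooth_step_denom_pos: "flat 0 (s - 1) + flat 0 (2 - s) > 0"
  using flat_nonneg[of 0 "s - 1"] flat_nonneg[of 0 "2 - s"] flat_pos[of "s - 1" 0] flat_pos[of "2 - s" 0]
  by (cases "s > 1") linarith+

lemma smooth_step_nonneg: "0 \<le> smooth_step s" and smooth_step_le_1: "smooth_step s \<le> 1"
  using smooth_step_denom_pos[of s] flat_nonneg[of 0 "s - 1"] flat_nonneg[of 0 "2 - s"]
  by (auto simp: smooth_step_def)

lemma smooth_step_zero: "s \<le> 1 \<Longrightarrow> smooth_step s = 0" by (simp add: smooth_step_def flat_zero)

lemma smooth_step_deriv_nonneg: "0 \<le> smooth_step_deriv s"
  by (auto simp: smooth_step_deriv_def intro!: divide_nonneg_nonneg add_nonneg_nonneg mult_nonneg_nonneg flat_nonneg)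

lemma smooth_step_deriv_pos: "1 < s \<Longrightarrow> s < 2 \<Longrightarrow> 0 < smooth_step_deriv s"
  using smooth_step_denom_pos[of s]
  by (auto simp: smooth_step_deriv_def intro!: divide_pos_pos add_pos_pos mult_pos_pos flat_pos)

lemma smooth_step_deriv_zero: "s \<le> 1 \<or> 2 \<le> s \<Longrightarrow> smooth_step_deriv s = 0"
  by (auto simp: smooth_step_deriv_def flat_zero)

lemma smooth_step_has_derivative: "(smooth_step has_real_derivative smooth_step_deriv s) (at s)"
proof -
  note [derivative_intros] = DERIV_chain2[OF flat_has_derivative]
  have "flat 0 (s - 1) + flat 0 (2 - s) \<noteq> 0" using smooth_step_denom_pos[of s] by simp
  then show ?thesis unfolding smooth_step_def[abs_def] smooth_step_deriv_def
    by (auto intro!: derivative_eq_intros simp: power2_eq_square) (simp add: algebra_simps numeral_2_eq_2)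
qed

text \<open>A smooth function that is positive on the nonnegative reals and is the identity where
  \<open>smooth_step\<close> is nonzero, so that negative powers of \<open>reg (x \<bullet> x)\<close> are smooth at 0.\<close>

definition reg :: "real \<Rightarrow> real" where "reg s = s + flat 0 (1 - s)"

lemma reg_pos: "0 \<le> s \<Longrightarrow> 0 < reg s"
  using flat_nonneg[of 0 "1 - s"] flat_pos[of "1 - s" 0] by (cases "s < 1") (auto simp: reg_def)

lemma reg_eq: "1 \<le> s \<Longrightarrow> reg s = s" by (simp add: reg_def flat_zero)

lemma smooth_step_reg: "smooth_step s * h (reg s) = smooth_step s * h s"
  using reg_eq[of s] smooth_step_zero[of s] by (cases "s \<ge> 1") auto

text \<open>With s = |x|^2 this is \<theta>(s) |x|^(-3); \<open>reg\<close> differs from s only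
  where the step vanishes.\<close>

definition profile :: "real \<Rightarrow> real" where "profile s = smooth_step s * reg s powr (-3/2)"

definition profile_deriv :: "real \<Rightarrow> real" where
  "profile_deriv s = smooth_step_deriv s * reg s powr (-3/2) - 3/2 * smooth_step s * reg s powr (-5/2)"

lemma profile_has_derivative:
  assumes "0 \<le> s" shows "(profile has_real_derivative profile_deriv s) (at s)"
proof -
  note [derivative_intros] = DERIV_chain2[OF flat_has_derivative] smooth_step_has_derivative
  have R: "(reg has_real_derivative (1 - flat 2 (1 - s))) (at s)"
    unfolding reg_def[abs_def] by (auto intro!: derivative_eq_intros simp: numeral_2_eq_2)
  have "((\<lambda>s. smooth_step s * reg s powr (-3/2)) has_real_derivative
     smooth_step_deriv s * reg s powr (-3/2) + smooth_step s * ((-3/2) * reg s powr (-3/2 - 1) * (1 - flat 2 (1 - s)))) (at s)"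
    using DERIV_mult'[OF smooth_step_has_derivative[of s] DERIV_fun_powr[OF R reg_pos[OF assms], of "-3/2"]]
    by (simp add: add.commute mult.commute)
  \<comment> \<open>The extra term in the derivative of \<open>reg\<close> lives on s < 1, where the
    step vanishes.\<close>
  moreover have "smooth_step s * flat 2 (1 - s) = 0"
    by (cases "s \<le> 1") (auto simp: smooth_step_zero flat_zero)
  then have "smooth_step s * ((-3/2) * reg s powr (-3/2 - 1) * (1 - flat 2 (1 - s))) = - (3/2 * smooth_step s * reg s powr (-5/2))"
    by (simp add: algebra_simps) auto
  ultimately have "((\<lambda>s. smooth_step s * reg s powr (-3/2)) has_real_derivative
      smooth_step_deriv s * reg s powr (-3/2) + - (3/2 * smooth_step s * reg s powr (-5/2))) (at s)" by (simp only:)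
  then show ?thesis by (simp add: profile_def[abs_def] profile_deriv_def)
qed

definition kernel :: "3 \<Rightarrow> real^3 \<Rightarrow> real" where "kernel l x = x $ l * profile (x \<bullet> x)"

text \<open>The divergence of the field \<open>kernel\<close>: x / |x|^3 is divergence free away
  from 0, so only the derivative of the step survives.\<close>

definition kernel_div :: "real^3 \<Rightarrow> real" where
  "kernel_div x = 2 * (x \<bullet> x) * smooth_step_deriv (x \<bullet> x) * reg (x \<bullet> x) powr (-3/2)"

lemma kernel_smooth: "smooth (kernel l)"
proof -
  \<comment> \<open>The quotient becomes a power -1 and differences become sums with a factor -1,
    the forms for which closure under \<open>C_k\<close> was shown.\<close>
  have "smooth (\<lambda>x::real^3. x $ l * (flat 0 (x \<bullet> x + (-1)) * (flat 0 (x \<bullet> x + (-1)) + flat 0 (2 + (-1) * (x \<bullet> x))) powr (-1)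
      * (x \<bullet> x + flat 0 (1 + (-1) * (x \<bullet> x))) powr (-3/2)))"
    using smooth_step_denom_pos reg_pos smooth_inner_self
    by (intro allI C_k_mult C_k_add C_k_powr C_k_flat C_k_coord C_k_const) (auto simp: reg_def)
  moreover have "(\<lambda>x::real^3. x $ l * (flat 0 (x \<bullet> x + (-1)) * (flat 0 (x \<bullet> x + (-1)) + flat 0 (2 + (-1) * (x \<bullet> x))) powr (-1)
      * (x \<bullet> x + flat 0 (1 + (-1) * (x \<bullet> x))) powr (-3/2))) = kernel l"
    using smooth_step_denom_pos by (auto simp: kernel_def[abs_def] profile_def smooth_step_def reg_def fun_eq_iff powr_minus_divide less_imp_le)
  ultimately show ?thesis by simp
qed

lemma partial_kernel: "partial_deriv j (kernel l) x =
   (if j = l then profile (x \<bullet> x) else 0) + 2 * (x $ l) * (x $ j) * profile_deriv (x \<bullet> x)"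
proof -
  have "((\<lambda>x. profile (x \<bullet> x)) has_derivative (\<lambda>h. profile_deriv (x \<bullet> x) * (2 * (x \<bullet> h)))) (at x)"
    using profile_has_derivative[of "x \<bullet> x"]
    by (intro has_derivative_compose[of "\<lambda>x. x \<bullet> x" _ _ UNIV profile])
       (auto intro!: derivative_eq_intros simp: inner_commute has_field_derivative_def)
  then have "(kernel l has_derivative (\<lambda>h. h $ l * profile (x \<bullet> x) + x $ l * (profile_deriv (x \<bullet> x) * (2 * (x \<bullet> h))))) (at x)"
    unfolding kernel_def[abs_def]
    by (auto intro!: derivative_eq_intros bounded_linear_imp_has_derivative bounded_linear_vec_nth)
  from partial_derivI[OF this, of j] show ?thesis by (simp add: inner_axis) (simp add: axis_def)
qed

text \<open>A field of the form x times a radial function is curl free. This symmetry is what lets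
  products of Clifford matrices collapse to a divergence.\<close>

lemma partial_kernel_sym: "partial_deriv j (kernel l) x = partial_deriv l (kernel j) x"
  by (auto simp: partial_kernel)

lemma sum_partial_kernel: "(\<Sum>j\<in>UNIV. partial_deriv j (kernel j) x) = kernel_div x"
proof -
  let ?s = "x \<bullet> x"
  have "(\<Sum>j\<in>UNIV. x $ j * x $ j) = ?s" by (simp add: inner_vec_def)
  then have s: "(\<Sum>j\<in>UNIV. 2 * (x $ j) * (x $ j) * profile_deriv ?s) = 2 * ?s * profile_deriv ?s"
    by (simp add: sum_distrib_left sum_distrib_right mult.assoc flip: \<open>_ = ?s\<close>)
  \<comment> \<open>Both powers are brought to -5/2. Then 3 \<theta> reg, with 3 the dimension,
    cancels against 2 s (3/2) \<theta>, because reg = s wherever \<theta> is nonzero.\<close>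
  have p: "reg ?s powr (-3/2) = reg ?s * reg ?s powr (-5/2)"
    using powr_add[of "reg ?s" 1 "-5/2"] reg_pos[of ?s] by simp
  have "smooth_step ?s * reg ?s = smooth_step ?s * ?s" using smooth_step_reg[of ?s "\<lambda>x. x"] .
  then have "3 * profile ?s + 2 * ?s * profile_deriv ?s = kernel_div x"
    unfolding profile_def profile_deriv_def kernel_div_def p
    by (simp add: algebra_simps) auto
  then show ?thesis using s by (simp add: partial_kernel sum.distrib)
qed

lemma kernel_div_nonneg: "0 \<le> kernel_div x"
  by (auto simp: kernel_div_def smooth_step_deriv_nonneg)

lemma kernel_div_test: "kernel_div \<in> test_functions"
proof (rule test_functionI[of _ 2])
  have "smooth (\<lambda>x. \<Sum>j\<in>UNIV. partial_deriv j (kernel j) x)"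
    using smooth_partial[OF kernel_smooth] by (intro allI C_k_sum) auto
  then show "smooth kernel_div" by (simp add: sum_partial_kernel)
  fix x :: "real^3" assume "norm x > 2"
  then have "(norm x)\<^sup>2 \<ge> 2\<^sup>2" by (intro power_mono) auto
  then show "kernel_div x = 0" by (simp add: kernel_div_def smooth_step_deriv_zero power2_norm_eq_inner)
qed

lemma kernel_bound: "\<bar>kernel l x\<bar> \<le> 1 / (norm x)\<^sup>2"
proof (cases "x \<bullet> x \<le> 1")
  \<comment> \<open>This case contains x = 0, where the right-hand side is 1/0 = 0.\<close>
  case True then show ?thesis by (simp add: kernel_def profile_def smooth_step_zero)
next
  case False
  then have x: "norm x > 1" by (smt (verit) norm_ge_zero power2_norm_eq_inner power_le_one)
  have "(x \<bullet> x) powr (-3/2) = norm x powr (-3)"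
  proof -
    have "x \<bullet> x = norm x powr 2" using x by (simp add: power2_norm_eq_inner[symmetric] powr_numeral)
    then show ?thesis by (simp only: powr_powr) simp
  qed
  then have e: "(x \<bullet> x) powr - (3/2) = 1 / norm x ^ 3"
    using x by (simp add: powr_minus_divide powr_numeral)
  have "\<bar>kernel l x\<bar> = \<bar>x $ l\<bar> * (smooth_step (x \<bullet> x) * (1 / norm x ^ 3))"
    using False smooth_step_nonneg[of "x \<bullet> x"] by (simp add: kernel_def profile_def reg_eq e abs_mult)
  also have "\<dots> \<le> norm x * (1 * (1 / norm x ^ 3))"
    using x by (intro mult_mono component_le_norm_cart smooth_step_le_1) (auto simp: smooth_step_nonneg)
  also have "\<dots> = 1 / (norm x)\<^sup>2" using x by (simp add: power2_eq_square power3_eq_cube)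
  finally show ?thesis .
qed

lemma kernel_le_1: "\<bar>kernel l x\<bar> \<le> 1"
proof (cases "x \<bullet> x \<le> 1")
  case False
  then have "(norm x)\<^sup>2 > 1" by (simp add: power2_norm_eq_inner)
  then have "1 / (norm x)\<^sup>2 \<le> 1" by (smt (verit) divide_le_eq_1_pos)
  then show ?thesis using kernel_bound[of l x] by linarith
qed (simp add: kernel_def profile_def smooth_step_zero)

text \<open>The factor exp 1 normalises the value at 0, so that the dilates tend to 1
  pointwise.\<close>

definition cutoff :: "real^3 \<Rightarrow> real" where "cutoff x = exp 1 * flat 0 (1 - x \<bullet> x)"

lemma cutoff_test: "cutoff \<in> test_functions"
proof (rule test_functionI[of _ 1])
  have "smooth (\<lambda>x::real^3. exp 1 * flat 0 (1 + (-1) * (x \<bullet> x)))"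
    using smooth_inner_self by (intro allI C_k_mult C_k_add C_k_flat C_k_const) auto
  then show "smooth cutoff" by (simp add: cutoff_def[abs_def])
  fix x :: "real^3" assume "norm x > 1"
  then have "(norm x)\<^sup>2 \<ge> 1" by simp
  then show "cutoff x = 0" by (simp add: cutoff_def flat_zero power2_norm_eq_inner)
qed

lemma cutoff_nonneg: "0 \<le> cutoff x" by (simp add: cutoff_def flat_nonneg)

lemma cutoff_le_1: "cutoff x \<le> 1"
proof -
  have "1 \<le> 1 / (1 - x \<bullet> x)" if "x \<bullet> x < 1" using that by simp
  then show ?thesis by (auto simp: cutoff_def flat_def mult_exp_exp)
qed

lemma cutoff_0: "cutoff 0 = 1" by (simp add: cutoff_def flat_def mult_exp_exp)

lemma cutoff_outside: "norm x > 1 \<Longrightarrow> cutoff x = 0"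
proof -
  assume "norm x > 1"
  then have "(norm x)\<^sup>2 \<ge> 1" by simp
  then show "cutoff x = 0" by (simp add: cutoff_def flat_zero power2_norm_eq_inner)
qed

subsection \<open>The Hardy--Littlewood--Sobolev inequality\<close>

lemma lborel_distr_diff: "distr lborel borel (\<lambda>y. x - y) = (lborel :: 'a::euclidean_space measure)"
  using lborel_affine[of "-1" x] by (simp add: density_1)

lemma nn_integral_lborel_diff:
  fixes x :: "'a::euclidean_space"
  assumes [measurable]: "f \<in> borel_measurable borel"
  shows "(\<integral>\<^sup>+y. f (x - y) \<partial>lborel) = (\<integral>\<^sup>+y. f y \<partial>lborel)"
  by (subst (2) lborel_distr_diff[of x, symmetric]) (simp add: nn_integral_distr)

section \<open>Power integrals, the layer cake formula and the Hoelder inequality\<close>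

lemma nn_integral_powr_0:
  assumes "b > -1" "a \<ge> (0::real)"
  shows "(\<integral>\<^sup>+t. ennreal (t powr b) * indicator {0..a} t \<partial>lborel) = ennreal (a powr (b + 1) / (b + 1))"
proof -
  have "((\<lambda>t. if t \<in> {0..a} then t powr b else 0) has_integral (a powr (b + 1) / (b + 1))) UNIV"
    using has_integral_powr_from_0[OF assms] by (simp only: has_integral_restrict_UNIV)
  then have "(\<integral>\<^sup>+t. ennreal (if t \<in> {0..a} then t powr b else 0) \<partial>lborel) = ennreal (a powr (b + 1) / (b + 1))"
    by (intro nn_integral_has_integral_lborel) auto
  then show ?thesis by (auto intro: arg_cong[where f=ennreal] elim!: trans[rotated] intro!: nn_integral_cong split: split_indicator)
qed

lemma nn_integral_powr_inf:
  assumes "b < -1" "a > (0::real)"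
  shows "(\<integral>\<^sup>+t. ennreal (t powr b) * indicator {a..} t \<partial>lborel) = ennreal (- (a powr (b + 1)) / (b + 1))"
proof -
  have "((\<lambda>t. if t \<in> {a..} then t powr b else 0) has_integral (- (a powr (b + 1)) / (b + 1))) UNIV"
    using has_integral_powr_to_inf[OF assms] by (simp only: has_integral_restrict_UNIV)
  then have "(\<integral>\<^sup>+t. ennreal (if t \<in> {a..} then t powr b else 0) \<partial>lborel) = ennreal (- (a powr (b + 1)) / (b + 1))"
    by (intro nn_integral_has_integral_lborel) auto
  then show ?thesis by (auto elim!: trans[rotated] intro!: nn_integral_cong split: split_indicator)
qed

text \<open>Write g^s as the integral of s t^(s-1) over 0 \<le> t \<le> g and exchange the two
  integrals.\<close>

lemma layer_cake:
  fixes g :: "'a \<Rightarrow> real"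
  assumes "sigma_finite_measure M" and [measurable]: "g \<in> borel_measurable M" and g: "\<And>x. 0 \<le> g x" and s: "s > 0"
  shows "(\<integral>\<^sup>+x. ennreal (g x powr s) \<partial>M)
    = (\<integral>\<^sup>+t. ennreal (s * t powr (s - 1)) * indicator {0..} t * emeasure M {x \<in> space M. t \<le> g x} \<partial>lborel)"
proof -
  interpret M: sigma_finite_measure M by fact
  interpret P: pair_sigma_finite M lborel ..
  have *: "ennreal (g x powr s) = (\<integral>\<^sup>+t. ennreal (s * t powr (s - 1)) * indicator {0..g x} t \<partial>lborel)" for x
  proof -
    have "(\<integral>\<^sup>+t. ennreal (s * t powr (s - 1)) * indicator {0..g x} t \<partial>lborel)
       = (\<integral>\<^sup>+t. ennreal s * (ennreal (t powr (s - 1)) * indicator {0..g x} t) \<partial>lborel)"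
      using s by (simp add: ennreal_mult mult.assoc)
    also have "\<dots> = ennreal s * ennreal (g x powr (s - 1 + 1) / (s - 1 + 1))"
      using s g[of x] by (subst nn_integral_cmult) (simp_all add: nn_integral_powr_0)
    also have "\<dots> = ennreal (g x powr s)" using s by (simp flip: ennreal_mult)
    finally show ?thesis by simp
  qed
  have "(\<integral>\<^sup>+x. ennreal (g x powr s) \<partial>M)
     = (\<integral>\<^sup>+x. \<integral>\<^sup>+t. ennreal (s * t powr (s - 1)) * indicator {0..} t * indicator {x \<in> space M. t \<le> g x} x \<partial>lborel \<partial>M)"
    unfolding * by (intro nn_integral_cong) (auto split: split_indicator)
  also have "\<dots> = (\<integral>\<^sup>+t. \<integral>\<^sup>+x. ennreal (s * t powr (s - 1)) * indicator {0..} t * indicator {x \<in> space M. t \<le> g x} x \<partial>M \<partial>lborel)"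
  proof (rule P.Fubini'[symmetric])
    have "(\<lambda>(x, t). ennreal (s * t powr (s - 1)) * indicator {0..} t * (if t \<le> g x then 1 else 0)) \<in> borel_measurable (M \<Otimes>\<^sub>M lborel)"
      by measurable
    then show "(\<lambda>(x, t). ennreal (s * t powr (s - 1)) * indicator {0..} t * indicator {x \<in> space M. t \<le> g x} x) \<in> borel_measurable (M \<Otimes>\<^sub>M lborel)"
      by (rule measurable_cong[THEN iffD1, rotated]) (auto simp: space_pair_measure split: split_indicator)
  qed
  also have "\<dots> = (\<integral>\<^sup>+t. ennreal (s * t powr (s - 1)) * indicator {0..} t * emeasure M {x \<in> space M. t \<le> g x} \<partial>lborel)"
    by (intro nn_integral_cong) (subst nn_integral_cmult_indicator, auto)
  finally show ?thesis .
qed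

text \<open>Stated with real upper bounds a and b instead of the integrals, which keeps powers of
  infinite values out. Young's inequality is applied to f/A and g/B with A^p = a and B^q = b; a zero
  bound makes the product vanish almost everywhere and is treated separately.\<close>

lemma Holder_nn_integral:
  fixes f g :: "'a \<Rightarrow> real"
  assumes pq: "p > 1" "q > 1" "1 / p + 1 / q = 1"
    and [measurable]: "f \<in> borel_measurable M" "g \<in> borel_measurable M"
    and nn: "\<And>x. 0 \<le> f x" "\<And>x. 0 \<le> g x"
    and a: "(\<integral>\<^sup>+x. ennreal (f x powr p) \<partial>M) \<le> ennreal a" "a \<ge> 0"
    and b: "(\<integral>\<^sup>+x. ennreal (g x powr q) \<partial>M) \<le> ennreal b" "b \<ge> 0"
  shows "(\<integral>\<^sup>+x. ennreal (f x * g x) \<partial>M) \<le> ennreal (a powr (1 / p) * b powr (1 / q))"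
proof (cases "a = 0 \<or> b = 0")
  case True
  have z: "AE x in M. h x = 0" if "(\<integral>\<^sup>+x. ennreal (h x powr r) \<partial>M) \<le> 0" "h \<in> borel_measurable M" "\<And>x. 0 \<le> h x" "r > 1"
    for h :: "'a \<Rightarrow> real" and r
  proof -
    note [measurable] = that(2)
    have "(\<integral>\<^sup>+x. ennreal (h x powr r) \<partial>M) = 0" using that by simp
    then have "AE x in M. ennreal (h x powr r) = 0" by (subst (asm) nn_integral_0_iff_AE) auto
    then show ?thesis by eventually_elim (use that in \<open>auto simp: ennreal_eq_0_iff\<close>)
  qed
  have "AE x in M. f x = 0 \<or> g x = 0"
    using True z[of f p] z[of g q] a b nn pq by (auto elim!: eventually_mono)
  then have "(\<integral>\<^sup>+x. ennreal (f x * g x) \<partial>M) = 0"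
    by (subst nn_integral_0_iff_AE) auto
  then show ?thesis by simp
next
  case False
  then have ab: "a > 0" "b > 0" using a b by auto
  define A B where "A = a powr (1/p)" and "B = b powr (1/q)"
  have AB: "A > 0" "B > 0" "A powr p = a" "B powr q = b" using ab pq by (auto simp: A_def B_def powr_powr)
  have "f x * g x \<le> A * B / (p * a) * f x powr p + A * B / (q * b) * g x powr q" for x
  proof -
    have "(f x / A) * (g x / B) \<le> (f x / A) powr p / p + (g x / B) powr q / q"
      using AB nn by (intro Youngs_inequality pq) auto
    also have "\<dots> = f x powr p / (p * a) + g x powr q / (q * b)"
      using AB nn[of x] by (simp add: powr_divide mult.commute)
    finally have "f x * g x \<le> (f x powr p / (p * a) + g x powr q / (q * b)) * (A * B)"
      using AB by (simp add: pos_divide_le_eq)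
    then show ?thesis by (simp add: algebra_simps)
  qed
  then have "(\<integral>\<^sup>+x. ennreal (f x * g x) \<partial>M)
     \<le> (\<integral>\<^sup>+x. ennreal (A * B / (p * a)) * ennreal (f x powr p) + ennreal (A * B / (q * b)) * ennreal (g x powr q) \<partial>M)"
    using AB ab pq by (intro nn_integral_mono) (simp add: ennreal_leI flip: ennreal_mult ennreal_plus)
  also have "\<dots> = ennreal (A * B / (p * a)) * (\<integral>\<^sup>+x. ennreal (f x powr p) \<partial>M) + ennreal (A * B / (q * b)) * (\<integral>\<^sup>+x. ennreal (g x powr q) \<partial>M)"
    by (subst nn_integral_add) (simp_all add: nn_integral_cmult)
  also have "\<dots> \<le> ennreal (A * B / (p * a)) * ennreal a + ennreal (A * B / (q * b)) * ennreal b"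
    by (intro add_mono mult_left_mono a b) auto
  also have "\<dots> = ennreal (A * B / (p * a) * a + A * B / (q * b) * b)"
  proof -
    have nn: "0 \<le> A * B / (p * a)" "0 \<le> A * B / (q * b)" using AB ab pq by auto
    show ?thesis unfolding ennreal_mult'[OF nn(1), symmetric] ennreal_mult'[OF nn(2), symmetric]
      using nn ab by (intro ennreal_plus[symmetric] mult_nonneg_nonneg) auto
  qed
  also have "A * B / (p * a) * a + A * B / (q * b) * b = A * B * (1/p + 1/q)"
    using ab by (simp add: algebra_simps)
  finally show ?thesis using pq by (simp add: A_def B_def)
qed

section \<open>Integrals of |x|^(-2) near the origin and at infinity\<close>

abbreviation "vol1 \<equiv> unit_ball_vol 3"

lemma emeasure_cball3: "t \<ge> 0 \<Longrightarrow> emeasure lborel (cball (0::real^3) t) = ennreal (vol1 * t ^ 3)"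
  using emeasure_cball[of t "0::real^3"] by simp

lemma emeasure_ball3: "t \<ge> 0 \<Longrightarrow> emeasure lborel (ball (0::real^3) t) = ennreal (vol1 * t ^ 3)"
  using emeasure_ball[of t "0::real^3"] by simp

lemma radial_superlevel:
  assumes "t > 0"
  shows "emeasure lborel {x::real^3. t \<le> 1 / (norm x)\<^sup>2} \<le> ennreal (vol1 * t powr (-3/2))"
proof -
  have "{x::real^3. t \<le> 1 / (norm x)\<^sup>2} \<subseteq> cball 0 (t powr (-1/2))"
  proof safe
    fix x :: "real^3" assume *: "t \<le> 1 / (norm x)\<^sup>2"
    \<comment> \<open>At the origin the quotient is 1/0 = 0 < t.\<close>
    then have "x \<noteq> 0" using assms by auto
    then have "(norm x)\<^sup>2 \<le> 1 / t" using * assms by (simp add: field_simps)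
    then have "norm x \<le> sqrt (1 / t)" using real_le_rsqrt by blast
    also have "\<dots> = t powr (-1/2)" using assms by (simp add: powr_half_sqrt[symmetric] powr_minus_divide powr_divide)
    finally show "x \<in> cball 0 (t powr (-1/2))" by simp
  qed
  then have "emeasure lborel {x::real^3. t \<le> 1 / (norm x)\<^sup>2} \<le> emeasure lborel (cball (0::real^3) (t powr (-1/2)))"
    by (intro emeasure_mono) auto
  also have "\<dots> = ennreal (vol1 * (t powr (-1/2)) ^ 3)" by (simp add: emeasure_cball3)
  also have "(t powr (-1/2)) ^ 3 = t powr (-3/2)" using assms by (simp add: powr_powr flip: powr_realpow)
  finally show ?thesis .
qed

text \<open>Layer cake with exponent 1: a superlevel set lies in the ball of radius R and also in
  the ball of radius t^(-1/2). The first bound, used for t \<le> R^(-2), contributes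
  \<open>vol1 * R\<close>; the second, used for larger t, contributes twice that.\<close>

lemma nn_integral_inv_square_near:
  assumes "R > 0"
  shows "(\<integral>\<^sup>+x. ennreal (if norm (x::real^3) < R then 1 / (norm x)\<^sup>2 else 0) \<partial>lborel) \<le> ennreal (3 * vol1 * R)"
proof -
  let ?g = "\<lambda>x::real^3. if norm x < R then 1 / (norm x)\<^sup>2 else 0"
  have "(\<integral>\<^sup>+x. ennreal (?g x) \<partial>lborel) = (\<integral>\<^sup>+x. ennreal (?g x powr 1) \<partial>lborel)"
    by (intro nn_integral_cong) auto
  also have "\<dots> = (\<integral>\<^sup>+t. ennreal (1 * t powr (1 - 1)) * indicator {0..} t * emeasure lborel {x \<in> space lborel. t \<le> ?g x} \<partial>lborel)"
    by (intro layer_cake lborel.sigma_finite_measure_axioms) auto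
  also have "\<dots> \<le> (\<integral>\<^sup>+t. ennreal (vol1 * R ^ 3) * indicator {0..R powr -2} t
      + ennreal vol1 * (ennreal (t powr (-3/2)) * indicator {R powr -2..} t) \<partial>lborel)"
  proof (intro nn_integral_mono_AE)
    have "AE t in lborel. t \<noteq> (0::real)" by (simp add: AE_lborel_singleton)
    then show "AE t in lborel. ennreal (1 * t powr (1 - 1)) * indicator {0..} t * emeasure lborel {x \<in> space lborel. t \<le> ?g x}
      \<le> ennreal (vol1 * R ^ 3) * indicator {0..R powr -2} t
      + ennreal vol1 * (ennreal (t powr (-3/2)) * indicator {R powr -2..} t)"
    proof eventually_elim
      case (elim t)
      consider "t < 0" | "0 < t" "t \<le> R powr -2" | "0 < t" "R powr -2 \<le> t" using elim by linarith
      then show ?case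
      proof cases
        case 2
        have "emeasure lborel {x \<in> space lborel. t \<le> ?g x} \<le> emeasure lborel (ball (0::real^3) R)"
          using 2 by (intro emeasure_mono) (auto split: if_splits)
        also have "\<dots> = ennreal (vol1 * R ^ 3)" using assms by (simp add: emeasure_ball3)
        also have "\<dots> = ennreal (vol1 * R ^ 3) * indicator {0..R powr -2} t" using 2 by simp
        also have "\<dots> \<le> ennreal (vol1 * R ^ 3) * indicator {0..R powr -2} t
            + ennreal vol1 * (ennreal (t powr (-3/2)) * indicator {R powr -2..} t)" by (rule add_increasing2) simp_all
        finally have E: "emeasure lborel {x \<in> space lborel. t \<le> ?g x} \<le> \<dots>" .
        have "ennreal (1 * t powr (1 - 1)) * indicator {0..} t = 1" using 2 by simp
        then show ?thesis using E by (simp only: mult_1)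
      next
        case 3
        have "emeasure lborel {x \<in> space lborel. t \<le> ?g x} \<le> emeasure lborel {x::real^3. t \<le> 1 / (norm x)\<^sup>2}"
          using 3 by (intro emeasure_mono) (auto split: if_splits)
        also have "\<dots> \<le> ennreal (vol1 * t powr (-3/2))" by (intro radial_superlevel 3)
        also have "\<dots> = ennreal vol1 * (ennreal (t powr (-3/2)) * indicator {R powr -2..} t)"
          using 3 by (simp add: ennreal_mult)
        also have "\<dots> \<le> ennreal (vol1 * R ^ 3) * indicator {0..R powr -2} t
            + ennreal vol1 * (ennreal (t powr (-3/2)) * indicator {R powr -2..} t)" by (rule add_increasing) simp_all
        finally have E: "emeasure lborel {x \<in> space lborel. t \<le> ?g x} \<le> \<dots>" .
        have "ennreal (1 * t powr (1 - 1)) * indicator {0..} t = 1" using 3 by simp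
        then show ?thesis using E by (simp only: mult_1)
      qed simp
    qed
  qed
  also have "\<dots> = ennreal (vol1 * R ^ 3) * ennreal (R powr -2) + ennreal vol1 * ennreal (2 * (R powr -2) powr (-1/2))"
    using assms by (subst nn_integral_add) (simp_all add: nn_integral_cmult nn_integral_cmult_indicator nn_integral_powr_inf mult.commute[of 2])
  also have "\<dots> = ennreal (vol1 * R ^ 3 * R powr -2 + vol1 * (2 * (R powr -2) powr (-1/2)))"
    by (simp add: ennreal_mult ennreal_plus assms less_imp_le)
  also have "vol1 * R ^ 3 * R powr -2 + vol1 * (2 * (R powr -2) powr (-1/2)) = 3 * vol1 * R"
  proof -
    have "(R powr -2) powr (-1/2) = R" using assms by (subst powr_powr) simp
    moreover have "R ^ 3 * R powr -2 = R"
      using assms by (simp add: powr_minus_divide powr_numeral power2_eq_square power3_eq_cube)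
    ultimately show ?thesis by (simp add: mult.assoc)
  qed
  finally show ?thesis .
qed

text \<open>The superlevel sets are empty for t > R^(-2) and of measure O(t^(-3/2)) below; r > 3/2
  makes t^(r - 5/2) integrable at 0.\<close>

lemma nn_integral_inv_square_far:
  assumes "R > 0" "r > 3/2"
  shows "(\<integral>\<^sup>+x. ennreal ((if norm (x::real^3) \<ge> R then 1 / (norm x)\<^sup>2 else 0) powr r) \<partial>lborel)
    \<le> ennreal (r * vol1 / (r - 3/2) * R powr (3 - 2 * r))"
proof -
  let ?g = "\<lambda>x::real^3. if norm x \<ge> R then 1 / (norm x)\<^sup>2 else 0"
  have "(\<integral>\<^sup>+x. ennreal (?g x powr r) \<partial>lborel) =
     (\<integral>\<^sup>+t. ennreal (r * t powr (r - 1)) * indicator {0..} t * emeasure lborel {x \<in> space lborel. t \<le> ?g x} \<partial>lborel)"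
    using assms by (intro layer_cake lborel.sigma_finite_measure_axioms) auto
  also have "\<dots> \<le> (\<integral>\<^sup>+t. ennreal (r * vol1) * (ennreal (t powr (r - 5/2)) * indicator {0..R powr -2} t) \<partial>lborel)"
  proof (intro nn_integral_mono_AE)
    have "AE t in lborel. t \<noteq> (0::real)" by (simp add: AE_lborel_singleton)
    then show "AE t in lborel. ennreal (r * t powr (r - 1)) * indicator {0..} t * emeasure lborel {x \<in> space lborel. t \<le> ?g x}
      \<le> ennreal (r * vol1) * (ennreal (t powr (r - 5/2)) * indicator {0..R powr -2} t)"
    proof eventually_elim
      case (elim t)
      consider "t < 0" | "0 < t" "t \<le> R powr -2" | "0 < t" "R powr -2 < t" using elim by linarith
      then show ?case
      proof cases
        case 2
        have "emeasure lborel {x \<in> space lborel. t \<le> ?g x} \<le> emeasure lborel {x::real^3. t \<le> 1 / (norm x)\<^sup>2}"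
          using 2 by (intro emeasure_mono) (auto split: if_splits)
        also have "\<dots> \<le> ennreal (vol1 * t powr (-3/2))" by (intro radial_superlevel 2)
        finally have "ennreal (r * t powr (r - 1)) * emeasure lborel {x \<in> space lborel. t \<le> ?g x}
          \<le> ennreal (r * t powr (r - 1)) * ennreal (vol1 * t powr (-3/2))" by (rule mult_left_mono) simp
        also have "\<dots> = ennreal (r * vol1 * (t powr (r - 1) * t powr (-3/2)))"
          using assms by (simp add: ennreal_mult[symmetric] mult_ac)
        also have "t powr (r - 1) * t powr (-3/2) = t powr (r - 5/2)" by (simp flip: powr_add)
        finally show ?thesis using 2 assms by (auto simp: ennreal_mult mult_ac split: split_indicator)
      next
        case 3
        have "\<not> t \<le> ?g x" for x
        proof
          assume t: "t \<le> ?g x"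
          then have R: "norm x \<ge> R" "t \<le> 1 / (norm x)\<^sup>2" using 3 by (auto split: if_splits)
          have "1 / (norm x)\<^sup>2 \<le> 1 / R\<^sup>2" using R assms by (intro divide_left_mono power_mono mult_pos_pos zero_less_power) auto
          then show False using 3 R assms by (simp add: powr_minus_divide powr_numeral)
        qed
        then show ?thesis by simp
      qed simp
    qed
  qed
  also have "\<dots> = ennreal (r * vol1) * ennreal ((R powr -2) powr (r - 3/2) / (r - 3/2))"
    using assms by (subst nn_integral_cmult) (simp_all add: nn_integral_powr_0)
  also have "\<dots> = ennreal (r * vol1 / (r - 3/2) * R powr (3 - 2 * r))"
    using assms by (simp add: powr_powr algebra_simps flip: ennreal_mult)
  finally show ?thesis .
qed

text \<open>The Riesz potential of order 1 in dimension 3, up to its normalising constant. Values in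
  \<open>ennreal\<close> separate estimates from the question of convergence.\<close>

definition riesz :: "(real^3 \<Rightarrow> real) \<Rightarrow> real^3 \<Rightarrow> ennreal" where
  "riesz f x = (\<integral>\<^sup>+y. ennreal (f y / (norm (x - y))\<^sup>2) \<partial>lborel)"

lemma riesz_measurable [measurable]:
  assumes [measurable]: "f \<in> borel_measurable borel"
  shows "riesz f \<in> borel_measurable borel"
proof -
  have "(\<lambda>x. \<integral>\<^sup>+y. ennreal (f y / (norm (x - y))\<^sup>2) \<partial>lborel) \<in> borel_measurable lborel"
    by (rule lborel.borel_measurable_nn_integral) measurable
  then show ?thesis by (simp add: riesz_def[abs_def])
qed

lemma riesz_cmult:
  assumes [measurable]: "f \<in> borel_measurable borel" and "c \<ge> 0"
  shows "riesz (\<lambda>y. c * f y) x = ennreal c * riesz f x"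
proof -
  have "riesz (\<lambda>y. c * f y) x = (\<integral>\<^sup>+y. ennreal c * ennreal (f y / (norm (x - y))\<^sup>2) \<partial>lborel)"
    unfolding riesz_def using assms(2) by (intro nn_integral_cong) (simp add: ennreal_mult'[symmetric])
  then show ?thesis unfolding riesz_def by (simp add: nn_integral_cmult)
qed

lemma riesz_mono: "(\<And>y. f y \<le> g y) \<Longrightarrow> riesz f x \<le> riesz g x"
  unfolding riesz_def by (intro nn_integral_mono ennreal_leI divide_right_mono) auto

lemma riesz_add:
  assumes [measurable]: "f \<in> borel_measurable borel" "g \<in> borel_measurable borel"
    and "\<And>y. f y \<ge> 0" "\<And>y. g y \<ge> 0"
  shows "riesz (\<lambda>y. f y + g y) x = riesz f x + riesz g x"
  unfolding riesz_def using assms(3,4)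
  by (subst nn_integral_add[symmetric]) (auto intro!: nn_integral_cong simp: add_divide_distrib ennreal_plus)

text \<open>For \<open>f\<close> with $\|f\|_q \le 1$, the radius $R = h^{-q/3}$ balances the part $|x - y| \ge R$ (by Hoelder)
  against the part with $f \le h$ and $|x - y| < R$: both are $O(h^{1-q/3})$.\<close>

definition split_const :: "real \<Rightarrow> real \<Rightarrow> bool" where
  "split_const q C \<longleftrightarrow> C > 0 \<and> (\<forall>f h x. f \<in> borel_measurable borel \<longrightarrow> (\<forall>y. f y \<ge> 0) \<longrightarrow>
    (\<integral>\<^sup>+y. ennreal (f y powr q) \<partial>lborel) \<le> 1 \<longrightarrow> h > 0 \<longrightarrow>
    riesz f x \<le> ennreal (C * h powr (1 - q/3)) +
      (\<integral>\<^sup>+y. ennreal ((if norm (x - y) < h powr (-q/3) then 1 / (norm (x - y))\<^sup>2 else 0) * (if f y > h then f y else 0)) \<partial>lborel))"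

lemma HLS_split:
  assumes q: "1 < q" "q < 3"
  obtains C where "split_const q C"
proof -
  \<comment> \<open>The dual exponent. The assumption q < 3 is equivalent to r > 3/2, the
    integrability of |x|^(-2r) at infinity.\<close>
  define r where "r = q / (q - 1)"
  have r: "r > 3/2" "1 / r + 1 / q = 1" "r > 1" using q by (auto simp: r_def field_simps)
  define K where "K = r * vol1 / (r - 3/2)"
  have K: "K > 0" using r by (simp add: K_def)
  define C where "C = K powr (1/r) + 3 * vol1"
  have C: "C > 0" using K by (simp add: C_def add_pos_pos)
  have "split_const q C" unfolding split_const_def
  proof (intro conjI allI impI C)
    fix f :: "real^3 \<Rightarrow> real" and h :: real and x :: "real^3"
    assume [measurable]: "f \<in> borel_measurable borel" and "\<forall>y. f y \<ge> 0"
      and f1: "(\<integral>\<^sup>+y. ennreal (f y powr q) \<partial>lborel) \<le> 1" and h: "h > 0"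
    then have nn: "\<And>y. f y \<ge> 0" by blast
    define R where "R = h powr (-q/3)"
    have R: "R > 0" using h by (simp add: R_def)
    let ?far = "\<lambda>z::real^3. if norm z \<ge> R then 1 / (norm z)\<^sup>2 else 0"
    let ?near = "\<lambda>z::real^3. if norm z < R then 1 / (norm z)\<^sup>2 else 0"
    have [measurable]: "?far \<in> borel_measurable borel" "?near \<in> borel_measurable borel" by measurable
    have "(\<integral>\<^sup>+y. ennreal (?far (x - y) powr r) \<partial>lborel) = (\<integral>\<^sup>+y. ennreal (?far y powr r) \<partial>lborel)"
      by (rule nn_integral_lborel_diff[of "\<lambda>z. ennreal (?far z powr r)"]) measurable
    also have "\<dots> \<le> ennreal (K * R powr (3 - 2 * r))"
      unfolding K_def using R r(1) by (rule nn_integral_inv_square_far)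
    finally have "(\<integral>\<^sup>+y. ennreal (?far (x - y) * f y) \<partial>lborel) \<le> ennreal ((K * R powr (3 - 2 * r)) powr (1/r) * 1 powr (1/q))"
      using q r K f1 by (intro Holder_nn_integral[OF r(3) q(1) r(2)]) (auto simp: nn)
    also have "(K * R powr (3 - 2 * r)) powr (1/r) * 1 powr (1/q) = K powr (1/r) * h powr (1 - q/3)"
    proof -
      have "- q / 3 * ((3 - 2 * r) * (1 / r)) = 1 - q / 3"
        using q by (simp add: r_def field_simps)
      then show ?thesis using K h by (simp add: powr_mult powr_powr R_def)
    qed
    finally have far: "(\<integral>\<^sup>+y. ennreal (?far (x - y) * f y) \<partial>lborel) \<le> ennreal (K powr (1/r) * h powr (1 - q/3))" .
    have "(\<integral>\<^sup>+y. ennreal (h * ?near (x - y)) \<partial>lborel) = (\<integral>\<^sup>+y. ennreal h * ennreal (?near (x - y)) \<partial>lborel)"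
      using h by (simp add: ennreal_mult)
    also have "\<dots> = ennreal h * (\<integral>\<^sup>+y. ennreal (?near (x - y)) \<partial>lborel)"
      by (rule nn_integral_cmult) measurable
    also have "(\<integral>\<^sup>+y. ennreal (?near (x - y)) \<partial>lborel) = (\<integral>\<^sup>+y. ennreal (?near y) \<partial>lborel)"
      by (rule nn_integral_lborel_diff[of "\<lambda>z. ennreal (?near z)"]) measurable
    also have "ennreal h * \<dots> \<le> ennreal h * ennreal (3 * vol1 * R)"
      by (intro mult_left_mono nn_integral_inv_square_near R) simp
    also have "\<dots> = ennreal (3 * vol1 * h powr (1 - q/3))"
      using h R by (simp add: R_def ennreal_mult'[symmetric] powr_diff powr_minus_divide mult_ac)
    finally have near: "(\<integral>\<^sup>+y. ennreal (h * ?near (x - y)) \<partial>lborel) \<le> ennreal (3 * vol1 * h powr (1 - q/3))" .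
    have "riesz f x \<le> (\<integral>\<^sup>+y. ennreal (?far (x - y) * f y) + ennreal (h * ?near (x - y))
        + ennreal (?near (x - y) * (if f y > h then f y else 0)) \<partial>lborel)"
      unfolding riesz_def
    proof (intro nn_integral_mono)
      fix y
      \<comment> \<open>Far from x the first term suffices; near x either f y \<le> h, or f y is
        kept in the last term.\<close>
      have "f y / (norm (x - y))\<^sup>2 \<le> ?far (x - y) * f y + h * ?near (x - y) + ?near (x - y) * (if f y > h then f y else 0)"
        using h nn[of y] by (auto intro!: divide_right_mono)
      then have "ennreal (f y / (norm (x - y))\<^sup>2) \<le> ennreal (?far (x - y) * f y + h * ?near (x - y) + ?near (x - y) * (if f y > h then f y else 0))"
        by (rule ennreal_leI)
      also have "\<dots> = ennreal (?far (x - y) * f y) + ennreal (h * ?near (x - y)) + ennreal (?near (x - y) * (if f y > h then f y else 0))"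
        using h nn[of y] by (subst ennreal_plus; simp)+
      finally show "ennreal (f y / (norm (x - y))\<^sup>2) \<le> \<dots>" .
    qed
    also have "\<dots> = (\<integral>\<^sup>+y. ennreal (?far (x - y) * f y) \<partial>lborel) + (\<integral>\<^sup>+y. ennreal (h * ?near (x - y)) \<partial>lborel)
        + (\<integral>\<^sup>+y. ennreal (?near (x - y) * (if f y > h then f y else 0)) \<partial>lborel)"
      by (subst nn_integral_add; measurable)+
    also have "\<dots> \<le> ennreal (K powr (1/r) * h powr (1 - q/3)) + ennreal (3 * vol1 * h powr (1 - q/3))
        + (\<integral>\<^sup>+y. ennreal (?near (x - y) * (if f y > h then f y else 0)) \<partial>lborel)"
      by (intro add_mono far near order_refl)
    also have "ennreal (K powr (1/r) * h powr (1 - q/3)) + ennreal (3 * vol1 * h powr (1 - q/3)) = ennreal (C * h powr (1 - q/3))"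
      by (simp add: C_def distrib_right)
    finally show "riesz f x \<le> ennreal (C * h powr (1 - q/3)) +
      (\<integral>\<^sup>+y. ennreal ((if norm (x - y) < h powr (-q/3) then 1 / (norm (x - y))\<^sup>2 else 0) * (if f y > h then f y else 0)) \<partial>lborel)"
      by (simp only: R_def)
  qed
  then show thesis by (rule that)
qed

text \<open>Tonelli and translation invariance: on L^1, convolution with the truncated kernel is
  bounded by the integral of that kernel.\<close>

lemma nn_integral_near_convolution:
  assumes [measurable]: "g \<in> borel_measurable borel" and g: "\<And>y. 0 \<le> g y" and R: "R > 0"
  shows "(\<integral>\<^sup>+x. \<integral>\<^sup>+y. ennreal ((if norm (x - y) < R then 1 / (norm (x - y))\<^sup>2 else 0) * g y) \<partial>lborel \<partial>lborel)
    \<le> ennreal (3 * vol1 * R) * (\<integral>\<^sup>+y. ennreal (g y) \<partial>(lborel :: (real^3) measure))"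
proof -
  let ?near = "\<lambda>z::real^3. if norm z < R then 1 / (norm z)\<^sup>2 else 0"
  have [measurable]: "?near \<in> borel_measurable borel" by measurable
  have "(\<integral>\<^sup>+x. \<integral>\<^sup>+y. ennreal (?near (x - y) * g y) \<partial>lborel \<partial>lborel)
      = (\<integral>\<^sup>+y. \<integral>\<^sup>+x. ennreal (?near (x - y) * g y) \<partial>lborel \<partial>lborel)"
    by (rule lborel_pair.Fubini') measurable
  also have "\<dots> = (\<integral>\<^sup>+y. (\<integral>\<^sup>+x. ennreal (?near x) \<partial>lborel) * ennreal (g y) \<partial>lborel)"
  proof (rule nn_integral_cong)
    fix y
    have "(\<integral>\<^sup>+x. ennreal (?near (x - y) * g y) \<partial>lborel) = (\<integral>\<^sup>+x. ennreal (?near (x - y)) * ennreal (g y) \<partial>lborel)"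
      using g by (simp add: ennreal_mult)
    also have "\<dots> = (\<integral>\<^sup>+x. ennreal (?near (x - y)) \<partial>lborel) * ennreal (g y)"
      by (rule nn_integral_multc) measurable
    also have "(\<integral>\<^sup>+x. ennreal (?near (x - y)) \<partial>lborel) = (\<integral>\<^sup>+x. ennreal (?near (y - x)) \<partial>lborel)"
      by (intro nn_integral_cong) (metis norm_minus_commute)
    also have "\<dots> = (\<integral>\<^sup>+x. ennreal (?near x) \<partial>lborel)"
      by (rule nn_integral_lborel_diff[of "\<lambda>z. ennreal (?near z)"]) measurable
    finally show "(\<integral>\<^sup>+x. ennreal (?near (x - y) * g y) \<partial>lborel) = (\<integral>\<^sup>+x. ennreal (?near x) \<partial>lborel) * ennreal (g y)" .
  qed
  also have "\<dots> = (\<integral>\<^sup>+x. ennreal (?near x) \<partial>lborel) * (\<integral>\<^sup>+y. ennreal (g y) \<partial>lborel)"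
    by (rule nn_integral_cmult) measurable
  also have "\<dots> \<le> ennreal (3 * vol1 * R) * (\<integral>\<^sup>+y. ennreal (g y) \<partial>lborel)"
    by (intro mult_right_mono nn_integral_inv_square_near R) simp
  finally show ?thesis .
qed

text \<open>Stating the inequality as a predicate in C makes explicit that one constant serves every
  f.\<close>

definition HLS1_const :: "real \<Rightarrow> real \<Rightarrow> real \<Rightarrow> bool" where
  "HLS1_const q s C \<longleftrightarrow> C > 0 \<and> (\<forall>f. f \<in> borel_measurable borel \<longrightarrow> (\<forall>y. f y \<ge> 0) \<longrightarrow>
    (\<integral>\<^sup>+y. ennreal (f y powr q) \<partial>lborel) \<le> 1 \<longrightarrow>
    (AE x in lborel. riesz f x < \<infinity>) \<and>
    (\<integral>\<^sup>+x. ennreal (enn2real (riesz f x) powr s) \<partial>lborel) \<le> ennreal C)"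

text \<open>A direct argument of Marcinkiewicz type. For each level t the height h is chosen so that
  the bounded part of the splitting equals t/2. Markov's inequality for the remaining part, whose
  L^1 norm sees only the values of f above h, controls the superlevel set of the potential.
  Exchanging the integrals over t and y then returns the integral of f^q.\<close>

lemma HLS_normalized:
  assumes q: "1 < q" "q < 3" and s: "s = 3 * q / (3 - q)"
  obtains C where "HLS1_const q s C"
proof -
  obtain C1 where sc: "split_const q C1" using HLS_split[OF q] by blast
  then have C1: "C1 > 0" by (simp add: split_const_def)
  \<comment> \<open>\<sigma> is the exponent of the inverse of h -> h^(1 - q/3).\<close>
  define \<sigma> where "\<sigma> = 3 / (3 - q)"
  have \<sigma>: "\<sigma> > 1" "s = \<sigma> * q" "(1 - q/3) * \<sigma> = 1" "s > \<sigma>"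
  proof -
    show 1: "\<sigma> > 1" and 2: "s = \<sigma> * q" and "(1 - q/3) * \<sigma> = 1" using q by (auto simp: \<sigma>_def s field_simps)
    show "s > \<sigma>" using mult_strict_left_mono[of 1 q \<sigma>] 1 2 q by simp
  qed
  \<comment> \<open>D collects the constants of the superlevel estimate multiplied by s t^(s-1); C
    adds those of the t-integral up to 2 C1 f^(1/\<sigma>).\<close>
  define D where "D = s * (3 * vol1 / C1) * (2 * C1) powr \<sigma>"
  have D: "D > 0" using C1 \<sigma> by (simp add: D_def)
  define C where "C = D * (2 * C1) powr (s - \<sigma>) / (s - \<sigma>)"
  have C: "C > 0" using D C1 \<sigma> by (simp add: C_def)
  have "HLS1_const q s C" unfolding HLS1_const_def
  proof (intro conjI allI impI C)
    fix f :: "real^3 \<Rightarrow> real"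
    assume f[measurable]: "f \<in> borel_measurable borel" and "\<forall>y. f y \<ge> 0"
      and f1: "(\<integral>\<^sup>+y. ennreal (f y powr q) \<partial>lborel) \<le> 1"
    then have nn: "\<And>y. f y \<ge> 0" by blast
    define N where "N h x = (\<integral>\<^sup>+y. ennreal ((if norm (x - y) < h powr (-q/3) then 1 / (norm (x - y))\<^sup>2 else 0) * (if f y > h then f y else 0)) \<partial>lborel)"
      for h and x :: "real^3"
    have sp: "riesz f x \<le> ennreal (C1 * h powr (1 - q/3)) + N h x" if "h > 0" for h x
      unfolding N_def using sc f nn f1 that unfolding split_const_def by blast
    have Nm[measurable]: "N h \<in> borel_measurable borel" for h
    proof -
      have "(\<lambda>x::real^3. \<integral>\<^sup>+y. ennreal ((if norm (x - y) < h powr (-q/3) then 1 / (norm (x - y))\<^sup>2 else 0) * (if f y > h then f y else 0)) \<partial>lborel) \<in> borel_measurable lborel"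
        by (rule lborel.borel_measurable_nn_integral) measurable
      then show ?thesis by (simp add: N_def[abs_def])
    qed
    have NI: "(\<integral>\<^sup>+x. N h x \<partial>lborel) \<le> ennreal (3 * vol1 * h powr (-q/3)) * (\<integral>\<^sup>+y. ennreal (if f y > h then f y else 0) \<partial>lborel)"
      if "h > 0" for h
      unfolding N_def by (rule nn_integral_near_convolution) (use that nn in auto)
    have fin: "AE x in lborel. riesz f x < \<infinity>"
    proof -
      \<comment> \<open>Height 1 is enough for finiteness, because f \<le> f^q where f > 1.\<close>
      have "(\<integral>\<^sup>+y. ennreal (if f y > 1 then f y else 0) \<partial>lborel) \<le> (\<integral>\<^sup>+y. ennreal (f y powr q) \<partial>lborel)"
      proof (intro nn_integral_mono ennreal_leI)
        fix y show "(if f y > 1 then f y else 0) \<le> f y powr q"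
          using q powr_mono[of 1 q "f y"] by auto
      qed
      also note f1
      finally have "(\<integral>\<^sup>+y. ennreal (if f y > 1 then f y else 0) \<partial>lborel) < \<infinity>" by (simp add: le_less_trans)
      then have "(\<integral>\<^sup>+x. N 1 x \<partial>lborel) < \<infinity>"
        using NI[of 1] by (simp add: ennreal_mult_less_top le_less_trans)
      then have "AE x in lborel. N 1 x \<noteq> \<infinity>" by (intro nn_integral_noteq_infinite) auto
      then show ?thesis
      proof eventually_elim
        case (elim x)
        have "ennreal (C1 * 1 powr (1 - q/3)) + N 1 x < \<infinity>" using elim by (simp add: less_top)
        then show ?case using sp[of 1 x] by (simp add: le_less_trans)
      qed
    qed
    define G where "G x = enn2real (riesz f x)" for x
    have [measurable]: "G \<in> borel_measurable borel" unfolding G_def[abs_def] by measurable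
    have level: "emeasure lborel {x \<in> space lborel. t \<le> G x} \<le>
        ennreal (3 * vol1 / C1 * (t / (2 * C1)) powr (- \<sigma>)) * (\<integral>\<^sup>+y. ennreal (if f y > (t / (2 * C1)) powr \<sigma> then f y else 0) \<partial>lborel)"
      if t: "t > 0" for t
    proof -
      \<comment> \<open>The height for which \<open>C1 * h powr (1 - q/3)\<close> is half of the
        level t.\<close>
      define h where "h = (t / (2 * C1)) powr \<sigma>"
      have h: "h > 0" using t C1 by (simp add: h_def)
      have hl: "C1 * h powr (1 - q/3) = t / 2"
        using \<sigma> t C1 by (simp add: h_def powr_powr mult.commute)
      \<comment> \<open>If the potential is at least t and the bounded part equals t/2, then the
        remainder is at least t/2.\<close>
      have "{x \<in> space lborel. t \<le> G x} \<subseteq> {x \<in> UNIV. 1 \<le> ennreal (2 / t) * N h x}"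
      proof safe
        fix x assume "t \<le> G x"
        then have "ennreal t \<le> riesz f x"
          using t unfolding G_def by (metis ennreal_enn2real_if ennreal_le_iff enn2real_nonneg linorder_not_less top_greatest)
        also have "\<dots> \<le> ennreal (t / 2) + N h x" using sp[OF h, of x] by (simp add: hl)
        finally have *: "ennreal t \<le> ennreal (t / 2) + N h x" .
        have "ennreal (t / 2) \<le> N h x"
        proof (cases "N h x")
          case (real n)
          then have "t \<le> t / 2 + n" using * t by (simp flip: ennreal_plus)
          then show ?thesis using real t by (simp add: ennreal_leI)
        qed simp
        then have "ennreal (2 / t) * ennreal (t / 2) \<le> ennreal (2 / t) * N h x" by (rule mult_left_mono) simp
        then show "1 \<le> ennreal (2 / t) * N h x" using t by (simp flip: ennreal_mult)
      qed simp
      then have "emeasure lborel {x \<in> space lborel. t \<le> G x} \<le> emeasure lborel {x \<in> UNIV. 1 \<le> ennreal (2 / t) * N h x}"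
        by (intro emeasure_mono) auto
      also have "\<dots> \<le> ennreal (2 / t) * (\<integral>\<^sup>+x. N h x * indicator UNIV x \<partial>lborel)"
        by (intro nn_integral_Markov_inequality) auto
      also have "\<dots> \<le> ennreal (2 / t) * (ennreal (3 * vol1 * h powr (-q/3)) * (\<integral>\<^sup>+y. ennreal (if f y > h then f y else 0) \<partial>lborel))"
        using NI[OF h] by (intro mult_left_mono) auto
      also have "\<dots> = ennreal (2 / t * (3 * vol1 * h powr (-q/3))) * (\<integral>\<^sup>+y. ennreal (if f y > h then f y else 0) \<partial>lborel)"
        using t by (subst ennreal_mult) (auto simp: mult.assoc)
      also have "2 / t * (3 * vol1 * h powr (-q/3)) = 3 * vol1 / C1 * (t / (2 * C1)) powr (- \<sigma>)"
      proof -
        have "h powr (-q/3) = h powr (1 - q/3) * h powr (-1)" by (subst powr_add[symmetric]) simp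
        also have "h powr (1 - q/3) = t / (2 * C1)" using hl C1 by (simp add: field_simps)
        also have "h powr (-1) = (t / (2 * C1)) powr (- \<sigma>)" unfolding h_def powr_powr by simp
        finally show ?thesis using t C1 by simp
      qed
      finally show ?thesis by (simp add: h_def)
    qed
    have "(\<integral>\<^sup>+x. ennreal (G x powr s) \<partial>lborel)
       = (\<integral>\<^sup>+t. ennreal (s * t powr (s - 1)) * indicator {0..} t * emeasure lborel {x \<in> space lborel. t \<le> G x} \<partial>lborel)"
      using \<sigma> q by (intro layer_cake lborel.sigma_finite_measure_axioms) (auto simp: G_def)
    \<comment> \<open>For fixed y the condition f > (t / (2 C1))^\<sigma> is read as the upper limit
      2 C1 f^(1/\<sigma>) for t.\<close>
    also have "\<dots> \<le> (\<integral>\<^sup>+t. \<integral>\<^sup>+y. ennreal (D * t powr (s - \<sigma> - 1) * f y) * indicator {0..2 * C1 * f y powr (1 / \<sigma>)} t \<partial>lborel \<partial>lborel)"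
    proof (intro nn_integral_mono_AE)
      have "AE t in lborel. t \<noteq> (0::real)" by (simp add: AE_lborel_singleton)
      then show "AE t in lborel. ennreal (s * t powr (s - 1)) * indicator {0..} t * emeasure lborel {x \<in> space lborel. t \<le> G x}
         \<le> (\<integral>\<^sup>+y. ennreal (D * t powr (s - \<sigma> - 1) * f y) * indicator {0..2 * C1 * f y powr (1 / \<sigma>)} t \<partial>lborel)"
      proof eventually_elim
        case (elim t)
        show ?case
        proof (cases "t > 0")
          case True
          have "s > 0" using \<sigma> by simp
          have "ennreal (s * t powr (s - 1)) * indicator {0..} t * emeasure lborel {x \<in> space lborel. t \<le> G x}
            = ennreal (s * t powr (s - 1)) * emeasure lborel {x \<in> space lborel. t \<le> G x}" using True by simp
          also have "\<dots> \<le> ennreal (s * t powr (s - 1)) * (ennreal (3 * vol1 / C1 * (t / (2 * C1)) powr (- \<sigma>)) *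
              (\<integral>\<^sup>+y. ennreal (if f y > (t / (2 * C1)) powr \<sigma> then f y else 0) \<partial>lborel))"
            by (intro mult_left_mono level True) simp
          also have "\<dots> = ennreal (s * t powr (s - 1) * (3 * vol1 / C1 * (t / (2 * C1)) powr (- \<sigma>))) *
              (\<integral>\<^sup>+y. ennreal (if f y > (t / (2 * C1)) powr \<sigma> then f y else 0) \<partial>lborel)"
            using \<open>s > 0\<close> C1 by (subst ennreal_mult) (auto simp: mult.assoc)
          also have "s * t powr (s - 1) * (3 * vol1 / C1 * (t / (2 * C1)) powr (- \<sigma>)) = D * t powr (s - \<sigma> - 1)"
          proof -
            have "t powr (s - 1) * t powr (- \<sigma>) = t powr (s - \<sigma> - 1)"
              by (subst powr_add[symmetric]) (simp add: algebra_simps)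
            moreover have "(t / (2 * C1)) powr (- \<sigma>) = t powr (- \<sigma>) * (2 * C1) powr \<sigma>"
              using True C1 by (simp add: powr_divide powr_minus_divide)
            ultimately show ?thesis by (simp add: D_def mult_ac)
          qed
          also have "ennreal (D * t powr (s - \<sigma> - 1)) * (\<integral>\<^sup>+y. ennreal (if f y > (t / (2 * C1)) powr \<sigma> then f y else 0) \<partial>lborel)
            = (\<integral>\<^sup>+y. ennreal (D * t powr (s - \<sigma> - 1)) * ennreal (if f y > (t / (2 * C1)) powr \<sigma> then f y else 0) \<partial>lborel)"
            by (rule nn_integral_cmult[symmetric]) measurable
          also have "\<dots> \<le> (\<integral>\<^sup>+y. ennreal (D * t powr (s - \<sigma> - 1) * f y) * indicator {0..2 * C1 * f y powr (1 / \<sigma>)} t \<partial>lborel)"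
          proof (rule nn_integral_mono)
            fix y
            show "ennreal (D * t powr (s - \<sigma> - 1)) * ennreal (if f y > (t / (2 * C1)) powr \<sigma> then f y else 0)
              \<le> ennreal (D * t powr (s - \<sigma> - 1) * f y) * indicator {0..2 * C1 * f y powr (1 / \<sigma>)} t"
            proof (cases "f y > (t / (2 * C1)) powr \<sigma>")
              case ft: True
              then have "((t / (2 * C1)) powr \<sigma>) powr (1 / \<sigma>) \<le> f y powr (1 / \<sigma>)"
                using \<sigma> by (intro powr_mono2) auto
              then have "t / (2 * C1) \<le> f y powr (1 / \<sigma>)" using \<sigma> True C1 by (simp add: powr_powr)
              then have "t \<le> 2 * C1 * f y powr (1 / \<sigma>)" using C1 by (simp add: pos_divide_le_eq mult.commute)
              then show ?thesis using ft True D nn[of y] by (simp add: ennreal_mult)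
            qed simp
          qed
          finally show ?thesis .
        qed (use elim in simp)
      qed
    qed
    also have "\<dots> = (\<integral>\<^sup>+y. \<integral>\<^sup>+t. ennreal (D * t powr (s - \<sigma> - 1) * f y) * indicator {0..2 * C1 * f y powr (1 / \<sigma>)} t \<partial>lborel \<partial>lborel)"
    proof (rule lborel_pair.Fubini')
      have "(\<lambda>(y, t). ennreal (D * t powr (s - \<sigma> - 1) * f y) * (if 0 \<le> t \<and> t \<le> 2 * C1 * f y powr (1 / \<sigma>) then 1 else 0)) \<in> borel_measurable (lborel \<Otimes>\<^sub>M lborel)"
        by measurable
      then show "(\<lambda>(y, t). ennreal (D * t powr (s - \<sigma> - 1) * f y) * indicator {0..2 * C1 * f y powr (1 / \<sigma>)} t) \<in> borel_measurable (lborel \<Otimes>\<^sub>M lborel)"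
        by (rule measurable_cong[THEN iffD1, rotated]) (auto split: split_indicator)
    qed
    also have "\<dots> = (\<integral>\<^sup>+y. ennreal C * ennreal (f y powr q) \<partial>lborel)"
    proof (rule nn_integral_cong)
      fix y
      have "(\<integral>\<^sup>+t. ennreal (D * t powr (s - \<sigma> - 1) * f y) * indicator {0..2 * C1 * f y powr (1 / \<sigma>)} t \<partial>lborel)
        = (\<integral>\<^sup>+t. ennreal (D * f y) * (ennreal (t powr (s - \<sigma> - 1)) * indicator {0..2 * C1 * f y powr (1 / \<sigma>)} t) \<partial>lborel)"
        using D nn[of y] by (intro nn_integral_cong) (simp add: ennreal_mult mult_ac)
      also have "\<dots> = ennreal (D * f y) * ennreal ((2 * C1 * f y powr (1 / \<sigma>)) powr (s - \<sigma> - 1 + 1) / (s - \<sigma> - 1 + 1))"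
        using \<sigma> C1 by (subst nn_integral_cmult) (simp_all add: nn_integral_powr_0)
      also have "\<dots> = ennreal (D * f y * ((2 * C1 * f y powr (1 / \<sigma>)) powr (s - \<sigma>) / (s - \<sigma>)))"
        using D nn[of y] \<sigma> by (simp add: ennreal_mult'[symmetric])
      \<comment> \<open>The exponents fit because s / \<sigma> = q: the product of f and f^((s -
        \<sigma>)/\<sigma>) is f^q.\<close>
      also have "D * f y * ((2 * C1 * f y powr (1 / \<sigma>)) powr (s - \<sigma>) / (s - \<sigma>)) = C * f y powr q"
      proof (cases "f y = 0")
        case False
        then have fy: "f y > 0" using nn[of y] by simp
        have "(2 * C1 * f y powr (1 / \<sigma>)) powr (s - \<sigma>) = (2 * C1) powr (s - \<sigma>) * f y powr (1 / \<sigma> * (s - \<sigma>))"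
          using C1 by (simp add: powr_mult powr_powr)
        moreover have "1 / \<sigma> * (s - \<sigma>) = q - 1" using \<sigma> by (simp add: field_simps)
        moreover have "f y * f y powr (q - 1) = f y powr q" using fy by (simp add: powr_diff)
        ultimately show ?thesis by (simp add: C_def mult_ac)
      qed (simp add: C_def)
      finally show "(\<integral>\<^sup>+t. ennreal (D * t powr (s - \<sigma> - 1) * f y) * indicator {0..2 * C1 * f y powr (1 / \<sigma>)} t \<partial>lborel)
         = ennreal C * ennreal (f y powr q)" using C by (simp add: ennreal_mult)
    qed
    also have "\<dots> = ennreal C * (\<integral>\<^sup>+y. ennreal (f y powr q) \<partial>lborel)" by (rule nn_integral_cmult) measurable
    also have "\<dots> \<le> ennreal C * 1" by (intro mult_left_mono f1) simp
    finally show "(\<integral>\<^sup>+x. ennreal (enn2real (riesz f x) powr s) \<partial>lborel) \<le> ennreal C" by (simp add: G_def)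
    show "AE x in lborel. riesz f x < \<infinity>" by (rule fin)
  qed
  then show thesis by (rule that)
qed

lemma powr_add_le:
  fixes x y s :: real
  assumes "0 \<le> x" "0 \<le> y" "0 < s"
  shows "(x + y) powr s \<le> 2 powr s * (x powr s + y powr s)"
proof -
  have "(x + y) powr s \<le> (2 * max x y) powr s" using assms by (intro powr_mono2) auto
  also have "\<dots> = 2 powr s * max x y powr s" using assms by (simp add: powr_mult)
  also have "\<dots> \<le> 2 powr s * (x powr s + y powr s)" by (intro mult_left_mono) (auto simp: max_def)
  finally show ?thesis .
qed

lemma nn_integral_powr_cmult:
  assumes [measurable]: "f \<in> borel_measurable M" and "c \<ge> 0" and "\<And>x. f x \<ge> 0"
  shows "(\<integral>\<^sup>+x. ennreal ((c * f x) powr s) \<partial>M) = ennreal (c powr s) * (\<integral>\<^sup>+x. ennreal (f x powr s) \<partial>M)"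
proof -
  have "(\<integral>\<^sup>+x. ennreal ((c * f x) powr s) \<partial>M) = (\<integral>\<^sup>+x. ennreal (c powr s) * ennreal (f x powr s) \<partial>M)"
    using assms(2,3) by (simp add: powr_mult ennreal_mult)
  then show ?thesis by (simp add: nn_integral_cmult)
qed

definition HLS_const :: "real \<Rightarrow> real \<Rightarrow> real \<Rightarrow> bool" where
  "HLS_const q s C \<longleftrightarrow> C > 0 \<and> (\<forall>f F. f \<in> borel_measurable borel \<longrightarrow> (\<forall>y. f y \<ge> 0) \<longrightarrow> F > 0 \<longrightarrow>
    (\<integral>\<^sup>+y. ennreal (f y powr q) \<partial>lborel) \<le> ennreal F \<longrightarrow>
    (AE x in lborel. riesz f x < \<infinity>) \<and>
    (\<integral>\<^sup>+x. ennreal (enn2real (riesz f x) powr s) \<partial>lborel) \<le> ennreal (C * F powr (s / q)))"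

lemma HLS_constD:
  assumes "HLS_const q s C" "f \<in> borel_measurable borel" "\<And>y. f y \<ge> 0" "F > 0"
    "(\<integral>\<^sup>+y. ennreal (f y powr q) \<partial>lborel) \<le> ennreal F"
  shows "(AE x in lborel. riesz f x < \<infinity>) \<and>
    (\<integral>\<^sup>+x. ennreal (enn2real (riesz f x) powr s) \<partial>lborel) \<le> ennreal (C * F powr (s / q))"
  using assms unfolding HLS_const_def by blast

text \<open>By homogeneity: f / F^(1/q) satisfies the normalised inequality, and scaling back costs
  F^(s/q).\<close>

theorem Hardy_Littlewood_Sobolev:
  assumes q: "1 < q" "q < 3" and s: "s = 3 * q / (3 - q)"
  obtains C where "HLS_const q s C"
proof -
  obtain C where hc: "HLS1_const q s C" using HLS_normalized[OF q s] by blast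
  then have C: "C > 0" by (simp add: HLS1_const_def)
  have "HLS_const q s C" unfolding HLS_const_def
  proof (intro conjI allI impI C)
    fix f :: "real^3 \<Rightarrow> real" and F :: real
    assume f[measurable]: "f \<in> borel_measurable borel" and "\<forall>y. f y \<ge> 0" and F: "F > 0"
      and fF: "(\<integral>\<^sup>+y. ennreal (f y powr q) \<partial>lborel) \<le> ennreal F"
    then have nn: "\<And>y. f y \<ge> 0" by blast
    define k where "k = F powr (1 / q)"
    have k: "k > 0" "k powr q = F" "k powr s = F powr (s / q)" using F q by (simp_all add: k_def powr_powr)
    let ?g = "\<lambda>y. (1 / k) * f y"
    have "(\<integral>\<^sup>+y. ennreal (?g y powr q) \<partial>lborel) = ennreal ((1 / k) powr q) * (\<integral>\<^sup>+y. ennreal (f y powr q) \<partial>lborel)"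
      using k nn by (intro nn_integral_powr_cmult) auto
    also have "\<dots> \<le> ennreal ((1 / k) powr q) * ennreal F" by (intro mult_left_mono fF) simp
    also have "\<dots> = 1" using k F by (simp add: powr_divide flip: ennreal_mult)
    finally have g: "(AE x in lborel. riesz ?g x < \<infinity>) \<and>
      (\<integral>\<^sup>+x. ennreal (enn2real (riesz ?g x) powr s) \<partial>lborel) \<le> ennreal C"
      using hc k nn unfolding HLS1_const_def by simp
    have fg: "riesz f x = ennreal k * riesz ?g x" for x
      using riesz_cmult[of ?g k x] k by simp
    show "AE x in lborel. riesz f x < \<infinity>"
      using conjunct1[OF g] by eventually_elim (simp add: fg ennreal_mult_less_top)
    show "(\<integral>\<^sup>+x. ennreal (enn2real (riesz f x) powr s) \<partial>lborel) \<le> ennreal (C * F powr (s / q))"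
    proof -
      have "(\<integral>\<^sup>+x. ennreal (enn2real (riesz f x) powr s) \<partial>lborel)
        = (\<integral>\<^sup>+x. ennreal ((k * enn2real (riesz ?g x)) powr s) \<partial>lborel)"
        using k by (simp add: fg enn2real_mult)
      also have "\<dots> = ennreal (k powr s) * (\<integral>\<^sup>+x. ennreal (enn2real (riesz ?g x) powr s) \<partial>lborel)"
        using k by (intro nn_integral_powr_cmult) auto
      also have "\<dots> \<le> ennreal (k powr s) * ennreal C" using g by (intro mult_left_mono) auto
      also have "\<dots> = ennreal (C * F powr (s / q))" using k C by (simp add: mult.commute flip: ennreal_mult)
      finally show ?thesis .
    qed
  qed
  then show thesis by (rule that)
qed

text \<open>Boundedness on L^s of the operator that multiplies by a and then takes the Riesz
  potential. Since \<alpha>^(s/3) bounds the s-th power of the L^3 norm of a, a small \<alpha> makes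
  it a contraction.\<close>

definition riesz_mult_const :: "real \<Rightarrow> real \<Rightarrow> bool" where
  "riesz_mult_const s C \<longleftrightarrow> C > 0 \<and> (\<forall>a w \<alpha> W. a \<in> borel_measurable borel \<longrightarrow> w \<in> borel_measurable borel \<longrightarrow>
    (\<forall>y. a y \<ge> 0) \<longrightarrow> (\<forall>y. w y \<ge> 0) \<longrightarrow> \<alpha> > 0 \<longrightarrow> W > 0 \<longrightarrow>
    (\<integral>\<^sup>+y. ennreal (a y powr 3) \<partial>lborel) \<le> ennreal \<alpha> \<longrightarrow>
    (\<integral>\<^sup>+y. ennreal (w y powr s) \<partial>lborel) \<le> ennreal W \<longrightarrow>
    (AE x in lborel. riesz (\<lambda>y. a y * w y) x < \<infinity>) \<and>
    (\<integral>\<^sup>+x. ennreal (enn2real (riesz (\<lambda>y. a y * w y) x) powr s) \<partial>lborel) \<le> ennreal (C * \<alpha> powr (s / 3) * W))"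

lemma riesz_mult_constD:
  assumes "riesz_mult_const s C" "a \<in> borel_measurable borel" "w \<in> borel_measurable borel"
    "\<And>y. a y \<ge> 0" "\<And>y. w y \<ge> 0" "\<alpha> > 0" "W > 0"
    "(\<integral>\<^sup>+y. ennreal (a y powr 3) \<partial>lborel) \<le> ennreal \<alpha>"
    "(\<integral>\<^sup>+y. ennreal (w y powr s) \<partial>lborel) \<le> ennreal W"
  shows "(AE x in lborel. riesz (\<lambda>y. a y * w y) x < \<infinity>) \<and>
    (\<integral>\<^sup>+x. ennreal (enn2real (riesz (\<lambda>y. a y * w y) x) powr s) \<partial>lborel) \<le> ennreal (C * \<alpha> powr (s / 3) * W)"
  using assms unfolding riesz_mult_const_def by blast

lemma HLS_exponent:
  fixes q s :: real
  assumes s: "s > 3/2" and q: "q = 3 * s / (s + 3)"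
  shows "1 < q" "q < 3" "s = 3 * q / (3 - q)"
proof -
  show "1 < q" "q < 3" using s by (auto simp: q field_simps)
  have "q * (s + 3) = 3 * s" using s by (simp add: q)
  then have "(3 - q) * (s + 3) = 9" by (simp add: algebra_simps)
  then have "3 - q = 9 / (s + 3)" using s by (simp add: eq_divide_eq)
  then have "3 * q / (3 - q) = q * (s + 3) / 3" by (simp only:) simp
  also have "\<dots> = s" using \<open>q * (s + 3) = 3 * s\<close> by simp
  finally show "s = 3 * q / (3 - q)" ..
qed

text \<open>Hoelder with 1/q = 1/3 + 1/s, then the Hardy--Littlewood--Sobolev inequality from L^q,
  which returns exactly to L^s. The assumption s > 3/2 is q > 1.\<close>

lemma riesz_mult_bound:
  assumes s: "s > 3/2"
  obtains C where "riesz_mult_const s C"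
proof -
  define q where "q = 3 * s / (s + 3)"
  note q = HLS_exponent[OF s q_def]
  have "q * (s + 3) = 3 * s" using s by (simp add: q_def)
  moreover have "1 / (3 / q) + 1 / (s / q) = (q * (s + 3)) / (3 * s)" using s by (simp add: field_simps)
  ultimately have e: "3 / q > 1" "s / q > 1" "1 / (3 / q) + 1 / (s / q) = 1" using s by (auto simp: q_def)
  obtain C where hc: "HLS_const q s C" using Hardy_Littlewood_Sobolev[OF q] by blast
  then have C: "C > 0" by (simp add: HLS_const_def)
  have "riesz_mult_const s C" unfolding riesz_mult_const_def
  proof (intro conjI allI impI C)
    fix a w :: "real^3 \<Rightarrow> real" and \<alpha> W :: real
    assume [measurable]: "a \<in> borel_measurable borel" "w \<in> borel_measurable borel"
      and nn': "\<forall>y. a y \<ge> 0" "\<forall>y. w y \<ge> 0" and pos: "\<alpha> > 0" "W > 0"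
      and a: "(\<integral>\<^sup>+y. ennreal (a y powr 3) \<partial>lborel) \<le> ennreal \<alpha>"
      and w: "(\<integral>\<^sup>+y. ennreal (w y powr s) \<partial>lborel) \<le> ennreal W"
    from nn' have nn: "\<And>y. a y \<ge> 0" "\<And>y. w y \<ge> 0" by auto
    define F where "F = \<alpha> powr (1 / (3 / q)) * W powr (1 / (s / q))"
    have F: "F > 0" "F powr (s / q) = \<alpha> powr (s / 3) * W"
    proof -
      have e1: "1 / (3 / q) * (s / q) = s / 3" "1 / (s / q) * (s / q) = 1" using q(1) s by auto
      show "F > 0" using pos by (simp add: F_def)
      show "F powr (s / q) = \<alpha> powr (s / 3) * W"
        using pos unfolding F_def by (simp only: powr_mult powr_ge_zero powr_powr e1) simp
    qed
    have "(\<integral>\<^sup>+y. ennreal (a y powr q * w y powr q) \<partial>lborel) \<le> ennreal F"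
      unfolding F_def using a w q(1,2) s pos
      by (intro Holder_nn_integral[OF e]) (auto simp: powr_powr)
    then have "(\<integral>\<^sup>+y. ennreal ((a y * w y) powr q) \<partial>lborel) \<le> ennreal F"
      by (simp add: powr_mult nn)
    from HLS_constD[OF hc _ _ F(1) this]
    have *: "(AE x in lborel. riesz (\<lambda>y. a y * w y) x < \<infinity>) \<and>
      (\<integral>\<^sup>+x. ennreal (enn2real (riesz (\<lambda>y. a y * w y) x) powr s) \<partial>lborel) \<le> ennreal (C * \<alpha> powr (s / 3) * W)"
      by (simp add: nn F(2) mult.assoc)
    show "AE x in lborel. riesz (\<lambda>y. a y * w y) x < \<infinity>"
      and "(\<integral>\<^sup>+x. ennreal (enn2real (riesz (\<lambda>y. a y * w y) x) powr s) \<partial>lborel) \<le> ennreal (C * \<alpha> powr (s / 3) * W)"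
      using * by auto
  qed
  then show thesis by (rule that)
qed

text \<open>The removed range 1/M \<le> a \<le> M eventually contains every positive value of a, so
  dominated convergence applies. The lower limit 1/M matters as much as the upper one: it confines
  the removed part to a set of finite measure.\<close>

lemma small_tail:
  assumes [measurable]: "a \<in> borel_measurable borel" and nn: "\<And>y::real^3. a y \<ge> 0"
    and fin: "(\<integral>\<^sup>+y. ennreal (a y powr 3) \<partial>lborel) < \<infinity>" and \<epsilon>: "\<epsilon> > 0"
  obtains M :: real where "M > 0" "(\<integral>\<^sup>+y. ennreal ((if 1 / M \<le> a y \<and> a y \<le> M then 0 else a y) powr 3) \<partial>lborel) \<le> ennreal \<epsilon>"
proof -
  let ?u = "\<lambda>(n::nat) y. ennreal ((if 1 / real (Suc n) \<le> a y \<and> a y \<le> real (Suc n) then 0 else a y) powr 3)"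
  have "(\<lambda>n. \<integral>\<^sup>+y. ?u n y \<partial>lborel) \<longlonglongrightarrow> (\<integral>\<^sup>+y. 0 \<partial>(lborel :: (real^3) measure))"
  proof (rule nn_integral_dominated_convergence[where w="\<lambda>y. ennreal (a y powr 3)"])
    show "AE y in lborel. (\<lambda>n. ?u n y) \<longlonglongrightarrow> 0"
    proof (intro AE_I2)
      fix y :: "real^3"
      obtain n where n: "real n \<ge> max (a y) (1 / a y)" using real_arch_simple by blast
      have z: "?u m y = 0" if "m \<ge> n" for m
      proof (cases "a y = 0")
        case False
        then have ay: "a y > 0" using nn[of y] by simp
        have m: "a y \<le> real (Suc m)" "1 / a y \<le> real (Suc m)" using n that by auto
        then have "1 / real (Suc m) \<le> a y" using ay by (simp add: field_simps)
        then show ?thesis using m by simp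
      qed simp
      have "\<forall>\<^sub>F m in sequentially. ?u m y = 0" by (rule eventually_sequentiallyI[of n]) (rule z)
      then show "(\<lambda>n. ?u n y) \<longlonglongrightarrow> 0" by (rule tendsto_eventually)
    qed
  qed (use fin in auto)
  then have "(\<lambda>n. \<integral>\<^sup>+y. ?u n y \<partial>lborel) \<longlonglongrightarrow> 0" by simp
  then have "\<forall>\<^sub>F n in sequentially. (\<integral>\<^sup>+y. ?u n y \<partial>lborel) < ennreal \<epsilon>"
    using \<epsilon> by (intro order_tendstoD) auto
  then obtain n where "(\<integral>\<^sup>+y. ?u n y \<partial>lborel) < ennreal \<epsilon>" by (auto simp: eventually_sequentially)
  then show thesis by (intro that[of "real (Suc n)"]) auto
qed

lemma powr_le_one_add:
  fixes u :: real assumes "0 \<le> u" "0 < q" "q \<le> p" shows "u powr q \<le> 1 + u powr p"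
proof (cases "u \<le> 1")
  case True
  then have "u powr q \<le> 1" using assms by (intro powr_le1) auto
  then show ?thesis by (simp add: add_increasing2)
next
  case False
  then have "u powr q \<le> u powr p" using assms by (intro powr_mono) auto
  then show ?thesis by simp
qed

lemma ennreal_lt_top_bound:
  fixes x :: ennreal
  assumes "x < \<infinity>" shows "\<exists>F>0. x \<le> ennreal F"
proof (intro exI conjI)
  show "x \<le> ennreal (enn2real x + 1)" using assms by (simp add: ennreal_plus)
qed (simp add: add_nonneg_pos)

subsection \<open>Bootstrapping integrability\<close>

text \<open>By induction, for each $n$ there is $v \ge 0$ whose $L^s$ norm is bounded independently of $n$ and for
  which $\int (u - v)_+^p \le P \, 2^{-n}$. Fatou's lemma gives $u \in L^s$.\<close>

theorem riesz_bootstrap: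
  fixes u a :: "real^3 \<Rightarrow> real"
  assumes [measurable]: "u \<in> borel_measurable borel" "a \<in> borel_measurable borel"
    and nn: "\<And>x. u x \<ge> 0" "\<And>x. a x \<ge> 0"
    and p: "p > 3/2" and s: "s > 3/2" and ps: "3 * s / (s + 3) \<le> p" and c: "c > 0"
    and up: "(\<integral>\<^sup>+x. ennreal (u x powr p) \<partial>lborel) < \<infinity>"
    and a3: "(\<integral>\<^sup>+x. ennreal (a x powr 3) \<partial>lborel) < \<infinity>"
    and le: "AE x in lborel. ennreal (u x) \<le> ennreal c * riesz (\<lambda>y. a y * u y) x"
  shows "(\<integral>\<^sup>+x. ennreal (u x powr s) \<partial>lborel) < \<infinity>"
proof -
  obtain Cp where bp: "riesz_mult_const p Cp" using riesz_mult_bound[OF p] by blast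
  then have Cp: "Cp > 0" by (simp add: riesz_mult_const_def)
  obtain Cs where bs: "riesz_mult_const s Cs" using riesz_mult_bound[OF s] by blast
  then have Cs: "Cs > 0" by (simp add: riesz_mult_const_def)
  \<comment> \<open>\<beta>p is chosen so that c^p Cp \<beta>p = 1/2, which halves the error in each
    step; \<beta>s has an additional factor 2^(-s) to absorb the constant of
    \<open>powr_add_le\<close>.\<close>
  define \<beta>p where "\<beta>p = 1 / (2 * Cp * c powr p)"
  define \<beta>s where "\<beta>s = 1 / (2 * 2 powr s * Cs * c powr s)"
  have \<beta>: "\<beta>p > 0" "\<beta>s > 0" using Cp Cs c by (simp_all add: \<beta>p_def \<beta>s_def)
  define \<alpha> where "\<alpha> = min (\<beta>p powr (3 / p)) (\<beta>s powr (3 / s))"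
  have \<alpha>: "\<alpha> > 0" using \<beta> by (simp add: \<alpha>_def)
  have "\<alpha> powr (p / 3) \<le> (\<beta>p powr (3 / p)) powr (p / 3)" using p \<alpha> by (intro powr_mono2) (auto simp: \<alpha>_def)
  then have \<alpha>p: "\<alpha> powr (p / 3) \<le> \<beta>p" using \<beta> p by (simp add: powr_powr)
  have "\<alpha> powr (s / 3) \<le> (\<beta>s powr (3 / s)) powr (s / 3)" using s \<alpha> by (intro powr_mono2) (auto simp: \<alpha>_def)
  then have \<alpha>s: "\<alpha> powr (s / 3) \<le> \<beta>s" using \<beta> s by (simp add: powr_powr)
  obtain M where M: "M > 0" and tail: "(\<integral>\<^sup>+y. ennreal ((if 1 / M \<le> a y \<and> a y \<le> M then 0 else a y) powr 3) \<partial>lborel) \<le> ennreal \<alpha>"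
    using small_tail[OF _ nn(2) a3 \<alpha>] by auto
  define a1 where "a1 y = (if 1 / M \<le> a y \<and> a y \<le> M then 0 else a y)" for y
  define a2 where "a2 y = (if 1 / M \<le> a y \<and> a y \<le> M then a y else 0)" for y
  have [measurable]: "a1 \<in> borel_measurable borel" "a2 \<in> borel_measurable borel"
    unfolding a1_def[abs_def] a2_def[abs_def] by measurable
  have ann: "a1 y \<ge> 0" "a2 y \<ge> 0" "a y = a1 y + a2 y" for y using nn by (auto simp: a1_def a2_def)
  have tail1: "(\<integral>\<^sup>+y. ennreal (a1 y powr 3) \<partial>lborel) \<le> ennreal \<alpha>" using tail unfolding a1_def .
  define q where "q = 3 * s / (s + 3)"
  have q: "1 < q" "q < 3" "s = 3 * q / (3 - q)" "q \<le> p"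
    by (rule HLS_exponent[OF s q_def])+ (use ps in \<open>simp add: q_def\<close>)
  \<comment> \<open>Where a2 is nonzero, 1 \<le> (M a)^3, so the constant in u^q \<le> 1 + u^p is
    paid for by the integral of a^3. This is where q \<le> p enters.\<close>
  have "(\<integral>\<^sup>+y. ennreal ((a2 y * u y) powr q) \<partial>lborel)
     \<le> (\<integral>\<^sup>+y. ennreal (M powr q * M powr 3) * ennreal (a y powr 3) + ennreal (M powr q) * ennreal (u y powr p) \<partial>lborel)"
  proof (intro nn_integral_mono)
    fix y
    have "(a2 y * u y) powr q \<le> M powr q * M powr 3 * a y powr 3 + M powr q * u y powr p"
    proof (cases "1 / M \<le> a y \<and> a y \<le> M")
      case True
      then have "1 \<le> M * a y" using M by (simp add: field_simps)
      then have "1 \<le> (M * a y) powr 3" by (intro ge_one_powr_ge_zero) auto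
      then have "u y powr q \<le> M powr 3 * a y powr 3 + u y powr p"
        using powr_le_one_add[of "u y" q p] q nn[of y] M by (simp add: powr_mult)
      moreover have "a2 y powr q \<le> M powr q" using True q nn[of y] by (intro powr_mono2) (auto simp: a2_def)
      ultimately have "a2 y powr q * u y powr q \<le> M powr q * (M powr 3 * a y powr 3 + u y powr p)"
        by (intro mult_mono) auto
      then show ?thesis using ann nn by (simp add: powr_mult algebra_simps)
    qed (auto simp: a2_def)
    then show "ennreal ((a2 y * u y) powr q) \<le> ennreal (M powr q * M powr 3) * ennreal (a y powr 3) + ennreal (M powr q) * ennreal (u y powr p)"
      by (simp add: ennreal_leI flip: ennreal_mult ennreal_plus)
  qed
  also have "\<dots> = ennreal (M powr q * M powr 3) * (\<integral>\<^sup>+y. ennreal (a y powr 3) \<partial>lborel) + ennreal (M powr q) * (\<integral>\<^sup>+y. ennreal (u y powr p) \<partial>lborel)"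
    by (subst nn_integral_add) (simp_all add: nn_integral_cmult)
  also have "\<dots> < \<infinity>" using up a3 by (simp add: ennreal_mult_less_top)
  finally obtain F where F: "(\<integral>\<^sup>+y. ennreal ((a2 y * u y) powr q) \<partial>lborel) \<le> ennreal F" "F > 0"
    by (meson ennreal_lt_top_bound)
  obtain C where hc: "HLS_const q s C" using Hardy_Littlewood_Sobolev[OF q(1,2,3)] by blast
  define r2 where "r2 = riesz (\<lambda>y. a2 y * u y)"
  have [measurable]: "r2 \<in> borel_measurable borel" unfolding r2_def by measurable
  have r2: "AE x in lborel. r2 x < \<infinity>" "(\<integral>\<^sup>+x. ennreal (enn2real (r2 x) powr s) \<partial>lborel) \<le> ennreal (C * F powr (s / q))"
    using HLS_constD[OF hc _ _ F(2,1)] ann nn by (auto simp: r2_def)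
  \<comment> \<open>The contribution of a2, computed from u itself; it is the same in every step of
    the iteration.\<close>
  define g where "g x = c * enn2real (r2 x)" for x
  have [measurable]: "g \<in> borel_measurable borel" unfolding g_def[abs_def] by measurable
  have "(\<integral>\<^sup>+x. ennreal (g x powr s) \<partial>lborel) = ennreal (c powr s) * (\<integral>\<^sup>+x. ennreal (enn2real (r2 x) powr s) \<partial>lborel)"
    unfolding g_def using c by (intro nn_integral_powr_cmult) auto
  also have "\<dots> \<le> ennreal (c powr s) * ennreal (C * F powr (s / q))" by (intro mult_left_mono r2) simp
  also have "\<dots> = ennreal (c powr s * (C * F powr (s / q)))" by (rule ennreal_mult'[symmetric]) simp
  also have "\<dots> \<le> ennreal (max 1 (c powr s * (C * F powr (s / q))))" by (intro ennreal_leI) simp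
  finally obtain \<Gamma> where \<Gamma>: "\<Gamma> > 0" "(\<integral>\<^sup>+x. ennreal (g x powr s) \<partial>lborel) \<le> ennreal \<Gamma>"
    by (metis less_max_iff_disj zero_less_one)
  \<comment> \<open>Half of K is reserved for g, the other half for the contraction on L^s.\<close>
  define K where "K = 2 * 2 powr s * \<Gamma>"
  have K: "K > 0" using \<Gamma> by (simp add: K_def)
  obtain P where P: "P > 0" "(\<integral>\<^sup>+x. ennreal (u x powr p) \<partial>lborel) \<le> ennreal P"
    using up by (meson ennreal_lt_top_bound)
  have approx: "\<exists>v. v \<in> borel_measurable borel \<and> (\<forall>x. v x \<ge> 0) \<and> (\<integral>\<^sup>+x. ennreal (v x powr s) \<partial>lborel) \<le> ennreal K \<and>
     (\<integral>\<^sup>+x. ennreal (max 0 (u x - v x) powr p) \<partial>lborel) \<le> ennreal (P * (1/2) ^ n)" for n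
  proof (induction n)
    case 0
    then show ?case using P nn by (intro exI[of _ "\<lambda>_. 0"]) (auto simp: max_absorb2)
  next
    case (Suc n)
    then obtain v where [measurable]: "v \<in> borel_measurable borel" and v: "\<And>x. v x \<ge> 0"
      "(\<integral>\<^sup>+x. ennreal (v x powr s) \<partial>lborel) \<le> ennreal K"
      and e: "(\<integral>\<^sup>+x. ennreal (max 0 (u x - v x) powr p) \<partial>lborel) \<le> ennreal (P * (1/2) ^ n)" by blast
    define e where "e x = max 0 (u x - v x)" for x
    have [measurable]: "e \<in> borel_measurable borel" unfolding e_def[abs_def] by measurable
    have e0: "e x \<ge> 0" "u x \<le> v x + e x" for x by (auto simp: e_def)
    have Pn: "P * (1/2) ^ n > 0" using P by simp
    have eP: "(\<integral>\<^sup>+x. ennreal (e x powr p) \<partial>lborel) \<le> ennreal (P * (1/2) ^ n)" using e by (simp only: e_def)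
    define rv where "rv = riesz (\<lambda>y. a1 y * v y)"
    define re where "re = riesz (\<lambda>y. a1 y * e y)"
    have [measurable]: "rv \<in> borel_measurable borel" "re \<in> borel_measurable borel" unfolding rv_def re_def by measurable
    have rv: "AE x in lborel. rv x < \<infinity>" "(\<integral>\<^sup>+x. ennreal (enn2real (rv x) powr s) \<partial>lborel) \<le> ennreal (Cs * \<alpha> powr (s / 3) * K)"
      using riesz_mult_constD[OF bs _ _ ann(1) v(1) \<alpha> K tail1 v(2)] by (auto simp: rv_def)
    have re: "AE x in lborel. re x < \<infinity>" "(\<integral>\<^sup>+x. ennreal (enn2real (re x) powr p) \<partial>lborel) \<le> ennreal (Cp * \<alpha> powr (p / 3) * (P * (1/2) ^ n))"
      using riesz_mult_constD[OF bp _ _ ann(1) e0(1) \<alpha> Pn tail1 eP] by (auto simp: re_def)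
    \<comment> \<open>One step of the iteration: a1 acts on the current approximation v, and the
      part of u that is still missed is bounded by a1 acting on the old error.\<close>
    define v' where "v' x = c * enn2real (rv x) + g x" for x
    have "v' \<in> borel_measurable borel" unfolding v'_def[abs_def] by measurable
    moreover have v'0: "v' x \<ge> 0" for x using c by (simp add: v'_def g_def)
    moreover have "(\<integral>\<^sup>+x. ennreal (v' x powr s) \<partial>lborel) \<le> ennreal K"
    proof -
      have "(\<integral>\<^sup>+x. ennreal (v' x powr s) \<partial>lborel) \<le> (\<integral>\<^sup>+x. ennreal (2 powr s * c powr s) * ennreal (enn2real (rv x) powr s) + ennreal (2 powr s) * ennreal (g x powr s) \<partial>lborel)"
      proof (intro nn_integral_mono)
        fix x
        have "v' x powr s \<le> 2 powr s * ((c * enn2real (rv x)) powr s + g x powr s)"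
          unfolding v'_def using c s by (intro powr_add_le) (auto simp: g_def)
        also have "\<dots> = 2 powr s * c powr s * enn2real (rv x) powr s + 2 powr s * g x powr s"
          using c by (simp add: powr_mult algebra_simps)
        finally show "ennreal (v' x powr s) \<le> ennreal (2 powr s * c powr s) * ennreal (enn2real (rv x) powr s) + ennreal (2 powr s) * ennreal (g x powr s)"
          by (simp add: ennreal_leI flip: ennreal_mult ennreal_plus)
      qed
      also have "\<dots> = ennreal (2 powr s * c powr s) * (\<integral>\<^sup>+x. ennreal (enn2real (rv x) powr s) \<partial>lborel) + ennreal (2 powr s) * (\<integral>\<^sup>+x. ennreal (g x powr s) \<partial>lborel)"
        by (subst nn_integral_add) (simp_all add: nn_integral_cmult)
      also have "\<dots> \<le> ennreal (2 powr s * c powr s) * ennreal (Cs * \<alpha> powr (s / 3) * K) + ennreal (2 powr s) * ennreal \<Gamma>"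
        by (intro add_mono mult_left_mono rv \<Gamma>) auto
      also have "\<dots> = ennreal (2 powr s * c powr s * (Cs * \<alpha> powr (s / 3) * K) + 2 powr s * \<Gamma>)"
        using Cs K \<Gamma> by (simp flip: ennreal_mult ennreal_plus)
      also have "\<dots> \<le> ennreal K"
      proof (rule ennreal_leI)
        have "2 powr s * c powr s * (Cs * \<alpha> powr (s / 3) * K) = (2 powr s * c powr s * Cs * K) * \<alpha> powr (s / 3)" by simp
        also have "\<dots> \<le> (2 powr s * c powr s * Cs * K) * \<beta>s" using Cs K by (intro mult_left_mono \<alpha>s) auto
        also have "\<dots> = K / 2" using Cs c by (simp add: \<beta>s_def)
        finally show "2 powr s * c powr s * (Cs * \<alpha> powr (s / 3) * K) + 2 powr s * \<Gamma> \<le> K" by (simp add: K_def)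
      qed
      finally show ?thesis .
    qed
    moreover have "(\<integral>\<^sup>+x. ennreal (max 0 (u x - v' x) powr p) \<partial>lborel) \<le> ennreal (P * (1/2) ^ Suc n)"
    proof -
      have "(\<integral>\<^sup>+x. ennreal (max 0 (u x - v' x) powr p) \<partial>lborel) \<le> (\<integral>\<^sup>+x. ennreal ((c * enn2real (re x)) powr p) \<partial>lborel)"
      proof (intro nn_integral_mono_AE)
        show "AE x in lborel. ennreal (max 0 (u x - v' x) powr p) \<le> ennreal ((c * enn2real (re x)) powr p)"
          using le rv(1) re(1) r2(1)
        proof eventually_elim
          case (elim x)
          have "riesz (\<lambda>y. a y * u y) x = riesz (\<lambda>y. a1 y * u y + a2 y * u y) x"
            by (simp add: ann(3) distrib_right)
          also have "\<dots> = riesz (\<lambda>y. a1 y * u y) x + r2 x"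
            unfolding r2_def using ann nn by (intro riesz_add) auto
          also have "riesz (\<lambda>y. a1 y * u y) x \<le> riesz (\<lambda>y. a1 y * v y + a1 y * e y) x"
          proof (rule riesz_mono)
            fix y
            show "a1 y * u y \<le> a1 y * v y + a1 y * e y"
              using mult_left_mono[OF e0(2)[of y] ann(1)[of y]] by (simp add: algebra_simps)
          qed
          also have "\<dots> = rv x + re x"
            unfolding rv_def re_def using ann v e0 by (intro riesz_add) auto
          finally have "riesz (\<lambda>y. a y * u y) x \<le> rv x + re x + r2 x" by (simp add: add_right_mono)
          then have "ennreal c * riesz (\<lambda>y. a y * u y) x \<le> ennreal c * (rv x + re x + r2 x)" by (rule mult_left_mono) simp
          with elim(1) have "ennreal (u x) \<le> ennreal c * (rv x + re x + r2 x)" by (rule order_trans)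
          also have "\<dots> = ennreal c * (ennreal (enn2real (rv x)) + ennreal (enn2real (re x)) + ennreal (enn2real (r2 x)))"
            using elim by simp
          also have "\<dots> = ennreal (c * (enn2real (rv x) + enn2real (re x) + enn2real (r2 x)))"
            using c by (simp add: ennreal_mult ennreal_plus)
          finally have "u x \<le> c * (enn2real (rv x) + enn2real (re x) + enn2real (r2 x))"
            using c by (subst (asm) ennreal_le_iff) auto
          then have "max 0 (u x - v' x) \<le> c * enn2real (re x)"
            using c by (simp add: v'_def g_def algebra_simps)
          then show ?case using p by (intro ennreal_leI powr_mono2) auto
        qed
      qed
      also have "\<dots> = ennreal (c powr p) * (\<integral>\<^sup>+x. ennreal (enn2real (re x) powr p) \<partial>lborel)"
        using c by (intro nn_integral_powr_cmult) auto
      also have "\<dots> \<le> ennreal (c powr p) * ennreal (Cp * \<alpha> powr (p / 3) * (P * (1/2) ^ n))"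
        by (intro mult_left_mono re) simp
      also have "\<dots> = ennreal (c powr p * (Cp * \<alpha> powr (p / 3) * (P * (1/2) ^ n)))" by (rule ennreal_mult'[symmetric]) simp
      also have "\<dots> \<le> ennreal (P * (1/2) ^ Suc n)"
      proof (rule ennreal_leI)
        have "c powr p * (Cp * \<alpha> powr (p / 3) * (P * (1/2) ^ n)) = (c powr p * Cp * (P * (1/2) ^ n)) * \<alpha> powr (p / 3)" by simp
        also have "\<dots> \<le> (c powr p * Cp * (P * (1/2) ^ n)) * \<beta>p" using Cp P by (intro mult_left_mono \<alpha>p) auto
        also have "\<dots> = P * (1/2) ^ Suc n" using Cp c by (simp add: \<beta>p_def)
        finally show "c powr p * (Cp * \<alpha> powr (p / 3) * (P * (1/2) ^ n)) \<le> P * (1/2) ^ Suc n" .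
      qed
      finally show ?thesis .
    qed
    ultimately show ?case by blast
  qed
  then have "\<forall>n. \<exists>v. v \<in> borel_measurable borel \<and> (\<forall>x. v x \<ge> 0) \<and> (\<integral>\<^sup>+x. ennreal (v x powr s) \<partial>lborel) \<le> ennreal K \<and>
     (\<integral>\<^sup>+x. ennreal (max 0 (u x - v x) powr p) \<partial>lborel) \<le> ennreal (P * (1/2) ^ n)" ..
  from choice[OF this] obtain v where V: "\<forall>n. v n \<in> borel_measurable borel \<and> (\<forall>x. v n x \<ge> 0) \<and>
     (\<integral>\<^sup>+x. ennreal (v n x powr s) \<partial>lborel) \<le> ennreal K \<and>
     (\<integral>\<^sup>+x. ennreal (max 0 (u x - v n x) powr p) \<partial>lborel) \<le> ennreal (P * (1/2) ^ n)" ..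
  have [measurable]: "\<And>n. v n \<in> borel_measurable borel" and v: "\<And>n x. v n x \<ge> 0"
     "\<And>n. (\<integral>\<^sup>+x. ennreal (v n x powr s) \<partial>lborel) \<le> ennreal K"
     and e: "\<And>n. (\<integral>\<^sup>+x. ennreal (max 0 (u x - v n x) powr p) \<partial>lborel) \<le> ennreal (P * (1/2) ^ n)"
    using V by blast+
  \<comment> \<open>Summability of the integrals forces the positive parts of u - v n to tend to 0
    almost everywhere along the whole sequence.\<close>
  have "(\<integral>\<^sup>+x. (\<Sum>n. ennreal (max 0 (u x - v n x) powr p)) \<partial>lborel)
      = (\<Sum>n. \<integral>\<^sup>+x. ennreal (max 0 (u x - v n x) powr p) \<partial>lborel)"
    by (rule nn_integral_suminf) measurable
  also have "\<dots> \<le> (\<Sum>n. ennreal (P * (1/2) ^ n))" by (intro suminf_le e) auto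
  also have "\<dots> = ennreal (\<Sum>n. P * (1/2) ^ n)" using P by (intro suminf_ennreal2) (auto intro: summable_mult)
  also have "\<dots> < \<infinity>" by simp
  finally have fin: "(\<integral>\<^sup>+x. (\<Sum>n. ennreal (max 0 (u x - v n x) powr p)) \<partial>lborel) \<noteq> \<infinity>"
    by (rule less_imp_neq)
  have "AE x in lborel. (\<Sum>n. ennreal (max 0 (u x - v n x) powr p)) \<noteq> \<infinity>"
    by (rule nn_integral_noteq_infinite[OF _ fin]) measurable
  \<comment> \<open>Subtracting from u the positive part of u - v n gives the minimum of u and v n,
    which is at most v n and converges to u.\<close>
  then have lim: "AE x in lborel. (\<lambda>n. ennreal ((u x - max 0 (u x - v n x)) powr s)) \<longlonglongrightarrow> ennreal (u x powr s)"
  proof eventually_elim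
    case (elim x)
    then have "summable (\<lambda>n. max 0 (u x - v n x) powr p)" by (intro summable_suminf_not_top) auto
    then have "(\<lambda>n. max 0 (u x - v n x) powr p) \<longlonglongrightarrow> 0" by (rule summable_LIMSEQ_zero)
    then have "(\<lambda>n. (max 0 (u x - v n x) powr p) powr (1 / p)) \<longlonglongrightarrow> 0"
      by (rule tendsto_zero_powrI[OF _ tendsto_const]) (use p in auto)
    then have "(\<lambda>n. max 0 (u x - v n x)) \<longlonglongrightarrow> 0" using p by (simp add: powr_powr)
    then have "(\<lambda>n. u x - max 0 (u x - v n x)) \<longlonglongrightarrow> u x - 0" by (intro tendsto_intros)
    then show ?case using s nn v by (intro tendsto_ennrealI tendsto_powr') (auto simp: max_def)
  qed
  have "(\<integral>\<^sup>+x. ennreal (u x powr s) \<partial>lborel) = (\<integral>\<^sup>+x. liminf (\<lambda>n. ennreal ((u x - max 0 (u x - v n x)) powr s)) \<partial>lborel)"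
  proof (rule nn_integral_cong_AE)
    show "AE x in lborel. ennreal (u x powr s) = liminf (\<lambda>n. ennreal ((u x - max 0 (u x - v n x)) powr s))"
      using lim by eventually_elim (rule lim_imp_Liminf[OF trivial_limit_sequentially, symmetric])
  qed
  also have "\<dots> \<le> liminf (\<lambda>n. \<integral>\<^sup>+x. ennreal ((u x - max 0 (u x - v n x)) powr s) \<partial>lborel)"
    by (rule nn_integral_liminf) measurable
  also have "\<dots> \<le> liminf (\<lambda>n. ennreal K)"
  proof (intro Liminf_mono always_eventually allI)
    fix n
    have "(\<integral>\<^sup>+x. ennreal ((u x - max 0 (u x - v n x)) powr s) \<partial>lborel) \<le> (\<integral>\<^sup>+x. ennreal (v n x powr s) \<partial>lborel)"
      using s nn v by (intro nn_integral_mono ennreal_leI powr_mono2) (auto simp: max_def)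
    also note v(2)
    finally show "(\<integral>\<^sup>+x. ennreal ((u x - max 0 (u x - v n x)) powr s) \<partial>lborel) \<le> ennreal K" .
  qed
  also have "\<dots> < \<infinity>" by (simp add: Liminf_const)
  finally show ?thesis .
qed

subsection \<open>Convolution and mollification\<close>

text \<open>Borel counterpart of \<open>in_Lp\<close>: the analysis is carried out on
  \<open>lborel\<close> with Borel representatives, and the completion enters only in the final
  transfer.\<close>

definition Lr :: "real \<Rightarrow> ('a::euclidean_space \<Rightarrow> 'b::euclidean_space) \<Rightarrow> bool" where
  "Lr r f \<longleftrightarrow> f \<in> borel_measurable borel \<and> (\<integral>\<^sup>+x. ennreal (norm (f x) powr r) \<partial>lborel) < \<infinity>"

definition loc_integrable :: "('a::euclidean_space \<Rightarrow> 'b::euclidean_space) \<Rightarrow> bool" where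
  "loc_integrable f \<longleftrightarrow> f \<in> borel_measurable borel \<and> (\<forall>R. integrable lborel (\<lambda>y. indicator (cball 0 R) y *\<^sub>R f y))"

definition convolution :: "('a::euclidean_space \<Rightarrow> real) \<Rightarrow> ('a \<Rightarrow> 'b::euclidean_space) \<Rightarrow> 'a \<Rightarrow> 'b" where
  "convolution k f x = (LINT y|lborel. k (x - y) *\<^sub>R f y)"

lemma Lr_measurable: "Lr r f \<Longrightarrow> f \<in> borel_measurable borel" by (simp add: Lr_def)
lemma loc_integrable_measurable: "loc_integrable f \<Longrightarrow> f \<in> borel_measurable borel" by (simp add: loc_integrable_def)

lemma convolution_measurable [measurable]:
  assumes [measurable]: "k \<in> borel_measurable borel" "f \<in> borel_measurable borel"
  shows "convolution k f \<in> borel_measurable borel"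
proof -
  have "(\<lambda>x. LINT y|lborel. k (x - y) *\<^sub>R f y) \<in> borel_measurable lborel"
    by (rule lborel.borel_measurable_lebesgue_integral) measurable
  then show ?thesis by (simp add: convolution_def[abs_def])
qed

lemma integrable_dominated:
  fixes f :: "'a \<Rightarrow> 'b::{banach,second_countable_topology}" and g :: "'a \<Rightarrow> real"
  assumes "integrable M g" "f \<in> borel_measurable M" "\<And>x. norm (f x) \<le> g x"
  shows "integrable M f"
proof (rule Bochner_Integration.integrable_bound[OF assms(1,2)])
  show "AE x in M. norm (f x) \<le> norm (g x)" using assms(3) by (auto intro: order_trans[OF _ abs_ge_self])
qed

lemma loc_integrable_norm_integrable:
  assumes "loc_integrable f" shows "integrable lborel (\<lambda>y. indicator (cball 0 R) y * norm (f y))"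
proof -
  have "integrable lborel (\<lambda>y. indicator (cball 0 R) y *\<^sub>R f y)" using assms by (simp add: loc_integrable_def)
  then have "integrable lborel (\<lambda>y. norm (indicator (cball 0 R) y *\<^sub>R f y))" by (rule integrable_norm)
  then show ?thesis by simp
qed

lemma integrable_powr_iff:
  assumes [measurable]: "f \<in> borel_measurable M"
  shows "integrable M (\<lambda>x. norm (f x) powr r) \<longleftrightarrow> (\<integral>\<^sup>+x. ennreal (norm (f x) powr r) \<partial>M) < \<infinity>"
  by (auto simp: integrable_iff_bounded)

lemma Lr_imp_loc_integrable:
  fixes f :: "'a::euclidean_space \<Rightarrow> 'b::euclidean_space"
  assumes "Lr r f" "r \<ge> 1" shows "loc_integrable f"
proof -
  have [measurable]: "f \<in> borel_measurable borel" using assms by (simp add: Lr_def)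
  have [measurable]: "cball (0::'a) R \<in> sets borel" for R by (rule borel_closed) simp
  have "integrable lborel (\<lambda>y. indicator (cball 0 R) y *\<^sub>R f y)" for R
  proof -
  have "integrable lborel (\<lambda>y. norm (f y) powr r)" using assms integrable_powr_iff[of f lborel r] by (simp add: Lr_def)
  moreover have "integrable lborel (indicator (cball (0::'a) R) :: 'a \<Rightarrow> real)"
    using emeasure_compact_finite[of "cball (0::'a) R"] by (intro integrable_real_indicator) auto
  ultimately have "integrable lborel (\<lambda>y. indicator (cball (0::'a) R) y + norm (f y) powr r)" by simp
  then show ?thesis
  proof (rule integrable_dominated)
    fix y show "norm (indicator (cball 0 R) y *\<^sub>R f y) \<le> indicator (cball 0 R) y + norm (f y) powr r"
      using powr_le_one_add[of "norm (f y)" 1 r] assms(2) by (auto split: split_indicator)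
  qed measurable
  qed
  then show ?thesis by (simp add: loc_integrable_def)
qed

section \<open>Convolution with test functions and Young's inequality\<close>

lemma smooth_measurable: "smooth f \<Longrightarrow> f \<in> borel_measurable borel"
  by (intro borel_measurable_continuous_onI smooth_continuous)

lemma test_measurable: "f \<in> test_functions \<Longrightarrow> f \<in> borel_measurable borel"
  by (intro smooth_measurable test_smooth)

lemma convolution_integrable:
  fixes f :: "real^'n::finite \<Rightarrow> 'b::euclidean_space"
  assumes k: "k \<in> test_functions" and f: "loc_integrable f"
  shows "integrable lborel (\<lambda>y. k (x - y) *\<^sub>R f y)"
proof -
  obtain M where M: "M > 0" "\<And>x. \<bar>k x\<bar> \<le> M" using test_bounded[OF k] by blast
  obtain R where R: "R > 0" "\<And>x. norm x > R \<Longrightarrow> k x = 0" using test_support[OF k] by blast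
  note [measurable] = test_measurable[OF k] loc_integrable_measurable[OF f]
  have "integrable lborel (\<lambda>y. M * (indicator (cball 0 (R + norm x)) y * norm (f y)))"
    using loc_integrable_norm_integrable[OF f] by simp
  then show ?thesis
  proof (rule integrable_dominated)
    fix y
    show "norm (k (x - y) *\<^sub>R f y) \<le> M * (indicator (cball 0 (R + norm x)) y * norm (f y))"
    proof (cases "norm (x - y) > R")
      case False
      then have "norm y \<le> R + norm x" using norm_triangle_ineq2[of y x] by (simp add: norm_minus_commute)
      then show ?thesis using M(2)[of "x - y"] by (auto intro: mult_right_mono)
    qed (use R M in auto)
  qed measurable
qed

lemma test_times_integrable:
  fixes f :: "real^'n::finite \<Rightarrow> 'b::euclidean_space"
  assumes k: "k \<in> test_functions" and f: "loc_integrable f"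
  shows "integrable lborel (\<lambda>y. k y *\<^sub>R f y)"
  using convolution_integrable[OF test_affine[OF k, of "-1" 0] f, of 0] by simp

lemma norm_integral_le_nn:
  fixes f :: "'a \<Rightarrow> 'b::{banach,second_countable_topology}"
  shows "ennreal (norm (integral\<^sup>L M f)) \<le> (\<integral>\<^sup>+x. ennreal (norm (f x)) \<partial>M)"
  using integral_norm_bound_ennreal[of M f] by (cases "integrable M f") (auto simp: not_integrable_integral_eq)

text \<open>Hoelder for |k| = |k|^(1/r') |k|^(1/r) bounds the r-th power of the convolution
  pointwise, and Tonelli integrates this bound.\<close>

lemma Young_nn:
  fixes k :: "'a::euclidean_space \<Rightarrow> real" and f :: "'a \<Rightarrow> 'b::euclidean_space"
  assumes [measurable]: "k \<in> borel_measurable borel" "f \<in> borel_measurable borel"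
    and r: "r > 1" and c: "(\<integral>\<^sup>+z. ennreal \<bar>k z\<bar> \<partial>lborel) \<le> ennreal c" "c \<ge> 0"
  shows "(\<integral>\<^sup>+x. ennreal (norm (convolution k f x) powr r) \<partial>lborel)
    \<le> ennreal (c powr r) * (\<integral>\<^sup>+x. ennreal (norm (f x) powr r) \<partial>lborel)"
proof -
  define r' where "r' = r / (r - 1)"
  have r': "r' > 1" "1 / r' + 1 / r = 1" using r by (auto simp: r'_def field_simps)
  have pt: "ennreal (norm (convolution k f x) powr r) \<le> ennreal (c powr (r - 1)) * (\<integral>\<^sup>+y. ennreal (\<bar>k (x - y)\<bar> * norm (f y) powr r) \<partial>lborel)" for x
  proof (cases "c = 0")
    \<comment> \<open>For c = 0 the asserted bound is 0 even where the inner integral is infinite,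
      so the convolution itself has to vanish.\<close>
    case True
    then have "(\<integral>\<^sup>+z. ennreal \<bar>k z\<bar> \<partial>lborel) = 0" using c by simp
    then have "(\<integral>\<^sup>+y. ennreal \<bar>k (x - y)\<bar> \<partial>lborel) = 0"
      using nn_integral_lborel_diff[of "\<lambda>z. ennreal \<bar>k z\<bar>" x] by simp
    then have z: "AE y in lborel. k (x - y) = 0" by (subst (asm) nn_integral_0_iff_AE) auto
    have "convolution k f x = (LINT y|(lborel :: 'a measure). 0)"
      unfolding convolution_def
    proof (rule integral_cong_AE)
      show "AE y in lborel. k (x - y) *\<^sub>R f y = 0" using z by eventually_elim simp
    qed measurable
    then show ?thesis using r by simp
  next
    case False
    then have c0: "c > 0" using c by simp
    show ?thesis
    proof (cases "\<integral>\<^sup>+y. ennreal (\<bar>k (x - y)\<bar> * norm (f y) powr r) \<partial>lborel")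
      case (real b)
      have kx: "(\<integral>\<^sup>+y. ennreal \<bar>k (x - y)\<bar> \<partial>lborel) \<le> ennreal c"
        using c nn_integral_lborel_diff[of "\<lambda>z. ennreal \<bar>k z\<bar>" x] by simp
      have split: "\<bar>t\<bar> powr (1 / r') * \<bar>t\<bar> powr (1 / r) = \<bar>t\<bar>" for t :: real
        by (subst powr_add[symmetric]) (simp add: r')
      have "ennreal (norm (convolution k f x)) \<le> (\<integral>\<^sup>+y. ennreal (norm (k (x - y) *\<^sub>R f y)) \<partial>lborel)"
        unfolding convolution_def by (rule norm_integral_le_nn)
      also have "\<dots> = (\<integral>\<^sup>+y. ennreal (\<bar>k (x - y)\<bar> powr (1 / r') * (\<bar>k (x - y)\<bar> powr (1 / r) * norm (f y))) \<partial>lborel)"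
        by (simp only: mult.assoc[symmetric] split norm_scaleR real_norm_def)
      also have "\<dots> \<le> ennreal (c powr (1 / r') * b powr (1 / r))"
        using r r' kx c real by (intro Holder_nn_integral[OF r'(1) r r'(2)]) (auto simp: powr_mult powr_powr)
      finally have "norm (convolution k f x) \<le> c powr (1 / r') * b powr (1 / r)" by simp
      then have "norm (convolution k f x) powr r \<le> (c powr (1 / r') * b powr (1 / r)) powr r"
        using r by (intro powr_mono2) auto
      also have "\<dots> = c powr (1 / r' * r) * b powr (1 / r * r)"
        by (simp only: powr_mult powr_ge_zero powr_powr)
      also have "1 / r' * r = r - 1" using r by (simp add: r'_def)
      also have "b powr (1 / r * r) = b" using r real by simp
      finally show ?thesis using real by (simp add: ennreal_leI flip: ennreal_mult)
    qed (use c0 in \<open>simp add: ennreal_mult_top\<close>)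
  qed
  have "(\<integral>\<^sup>+x. ennreal (norm (convolution k f x) powr r) \<partial>lborel)
    \<le> (\<integral>\<^sup>+x. ennreal (c powr (r - 1)) * (\<integral>\<^sup>+y. ennreal (\<bar>k (x - y)\<bar> * norm (f y) powr r) \<partial>lborel) \<partial>lborel)"
    by (intro nn_integral_mono pt)
  also have "\<dots> = ennreal (c powr (r - 1)) * (\<integral>\<^sup>+x. \<integral>\<^sup>+y. ennreal (\<bar>k (x - y)\<bar> * norm (f y) powr r) \<partial>lborel \<partial>lborel)"
    by (rule nn_integral_cmult) measurable
  also have "(\<integral>\<^sup>+x. \<integral>\<^sup>+y. ennreal (\<bar>k (x - y)\<bar> * norm (f y) powr r) \<partial>lborel \<partial>lborel)
      = (\<integral>\<^sup>+y. \<integral>\<^sup>+x. ennreal (\<bar>k (x - y)\<bar> * norm (f y) powr r) \<partial>lborel \<partial>lborel)"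
    by (rule lborel_pair.Fubini') measurable
  also have "\<dots> = (\<integral>\<^sup>+y. (\<integral>\<^sup>+z. ennreal \<bar>k z\<bar> \<partial>lborel) * ennreal (norm (f y) powr r) \<partial>lborel)"
  proof (rule nn_integral_cong)
    fix y
    have "(\<integral>\<^sup>+x. ennreal (\<bar>k (x - y)\<bar> * norm (f y) powr r) \<partial>lborel) = (\<integral>\<^sup>+x. ennreal \<bar>k (x - y)\<bar> \<partial>lborel) * ennreal (norm (f y) powr r)"
      by (subst nn_integral_multc[symmetric]) (auto simp: ennreal_mult)
    also have "(\<integral>\<^sup>+x. ennreal \<bar>k (x - y)\<bar> \<partial>lborel) = (\<integral>\<^sup>+z. ennreal \<bar>k z\<bar> \<partial>lborel)"
      by (subst (2) lborel_distr_plus[of "- y", symmetric]) (simp add: nn_integral_distr)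
    finally show "(\<integral>\<^sup>+x. ennreal (\<bar>k (x - y)\<bar> * norm (f y) powr r) \<partial>lborel) = (\<integral>\<^sup>+z. ennreal \<bar>k z\<bar> \<partial>lborel) * ennreal (norm (f y) powr r)" .
  qed
  also have "\<dots> = (\<integral>\<^sup>+z. ennreal \<bar>k z\<bar> \<partial>lborel) * (\<integral>\<^sup>+y. ennreal (norm (f y) powr r) \<partial>lborel)"
    by (rule nn_integral_cmult) measurable
  also have "\<dots> \<le> ennreal c * (\<integral>\<^sup>+y. ennreal (norm (f y) powr r) \<partial>lborel)" by (intro mult_right_mono c) simp
  also have "ennreal (c powr (r - 1)) * (ennreal c * (\<integral>\<^sup>+y. ennreal (norm (f y) powr r) \<partial>lborel))
      = ennreal (c powr (r - 1) * c) * (\<integral>\<^sup>+y. ennreal (norm (f y) powr r) \<partial>lborel)"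
    using c by (simp add: ennreal_mult mult.assoc)
  also have "c powr (r - 1) * c = c powr r" using c by (cases "c = 0") (auto simp: powr_diff)
  finally show ?thesis by (simp add: mult_left_mono)
qed

lemma Lr_convolution:
  assumes "k \<in> borel_measurable borel" "Lr r f" "r > 1" "integrable lborel k"
  shows "Lr r (convolution k f)"
proof -
  have f: "f \<in> borel_measurable borel" "(\<integral>\<^sup>+x. ennreal (norm (f x) powr r) \<partial>lborel) < \<infinity>" using assms by (auto simp: Lr_def)
  have "(\<integral>\<^sup>+z. ennreal \<bar>k z\<bar> \<partial>lborel) = ennreal (LINT z|lborel. \<bar>k z\<bar>)"
    using assms by (intro nn_integral_eq_integral) auto
  then have "(\<integral>\<^sup>+x. ennreal (norm (convolution k f x) powr r) \<partial>lborel)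
    \<le> ennreal ((LINT z|lborel. \<bar>k z\<bar>) powr r) * (\<integral>\<^sup>+x. ennreal (norm (f x) powr r) \<partial>lborel)"
    using assms f by (intro Young_nn) auto
  also have "\<dots> < \<infinity>" using f by (simp add: ennreal_mult_less_top)
  finally show ?thesis using assms f by (simp add: Lr_def)
qed

lemma test_integrable: "k \<in> test_functions \<Longrightarrow> integrable lborel k"
  for k :: "real^'n::finite \<Rightarrow> real"
proof -
  assume k: "k \<in> test_functions"
  obtain M where M: "M > 0" "\<And>x. \<bar>k x\<bar> \<le> M" using test_bounded[OF k] by blast
  obtain R where R: "R > 0" "\<And>x. norm x > R \<Longrightarrow> k x = 0" using test_support[OF k] by blast
  note [measurable] = test_measurable[OF k]
  have "integrable lborel (indicator (cball (0::real^'n) R) :: real^'n \<Rightarrow> real)"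
    using emeasure_compact_finite[of "cball (0::real^'n) R"] by (intro integrable_real_indicator) auto
  then have "integrable lborel (\<lambda>x. M * indicator (cball (0::real^'n) R) x)" by simp
  then show ?thesis
  proof (rule integrable_dominated)
    fix x show "norm (k x) \<le> M * indicator (cball 0 R) x"
      using M R(2)[of x] by (auto split: split_indicator simp: not_le)
  qed measurable
qed

lemma Lr_add:
  assumes "Lr r f" "Lr r g" "r > 0" shows "Lr r (\<lambda>x. f x + g x)"
proof -
  have [measurable]: "f \<in> borel_measurable borel" "g \<in> borel_measurable borel" using assms by (auto simp: Lr_def)
  have "(\<integral>\<^sup>+x. ennreal (norm (f x + g x) powr r) \<partial>lborel)
     \<le> (\<integral>\<^sup>+x. ennreal (2 powr r) * (ennreal (norm (f x) powr r) + ennreal (norm (g x) powr r)) \<partial>lborel)"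
  proof (intro nn_integral_mono)
    fix x
    have "norm (f x + g x) powr r \<le> (norm (f x) + norm (g x)) powr r"
      using assms by (intro powr_mono2 norm_triangle_ineq) auto
    also have "\<dots> \<le> 2 powr r * (norm (f x) powr r + norm (g x) powr r)" using assms by (intro powr_add_le) auto
    finally show "ennreal (norm (f x + g x) powr r) \<le> ennreal (2 powr r) * (ennreal (norm (f x) powr r) + ennreal (norm (g x) powr r))"
      by (simp add: ennreal_leI flip: ennreal_mult ennreal_plus)
  qed
  also have "\<dots> = ennreal (2 powr r) * ((\<integral>\<^sup>+x. ennreal (norm (f x) powr r) \<partial>lborel) + (\<integral>\<^sup>+x. ennreal (norm (g x) powr r) \<partial>lborel))"
    by (simp add: nn_integral_cmult nn_integral_add)
  also have "\<dots> < \<infinity>" using assms by (simp add: Lr_def ennreal_mult_less_top)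
  finally show ?thesis by (simp add: Lr_def)
qed

text \<open>Dominated convergence along a real parameter, reduced to sequences tending to 0.
  Domination is available only for |t| \<le> 1, hence the shift by N.\<close>

lemma dominated_filter_at:
  fixes s :: "real \<Rightarrow> 'a \<Rightarrow> 'b::{banach,second_countable_topology}" and w :: "'a \<Rightarrow> real"
  assumes "f \<in> borel_measurable M" "\<And>t. s t \<in> borel_measurable M" "integrable M w"
    and lim: "\<And>x. ((\<lambda>t. s t x) \<longlongrightarrow> f x) (at 0)"
    and bound: "\<And>t x. 0 < \<bar>t\<bar> \<Longrightarrow> \<bar>t\<bar> \<le> 1 \<Longrightarrow> norm (s t x) \<le> w x"
  shows "((\<lambda>t. integral\<^sup>L M (s t)) \<longlongrightarrow> integral\<^sup>L M f) (at 0)"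
  unfolding tendsto_at_iff_sequentially
proof (intro allI impI)
  fix X :: "nat \<Rightarrow> real" assume X: "\<forall>i. X i \<in> UNIV - {0}" "X \<longlonglongrightarrow> 0"
  from tendsto_norm_zero[OF X(2)] have "\<forall>\<^sub>F n in sequentially. norm (X n) < 1" by (rule order_tendstoD(2)) simp
  then obtain N where N: "\<And>n. n \<ge> N \<Longrightarrow> \<bar>X n\<bar> < 1" by (auto simp: eventually_sequentially)
  have "(\<lambda>n. integral\<^sup>L M (s (X (n + N)))) \<longlonglongrightarrow> integral\<^sup>L M f"
  proof (rule integral_dominated_convergence[where w=w])
    show "AE x in M. (\<lambda>n. s (X (n + N)) x) \<longlonglongrightarrow> f x"
    proof (rule AE_I2)
      fix x
      have "(\<lambda>n. s (X n) x) \<longlonglongrightarrow> f x"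
        using lim[of x] X unfolding tendsto_at_iff_sequentially by (auto simp: o_def)
      then show "(\<lambda>n. s (X (n + N)) x) \<longlonglongrightarrow> f x" by (rule LIMSEQ_ignore_initial_segment)
    qed
    show "AE x in M. norm (s (X (n + N)) x) \<le> w x" for n
      using bound[of "X (n + N)"] N[of "n + N"] X by (auto simp: less_imp_le)
  qed (use assms in auto)
  then show "((\<lambda>t. integral\<^sup>L M (s t)) \<circ> X) \<longlonglongrightarrow> integral\<^sup>L M f"
    unfolding o_def by (rule LIMSEQ_offset)
qed

lemma test_increment_bound:
  fixes k :: "real^'n::finite \<Rightarrow> real"
  assumes k: "k \<in> test_functions"
  obtains M where "M > 0" "\<And>z (t::real). \<bar>k (z + t *\<^sub>R axis j 1) - k z\<bar> \<le> M * \<bar>t\<bar>"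
proof -
  obtain M where M: "M > 0" "\<And>x. \<bar>partial_deriv j k x\<bar> \<le> M" using test_bounded[OF test_partial[OF k]] by blast
  have "\<bar>k (z + t *\<^sub>R axis j 1) - k z\<bar> \<le> M * \<bar>t\<bar>" for z and t :: real
  proof -
    have D: "((\<lambda>s. k (z + s *\<^sub>R axis j 1)) has_field_derivative partial_deriv j k (z + s *\<^sub>R axis j 1)) (at s within UNIV)" for s
    proof -
      have "((\<lambda>t. k ((z + s *\<^sub>R axis j 1) + t *\<^sub>R axis j 1)) has_vector_derivative partial_deriv j k (z + s *\<^sub>R axis j 1)) (at 0)"
        by (rule has_vector_derivative_partial) (rule smooth_differentiable[OF test_smooth[OF k]])
      then have "((\<lambda>t. k (z + (s + t) *\<^sub>R axis j 1)) has_real_derivative partial_deriv j k (z + s *\<^sub>R axis j 1)) (at 0)"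
        by (simp add: has_real_derivative_iff_has_vector_derivative algebra_simps)
      then show ?thesis using DERIV_shift[of "\<lambda>s. k (z + s *\<^sub>R axis j 1)" _ 0 s] by (simp add: add.commute)
    qed
    have "norm (k (z + t *\<^sub>R axis j 1) - k (z + 0 *\<^sub>R axis j 1)) \<le> M * norm (t - 0)"
      by (rule field_differentiable_bound[OF convex_UNIV D]) (use M in auto)
    then show ?thesis by simp
  qed
  with M(1) show thesis by (rule that)
qed

lemma has_vector_derivative_quotientI:
  fixes g :: "real \<Rightarrow> 'a::real_normed_vector"
  assumes "((\<lambda>t. (g t - g 0) /\<^sub>R t) \<longlongrightarrow> d) (at 0)"
  shows "(g has_vector_derivative d) (at 0)"
proof -
  have "((\<lambda>t. norm ((g t - g 0) /\<^sub>R t - d)) \<longlongrightarrow> 0) (at 0)"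
    using assms by (simp add: LIM_zero tendsto_norm_zero)
  moreover have "\<forall>\<^sub>F t in at 0. norm ((g t - g 0) /\<^sub>R t - d) = norm (g t - g 0 - t *\<^sub>R d) / norm t"
  proof -
    have "norm ((g t - g 0) /\<^sub>R t - d) = norm (g t - g 0 - t *\<^sub>R d) / norm t" if "t \<noteq> 0" for t
    proof -
      have "(g t - g 0) /\<^sub>R t - d = (g t - g 0 - t *\<^sub>R d) /\<^sub>R t" using that by (simp add: scaleR_diff_right)
      then show ?thesis by (simp add: divide_inverse mult.commute)
    qed
    then show ?thesis by (auto simp: eventually_at_filter)
  qed
  ultimately have "((\<lambda>t. norm (g t - g 0 - t *\<^sub>R d) / norm t) \<longlongrightarrow> 0) (at 0)"
    by (rule Lim_transform_eventually)
  then show ?thesis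
    by (simp add: has_vector_derivative_def has_derivative_at bounded_linear_scaleR_left)
qed

text \<open>Differentiation under the integral sign: increments of k are at most M |t|, and for |t|
  \<le> 1 they vanish unless y lies in a ball of radius R + 1 + |x|, on which f is
  integrable.\<close>

lemma convolution_has_derivative:
  fixes k :: "real^'n::finite \<Rightarrow> real" and f :: "real^'n::finite \<Rightarrow> 'b::euclidean_space"
  assumes k: "k \<in> test_functions" and f: "loc_integrable f"
  shows "((\<lambda>t::real. convolution k f (x + t *\<^sub>R axis j 1)) has_vector_derivative convolution (partial_deriv j k) f x) (at 0)"
proof -
  obtain M where M: "M > 0" "\<And>z (t::real). \<bar>k (z + t *\<^sub>R axis j 1) - k z\<bar> \<le> M * \<bar>t\<bar>" using test_increment_bound[OF k] by blast
  obtain R where R: "R > 0" "\<And>x. norm x > R \<Longrightarrow> k x = 0" using test_support[OF k] by blast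
  note [measurable] = test_measurable[OF k] test_measurable[OF test_partial[OF k]] loc_integrable_measurable[OF f]
  let ?e = "axis j 1 :: real^'n"
  have "((\<lambda>t::real. LINT y|lborel. ((k (x + t *\<^sub>R ?e - y) - k (x - y)) / t) *\<^sub>R f y) \<longlongrightarrow> (LINT y|lborel. partial_deriv j k (x - y) *\<^sub>R f y)) (at 0)"
  proof (rule dominated_filter_at[where w="\<lambda>y. M * (indicator (cball 0 (R + 1 + norm x)) y * norm (f y))"])
    fix y
    have "((\<lambda>t. k ((x - y) + t *\<^sub>R ?e)) has_vector_derivative partial_deriv j k (x - y)) (at 0)"
      by (rule has_vector_derivative_partial) (rule smooth_differentiable[OF test_smooth[OF k]])
    then have "((\<lambda>t::real. (k ((x - y) + t *\<^sub>R ?e) - k (x - y)) / t) \<longlongrightarrow> partial_deriv j k (x - y)) (at 0)"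
      by (simp add: has_real_derivative_iff_has_vector_derivative[symmetric] DERIV_def)
    then show "((\<lambda>t. ((k (x + t *\<^sub>R ?e - y) - k (x - y)) / t) *\<^sub>R f y) \<longlongrightarrow> partial_deriv j k (x - y) *\<^sub>R f y) (at 0)"
      by (intro tendsto_scaleR tendsto_const) (simp add: algebra_simps)
  next
    fix t :: real and y assume t: "0 < \<bar>t\<bar>" "\<bar>t\<bar> \<le> 1"
    show "norm (((k (x + t *\<^sub>R ?e - y) - k (x - y)) / t) *\<^sub>R f y) \<le> M * (indicator (cball 0 (R + 1 + norm x)) y * norm (f y))"
    proof (cases "norm y > R + 1 + norm x")
      case True
      have "norm (x - y) > R + 1" using True norm_triangle_ineq2[of y x] by (simp add: norm_minus_commute)
      moreover have "norm (x - y) \<le> norm (x + t *\<^sub>R ?e - y) + norm (t *\<^sub>R ?e)"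
        using norm_triangle_ineq4[of "x + t *\<^sub>R ?e - y" "t *\<^sub>R ?e"] by (simp add: algebra_simps)
      ultimately have "k (x + t *\<^sub>R ?e - y) = 0" "k (x - y) = 0" using t by (auto intro!: R)
      then show ?thesis using M by simp
    next
      case False
      have "\<bar>k ((x - y) + t *\<^sub>R ?e) - k (x - y)\<bar> / \<bar>t\<bar> \<le> M" using M(2)[of "x - y" t] t by (simp add: pos_divide_le_eq)
      then have "\<bar>(k (x + t *\<^sub>R ?e - y) - k (x - y)) / t\<bar> \<le> M" by (simp add: algebra_simps)
      then have "norm (((k (x + t *\<^sub>R ?e - y) - k (x - y)) / t) *\<^sub>R f y) \<le> M * norm (f y)"
        unfolding norm_scaleR real_norm_def by (rule mult_right_mono) simp
      then show ?thesis using False by simp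
    qed
  next
    show "integrable lborel (\<lambda>y. M * (indicator (cball 0 (R + 1 + norm x)) y * norm (f y)))"
      using loc_integrable_norm_integrable[OF f] by simp
  qed measurable
  moreover have "(LINT y|lborel. ((k (x + t *\<^sub>R ?e - y) - k (x - y)) / t) *\<^sub>R f y)
     = (convolution k f (x + t *\<^sub>R ?e) - convolution k f x) /\<^sub>R t" for t
  proof -
    have "(convolution k f (x + t *\<^sub>R ?e) - convolution k f x) = (LINT y|lborel. k (x + t *\<^sub>R ?e - y) *\<^sub>R f y - k (x - y) *\<^sub>R f y)"
      unfolding convolution_def by (subst Bochner_Integration.integral_diff) (auto intro: convolution_integrable[OF k f])
    then have "(convolution k f (x + t *\<^sub>R ?e) - convolution k f x) /\<^sub>R t = (LINT y|lborel. (1 / t) *\<^sub>R (k (x + t *\<^sub>R ?e - y) *\<^sub>R f y - k (x - y) *\<^sub>R f y))"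
      by (simp add: divide_inverse)
    then show ?thesis by (simp add: scaleR_diff_left diff_divide_distrib scaleR_diff_right)
  qed
  ultimately have "((\<lambda>t. (convolution k f (x + t *\<^sub>R ?e) - convolution k f x) /\<^sub>R t) \<longlongrightarrow> convolution (partial_deriv j k) f x) (at 0)"
    by (simp add: convolution_def)
  then show ?thesis by (intro has_vector_derivative_quotientI) simp
qed

lemma convolution_continuous:
  fixes f :: "real^'n::finite \<Rightarrow> 'b::euclidean_space"
  assumes k: "k \<in> test_functions" and f: "loc_integrable f"
  shows "continuous_on UNIV (convolution k f)"
proof (rule continuous_at_imp_continuous_on, intro ballI)
  fix x :: "real^'n"
  obtain M where M: "M > 0" "\<And>x. \<bar>k x\<bar> \<le> M" using test_bounded[OF k] by blast
  obtain R where R: "R > 0" "\<And>x. norm x > R \<Longrightarrow> k x = 0" using test_support[OF k] by blast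
  note [measurable] = test_measurable[OF k] loc_integrable_measurable[OF f]
  show "isCont (convolution k f) x"
    unfolding continuous_at_sequentially o_def
  proof (intro allI impI)
    fix X assume X: "X \<longlonglongrightarrow> x"
    then obtain B where B: "\<And>n. norm (X n) \<le> B" by (metis Bseq_def convergentI convergent_imp_Bseq)
    show "(\<lambda>n. convolution k f (X n)) \<longlonglongrightarrow> convolution k f x"
      unfolding convolution_def
    proof (rule integral_dominated_convergence[where w="\<lambda>y. M * (indicator (cball 0 (R + B)) y * norm (f y))"])
      show "AE y in lborel. (\<lambda>n. k (X n - y) *\<^sub>R f y) \<longlonglongrightarrow> k (x - y) *\<^sub>R f y"
      proof (intro AE_I2 tendsto_scaleR tendsto_const)
        fix y show "(\<lambda>n. k (X n - y)) \<longlonglongrightarrow> k (x - y)"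
          using smooth_continuous[OF test_smooth[OF k]] X
          by (intro continuous_on_tendsto_compose[of UNIV k] tendsto_intros) auto
      qed
      show "AE y in lborel. norm (k (X n - y) *\<^sub>R f y) \<le> M * (indicator (cball 0 (R + B)) y * norm (f y))" for n
      proof (rule AE_I2)
        fix y
        show "norm (k (X n - y) *\<^sub>R f y) \<le> M * (indicator (cball 0 (R + B)) y * norm (f y))"
        proof (cases "norm (X n - y) > R")
          case False
          then have "norm y \<le> R + B" using norm_triangle_ineq2[of y "X n"] B[of n] by (simp add: norm_minus_commute)
          then show ?thesis using M(2)[of "X n - y"] by (auto intro: mult_right_mono)
        qed (use R M in auto)
      qed
      show "integrable lborel (\<lambda>y. M * (indicator (cball 0 (R + B)) y * norm (f y)))"
        using loc_integrable_norm_integrable[OF f] by simp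
    qed measurable
  qed
qed

section \<open>Mollifiers as an approximate identity in L^r\<close>

definition kernel_mass :: real where "kernel_mass = (LINT x|lborel. kernel_div x)"

lemma AE_open_empty:
  fixes U :: "'a::euclidean_space set"
  assumes "open U" "AE x in lborel. x \<notin> U" shows "U = {}"
proof -
  have "U \<in> null_sets lborel"
    using assms AE_iff_null_sets[of U lborel] by (auto simp: borel_open)
  then have "negligible U" by (auto simp: negligible_iff_null_sets intro: null_sets_completionI)
  then show ?thesis using assms(1) open_not_negligible by blast
qed

text \<open>The divergence theorem would give the value 4 pi. Positivity, which is what the
  normalisation requires, already follows from a nonnegative continuous integrand that is positive
  somewhere.\<close>

lemma kernel_mass_pos: "kernel_mass > 0"
proof -
  have i: "integrable lborel kernel_div" by (rule test_integrable[OF kernel_div_test])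
  have "kernel_mass \<noteq> 0"
  proof
    assume "kernel_mass = 0"
    then have "AE x in lborel. kernel_div x = 0"
      using integral_nonneg_eq_0_iff_AE[OF i] kernel_div_nonneg by (simp add: kernel_mass_def)
    then have "AE x in lborel. x \<notin> {x. kernel_div x \<noteq> 0}" by simp
    moreover have "open {x. kernel_div x \<noteq> 0}"
      using smooth_continuous[OF test_smooth[OF kernel_div_test]] by (intro open_Collect_neq) auto
    ultimately have e: "{x. kernel_div x \<noteq> 0} = {}" by (intro AE_open_empty)
    \<comment> \<open>A point with |x|^2 = 3/2, inside the transition zone of the step.\<close>
    let ?x = "sqrt (3/2) *\<^sub>R axis 1 1 :: real^3"
    have "?x \<bullet> ?x = 3/2" by (simp add: inner_axis_axis)
    then have "kernel_div ?x > 0" using smooth_step_deriv_pos[of "3/2"] reg_pos[of "3/2"] by (simp add: kernel_div_def)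
    then show False using e by auto
  qed
  moreover have "kernel_mass \<ge> 0" unfolding kernel_mass_def by (intro integral_nonneg_AE AE_I2 kernel_div_nonneg)
  ultimately show ?thesis by simp
qed

lemma lborel_integral_scale:
  fixes f :: "'a::euclidean_space \<Rightarrow> real"
  assumes [measurable]: "f \<in> borel_measurable borel" and c: "c > 0"
  shows "(LINT x|lborel. f (c *\<^sub>R x)) = (LINT x|lborel. f x) / c ^ DIM('a)"
proof -
  have "(LINT x|lborel. f x) = (LINT x|density (distr lborel borel (\<lambda>x. 0 + c *\<^sub>R x)) (\<lambda>_. ennreal (\<bar>c\<bar>^DIM('a))). f x)"
    using lborel_affine[of c "0::'a"] c by (simp add: ennreal_power)
  also have "\<dots> = (LINT x|distr lborel borel (\<lambda>x. 0 + c *\<^sub>R x). (\<bar>c\<bar>^DIM('a)) *\<^sub>R f x)"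
    by (rule integral_density) auto
  also have "\<dots> = (LINT x|lborel. (\<bar>c\<bar>^DIM('a)) *\<^sub>R f (0 + c *\<^sub>R x))"
    by (rule integral_distr) measurable
  finally show ?thesis using c by simp
qed

text \<open>Built from \<open>kernel_div\<close> and not from an arbitrary bump, so that it is
  exactly the divergence of the rescaled field \<open>kernel\<close>.\<close>

definition mollifier :: "nat \<Rightarrow> real^3 \<Rightarrow> real" where
  "mollifier n x = real (Suc n) ^ 3 / kernel_mass * kernel_div (real (Suc n) *\<^sub>R x)"

lemma mollifier_test: "mollifier n \<in> test_functions"
  using test_cmult[OF test_affine[OF kernel_div_test, of "real (Suc n)" 0], of "real (Suc n) ^ 3 / kernel_mass"]
  by (simp add: mollifier_def[abs_def])

lemma mollifier_nonneg: "mollifier n x \<ge> 0"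
  using kernel_mass_pos by (simp add: mollifier_def kernel_div_nonneg)

lemma mollifier_integral: "(LINT x|lborel. mollifier n x) = 1"
proof -
  have "(LINT x|lborel. mollifier n x) = real (Suc n) ^ 3 / kernel_mass * (LINT x|lborel. kernel_div (real (Suc n) *\<^sub>R x))"
    unfolding mollifier_def by simp
  also have "\<dots> = 1"
    using kernel_mass_pos by (subst lborel_integral_scale) (auto simp: kernel_mass_def[symmetric] intro: test_measurable[OF kernel_div_test])
  finally show ?thesis .
qed

lemma kernel_div_outside: "norm x \<ge> 2 \<Longrightarrow> kernel_div x = 0"
proof -
  assume "norm x \<ge> 2"
  then have "(norm x)\<^sup>2 \<ge> 2\<^sup>2" by (intro power_mono) auto
  then show "kernel_div x = 0" by (simp add: kernel_div_def smooth_step_deriv_zero power2_norm_eq_inner)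
qed

lemma mollifier_outside: "norm x \<ge> 2 / real (Suc n) \<Longrightarrow> mollifier n x = 0"
proof -
  assume "norm x \<ge> 2 / real (Suc n)"
  then have "real (Suc n) * norm x \<ge> 2" by (simp add: pos_divide_le_eq mult.commute del: of_nat_Suc)
  then have "norm (real (Suc n) *\<^sub>R x) \<ge> 2" unfolding norm_scaleR by simp
  then show "mollifier n x = 0" unfolding mollifier_def by (simp only: kernel_div_outside mult_zero_right)
qed

lemma integral_lborel_diff:
  fixes f :: "'a::euclidean_space \<Rightarrow> 'b::{banach,second_countable_topology}"
  assumes [measurable]: "f \<in> borel_measurable borel"
  shows "(LINT y|lborel. f (x - y)) = (LINT y|lborel. f y)"
  by (subst (2) lborel_distr_diff[of x, symmetric]) (simp add: integral_distr)

lemma integrable_lborel_diff: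
  fixes f :: "'a::euclidean_space \<Rightarrow> 'b::{banach,second_countable_topology}"
  assumes "integrable lborel f"
  shows "integrable lborel (\<lambda>y. f (x - y))"
proof -
  have [measurable]: "f \<in> borel_measurable borel" using assms by simp
  have "integrable (distr lborel borel (\<lambda>y. x - y)) f" using assms by (simp add: lborel_distr_diff)
  then show ?thesis by (subst (asm) integrable_distr_eq) auto
qed

text \<open>The mollifier is a probability density that vanishes outside the ball of radius 2 / (n +
  1). With small e this is used for pointwise convergence, with e = 0 for points far from the
  support of g.\<close>

lemma convolution_mollifier_close:
  fixes g :: "real^3 \<Rightarrow> 'b::euclidean_space"
  assumes g: "loc_integrable g" and close: "\<And>y. norm (x - y) < 2 / real (Suc n) \<Longrightarrow> norm (g y - g x) \<le> e"
  shows "norm (convolution (mollifier n) g x - g x) \<le> e"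
proof -
  note [measurable] = loc_integrable_measurable[OF g] test_measurable[OF mollifier_test[of n]]
  have i: "integrable lborel (\<lambda>y. mollifier n (x - y))" by (intro integrable_lborel_diff test_integrable mollifier_test)
  have "(LINT y|lborel. mollifier n (x - y) *\<^sub>R g x) = g x"
    using i integral_lborel_diff[of "mollifier n" x] by (simp add: mollifier_integral)
  then have "convolution (mollifier n) g x - g x = (LINT y|lborel. mollifier n (x - y) *\<^sub>R g y) - (LINT y|lborel. mollifier n (x - y) *\<^sub>R g x)"
    by (simp add: convolution_def)
  also have "\<dots> = (LINT y|lborel. mollifier n (x - y) *\<^sub>R g y - mollifier n (x - y) *\<^sub>R g x)"
    using i by (intro Bochner_Integration.integral_diff[symmetric] convolution_integrable[OF mollifier_test g]) auto
  also have "norm \<dots> \<le> (LINT y|lborel. mollifier n (x - y) * e)"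
  proof (rule order_trans[OF integral_norm_bound Bochner_Integration.integral_mono])
    show "integrable lborel (\<lambda>y. norm (mollifier n (x - y) *\<^sub>R g y - mollifier n (x - y) *\<^sub>R g x))"
      using i by (intro integrable_norm Bochner_Integration.integrable_diff convolution_integrable[OF mollifier_test g]) auto
    show "integrable lborel (\<lambda>y. mollifier n (x - y) * e)" using i by simp
    fix y
    show "norm (mollifier n (x - y) *\<^sub>R g y - mollifier n (x - y) *\<^sub>R g x) \<le> mollifier n (x - y) * e"
    proof (cases "norm (x - y) < 2 / real (Suc n)")
      case True
      then show ?thesis using close[OF True] mollifier_nonneg[of n "x - y"]
        by (simp add: scaleR_diff_right[symmetric] mult_left_mono)
    qed (simp add: mollifier_outside)
  qed
  also have "\<dots> = e" using integral_lborel_diff[of "mollifier n" x] by (simp add: mollifier_integral)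
  finally show ?thesis .
qed

lemma continuous_compact_support_Lr:
  fixes g :: "'a::euclidean_space \<Rightarrow> 'b::euclidean_space"
  assumes "continuous_on UNIV g" "\<And>x. norm x > R \<Longrightarrow> g x = 0" and r: "r > 0"
  shows "Lr r g" and "\<exists>B>0. \<forall>x. norm (g x) \<le> B"
proof -
  have "compact (g ` cball 0 R)" using assms by (intro compact_continuous_image) (auto intro: continuous_on_subset)
  then have "bounded (g ` cball 0 R)" by (rule compact_imp_bounded)
  then obtain B where B: "B > 0" "\<And>y. y \<in> g ` cball 0 R \<Longrightarrow> norm y \<le> B" unfolding bounded_pos by blast
  have bound: "norm (g x) \<le> B" for x using B assms(2)[of x] by (cases "norm x > R") auto
  then show "\<exists>B>0. \<forall>x. norm (g x) \<le> B" using B by blast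
  have [measurable]: "cball (0::'a) R \<in> sets borel" by (rule borel_closed) simp
  have "(\<integral>\<^sup>+x. ennreal (norm (g x) powr r) \<partial>lborel) \<le> (\<integral>\<^sup>+x. ennreal (B powr r) * indicator (cball (0::'a) R) x \<partial>lborel)"
  proof (intro nn_integral_mono)
    fix x show "ennreal (norm (g x) powr r) \<le> ennreal (B powr r) * indicator (cball (0::'a) R) x"
      using bound[of x] assms(2)[of x] r by (cases "norm x > R") (auto intro!: ennreal_leI powr_mono2)
  qed
  also have "\<dots> < \<infinity>"
    using emeasure_compact_finite[of "cball (0::'a) R"] by (simp add: nn_integral_cmult_indicator ennreal_mult_less_top)
  finally show "Lr r g" using assms by (simp add: Lr_def borel_measurable_continuous_onI)
qed

text \<open>Continuity gives pointwise convergence; the common bound 2 B and the common support in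
  the ball of radius R + 2 give domination.\<close>

lemma convolution_mollifier_continuous:
  fixes g :: "real^3 \<Rightarrow> 'b::euclidean_space"
  assumes g: "continuous_on UNIV g" "\<And>x. norm x > R \<Longrightarrow> g x = 0" and r: "r > 1"
  shows "(\<lambda>n. \<integral>\<^sup>+x. ennreal (norm (convolution (mollifier n) g x - g x) powr r) \<partial>lborel) \<longlonglongrightarrow> 0"
proof -
  obtain B where B: "B > 0" "\<And>x. norm (g x) \<le> B" using continuous_compact_support_Lr(2)[OF g, where r=1] by auto
  have "Lr r g" using continuous_compact_support_Lr(1)[OF g] r by simp
  then have loc_integrable: "loc_integrable g" by (rule Lr_imp_loc_integrable) (use r in simp)
  note [measurable] = loc_integrable_measurable[OF loc_integrable] test_measurable[OF mollifier_test]
  have [measurable]: "cball (0::real^3) (R + 2) \<in> sets borel" by (rule borel_closed) simp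
  have "(\<lambda>n. \<integral>\<^sup>+x. ennreal (norm (convolution (mollifier n) g x - g x) powr r) \<partial>lborel) \<longlonglongrightarrow> (\<integral>\<^sup>+x. 0 \<partial>(lborel :: (real^3) measure))"
  proof (rule nn_integral_dominated_convergence[where w="\<lambda>x. ennreal ((2 * B) powr r) * indicator (cball (0::real^3) (R + 2)) x"])
    show "AE x in lborel. ennreal (norm (convolution (mollifier n) g x - g x) powr r) \<le> ennreal ((2 * B) powr r) * indicator (cball (0::real^3) (R + 2)) x" for n
    proof (rule AE_I2)
      fix x
      have n2: "2 / real (Suc n) \<le> 2" by (simp add: divide_le_eq)
      show "ennreal (norm (convolution (mollifier n) g x - g x) powr r) \<le> ennreal ((2 * B) powr r) * indicator (cball (0::real^3) (R + 2)) x"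
      proof (cases "norm x > R + 2")
        case True
        have "norm (convolution (mollifier n) g x - g x) \<le> 0"
        proof (rule convolution_mollifier_close[OF loc_integrable])
          fix y assume "norm (x - y) < 2 / real (Suc n)"
          then have "norm (x - y) < 2" using n2 by linarith
          then have "norm y > R" using norm_triangle_ineq2[of x y] True by linarith
          then show "norm (g y - g x) \<le> 0" using True by (simp add: g(2))
        qed
        then show ?thesis by simp
      next
        case False
        have "norm (convolution (mollifier n) g x - g x) \<le> 2 * B"
        proof (rule convolution_mollifier_close[OF loc_integrable])
          fix y show "norm (g y - g x) \<le> 2 * B" using norm_triangle_ineq4[of "g y" "g x"] B(2)[of x] B(2)[of y] by linarith
        qed
        then show ?thesis using False r by (auto intro!: ennreal_leI powr_mono2)
      qed
    qed
    show "(\<integral>\<^sup>+x. ennreal ((2 * B) powr r) * indicator (cball (0::real^3) (R + 2)) x \<partial>lborel) < \<infinity>"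
      using emeasure_compact_finite[of "cball (0::real^3) (R + 2)"] by (simp add: nn_integral_cmult_indicator ennreal_mult_less_top)
    show "AE x in lborel. (\<lambda>n. ennreal (norm (convolution (mollifier n) g x - g x) powr r)) \<longlonglongrightarrow> 0"
    proof (rule AE_I2)
      fix x
      have "(\<lambda>n. norm (convolution (mollifier n) g x - g x)) \<longlonglongrightarrow> 0"
      proof (rule LIMSEQ_I)
        fix e :: real assume e: "e > 0"
        have "isCont g x" using g(1) by (simp add: continuous_on_eq_continuous_at)
        then obtain d where d: "d > 0" "\<And>y. dist y x < d \<Longrightarrow> dist (g y) (g x) < e / 2"
          using e unfolding continuous_at_eps_delta by (metis half_gt_zero)
        obtain N where N: "real N > 2 / d" using reals_Archimedean2 by blast
        show "\<exists>N. \<forall>n\<ge>N. norm (norm (convolution (mollifier n) g x - g x) - 0) < e"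
        proof (intro exI allI impI)
          fix n assume "n \<ge> N"
          then have "2 / d < real (Suc n)" using N by linarith
          then have n: "2 / real (Suc n) < d" using d by (simp add: field_simps)
          have "norm (convolution (mollifier n) g x - g x) \<le> e / 2"
          proof (rule convolution_mollifier_close[OF loc_integrable])
            fix y assume "norm (x - y) < 2 / real (Suc n)"
            then have "dist y x < d" using n by (simp add: dist_norm norm_minus_commute)
            then show "norm (g y - g x) \<le> e / 2" using d(2)[of y] by (simp add: dist_norm)
          qed
          then show "norm (norm (convolution (mollifier n) g x - g x) - 0) < e" using e by simp
        qed
      qed
      then have "(\<lambda>n. norm (convolution (mollifier n) g x - g x) powr r) \<longlonglongrightarrow> 0"
        by (rule tendsto_zero_powrI[OF _ tendsto_const]) (use r in auto)
      then show "(\<lambda>n. ennreal (norm (convolution (mollifier n) g x - g x) powr r)) \<longlonglongrightarrow> 0"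
        using tendsto_ennrealI by fastforce
    qed
  qed measurable
  then show ?thesis by simp
qed

lemma nn_powr_triangle:
  assumes [measurable]: "f \<in> borel_measurable M" "g \<in> borel_measurable M"
    and le: "\<And>x. norm (h x) \<le> norm (f x) + norm (g x)" and r: "r > 0"
  shows "(\<integral>\<^sup>+x. ennreal (norm (h x) powr r) \<partial>M) \<le> ennreal (2 powr r) *
      ((\<integral>\<^sup>+x. ennreal (norm (f x) powr r) \<partial>M) + (\<integral>\<^sup>+x. ennreal (norm (g x) powr r) \<partial>M))"
proof -
  have "(\<integral>\<^sup>+x. ennreal (norm (h x) powr r) \<partial>M)
     \<le> (\<integral>\<^sup>+x. ennreal (2 powr r) * (ennreal (norm (f x) powr r) + ennreal (norm (g x) powr r)) \<partial>M)"
  proof (intro nn_integral_mono)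
    fix x
    have "norm (h x) powr r \<le> (norm (f x) + norm (g x)) powr r"
      using r by (intro powr_mono2 le) auto
    also have "\<dots> \<le> 2 powr r * (norm (f x) powr r + norm (g x) powr r)" using r by (intro powr_add_le) auto
    finally show "ennreal (norm (h x) powr r) \<le> ennreal (2 powr r) * (ennreal (norm (f x) powr r) + ennreal (norm (g x) powr r))"
      by (simp add: ennreal_leI flip: ennreal_mult ennreal_plus)
  qed
  also have "\<dots> = ennreal (2 powr r) * ((\<integral>\<^sup>+x. ennreal (norm (f x) powr r) \<partial>M) + (\<integral>\<^sup>+x. ennreal (norm (g x) powr r) \<partial>M))"
    by (simp add: nn_integral_cmult nn_integral_add)
  finally show ?thesis .
qed

text \<open>A continuous cutoff in x, vanishing for |x| > M + 1, combined with the radial projection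
  of v to the ball of radius M. Continuity in v lets truncations of convergent functions
  converge.\<close>

definition truncate :: "real \<Rightarrow> 'a::real_normed_vector \<Rightarrow> 'b::real_normed_vector \<Rightarrow> 'b" where
  "truncate M x v = (max 0 (min 1 (M + 1 - norm x)) / max 1 (norm v / M)) *\<^sub>R v"

lemma truncate_factor: "max 0 (min 1 t) / max 1 s \<le> (1::real)"
proof -
  have "max 0 (min 1 t) \<le> 1" "1 \<le> max 1 s" by auto
  then show ?thesis by (smt (verit) divide_le_eq_1_pos)
qed

lemma truncate_diff_le: "norm (truncate M x v - v) \<le> norm v"
proof -
  let ?c = "max 0 (min 1 (M + 1 - norm x)) / max 1 (norm v / M)"
  have c: "?c \<le> 1" "0 \<le> ?c" by (rule truncate_factor) simp
  have "truncate M x v - v = (?c - 1) *\<^sub>R v" by (simp add: truncate_def scaleR_diff_left)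
  then show ?thesis using c mult_right_mono[of "\<bar>?c - 1\<bar>" 1 "norm v"] by simp
qed

lemma truncate_bounded: "M > 0 \<Longrightarrow> norm (truncate M x v) \<le> M"
proof -
  assume M: "M > 0"
  have "norm (truncate M x v) = max 0 (min 1 (M + 1 - norm x)) * (norm v / max 1 (norm v / M))"
    by (simp add: truncate_def abs_div_pos)
  also have "\<dots> \<le> 1 * (norm v / max 1 (norm v / M))" by (intro mult_right_mono) auto
  also have "\<dots> \<le> M"
  proof (cases "norm v \<le> M")
    case True
    then show ?thesis using M by (simp add: max_absorb1)
  next
    case False
    then have "max 1 (norm v / M) = norm v / M" using M by (intro max_absorb2) simp
    then show ?thesis using M False by simp
  qed
  finally show ?thesis .
qed

lemma truncate_outside: "norm x > M + 1 \<Longrightarrow> truncate M x v = 0"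
  by (simp add: truncate_def)

lemma truncate_eq: "M > 0 \<Longrightarrow> norm x \<le> M \<Longrightarrow> norm v \<le> M \<Longrightarrow> truncate M x v = v"
  by (simp add: truncate_def max_def min_def)

lemma truncate_continuous:
  "M > 0 \<Longrightarrow> continuous_on UNIV g \<Longrightarrow> continuous_on UNIV (\<lambda>x. truncate M x (g x))"
  unfolding truncate_def by (intro continuous_intros) (auto simp: max_def)

lemma truncate_tendsto: "M > 0 \<Longrightarrow> (X \<longlonglongrightarrow> v) \<Longrightarrow> (\<lambda>n. truncate M x (X n)) \<longlonglongrightarrow> truncate M x v"
  unfolding truncate_def by (intro tendsto_intros) (auto simp: max_def)

lemma truncate_measurable [measurable]:
  fixes f :: "'a::euclidean_space \<Rightarrow> 'b::euclidean_space"
  assumes [measurable]: "f \<in> borel_measurable borel"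
  shows "(\<lambda>x. truncate M x (f x)) \<in> borel_measurable borel"
  unfolding truncate_def by measurable

text \<open>Two dominated limits: f is close to its truncation, with |f| as the bound; the
  truncation of f is close to equally truncated continuous functions, with 2 M on a ball as the
  bound.\<close>

lemma Lr_dense:
  fixes f :: "'a::euclidean_space \<Rightarrow> 'b::euclidean_space"
  assumes f: "Lr r f" and r: "r > 0" and e: "e > 0"
  obtains g R where "continuous_on UNIV g" "\<And>x. norm x > R \<Longrightarrow> g x = 0"
    "(\<integral>\<^sup>+x. ennreal (norm (g x - f x) powr r) \<partial>lborel) \<le> ennreal e"
proof -
  have [measurable]: "f \<in> borel_measurable borel" and fin: "(\<integral>\<^sup>+x. ennreal (norm (f x) powr r) \<partial>lborel) < \<infinity>"
    using f by (auto simp: Lr_def)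
  define d where "d = e / (2 powr r * 2)"
  have d: "d > 0" using e by (simp add: d_def)
  have "(\<lambda>m. \<integral>\<^sup>+x. ennreal (norm (truncate (real (Suc m)) x (f x) - f x) powr r) \<partial>lborel) \<longlonglongrightarrow> (\<integral>\<^sup>+x. 0 \<partial>(lborel::'a measure))"
  proof (rule nn_integral_dominated_convergence[where w="\<lambda>x. ennreal (norm (f x) powr r)"])
    show "AE x in lborel. (\<lambda>m. ennreal (norm (truncate (real (Suc m)) x (f x) - f x) powr r)) \<longlonglongrightarrow> 0"
    proof (rule AE_I2)
      fix x
      obtain N where N: "real N \<ge> max (norm x) (norm (f x))" using real_arch_simple by blast
      have "\<forall>\<^sub>F m in sequentially. ennreal (norm (truncate (real (Suc m)) x (f x) - f x) powr r) = 0"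
      proof (rule eventually_sequentiallyI[of N])
        fix m assume "m \<ge> N"
        then have "truncate (real (Suc m)) x (f x) = f x" using N by (intro truncate_eq) auto
        then show "ennreal (norm (truncate (real (Suc m)) x (f x) - f x) powr r) = 0" by simp
      qed
      then show "(\<lambda>m. ennreal (norm (truncate (real (Suc m)) x (f x) - f x) powr r)) \<longlonglongrightarrow> 0" by (rule tendsto_eventually)
    qed
    show "AE x in lborel. ennreal (norm (truncate (real (Suc m)) x (f x) - f x) powr r) \<le> ennreal (norm (f x) powr r)" for m
      using r by (intro AE_I2 ennreal_leI powr_mono2 truncate_diff_le) auto
  qed (use fin in measurable)
  then have "(\<lambda>m. \<integral>\<^sup>+x. ennreal (norm (truncate (real (Suc m)) x (f x) - f x) powr r) \<partial>lborel) \<longlonglongrightarrow> 0" by simp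
  then have "\<forall>\<^sub>F m in sequentially. (\<integral>\<^sup>+x. ennreal (norm (truncate (real (Suc m)) x (f x) - f x) powr r) \<partial>lborel) < ennreal d"
    using d by (intro order_tendstoD) auto
  then obtain m where m: "(\<integral>\<^sup>+x. ennreal (norm (truncate (real (Suc m)) x (f x) - f x) powr r) \<partial>lborel) < ennreal d"
    by (auto simp: eventually_sequentially)
  define M where "M = real (Suc m)"
  have M: "M > 0" by (simp add: M_def)
  have "f \<in> borel_measurable lebesgue" by (rule measurable_completion) simp
  \<comment> \<open>Measurability in the sense of \<open>measurable_on\<close> provides continuous
    functions converging to f off a negligible set.\<close>
  then have "f measurable_on UNIV" by (rule lebesgue_measurable_imp_measurable_on) auto
  then obtain N g where N: "negligible N" and g: "\<And>n. continuous_on UNIV (g n)" "\<And>x. x \<notin> N \<Longrightarrow> (\<lambda>n. g n x) \<longlonglongrightarrow> f x"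
    by (auto simp: measurable_on_def)
  have [measurable]: "g n \<in> borel_measurable borel" for n using g(1) by (rule borel_measurable_continuous_onI)
  have "N \<in> null_sets lebesgue" using N by (simp add: negligible_iff_null_sets)
  then have "AE x in lebesgue. x \<notin> N" by (rule AE_not_in)
  then have "AE x in lebesgue. (\<lambda>n. g n x) \<longlonglongrightarrow> f x" by (auto elim!: eventually_mono intro: g)
  then have gAE: "AE x in lborel. (\<lambda>n. g n x) \<longlonglongrightarrow> f x"
    by (simp add: AE_completion_iff)
  have [measurable]: "cball (0::'a) (M + 1) \<in> sets borel" by (rule borel_closed) simp
  have "(\<lambda>n. \<integral>\<^sup>+x. ennreal (norm (truncate M x (g n x) - truncate M x (f x)) powr r) \<partial>lborel) \<longlonglongrightarrow> (\<integral>\<^sup>+x. 0 \<partial>(lborel::'a measure))"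
  proof (rule nn_integral_dominated_convergence[where w="\<lambda>x. ennreal ((2 * M) powr r) * indicator (cball (0::'a) (M + 1)) x"])
    show "AE x in lborel. (\<lambda>n. ennreal (norm (truncate M x (g n x) - truncate M x (f x)) powr r)) \<longlonglongrightarrow> 0"
      using gAE
    proof eventually_elim
      case (elim x)
      have "(\<lambda>n. norm (truncate M x (g n x) - truncate M x (f x))) \<longlonglongrightarrow> 0"
        using truncate_tendsto[OF M elim, of x] by (simp add: LIM_zero tendsto_norm_zero)
      then have "(\<lambda>n. norm (truncate M x (g n x) - truncate M x (f x)) powr r) \<longlonglongrightarrow> 0"
        by (rule tendsto_zero_powrI[OF _ tendsto_const]) (use r in auto)
      then show ?case using tendsto_ennrealI by fastforce
    qed
    show "AE x in lborel. ennreal (norm (truncate M x (g n x) - truncate M x (f x)) powr r) \<le> ennreal ((2 * M) powr r) * indicator (cball (0::'a) (M + 1)) x" for n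
    proof (rule AE_I2)
      fix x
      show "ennreal (norm (truncate M x (g n x) - truncate M x (f x)) powr r) \<le> ennreal ((2 * M) powr r) * indicator (cball (0::'a) (M + 1)) x"
      proof (cases "norm x > M + 1")
        case False
        have "norm (truncate M x (g n x) - truncate M x (f x)) \<le> 2 * M"
          using norm_triangle_ineq4[of "truncate M x (g n x)" "truncate M x (f x)"] truncate_bounded[OF M, of x "g n x"] truncate_bounded[OF M, of x "f x"] by linarith
        then show ?thesis using False r by (auto intro!: ennreal_leI powr_mono2)
      qed (simp add: truncate_outside)
    qed
    show "(\<integral>\<^sup>+x. ennreal ((2 * M) powr r) * indicator (cball (0::'a) (M + 1)) x \<partial>(lborel::'a measure)) < \<infinity>"
      using emeasure_compact_finite[of "cball (0::'a) (M + 1)"] by (simp add: nn_integral_cmult_indicator ennreal_mult_less_top)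
  qed measurable
  then have "(\<lambda>n. \<integral>\<^sup>+x. ennreal (norm (truncate M x (g n x) - truncate M x (f x)) powr r) \<partial>lborel) \<longlonglongrightarrow> 0" by simp
  then have "\<forall>\<^sub>F n in sequentially. (\<integral>\<^sup>+x. ennreal (norm (truncate M x (g n x) - truncate M x (f x)) powr r) \<partial>lborel) < ennreal d"
    using d by (intro order_tendstoD) auto
  then obtain n where n: "(\<integral>\<^sup>+x. ennreal (norm (truncate M x (g n x) - truncate M x (f x)) powr r) \<partial>lborel) < ennreal d"
    by (auto simp: eventually_sequentially)
  let ?h = "\<lambda>x. truncate M x (g n x)"
  have "(\<integral>\<^sup>+x. ennreal (norm (?h x - f x) powr r) \<partial>lborel) \<le> ennreal (2 powr r) *
      ((\<integral>\<^sup>+x. ennreal (norm (?h x - truncate M x (f x)) powr r) \<partial>lborel) + (\<integral>\<^sup>+x. ennreal (norm (truncate M x (f x) - f x) powr r) \<partial>lborel))"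
  proof (rule nn_powr_triangle)
    fix x
    show "norm (?h x - f x) \<le> norm (?h x - truncate M x (f x)) + norm (truncate M x (f x) - f x)"
      using norm_triangle_ineq[of "?h x - truncate M x (f x)" "truncate M x (f x) - f x"] by simp
  qed (use r in measurable)
  also have "\<dots> \<le> ennreal (2 powr r) * (ennreal d + ennreal d)"
    using m n by (intro mult_left_mono add_mono) (auto simp: M_def)
  also have "\<dots> = ennreal (2 powr r * (d + d))" using d by (simp flip: ennreal_mult ennreal_plus)
  also have "2 powr r * (d + d) = e" by (simp add: d_def)
  finally show thesis by (intro that[of ?h "M + 1"] truncate_continuous M g truncate_outside)
qed

lemma convolution_add:
  fixes f g :: "real^'n::finite \<Rightarrow> 'b::euclidean_space"
  assumes "k \<in> test_functions" "loc_integrable f" "loc_integrable g"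
  shows "convolution k (\<lambda>x. f x + g x) x = convolution k f x + convolution k g x"
  unfolding convolution_def using assms by (simp add: scaleR_add_right convolution_integrable)

lemma Lr_uminus: "Lr r f \<Longrightarrow> Lr r (\<lambda>x. - f x)" by (simp add: Lr_def)

lemma Lr_diff: "Lr r f \<Longrightarrow> Lr r g \<Longrightarrow> r > 0 \<Longrightarrow> Lr r (\<lambda>x. f x - g x)"
  using Lr_add[of r f "\<lambda>x. - g x"] Lr_uminus[of r g] by simp

text \<open>Compare with a compactly supported continuous g: mollification does not increase the L^r
  norm of f - g, and for g itself convergence is known.\<close>

theorem convolution_mollifier_Lr:
  fixes f :: "real^3 \<Rightarrow> 'b::euclidean_space"
  assumes f: "Lr r f" and r: "r > 1" and e: "e > 0"
  shows "\<forall>\<^sub>F n in sequentially. (\<integral>\<^sup>+x. ennreal (norm (convolution (mollifier n) f x - f x) powr r) \<partial>lborel) \<le> ennreal e"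
proof -
  \<comment> \<open>Two nested uses of \<open>nn_powr_triangle\<close> produce exactly the factor
    2^r (1 + 2 * 2^r).\<close>
  define d where "d = e / (2 powr r * (1 + 2 powr r * 2))"
  have d: "d > 0" using e by (simp add: d_def add_pos_pos)
  have r0: "r > 0" using r by simp
  obtain g R where g: "continuous_on UNIV g" "\<And>x. norm x > R \<Longrightarrow> g x = 0"
    and gf: "(\<integral>\<^sup>+x. ennreal (norm (g x - f x) powr r) \<partial>lborel) \<le> ennreal d"
    using Lr_dense[OF f r0 d] by blast
  have gL: "Lr r g" using continuous_compact_support_Lr(1)[OF g] r by simp
  have hL: "Lr r (\<lambda>x. f x - g x)" using f gL r by (intro Lr_diff) auto
  have loc_integrable: "loc_integrable f" "loc_integrable g" "loc_integrable (\<lambda>x. f x - g x)" using f gL hL r by (auto intro: Lr_imp_loc_integrable)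
  note [measurable] = loc_integrable_measurable[OF loc_integrable(1)] loc_integrable_measurable[OF loc_integrable(2)] test_measurable[OF mollifier_test]
  have "\<forall>\<^sub>F n in sequentially. (\<integral>\<^sup>+x. ennreal (norm (convolution (mollifier n) g x - g x) powr r) \<partial>lborel) < ennreal d"
    using convolution_mollifier_continuous[OF g r] d by (intro order_tendstoD) auto
  then show ?thesis
  proof eventually_elim
    case (elim n)
    have lin: "convolution (mollifier n) f x = convolution (mollifier n) (\<lambda>x. f x - g x) x + convolution (mollifier n) g x" for x
      using convolution_add[OF mollifier_test loc_integrable(3) loc_integrable(2), of n x] by simp
    have k1: "(\<integral>\<^sup>+z. ennreal \<bar>mollifier n z\<bar> \<partial>lborel) \<le> ennreal 1"
      using nn_integral_eq_integral[of lborel "mollifier n"] test_integrable[OF mollifier_test[of n]] by (simp add: mollifier_nonneg mollifier_integral)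
    have fg: "(\<integral>\<^sup>+x. ennreal (norm (f x - g x) powr r) \<partial>lborel) \<le> ennreal d"
      using gf by (simp add: norm_minus_commute)
    have Y: "(\<integral>\<^sup>+x. ennreal (norm (convolution (mollifier n) (\<lambda>x. f x - g x) x) powr r) \<partial>lborel) \<le> ennreal d"
      using Young_nn[OF _ _ r k1, of "\<lambda>x. f x - g x"] fg by simp
    have "(\<integral>\<^sup>+x. ennreal (norm (convolution (mollifier n) f x - f x) powr r) \<partial>lborel)
      \<le> ennreal (2 powr r) * ((\<integral>\<^sup>+x. ennreal (norm (convolution (mollifier n) (\<lambda>x. f x - g x) x) powr r) \<partial>lborel)
         + (\<integral>\<^sup>+x. ennreal (norm (convolution (mollifier n) g x - f x) powr r) \<partial>lborel))"
    proof (rule nn_powr_triangle)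
      fix x
      have "convolution (mollifier n) f x - f x = convolution (mollifier n) (\<lambda>x. f x - g x) x + (convolution (mollifier n) g x - f x)" by (simp add: lin)
      then show "norm (convolution (mollifier n) f x - f x) \<le> norm (convolution (mollifier n) (\<lambda>x. f x - g x) x) + norm (convolution (mollifier n) g x - f x)"
        by (metis norm_triangle_ineq)
    qed (use r0 in measurable)
    also have "(\<integral>\<^sup>+x. ennreal (norm (convolution (mollifier n) g x - f x) powr r) \<partial>lborel)
      \<le> ennreal (2 powr r) * ((\<integral>\<^sup>+x. ennreal (norm (convolution (mollifier n) g x - g x) powr r) \<partial>lborel)
         + (\<integral>\<^sup>+x. ennreal (norm (g x - f x) powr r) \<partial>lborel))"
    proof (rule nn_powr_triangle)
      fix x
      show "norm (convolution (mollifier n) g x - f x) \<le> norm (convolution (mollifier n) g x - g x) + norm (g x - f x)"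
        using norm_triangle_ineq[of "convolution (mollifier n) g x - g x" "g x - f x"] by simp
    qed (use r0 in measurable)
    also have "\<dots> \<le> ennreal (2 powr r) * (ennreal d + ennreal d)"
      using elim gf by (intro mult_left_mono add_mono) auto
    also note Y
    also have "ennreal (2 powr r) * (ennreal d + ennreal (2 powr r) * (ennreal d + ennreal d))
        = ennreal (2 powr r * (d + 2 powr r * (d + d)))"
      using d by (simp flip: ennreal_mult ennreal_plus)
    also have "2 powr r * (d + 2 powr r * (d + d)) = d * (2 powr r * (1 + 2 powr r * 2))" by (simp add: algebra_simps)
    also have "\<dots> = e" unfolding d_def by (rule nonzero_eq_divide_eq[THEN iffD1, OF _ refl]) (smt (verit) powr_gt_zero mult_pos_pos)
    finally show ?case by (simp add: mult_left_mono add_left_mono add_right_mono)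
  qed
qed

subsection \<open>Almost everywhere convergent subsequences and the fundamental lemma\<close>

lemma strict_mono_selection:
  assumes "\<And>k::nat. \<exists>N. \<forall>n\<ge>N. P k (n::nat)"
  obtains \<sigma> where "strict_mono \<sigma>" "\<And>k. P k (\<sigma> k)"
proof -
  have "\<exists>\<sigma>. \<forall>n. P n (\<sigma> n) \<and> \<sigma> n < \<sigma> (Suc n)"
  proof (intro dependent_nat_choice)
    show "\<exists>x. P 0 x" using assms[of 0] by blast
    fix x n
    obtain N where "\<forall>m\<ge>N. P (Suc n) m" using assms by blast
    then show "\<exists>y. P (Suc n) y \<and> x < y" by (intro exI[of _ "max N (Suc x)"]) auto
  qed
  then show thesis using that by (auto simp: strict_mono_Suc_iff)
qed

lemma nn_integral_suminf_geometric:
  fixes h :: "nat \<Rightarrow> 'a \<Rightarrow> real"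
  assumes [measurable]: "\<And>k. h k \<in> borel_measurable M"
    and "\<And>k. (\<integral>\<^sup>+x. ennreal (h k x) \<partial>M) \<le> ennreal ((1/2) ^ k)" "\<And>k x. h k x \<ge> 0"
  shows "AE x in M. summable (\<lambda>k. h k x)" "(\<integral>\<^sup>+x. ennreal (\<Sum>k. h k x) \<partial>M) < \<infinity>"
proof -
  have "(\<integral>\<^sup>+x. (\<Sum>k. ennreal (h k x)) \<partial>M) = (\<Sum>k. \<integral>\<^sup>+x. ennreal (h k x) \<partial>M)"
    by (rule nn_integral_suminf) measurable
  also have "\<dots> \<le> (\<Sum>k. ennreal ((1/2) ^ k))" by (intro suminf_le assms) auto
  also have "\<dots> = ennreal (\<Sum>k. (1/2) ^ k)" by (intro suminf_ennreal2) auto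
  also have "\<dots> < \<infinity>" by simp
  finally have fin: "(\<integral>\<^sup>+x. (\<Sum>k. ennreal (h k x)) \<partial>M) < \<infinity>" .
  have "AE x in M. (\<Sum>k. ennreal (h k x)) \<noteq> \<infinity>"
    by (rule nn_integral_noteq_infinite[OF _ less_imp_neq[OF fin]]) measurable
  then show S: "AE x in M. summable (\<lambda>k. h k x)"
    by eventually_elim (auto intro!: summable_suminf_not_top assms)
  have "(\<integral>\<^sup>+x. ennreal (\<Sum>k. h k x) \<partial>M) = (\<integral>\<^sup>+x. (\<Sum>k. ennreal (h k x)) \<partial>M)"
    by (rule nn_integral_cong_AE, use S in eventually_elim) (intro suminf_ennreal2[symmetric] assms)
  then show "(\<integral>\<^sup>+x. ennreal (\<Sum>k. h k x) \<partial>M) < \<infinity>" using fin by simp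
qed

text \<open>Along a subsequence whose errors are at most 2^(-k), the sum S of the r-th powers of the
  differences is integrable. This gives convergence almost everywhere and, as needed for later
  limits, the dominating function |f| + S^(1/r).\<close>

theorem Lr_convergent_subseq:
  fixes u :: "nat \<Rightarrow> 'a::euclidean_space \<Rightarrow> 'b::euclidean_space"
  assumes [measurable]: "\<And>n. u n \<in> borel_measurable borel" and f: "Lr r f" and r: "r > 0"
    and approx: "\<And>e. e > 0 \<Longrightarrow> \<forall>\<^sub>F n in sequentially. (\<integral>\<^sup>+x. ennreal (norm (u n x - f x) powr r) \<partial>lborel) \<le> ennreal e"
  obtains \<sigma> w where "strict_mono \<sigma>" "AE x in lborel. (\<lambda>k. u (\<sigma> k) x) \<longlonglongrightarrow> f x"
    "Lr r (w :: 'a \<Rightarrow> real)" "\<And>k. AE x in lborel. norm (u (\<sigma> k) x) \<le> w x"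
proof -
  note [measurable] = Lr_measurable[OF f]
  have "\<exists>N. \<forall>n\<ge>N. (\<integral>\<^sup>+x. ennreal (norm (u n x - f x) powr r) \<partial>lborel) \<le> ennreal ((1/2) ^ k)" for k :: nat
    using approx[of "(1/2) ^ k"] by (auto simp: eventually_sequentially)
  then obtain \<sigma> where \<sigma>: "strict_mono \<sigma>"
    "\<And>k. (\<integral>\<^sup>+x. ennreal (norm (u (\<sigma> k) x - f x) powr r) \<partial>lborel) \<le> ennreal ((1/2) ^ k)"
    using strict_mono_selection[of "\<lambda>k n. (\<integral>\<^sup>+x. ennreal (norm (u n x - f x) powr r) \<partial>lborel) \<le> ennreal ((1/2) ^ k)"] by blast
  define S where "S x = (\<Sum>k. norm (u (\<sigma> k) x - f x) powr r)" for x
  have S: "AE x in lborel. summable (\<lambda>k. norm (u (\<sigma> k) x - f x) powr r)" "(\<integral>\<^sup>+x. ennreal (S x) \<partial>lborel) < \<infinity>"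
    unfolding S_def using \<sigma>(2) by (rule nn_integral_suminf_geometric[rotated]; simp)+
  have [measurable]: "S \<in> borel_measurable borel" unfolding S_def[abs_def] by measurable
  have lim: "AE x in lborel. (\<lambda>k. u (\<sigma> k) x) \<longlonglongrightarrow> f x"
    using S(1)
  proof eventually_elim
    case (elim x)
    then have "(\<lambda>k. norm (u (\<sigma> k) x - f x) powr r) \<longlonglongrightarrow> 0" by (rule summable_LIMSEQ_zero)
    then have "(\<lambda>k. (norm (u (\<sigma> k) x - f x) powr r) powr (1 / r)) \<longlonglongrightarrow> 0"
      by (rule tendsto_zero_powrI[OF _ tendsto_const]) (use r in auto)
    then have "(\<lambda>k. norm (u (\<sigma> k) x - f x)) \<longlonglongrightarrow> 0" using r by (simp add: powr_powr)
    then show ?case by (simp add: tendsto_norm_zero_iff LIM_zero_iff)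
  qed
  \<comment> \<open>The absolute value guards against the unspecified value of S where the series
    diverges.\<close>
  have "Lr r (\<lambda>x. \<bar>S x\<bar> powr (1 / r))"
  proof -
    have "(\<integral>\<^sup>+x. ennreal (norm (\<bar>S x\<bar> powr (1 / r)) powr r) \<partial>lborel) = (\<integral>\<^sup>+x. ennreal (S x) \<partial>lborel)"
      by (rule nn_integral_cong_AE, use S(1) in eventually_elim) (use r in \<open>simp add: powr_powr S_def suminf_nonneg\<close>)
    then show ?thesis using S(2) by (simp add: Lr_def)
  qed
  moreover have "Lr r (\<lambda>x. norm (f x))" using f by (simp add: Lr_def)
  ultimately have w: "Lr r (\<lambda>x. norm (f x) + \<bar>S x\<bar> powr (1 / r))" using r by (intro Lr_add)
  have "AE x in lborel. norm (u (\<sigma> k) x) \<le> norm (f x) + \<bar>S x\<bar> powr (1 / r)" for k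
    using S(1)
  proof eventually_elim
    case (elim x)
    have "norm (u (\<sigma> k) x - f x) powr r \<le> S x"
      unfolding S_def using sum_le_suminf[OF elim, of "{k}"] by simp
    then have "(norm (u (\<sigma> k) x - f x) powr r) powr (1 / r) \<le> \<bar>S x\<bar> powr (1 / r)"
      using r by (intro powr_mono2) auto
    then have "norm (u (\<sigma> k) x - f x) \<le> \<bar>S x\<bar> powr (1 / r)" using r by (simp add: powr_powr)
    then show ?case using norm_triangle_ineq[of "f x" "u (\<sigma> k) x - f x"] by simp
  qed
  with \<sigma>(1) lim w show thesis by (rule that)
qed

text \<open>Errors 8^(-k) leave room for a weight 4^k: integrability of E, the sum of 4^k |d k|^2,
  gives |d k| \<le> 2^(-k) sqrt E almost everywhere. The telescoping series then converges
  absolutely, with a dominating function in L^2.\<close>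

theorem L2_Cauchy_subseq:
  fixes g :: "nat \<Rightarrow> 'a::euclidean_space \<Rightarrow> 'b::euclidean_space"
  assumes g: "\<And>n. Lr 2 (g n)"
    and Cauchy: "\<And>e. e > 0 \<Longrightarrow> \<exists>N. \<forall>m\<ge>N. \<forall>n\<ge>N. (\<integral>\<^sup>+x. ennreal (norm (g m x - g n x) powr 2) \<partial>lborel) \<le> ennreal e"
  obtains \<sigma> h w where "strict_mono \<sigma>" "Lr 2 h" "AE x in lborel. (\<lambda>k. g (\<sigma> k) x) \<longlonglongrightarrow> h x"
    "Lr 2 (w :: 'a \<Rightarrow> real)" "\<And>k. AE x in lborel. norm (g (\<sigma> k) x) \<le> w x"
proof -
  have gm[measurable]: "g n \<in> borel_measurable borel" for n using Lr_measurable[OF g] .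
  have "\<exists>N. \<forall>n\<ge>N. \<forall>m\<ge>n. (\<integral>\<^sup>+x. ennreal (norm (g m x - g n x) powr 2) \<partial>lborel) \<le> ennreal ((1/8) ^ k)" for k :: nat
  proof -
    obtain N where "\<forall>m\<ge>N. \<forall>n\<ge>N. (\<integral>\<^sup>+x. ennreal (norm (g m x - g n x) powr 2) \<partial>lborel) \<le> ennreal ((1/8) ^ k)"
      using Cauchy[of "(1/8) ^ k"] by auto
    then show ?thesis by (intro exI[of _ N]) auto
  qed
  then obtain \<sigma> where \<sigma>: "strict_mono \<sigma>"
    "\<And>k. \<forall>m\<ge>\<sigma> k. (\<integral>\<^sup>+x. ennreal (norm (g m x - g (\<sigma> k) x) powr 2) \<partial>lborel) \<le> ennreal ((1/8) ^ k)"
    using strict_mono_selection[of "\<lambda>k n. \<forall>m\<ge>n. (\<integral>\<^sup>+x. ennreal (norm (g m x - g n x) powr 2) \<partial>lborel) \<le> ennreal ((1/8) ^ k)"] by blast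
  define d where "d k x = g (\<sigma> (Suc k)) x - g (\<sigma> k) x" for k x
  have [measurable]: "d k \<in> borel_measurable borel" for k unfolding d_def[abs_def] by measurable
  have dI: "(\<integral>\<^sup>+x. ennreal (4 ^ k * norm (d k x) powr 2) \<partial>lborel) \<le> ennreal ((1/2) ^ k)" for k
  proof -
    have "(\<integral>\<^sup>+x. ennreal (4 ^ k * norm (d k x) powr 2) \<partial>lborel) = ennreal (4 ^ k) * (\<integral>\<^sup>+x. ennreal (norm (d k x) powr 2) \<partial>lborel)"
      by (subst nn_integral_cmult[symmetric]) (auto simp: ennreal_mult)
    also have "\<dots> \<le> ennreal (4 ^ k) * ennreal ((1/8) ^ k)"
      using \<sigma>(2)[of k] strict_mono_less_eq[OF \<sigma>(1), of k "Suc k"] by (intro mult_left_mono) (auto simp: d_def)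
    also have "\<dots> = ennreal ((1/2) ^ k)" by (simp flip: ennreal_mult power_mult_distrib)
    finally show ?thesis .
  qed
  define E where "E x = (\<Sum>k. 4 ^ k * norm (d k x) powr 2)" for x
  have E: "AE x in lborel. summable (\<lambda>k. 4 ^ k * norm (d k x) powr 2)" "(\<integral>\<^sup>+x. ennreal (E x) \<partial>lborel) < \<infinity>"
    unfolding E_def using dI by (rule nn_integral_suminf_geometric[rotated]; simp)+
  have [measurable]: "E \<in> borel_measurable borel" unfolding E_def[abs_def] by measurable
  have E0: "AE x in lborel. E x \<ge> 0"
    using E(1) by eventually_elim (simp add: E_def suminf_nonneg)
  have dE: "AE x in lborel. \<forall>k. norm (d k x) \<le> sqrt (E x) * (1/2) ^ k"
    using E(1)
  proof eventually_elim
    case (elim x)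
    show ?case
    proof
      fix k
      have "4 ^ k * norm (d k x) powr 2 \<le> E x"
        unfolding E_def using sum_le_suminf[OF elim, of "{k}"] by simp
      then have "(2 ^ k * norm (d k x))\<^sup>2 \<le> E x"
        by (simp add: power_mult_distrib power_mult[symmetric] mult.commute[of k] power_mult)
      then have "2 ^ k * norm (d k x) \<le> sqrt (E x)" by (rule real_le_rsqrt)
      then show "norm (d k x) \<le> sqrt (E x) * (1/2) ^ k" by (simp add: field_simps power_divide)
    qed
  qed
  have tel: "g (\<sigma> n) x = g (\<sigma> 0) x + (\<Sum>k<n. d k x)" for n x
    by (induction n) (auto simp: d_def)
  define h where "h x = g (\<sigma> 0) x + (\<Sum>k. d k x)" for x
  have [measurable]: "h \<in> borel_measurable borel" unfolding h_def[abs_def] by measurable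
  define w where "w x = norm (g (\<sigma> 0) x) + 2 * sqrt \<bar>E x\<bar>" for x
  have lim: "AE x in lborel. (\<lambda>n. g (\<sigma> n) x) \<longlonglongrightarrow> h x"
    using dE
  proof eventually_elim
    case (elim x)
    have "summable (\<lambda>k. sqrt (E x) * (1/2) ^ k)" by (intro summable_mult summable_geometric) auto
    then have "summable (\<lambda>k. d k x)" by (rule summable_comparison_test'[where N=0]) (use elim in auto)
    then have "(\<lambda>n. \<Sum>k<n. d k x) \<longlonglongrightarrow> (\<Sum>k. d k x)" by (rule summable_LIMSEQ)
    then have "(\<lambda>n. g (\<sigma> 0) x + (\<Sum>k<n. d k x)) \<longlonglongrightarrow> h x" unfolding h_def by (intro tendsto_intros)
    then show ?case by (simp only: tel[symmetric])
  qed
  have bound: "AE x in lborel. norm (g (\<sigma> n) x) \<le> w x" for n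
    using dE E0
  proof eventually_elim
    case (elim x)
    have "norm (\<Sum>k<n. d k x) \<le> (\<Sum>k<n. sqrt (E x) * (1/2) ^ k)" using elim by (intro sum_norm_le) auto
    also have "\<dots> = sqrt (E x) * (\<Sum>k<n. (1/2) ^ k)" by (simp add: sum_distrib_left)
    also have "(\<Sum>k<n. (1/2) ^ k :: real) \<le> 2" by (simp add: sum_gp_strict)
    finally have "norm (\<Sum>k<n. d k x) \<le> sqrt (E x) * 2" using elim by (simp add: mult_left_mono)
    then show ?case unfolding tel[of n] w_def
      using norm_triangle_ineq[of "g (\<sigma> 0) x" "\<Sum>k<n. d k x"] elim by simp
  qed
  have "Lr 2 (\<lambda>x. 2 * sqrt \<bar>E x\<bar>)"
  proof -
    have "(\<integral>\<^sup>+x. ennreal (norm (2 * sqrt \<bar>E x\<bar>) powr 2) \<partial>lborel) = (\<integral>\<^sup>+x. ennreal 4 * ennreal (E x) \<partial>lborel)"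
      by (rule nn_integral_cong_AE, use E0 in eventually_elim) (simp add: power_mult_distrib ennreal_mult)
    also have "\<dots> < \<infinity>" using E(2) by (simp add: nn_integral_cmult ennreal_mult_less_top)
    finally show ?thesis by (simp add: Lr_def)
  qed
  moreover have "Lr 2 (\<lambda>x. norm (g (\<sigma> 0) x))" using g[of "\<sigma> 0"] by (simp add: Lr_def)
  ultimately have w: "Lr 2 w" unfolding w_def by (intro Lr_add) auto
  have "AE x in lborel. \<forall>n. norm (g (\<sigma> n) x) \<le> w x" using bound by (simp add: AE_all_countable)
  then have "AE x in lborel. norm (h x) \<le> w x"
    using lim
  proof eventually_elim
    case (elim x)
    then show ?case by (intro tendsto_upperbound[OF tendsto_norm[OF elim(2)]]) auto
  qed
  then have "AE x in lborel. ennreal (norm (h x) powr 2) \<le> ennreal (norm (w x) powr 2)"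
    by eventually_elim (intro ennreal_leI powr_mono2, auto)
  then have "(\<integral>\<^sup>+x. ennreal (norm (h x) powr 2) \<partial>lborel) \<le> (\<integral>\<^sup>+x. ennreal (norm (w x) powr 2) \<partial>lborel)"
    by (rule nn_integral_mono_AE)
  then have "Lr 2 h" using w by (auto simp: Lr_def)
  with \<sigma>(1) show thesis using lim w bound by (rule that)
qed

lemma loc_integrable_bounded_set_integrable:
  fixes f :: "'a::euclidean_space \<Rightarrow> 'b::euclidean_space"
  assumes f: "loc_integrable f" and S: "bounded S" "S \<in> sets borel"
  shows "integrable lborel (\<lambda>y. indicator S y *\<^sub>R f y)"
proof -
  note [measurable] = loc_integrable_measurable[OF f] S(2)
  obtain R where R: "\<And>x. x \<in> S \<Longrightarrow> norm x \<le> R" using S(1) by (auto simp: bounded_iff)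
  show ?thesis
  proof (rule integrable_dominated[OF loc_integrable_norm_integrable[OF f, of R]])
    fix x show "norm (indicator S x *\<^sub>R f x) \<le> indicator (cball 0 R) x * norm (f x)"
      using R[of x] by (auto split: split_indicator)
  qed measurable
qed

lemma C_k_prod: "(\<And>i. i \<in> I \<Longrightarrow> C_k k (f i)) \<Longrightarrow> C_k k (\<lambda>x. \<Prod>i\<in>I. f i x)"
  by (induction I rule: infinite_finite_induct) (auto intro: C_k_const C_k_mult)

text \<open>Smooth approximation of the indicator of a half-line; products of such factors
  approximate open boxes.\<close>

lemma flat_scaled_tendsto: "(\<lambda>m. flat 0 (real (Suc m) * t)) \<longlonglongrightarrow> (if t > 0 then 1 else 0)"
proof (cases "t > 0")
  case True
  have "(\<lambda>m. 1 / t * (1 / real (Suc m))) \<longlonglongrightarrow> 1 / t * 0"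
    by (intro tendsto_mult tendsto_const LIMSEQ_Suc[OF lim_1_over_n])
  then have "(\<lambda>m. exp (- (1 / t * (1 / real (Suc m))))) \<longlonglongrightarrow> exp (- 0)" by (intro tendsto_exp tendsto_minus) simp
  moreover have "flat 0 (real (Suc m) * t) = exp (- (1 / t * (1 / real (Suc m))))" for m
    using True by (simp add: flat_def mult.commute)
  ultimately show ?thesis using True by simp
next
  case False
  then have "flat 0 (real (Suc m) * t) = 0" for m by (intro flat_zero) (simp add: mult_nonneg_nonpos)
  then show ?thesis using False by simp
qed

text \<open>Test functions approximate indicators of open boxes boundedly, so h has integral 0 over
  every box, and Lebesgue differentiation gives h = 0 almost everywhere.\<close>

theorem fundamental_lemma:
  fixes h :: "real^'n::finite \<Rightarrow> 'b::euclidean_space"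
  assumes h: "loc_integrable h" and z: "\<And>\<phi>. \<phi> \<in> test_functions \<Longrightarrow> (LINT x|lborel. \<phi> x *\<^sub>R h x) = 0"
  shows "AE x in lborel. h x = 0"
proof -
  note [measurable] = loc_integrable_measurable[OF h]
  have box0: "(LINT x|lborel. indicator (box a b) x *\<^sub>R h x) = 0" for a b :: "real^'n"
  proof -
    define \<phi> where "\<phi> m x = (\<Prod>i\<in>UNIV. flat 0 (real (Suc m) * (x $ i - a $ i)) * flat 0 (real (Suc m) * (b $ i - x $ i)))" for m and x :: "real^'n"
    have "bounded (box a b)" by simp
    then obtain R where R: "\<And>x. x \<in> box a b \<Longrightarrow> norm x \<le> R" by (auto simp: bounded_iff)
    have out: "\<phi> m x = 0" if o: "x \<notin> box a b" for m x
    proof -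
      obtain i where "\<not> (a $ i < x $ i \<and> x $ i < b $ i)" using o unfolding mem_box_cart by blast
      then have "flat 0 (real (Suc m) * (x $ i - a $ i)) * flat 0 (real (Suc m) * (b $ i - x $ i)) = 0"
        by (auto simp: not_less intro!: flat_zero mult_nonneg_nonpos)
      then show ?thesis unfolding \<phi>_def by (intro prod_zero) auto
    qed
    have sm: "smooth (\<phi> m)" for m
    proof -
      have "smooth (\<lambda>x::real^'n. \<Prod>i\<in>UNIV. flat 0 (real (Suc m) * (x $ i + (- a $ i))) * flat 0 (real (Suc m) * (b $ i + (-1) * x $ i)))"
        by (intro allI C_k_prod C_k_mult C_k_flat C_k_add C_k_const C_k_coord)
      then show ?thesis unfolding \<phi>_def[abs_def] by simp
    qed
    have test: "\<phi> m \<in> test_functions" for m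
    proof (rule test_functionI[of _ R])
      show "smooth (\<phi> m)" by (rule sm)
      fix x :: "real^'n" assume "norm x > R"
      then have "x \<notin> box a b" using R[of x] by linarith
      then show "\<phi> m x = 0" by (rule out)
    qed
    note [measurable] = test_measurable[OF test]
    have bd: "0 \<le> \<phi> m x" "\<phi> m x \<le> 1" for m x
      unfolding \<phi>_def using flat_nonneg flat_0_le_1 by (auto intro!: prod_nonneg prod_le_1 mult_nonneg_nonneg mult_le_one)
    have "(\<lambda>m. LINT x|lborel. \<phi> m x *\<^sub>R h x) \<longlonglongrightarrow> (LINT x|lborel. indicator (box a b) x *\<^sub>R h x)"
    proof (rule integral_dominated_convergence[where w="\<lambda>x. indicator (cball 0 R) x * norm (h x)"])
      show "integrable lborel (\<lambda>x. indicator (cball 0 R) x * norm (h x))" by (rule loc_integrable_norm_integrable[OF h])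
      show "AE x in lborel. norm (\<phi> m x *\<^sub>R h x) \<le> indicator (cball 0 R) x * norm (h x)" for m
      proof (rule AE_I2)
        fix x show "norm (\<phi> m x *\<^sub>R h x) \<le> indicator (cball 0 R) x * norm (h x)"
          using bd[of m x] out[of x m] R[of x] mult_right_mono[of "\<phi> m x" 1 "norm (h x)"]
          by (cases "x \<in> box a b") auto
      qed
      show "AE x in lborel. (\<lambda>m. \<phi> m x *\<^sub>R h x) \<longlonglongrightarrow> indicator (box a b) x *\<^sub>R h x"
      proof (intro AE_I2 tendsto_scaleR tendsto_const)
        fix x :: "real^'n"
        have "(\<lambda>m. \<phi> m x) \<longlonglongrightarrow> (\<Prod>i\<in>UNIV. (if x $ i - a $ i > 0 then 1 else 0) * (if b $ i - x $ i > 0 then 1 else 0))"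
          unfolding \<phi>_def by (intro tendsto_prod tendsto_mult flat_scaled_tendsto)
        also have "(\<Prod>i\<in>UNIV. (if x $ i - a $ i > 0 then 1 else 0) * (if b $ i - x $ i > 0 then 1 else 0)) = (indicator (box a b) x :: real)"
        proof (cases "x \<in> box a b")
          case True then show ?thesis by (auto simp: mem_box_cart intro!: prod.neutral)
        next
          case False
          then obtain i where "\<not> (a $ i < x $ i \<and> x $ i < b $ i)" unfolding mem_box_cart by blast
          then show ?thesis using False by (auto intro!: prod_zero exI[of _ i])
        qed
        finally show "(\<lambda>m. \<phi> m x) \<longlonglongrightarrow> indicator (box a b) x" .
      qed
    qed measurable
    moreover have "(LINT x|lborel. \<phi> m x *\<^sub>R h x) = 0" for m using z[OF test] .
    ultimately show ?thesis by (simp add: LIMSEQ_const_iff)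
  qed
  have int: "h integrable_on cbox a b" for a b
  proof -
    have "integrable lborel (\<lambda>x. indicator (cbox a b) x *\<^sub>R h x)" by (intro loc_integrable_bounded_set_integrable h) auto
    then have "(\<lambda>x. indicator (cbox a b) x *\<^sub>R h x) integrable_on UNIV" by (rule integrable_on_lborel)
    then have "(\<lambda>x. if x \<in> cbox a b then h x else 0) integrable_on UNIV"
      by (rule integrable_eq) (auto split: split_indicator)
    then show ?thesis by (simp only: integrable_restrict_UNIV)
  qed
  \<comment> \<open>Open and closed boxes give the same integral, since the boundary is
    negligible.\<close>
  have int0: "integral (cbox a b) h = 0" for a b
  proof -
    have "integrable lborel (\<lambda>x. indicator (box a b) x *\<^sub>R h x)" by (intro loc_integrable_bounded_set_integrable h) auto
    then have "integral UNIV (\<lambda>x. indicator (box a b) x *\<^sub>R h x) = 0" by (simp add: integral_lborel box0)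
    moreover have "integral UNIV (\<lambda>x. indicator (box a b) x *\<^sub>R h x) = integral UNIV (\<lambda>x. if x \<in> box a b then h x else 0)"
      by (rule integral_cong) (auto split: split_indicator)
    ultimately show ?thesis by (simp add: integral_restrict_UNIV integral_open_interval)
  qed
  \<comment> \<open>Lebesgue differentiation along shrinking cubes with corner x.\<close>
  obtain N where N: "negligible N" and lim: "\<And>x e. x \<notin> N \<Longrightarrow> 0 < e \<Longrightarrow>
      \<exists>d>0. \<forall>t. 0 < t \<and> t < d \<longrightarrow> norm (integral (cbox x (x + t *\<^sub>R One)) h /\<^sub>R t ^ DIM(real^'n) - h x) < e"
    using integrable_ccontinuous_explicit[of h] int by (metis (no_types, lifting))
  have h0: "h x = 0" if xN: "x \<notin> N" for x
  proof (rule ccontr)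
    assume "h x \<noteq> 0"
    then obtain d where d: "d > 0" "\<forall>t. 0 < t \<and> t < d \<longrightarrow> norm (integral (cbox x (x + t *\<^sub>R One)) h /\<^sub>R t ^ DIM(real^'n) - h x) < norm (h x)"
      using lim[OF xN, of "norm (h x)"] by auto
    have "norm (integral (cbox x (x + (d/2) *\<^sub>R One)) h /\<^sub>R (d/2) ^ DIM(real^'n) - h x) < norm (h x)"
      using d(1) by (intro d(2)[rule_format]) auto
    then show False by (simp add: int0)
  qed
  have "N \<in> null_sets lebesgue" using N by (simp add: negligible_iff_null_sets)
  then have "AE x in lebesgue. x \<notin> N" by (rule AE_not_in)
  then have "AE x in lebesgue. h x = 0" by (auto elim!: eventually_mono intro: h0)
  then show ?thesis by (simp add: AE_completion_iff)
qed

section \<open>Vanishing integral of a directional derivative\<close>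

lemma has_vector_derivative_quotientD:
  fixes g :: "real \<Rightarrow> 'a::real_normed_vector"
  assumes "(g has_vector_derivative d) (at 0)"
  shows "((\<lambda>t. (g t - g 0) /\<^sub>R t) \<longlongrightarrow> d) (at 0)"
proof -
  have "((\<lambda>t. norm (g t - g 0 - t *\<^sub>R d) / norm t) \<longlongrightarrow> 0) (at 0)"
    using assms by (simp add: has_vector_derivative_def has_derivative_at)
  moreover have "\<forall>\<^sub>F t in at 0. norm (g t - g 0 - t *\<^sub>R d) / norm t = norm ((g t - g 0) /\<^sub>R t - d)"
  proof -
    have "norm (g t - g 0 - t *\<^sub>R d) / norm t = norm ((g t - g 0) /\<^sub>R t - d)" if "t \<noteq> 0" for t
    proof -
      have "(g t - g 0) /\<^sub>R t - d = (g t - g 0 - t *\<^sub>R d) /\<^sub>R t" using that by (simp add: scaleR_diff_right)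
      then show ?thesis by (simp add: divide_inverse mult.commute)
    qed
    then show ?thesis by (auto simp: eventually_at_filter)
  qed
  ultimately have "((\<lambda>t. norm ((g t - g 0) /\<^sub>R t - d)) \<longlongrightarrow> 0) (at 0)"
    by (rule Lim_transform_eventually)
  then show ?thesis by (simp add: tendsto_norm_zero_iff LIM_zero_iff)
qed

text \<open>Translation invariance makes the integral of every difference quotient vanish; the
  quotients are bounded with support in a fixed ball, so the limit t -> 0 may be taken under the
  integral.\<close>

theorem integral_directional_derivative_zero:
  fixes F F' :: "real^'n::finite \<Rightarrow> 'b::euclidean_space"
  assumes D: "\<And>x. ((\<lambda>t. F (x + t *\<^sub>R axis j 1)) has_vector_derivative F' x) (at 0)"
    and c: "continuous_on UNIV F" "continuous_on UNIV F'" and out: "\<And>x. norm x > R \<Longrightarrow> F x = 0"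
  shows "(LINT x|lborel. F' x) = 0"
proof -
  let ?e = "axis j 1 :: real^'n"
  have [measurable]: "F \<in> borel_measurable borel" "F' \<in> borel_measurable borel" using c by (auto intro: borel_measurable_continuous_onI)
  have D': "((\<lambda>t. F (x + t *\<^sub>R ?e)) has_vector_derivative F' (x + s *\<^sub>R ?e)) (at s)" for x s
  proof -
    have "((\<lambda>t. F ((x + s *\<^sub>R ?e) + t *\<^sub>R ?e)) \<circ> (\<lambda>t. t - s) has_vector_derivative 1 *\<^sub>R F' (x + s *\<^sub>R ?e)) (at s)"
      by (rule vector_diff_chain_at) (use D[of "x + s *\<^sub>R ?e"] in \<open>auto intro!: derivative_eq_intros\<close>)
    moreover have "(\<lambda>t. F ((x + s *\<^sub>R ?e) + t *\<^sub>R ?e)) \<circ> (\<lambda>t. t - s) = (\<lambda>t. F (x + t *\<^sub>R ?e))"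
      by (auto simp: fun_eq_iff scaleR_diff_left)
    ultimately show ?thesis by simp
  qed
  \<comment> \<open>Radius R + 2 accommodates points of the ball of radius R + 1 moved by at most
    1.\<close>
  have "compact (F' ` cball 0 (R + 2))" using c by (intro compact_continuous_image) (auto intro: continuous_on_subset)
  then have "bounded (F' ` cball 0 (R + 2))" by (rule compact_imp_bounded)
  then obtain B where B: "B > 0" "\<And>y. y \<in> F' ` cball 0 (R + 2) \<Longrightarrow> norm y \<le> B" unfolding bounded_pos by blast
  have quot: "norm ((F (x + t *\<^sub>R ?e) - F x) /\<^sub>R t) \<le> B * indicator (cball 0 (R + 1)) x" if t: "0 < \<bar>t\<bar>" "\<bar>t\<bar> \<le> 1" for t x
  proof (cases "norm x > R + 1")
    case True
    have "norm x \<le> norm (x + t *\<^sub>R ?e) + norm (t *\<^sub>R ?e)" using norm_triangle_ineq4[of "x + t *\<^sub>R ?e" "t *\<^sub>R ?e"] by simp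
    then have "norm (x + t *\<^sub>R ?e) > R" using True t by simp
    then show ?thesis using True out by simp
  next
    case False
    have "norm (F (x + t *\<^sub>R ?e) - F (x + 0 *\<^sub>R ?e)) \<le> B * norm (t - 0)"
    proof (rule differentiable_bound[of "closed_segment 0 t" _ "\<lambda>s u. u *\<^sub>R F' (x + s *\<^sub>R ?e)"])
      fix s assume "s \<in> closed_segment 0 t"
      then have s: "\<bar>s\<bar> \<le> 1" using t by (auto simp: closed_segment_eq_real_ivl split: if_splits)
      show "((\<lambda>t. F (x + t *\<^sub>R ?e)) has_derivative (\<lambda>u. u *\<^sub>R F' (x + s *\<^sub>R ?e))) (at s within closed_segment 0 t)"
        using D'[of x s] unfolding has_vector_derivative_def by (rule has_derivative_at_withinI)
      have "norm (x + s *\<^sub>R ?e) \<le> R + 2" using norm_triangle_ineq[of x "s *\<^sub>R ?e"] s False by simp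
      then have "norm (F' (x + s *\<^sub>R ?e)) \<le> B" by (intro B) auto
      then show "onorm (\<lambda>u. u *\<^sub>R F' (x + s *\<^sub>R ?e)) \<le> B"
        by (intro onorm_le) (auto simp: mult.commute[of B] intro: mult_left_mono)
    qed auto
    then have "norm (F (x + t *\<^sub>R ?e) - F x) / \<bar>t\<bar> \<le> B" using t by (simp add: pos_divide_le_eq)
    then show ?thesis using False by (simp add: divide_inverse mult.commute)
  qed
  have "((\<lambda>t. LINT x|lborel. (F (x + t *\<^sub>R ?e) - F x) /\<^sub>R t) \<longlongrightarrow> (LINT x|lborel. F' x)) (at 0)"
  proof (rule dominated_filter_at[where w="\<lambda>x. B * indicator (cball 0 (R + 1)) x"])
    show "integrable lborel (\<lambda>x::real^'n. B * indicator (cball 0 (R + 1)) x)"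
      using emeasure_compact_finite[of "cball (0::real^'n) (R + 1)"] by (intro integrable_mult_right integrable_real_indicator) auto
    fix x
    have "((\<lambda>t. (F (x + t *\<^sub>R ?e) - F (x + 0 *\<^sub>R ?e)) /\<^sub>R (t - 0)) \<longlongrightarrow> F' x) (at 0)"
      using has_vector_derivative_quotientD[OF D[of x]] by simp
    then show "((\<lambda>t. (F (x + t *\<^sub>R ?e) - F x) /\<^sub>R t) \<longlongrightarrow> F' x) (at 0)" by simp
  qed (use quot in \<open>auto\<close>)
  moreover have "(LINT x|lborel. (F (x + t *\<^sub>R ?e) - F x) /\<^sub>R t) = 0" for t
  proof -
    have "Lr 1 F" using continuous_compact_support_Lr(1)[OF c(1) out, where r=1] by simp
    then have i: "integrable lborel F"
      using integrable_powr_iff[of F lborel 1] by (simp add: Lr_def integrable_norm_iff)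
    have i2: "integrable lborel (\<lambda>x. F (x + t *\<^sub>R ?e))"
    proof -
      have "integrable (distr lborel borel ((+) (t *\<^sub>R ?e))) F" using i by (simp add: lborel_distr_plus)
      then show ?thesis by (subst (asm) integrable_distr_eq) (auto simp: add.commute)
    qed
    have e: "(LINT x|lborel. F (x + t *\<^sub>R ?e)) = (LINT x|lborel. F x)"
      by (subst (2) lborel_distr_plus[of "t *\<^sub>R ?e", symmetric]) (simp add: integral_distr add.commute)
    have "(LINT x|lborel. (F (x + t *\<^sub>R ?e) - F x) /\<^sub>R t) = (LINT x|lborel. F (x + t *\<^sub>R ?e) - F x) /\<^sub>R t"
      by simp
    also have "\<dots> = 0" using i i2 e by (subst Bochner_Integration.integral_diff) auto
    finally show ?thesis .
  qed
  ultimately have "((\<lambda>t::real. 0) \<longlongrightarrow> (LINT x|lborel. F' x)) (at 0)" by (simp only:)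
  then show ?thesis by (simp add: tendsto_const_iff)
qed

subsection \<open>Representation of solutions of Dirac equations\<close>

text \<open>A real form of the Clifford relations: the maps are skew for the real inner product and
  have square -1. The Pauli case is B j = i \<sigma>_j.\<close>

locale clifford =
  fixes B :: "'n::finite \<Rightarrow> 'b::euclidean_space \<Rightarrow> 'b"
  assumes lin: "linear (B j)" and sq: "B j (B j v) = - v"
    and anti: "j \<noteq> k \<Longrightarrow> B j (B k v) = - B k (B j v)"
    and skew: "B j v \<bullet> w = - (v \<bullet> B j w)"
begin

lemma norm_B: "norm (B j v) = norm v"
  by (simp add: norm_eq_sqrt_inner skew sq)

text \<open>Symmetrise in l and j: off the diagonal the anticommutator vanishes, on it the square is
  -1, so only the trace of V remains. For V the integrals of derivatives of a curl-free kernel, the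
  trace is a divergence.\<close>

lemma sum_symmetric:
  assumes sym: "\<And>j k. V j k = V k j"
  shows "(\<Sum>l\<in>UNIV. \<Sum>j\<in>UNIV. B l (B j (V l j))) = - (\<Sum>j\<in>UNIV. V j j)"
proof -
  let ?S = "\<Sum>l\<in>UNIV. \<Sum>j\<in>UNIV. B l (B j (V l j))"
  have "?S = (\<Sum>l\<in>UNIV. \<Sum>j\<in>UNIV. B j (B l (V l j)))"
    by (subst sum.swap) (simp add: sym)
  then have "?S + ?S = (\<Sum>l\<in>UNIV. \<Sum>j\<in>UNIV. B l (B j (V l j)) + B j (B l (V l j)))"
    by (simp add: sum.distrib)
  also have "\<dots> = (\<Sum>l\<in>UNIV. \<Sum>j\<in>UNIV. if j = l then - (2 *\<^sub>R V l l) else 0)"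
  proof (intro sum.cong refl)
    fix l j
    show "B l (B j (V l j)) + B j (B l (V l j)) = (if j = l then - (2 *\<^sub>R V l l) else 0)"
      using anti[of l j "V l j"] by (cases "j = l") (simp_all add: sq scaleR_2)
  qed
  also have "\<dots> = - (2 *\<^sub>R (\<Sum>j\<in>UNIV. V j j))" by (simp add: sum_negf scaleR_sum_right)
  finally have "2 *\<^sub>R ?S = 2 *\<^sub>R (- (\<Sum>j\<in>UNIV. V j j))" by (simp add: scaleR_2)
  then show ?thesis by (subst (asm) scaleR_cancel_left) simp
qed

end

text \<open>(1 + |y|)^(-3) lies in L^q for every q > 1, in particular for the exponent dual to
  p.\<close>

lemma decay_integrable:
  fixes \<psi> :: "real^3 \<Rightarrow> 'b::euclidean_space"
  assumes \<psi>: "Lr p \<psi>" and p: "p > 1"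
  shows "integrable lborel (\<lambda>y. norm (\<psi> y) / (1 + norm y) ^ 3)"
proof -
  note [measurable] = Lr_measurable[OF \<psi>]
  define q where "q = p / (p - 1)"
  have q: "q > 1" "1 / q + 1 / p = 1" using p by (auto simp: q_def field_simps)
  \<comment> \<open>|y|^(-3q) is written as a power of |y|^(-2) with exponent 3q/2 > 3/2, to which
    the exterior estimate applies.\<close>
  have far: "integrable lborel (\<lambda>y::real^3. (if norm y \<ge> 1 then 1 / (norm y)\<^sup>2 else 0) powr (3 * q / 2))"
  proof -
    have "(\<integral>\<^sup>+y. ennreal ((if norm (y::real^3) \<ge> 1 then 1 / (norm y)\<^sup>2 else 0) powr (3 * q / 2)) \<partial>lborel) < \<infinity>"
      using nn_integral_inv_square_far[of 1 "3 * q / 2"] q by (simp add: le_less_trans)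
    then show ?thesis by (simp add: integrable_iff_bounded)
  qed
  have i: "integrable lborel (\<lambda>y. indicator (ball (0::real^3) 1) y + (if norm y \<ge> 1 then 1 / (norm y)\<^sup>2 else 0) powr (3 * q / 2) + norm (\<psi> y) powr p)"
  proof (intro Bochner_Integration.integrable_add far)
    show "integrable lborel (\<lambda>y. indicator (ball (0::real^3) 1) y :: real)"
      by (intro integrable_real_indicator) (auto simp: emeasure_ball3)
    show "integrable lborel (\<lambda>y. norm (\<psi> y) powr p)" using \<psi> integrable_powr_iff[of \<psi> lborel p] by (simp add: Lr_def)
  qed
  show ?thesis
  proof (rule integrable_dominated[OF i])
    fix y :: "real^3"
    let ?a = "1 / (1 + norm y) ^ 3"
    have "?a * norm (\<psi> y) \<le> ?a powr q / q + norm (\<psi> y) powr p / p"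
      using q p by (intro Youngs_inequality) auto
    also have "\<dots> \<le> ?a powr q + norm (\<psi> y) powr p"
      using q p by (intro add_mono) (simp_all add: divide_le_eq mult_left_mono[of 1 _ "_ powr _", simplified])
    also have "?a powr q \<le> indicator (ball 0 1) y + (if norm y \<ge> 1 then 1 / (norm y)\<^sup>2 else 0) powr (3 * q / 2)"
    proof (cases "norm y \<ge> 1")
      case True
      have "(1 / (norm y)\<^sup>2) powr (3 * q / 2) = (1 / norm y ^ 3) powr q"
      proof -
        have "(norm y)\<^sup>2 = norm y powr 2" "norm y ^ 3 = norm y powr 3" using True by (simp_all add: powr_numeral)
        then have "(norm y)\<^sup>2 powr (3 * q / 2) = (norm y ^ 3) powr q" by (simp only: powr_powr) simp
        then show ?thesis by (simp add: powr_divide)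
      qed
      moreover have "?a \<le> 1 / norm y ^ 3" using True by (intro divide_left_mono power_mono mult_pos_pos zero_less_power) auto
      ultimately have "?a powr q \<le> (1 / (norm y)\<^sup>2) powr (3 * q / 2)" using q by (simp add: powr_mono2)
      then show ?thesis using True by simp
    next
      case False
      have "1 ^ 3 \<le> (1 + norm y) ^ 3" by (intro power_mono) auto
      then have "1 \<le> (1 + norm y) ^ 3" by (simp only: power_one)
      then have "?a \<le> 1" by (smt (verit) divide_le_eq_1_pos)
      then have "?a powr q \<le> 1" using q by (intro powr_le1) auto
      then show ?thesis using False by simp
    qed
    finally show "norm (norm (\<psi> y) / (1 + norm y) ^ 3) \<le> indicator (ball 0 1) y + (if norm y \<ge> 1 then 1 / (norm y)\<^sup>2 else 0) powr (3 * q / 2) + norm (\<psi> y) powr p"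
      by simp
  qed measurable
qed

text \<open>Two powers of the dilation factor stand here; differentiation supplies the third, which
  normalises the mollifier.\<close>

definition kernel_at :: "nat \<Rightarrow> 3 \<Rightarrow> real^3 \<Rightarrow> real" where
  "kernel_at n l z = (real (Suc n))\<^sup>2 / kernel_mass * kernel l (0 + real (Suc n) *\<^sub>R z)"

lemma kernel_at_smooth: "smooth (kernel_at n l)"
  unfolding kernel_at_def[abs_def] using kernel_smooth by (intro allI C_k_mult C_k_const C_k_affine) auto

lemma partial_kernel_at: "partial_deriv j (kernel_at n l) z = real (Suc n) ^ 3 / kernel_mass * partial_deriv j (kernel l) (real (Suc n) *\<^sub>R z)"
proof -
  have s: "smooth (\<lambda>z. kernel l (0 + real (Suc n) *\<^sub>R z))" using kernel_smooth by (intro allI C_k_affine) auto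
  have "partial_deriv j (\<lambda>z. (real (Suc n))\<^sup>2 / kernel_mass * kernel l (0 + real (Suc n) *\<^sub>R z)) z
     = (real (Suc n))\<^sup>2 / kernel_mass * (real (Suc n) * partial_deriv j (kernel l) (0 + real (Suc n) *\<^sub>R z))"
    using C_k_const s partial_deriv_affine(1)[of "kernel l" j 0 "real (Suc n)"] smooth_differentiable[OF kernel_smooth]
    by (subst partial_deriv_mult) (auto simp: partial_derivI[OF has_derivative_const])
  then show ?thesis by (simp add: kernel_at_def[abs_def] power2_eq_square power3_eq_cube del: of_nat_Suc)
qed

lemma partial_kernel_at_sym: "partial_deriv j (kernel_at n l) z = partial_deriv l (kernel_at n j) z"
  by (simp add: partial_kernel_at partial_kernel_sym[of j])

lemma sum_partial_kernel_at: "(\<Sum>j\<in>UNIV. partial_deriv j (kernel_at n j) z) = mollifier n z"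
  by (simp only: partial_kernel_at sum_distrib_left[symmetric] sum_partial_kernel mollifier_def)

text \<open>Homogeneity of |x|^(-2) cancels the dilation. The bound is therefore uniform in n, which
  is what survives the removal of the mollification.\<close>

lemma kernel_at_bound: "\<bar>kernel_at n l z\<bar> \<le> 1 / kernel_mass * (1 / (norm z)\<^sup>2)"
proof -
  have "\<bar>kernel_at n l z\<bar> = (real (Suc n))\<^sup>2 / kernel_mass * \<bar>kernel l (real (Suc n) *\<^sub>R z)\<bar>"
    using kernel_mass_pos by (simp add: kernel_at_def abs_mult del: of_nat_Suc)
  also have "\<dots> \<le> (real (Suc n))\<^sup>2 / kernel_mass * (1 / (norm (real (Suc n) *\<^sub>R z))\<^sup>2)"
    using kernel_mass_pos by (intro mult_left_mono kernel_bound) auto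
  also have "\<dots> = 1 / kernel_mass * (1 / (norm z)\<^sup>2)" unfolding norm_scaleR power_mult_distrib by (simp del: of_nat_Suc)
  finally show ?thesis .
qed

lemma kernel_at_le: "\<bar>kernel_at n l z\<bar> \<le> (real (Suc n))\<^sup>2 / kernel_mass"
  using kernel_mass_pos mult_left_mono[OF kernel_le_1[of l "real (Suc n) *\<^sub>R z"], of "(real (Suc n))\<^sup>2 / kernel_mass"]
  by (simp add: kernel_at_def abs_mult del: of_nat_Suc)

lemma kernel_at_decay: "\<exists>C. \<forall>y. \<bar>kernel_at n l (x - y)\<bar> \<le> C / (1 + norm y)\<^sup>2"
proof -
  \<comment> \<open>For |y| \<ge> 2|x| + 1 one has |x - y| \<ge> (1 + |y|)/4, hence the 16;
    otherwise 1 + |y| \<le> 2|x| + 2, and the uniform bound on the kernel is used.\<close>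
  define C where "C = 16 / kernel_mass + (real (Suc n))\<^sup>2 / kernel_mass * (2 * norm x + 2)\<^sup>2"
  have "\<bar>kernel_at n l (x - y)\<bar> \<le> C / (1 + norm y)\<^sup>2" for y
  proof (cases "norm y \<ge> 2 * norm x + 1")
    case True
    have "norm (x - y) \<ge> norm y - norm x" using norm_triangle_ineq2[of y x] by (simp add: norm_minus_commute)
    then have d: "norm (x - y) \<ge> (1 + norm y) / 4"
    proof -
      have "2 * norm x \<le> norm y - 1" using True by simp
      then have "norm y + 1 \<le> 2 * norm (x - y)"
        using \<open>norm (x - y) \<ge> norm y - norm x\<close> by argo
      then show ?thesis using norm_ge_zero[of y] by argo
    qed
    have pos: "(1 + norm y) / 4 > 0" by (simp add: add_pos_nonneg)
    have "\<bar>kernel_at n l (x - y)\<bar> \<le> 1 / kernel_mass * (1 / (norm (x - y))\<^sup>2)" by (rule kernel_at_bound)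
    also have "\<dots> \<le> 1 / kernel_mass * (1 / ((1 + norm y) / 4)\<^sup>2)"
      using kernel_mass_pos pos d by (intro mult_left_mono divide_left_mono power_mono mult_pos_pos zero_less_power) auto
    also have "\<dots> = (16 / kernel_mass) / (1 + norm y)\<^sup>2" by (simp add: power_divide)
    also have "\<dots> \<le> C / (1 + norm y)\<^sup>2" using kernel_mass_pos by (intro divide_right_mono) (auto simp: C_def)
    finally show ?thesis .
  next
    case False
    have pos: "0 < (1 + norm y)\<^sup>2" by (intro zero_less_power add_pos_nonneg) auto
    have "(1 + norm y)\<^sup>2 \<le> (2 * norm x + 2)\<^sup>2" using False by (intro power_mono) auto
    then have "\<bar>kernel_at n l (x - y)\<bar> * (1 + norm y)\<^sup>2 \<le> (real (Suc n))\<^sup>2 / kernel_mass * (2 * norm x + 2)\<^sup>2"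
      using kernel_mass_pos by (intro mult_mono kernel_at_le) auto
    also have "\<dots> \<le> C" using kernel_mass_pos by (simp add: C_def)
    finally show ?thesis using pos by (simp add: pos_le_divide_eq)
  qed
  then show ?thesis by blast
qed

section \<open>Cutoffs at infinity\<close>

definition cutoff_at :: "nat \<Rightarrow> real^3 \<Rightarrow> real" where "cutoff_at m y = cutoff (0 + (1 / real (Suc m)) *\<^sub>R y)"

lemma cutoff_at_test: "cutoff_at m \<in> test_functions"
  unfolding cutoff_at_def[abs_def] by (intro test_affine cutoff_test) simp

lemma cutoff_at_bounds: "0 \<le> cutoff_at m y" "cutoff_at m y \<le> 1"
  by (simp_all add: cutoff_at_def cutoff_nonneg cutoff_le_1)

lemma cutoff_at_tendsto: "(\<lambda>m. cutoff_at m y) \<longlonglongrightarrow> 1"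
proof -
  have "(\<lambda>m. (1 / real (Suc m)) *\<^sub>R y) \<longlonglongrightarrow> 0 *\<^sub>R y" by (intro tendsto_scaleR tendsto_const LIMSEQ_Suc[OF lim_1_over_n])
  then have "(\<lambda>m. 0 + (1 / real (Suc m)) *\<^sub>R y) \<longlonglongrightarrow> 0 + 0 *\<^sub>R y" by (intro tendsto_add tendsto_const)
  then have "(\<lambda>m. cutoff (0 + (1 / real (Suc m)) *\<^sub>R y)) \<longlonglongrightarrow> cutoff (0 + 0 *\<^sub>R y)"
    by (rule continuous_on_tendsto_compose[OF smooth_continuous[OF test_smooth[OF cutoff_test]]]) simp_all
  then show ?thesis by (simp add: cutoff_at_def cutoff_0)
qed

text \<open>For dilation factor m the gradient is of size 1/m and vanishes for |y| > m. Together
  this gives the bound of order 1/(1 + |y|) that does not depend on m.\<close>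

lemma partial_cutoff_at_bound: "\<exists>M>0. \<forall>m y. \<bar>partial_deriv j (cutoff_at m) y\<bar> \<le> M / real (Suc m) \<and> \<bar>partial_deriv j (cutoff_at m) y\<bar> \<le> 2 * M / (1 + norm y)"
proof -
  obtain M where M: "M > 0" "\<And>x. \<bar>partial_deriv j cutoff x\<bar> \<le> M" using test_bounded[OF test_partial[OF cutoff_test]] by blast
  have p: "partial_deriv j (cutoff_at m) y = 1 / real (Suc m) * partial_deriv j cutoff ((1 / real (Suc m)) *\<^sub>R y)" for m y
    unfolding cutoff_at_def[abs_def] using partial_deriv_affine(1)[OF smooth_differentiable[OF test_smooth[OF cutoff_test]], of j 0 "1 / real (Suc m)"] by simp
  have 1: "\<bar>partial_deriv j (cutoff_at m) y\<bar> \<le> M / real (Suc m)" for m y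
    unfolding p using M(2)[of "(1 / real (Suc m)) *\<^sub>R y"] by (simp add: abs_mult divide_right_mono del: of_nat_Suc)
  have 2: "\<bar>partial_deriv j (cutoff_at m) y\<bar> \<le> 2 * M / (1 + norm y)" for m y
  proof (cases "norm y > real (Suc m)")
    case True
    then have "norm ((1 / real (Suc m)) *\<^sub>R y) > 1" by (simp add: field_simps del: of_nat_Suc)
    then have "partial_deriv j cutoff ((1 / real (Suc m)) *\<^sub>R y) = 0"
      using partial_deriv_zero_outside[of 1 cutoff] cutoff_outside by blast
    then show ?thesis using M by (simp add: p)
  next
    case False
    then have "1 + norm y \<le> 2 * real (Suc m)" by simp
    then have "1 / real (Suc m) \<le> 2 / (1 + norm y)" by (simp add: field_simps add_pos_nonneg del: of_nat_Suc)
    then have "M * (1 / real (Suc m)) \<le> M * (2 / (1 + norm y))" using M by (intro mult_left_mono) auto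
    then have "M / real (Suc m) \<le> 2 * M / (1 + norm y)" by (simp add: mult.commute)
    with 1[of m y] show ?thesis by (rule order_trans)
  qed
  show ?thesis using M 1 2 by blast
qed

text \<open>The weak form of - (\<Sum>j. B j (d_j \<psi>)) = f, with the derivative moved to the
  test function. For the Pauli operator f is \<sigma> \<cdot> A \<psi>.\<close>

locale dirac = clifford B for B :: "3 \<Rightarrow> 'b::euclidean_space \<Rightarrow> 'b" +
  fixes \<psi> f :: "real^3 \<Rightarrow> 'b"
  assumes loc_psi: "loc_integrable \<psi>" and loc_f: "loc_integrable f"
    and pde: "\<phi> \<in> test_functions \<Longrightarrow>
      (\<Sum>j\<in>UNIV. B j (LINT y|lborel. partial_deriv j \<phi> y *\<^sub>R \<psi> y)) = (LINT y|lborel. \<phi> y *\<^sub>R f y)"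
begin

text \<open>Test the equation with the cutoff times \<open>kernel_at n l (x - y)\<close>, apply B l
  and sum over l. Where the derivative falls on the kernel, \<open>sum_symmetric\<close> leaves the
  divergence, that is the mollifier; where it falls on the cutoff, an error term remains.\<close>

lemma cutoff_at_identity:
  "(LINT y|lborel. (cutoff_at m y * mollifier n (x - y)) *\<^sub>R \<psi> y) =
     (\<Sum>l\<in>UNIV. B l (LINT y|lborel. (cutoff_at m y * kernel_at n l (x - y)) *\<^sub>R f y))
     - (\<Sum>l\<in>UNIV. \<Sum>j\<in>UNIV. B l (B j (LINT y|lborel. (partial_deriv j (cutoff_at m) y * kernel_at n l (x - y)) *\<^sub>R \<psi> y)))"
proof -
  let ?k = "\<lambda>l y. kernel_at n l (x + (-1) *\<^sub>R y)"
  have ks: "smooth (?k l)" for l using kernel_at_smooth by (intro allI C_k_affine) auto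
  have dks: "smooth (\<lambda>y. partial_deriv j (kernel_at n l) (x + (-1) *\<^sub>R y))" for j l
    using smooth_partial[OF kernel_at_smooth] by (intro allI C_k_affine) auto
  have test: "(\<lambda>y. cutoff_at m y * ?k l y) \<in> test_functions" for l by (intro test_mult cutoff_at_test ks)
  \<comment> \<open>The minus sign comes from the reflection y -> x - y; it cancels the one in
    \<open>sum_symmetric\<close>.\<close>
  have pd: "partial_deriv j (\<lambda>y. cutoff_at m y * ?k l y) =
      (\<lambda>y. - (cutoff_at m y * partial_deriv j (kernel_at n l) (x - y)) + partial_deriv j (cutoff_at m) y * kernel_at n l (x - y))" for j l
    unfolding partial_deriv_mult[OF test_smooth[OF cutoff_at_test] ks]
    using partial_deriv_affine(1)[OF smooth_differentiable[OF kernel_at_smooth], of j n l x "-1"] by simp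
  define V where "V l j = (LINT y|lborel. (cutoff_at m y * partial_deriv j (kernel_at n l) (x - y)) *\<^sub>R \<psi> y)" for l j
  define E where "E l j = (LINT y|lborel. (partial_deriv j (cutoff_at m) y * kernel_at n l (x - y)) *\<^sub>R \<psi> y)" for l j
  have iV: "integrable lborel (\<lambda>y. (cutoff_at m y * partial_deriv j (kernel_at n l) (x - y)) *\<^sub>R \<psi> y)" for j l
    using test_times_integrable[OF test_mult[OF cutoff_at_test dks] loc_psi] by simp
  have iE: "integrable lborel (\<lambda>y. (partial_deriv j (cutoff_at m) y * kernel_at n l (x - y)) *\<^sub>R \<psi> y)" for j l
    using test_times_integrable[OF test_mult[OF test_partial[OF cutoff_at_test] ks] loc_psi] by simp
  have split: "(LINT y|lborel. partial_deriv j (\<lambda>y. cutoff_at m y * ?k l y) y *\<^sub>R \<psi> y) = - V l j + E l j" for j l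
    unfolding pd V_def E_def using iV iE by (simp add: scaleR_add_left scaleR_diff_left)
  have eq: "(\<Sum>j\<in>UNIV. B j (- V l j + E l j)) = (LINT y|lborel. (cutoff_at m y * kernel_at n l (x - y)) *\<^sub>R f y)" for l
    using pde[OF test, of l] unfolding split by simp
  have "(\<Sum>l\<in>UNIV. B l (LINT y|lborel. (cutoff_at m y * kernel_at n l (x - y)) *\<^sub>R f y))
      = (\<Sum>l\<in>UNIV. \<Sum>j\<in>UNIV. B l (B j (- V l j + E l j)))"
    by (simp add: eq[symmetric] linear_sum[OF lin])
  also have "\<dots> = - (\<Sum>l\<in>UNIV. \<Sum>j\<in>UNIV. B l (B j (V l j))) + (\<Sum>l\<in>UNIV. \<Sum>j\<in>UNIV. B l (B j (E l j)))"
    by (simp only: linear_add[OF lin] linear_neg[OF lin] sum.distrib sum_negf)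
  also have "(\<Sum>l\<in>UNIV. \<Sum>j\<in>UNIV. B l (B j (V l j))) = - (\<Sum>j\<in>UNIV. V j j)"
    by (rule sum_symmetric) (simp add: V_def partial_kernel_at_sym)
  also have "(\<Sum>j\<in>UNIV. V j j) = (LINT y|lborel. (cutoff_at m y * mollifier n (x - y)) *\<^sub>R \<psi> y)"
    unfolding V_def sum_partial_kernel_at[symmetric] using iV
    by (subst Bochner_Integration.integral_sum[symmetric]) (auto simp: sum_distrib_left scaleR_sum_left)
  finally show ?thesis by (simp add: E_def)
qed

text \<open>The gradient of the cutoff and the kernel together decay like (1 + |y|)^(-3), which is
  integrable against \<psi>; the gradient itself tends to 0 pointwise. Here the global integrability
  of \<psi> excludes contributions from infinity.\<close>

lemma error_tendsto_zero:
  assumes \<psi>p: "Lr p \<psi>" and p: "p > 1"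
  shows "(\<lambda>m. LINT y|lborel. (partial_deriv j (cutoff_at m) y * kernel_at n l (x - y)) *\<^sub>R \<psi> y) \<longlonglongrightarrow> 0"
proof -
  note [measurable] = loc_integrable_measurable[OF loc_psi] test_measurable[OF test_partial[OF cutoff_at_test]] smooth_measurable[OF kernel_at_smooth]
  obtain M where M: "M > 0" "\<And>m y. \<bar>partial_deriv j (cutoff_at m) y\<bar> \<le> M / real (Suc m)"
    "\<And>m y. \<bar>partial_deriv j (cutoff_at m) y\<bar> \<le> 2 * M / (1 + norm y)"
    using partial_cutoff_at_bound[of j] by blast
  obtain C where C: "\<And>y. \<bar>kernel_at n l (x - y)\<bar> \<le> C / (1 + norm y)\<^sup>2" using kernel_at_decay by blast
  have "(\<lambda>m. LINT y|lborel. (partial_deriv j (cutoff_at m) y * kernel_at n l (x - y)) *\<^sub>R \<psi> y) \<longlonglongrightarrow> (LINT y|(lborel :: (real^3) measure). 0)"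
  proof (rule integral_dominated_convergence[where w="\<lambda>y. 2 * M * C * (norm (\<psi> y) / (1 + norm y) ^ 3)"])
    show "integrable lborel (\<lambda>y. 2 * M * C * (norm (\<psi> y) / (1 + norm y) ^ 3))"
      using decay_integrable[OF \<psi>p p] by (rule integrable_mult_right)
    show "AE y in lborel. norm ((partial_deriv j (cutoff_at m) y * kernel_at n l (x - y)) *\<^sub>R \<psi> y) \<le> 2 * M * C * (norm (\<psi> y) / (1 + norm y) ^ 3)" for m
    proof (rule AE_I2)
      fix y
      have "\<bar>partial_deriv j (cutoff_at m) y\<bar> * \<bar>kernel_at n l (x - y)\<bar> \<le> (2 * M / (1 + norm y)) * (C / (1 + norm y)\<^sup>2)"
        using M C by (intro mult_mono) (auto simp: add_nonneg_nonneg)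
      also have "\<dots> = 2 * M * C / (1 + norm y) ^ 3" by (simp add: power2_eq_square power3_eq_cube)
      finally have "(\<bar>partial_deriv j (cutoff_at m) y\<bar> * \<bar>kernel_at n l (x - y)\<bar>) * norm (\<psi> y) \<le> 2 * M * C / (1 + norm y) ^ 3 * norm (\<psi> y)"
        by (rule mult_right_mono) simp
      then show "norm ((partial_deriv j (cutoff_at m) y * kernel_at n l (x - y)) *\<^sub>R \<psi> y) \<le> 2 * M * C * (norm (\<psi> y) / (1 + norm y) ^ 3)"
        by (simp add: abs_mult)
    qed
    show "AE y in lborel. (\<lambda>m. (partial_deriv j (cutoff_at m) y * kernel_at n l (x - y)) *\<^sub>R \<psi> y) \<longlonglongrightarrow> 0"
    proof (rule AE_I2)
      fix y
      have "(\<lambda>m. M * (1 / real (Suc m))) \<longlonglongrightarrow> M * 0" by (intro tendsto_mult tendsto_const LIMSEQ_Suc[OF lim_1_over_n])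
      then have L: "(\<lambda>m. M / real (Suc m)) \<longlonglongrightarrow> 0" by simp
      have "(\<lambda>m. partial_deriv j (cutoff_at m) y) \<longlonglongrightarrow> 0"
        by (rule Lim_null_comparison[OF _ L], rule always_eventually, rule allI) (simp only: real_norm_def M(2))
      then have "(\<lambda>m. (partial_deriv j (cutoff_at m) y * kernel_at n l (x - y)) *\<^sub>R \<psi> y) \<longlonglongrightarrow> (0 * kernel_at n l (x - y)) *\<^sub>R \<psi> y"
        by (intro tendsto_intros)
      then show "(\<lambda>m. (partial_deriv j (cutoff_at m) y * kernel_at n l (x - y)) *\<^sub>R \<psi> y) \<longlonglongrightarrow> 0" by simp
    qed
  qed measurable
  then show ?thesis by simp
qed

text \<open>The B l are isometries and each of the three kernels is at most |x - y|^(-2) /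
  \<open>kernel_mass\<close>, whence the constant. The right-hand side is allowed to be
  infinite.\<close>

lemma convolution_mollifier_bound:
  assumes \<psi>p: "Lr p \<psi>" and p: "p > 1"
  shows "ennreal (norm (convolution (mollifier n) \<psi> x)) \<le> ennreal (3 / kernel_mass) * riesz (\<lambda>y. norm (f y)) x"
proof -
  note [measurable] = loc_integrable_measurable[OF loc_psi] loc_integrable_measurable[OF loc_f] test_measurable[OF cutoff_at_test] smooth_measurable[OF kernel_at_smooth]
    test_measurable[OF mollifier_test]
  define err where "err m = (\<Sum>l\<in>UNIV. \<Sum>j\<in>UNIV. norm (LINT y|lborel. (partial_deriv j (cutoff_at m) y * kernel_at n l (x - y)) *\<^sub>R \<psi> y))" for m
  have "err \<longlonglongrightarrow> (\<Sum>l\<in>(UNIV::3 set). \<Sum>j\<in>(UNIV::3 set). norm (0::'b))"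
    unfolding err_def[abs_def] by (intro tendsto_sum tendsto_norm error_tendsto_zero[OF \<psi>p p])
  then have err0: "err \<longlonglongrightarrow> 0" by simp
  have err_nn: "err m \<ge> 0" for m by (auto simp: err_def intro!: sum_nonneg)
  have fb: "ennreal (norm (LINT y|lborel. (cutoff_at m y * kernel_at n l (x - y)) *\<^sub>R f y)) \<le> ennreal (1 / kernel_mass) * riesz (\<lambda>y. norm (f y)) x" for m l
  proof -
    have "ennreal (norm (LINT y|lborel. (cutoff_at m y * kernel_at n l (x - y)) *\<^sub>R f y))
       \<le> (\<integral>\<^sup>+y. ennreal (norm ((cutoff_at m y * kernel_at n l (x - y)) *\<^sub>R f y)) \<partial>lborel)" by (rule norm_integral_le_nn)
    also have "\<dots> \<le> (\<integral>\<^sup>+y. ennreal (1 / kernel_mass * norm (f y) / (norm (x - y))\<^sup>2) \<partial>lborel)"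
    proof (intro nn_integral_mono ennreal_leI)
      fix y
      have "\<bar>cutoff_at m y\<bar> * \<bar>kernel_at n l (x - y)\<bar> \<le> 1 * (1 / kernel_mass * (1 / (norm (x - y))\<^sup>2))"
        using cutoff_at_bounds[of m y] kernel_mass_pos by (intro mult_mono kernel_at_bound) auto
      then have "(\<bar>cutoff_at m y\<bar> * \<bar>kernel_at n l (x - y)\<bar>) * norm (f y) \<le> (1 / kernel_mass * (1 / (norm (x - y))\<^sup>2)) * norm (f y)"
        by (intro mult_right_mono) auto
      then show "norm ((cutoff_at m y * kernel_at n l (x - y)) *\<^sub>R f y) \<le> 1 / kernel_mass * norm (f y) / (norm (x - y))\<^sup>2"
        by (simp add: abs_mult)
    qed
    also have "\<dots> = riesz (\<lambda>y. 1 / kernel_mass * norm (f y)) x" by (simp add: riesz_def)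
    also have "\<dots> = ennreal (1 / kernel_mass) * riesz (\<lambda>y. norm (f y)) x" using kernel_mass_pos by (intro riesz_cmult) auto
    finally show ?thesis .
  qed
  have main: "ennreal (norm (LINT y|lborel. (cutoff_at m y * mollifier n (x - y)) *\<^sub>R \<psi> y)) \<le> ennreal (3 / kernel_mass) * riesz (\<lambda>y. norm (f y)) x + ennreal (err m)" for m
  proof -
    have "norm (LINT y|lborel. (cutoff_at m y * mollifier n (x - y)) *\<^sub>R \<psi> y) \<le>
      norm (\<Sum>l\<in>UNIV. B l (LINT y|lborel. (cutoff_at m y * kernel_at n l (x - y)) *\<^sub>R f y)) +
      norm (\<Sum>l\<in>UNIV. \<Sum>j\<in>UNIV. B l (B j (LINT y|lborel. (partial_deriv j (cutoff_at m) y * kernel_at n l (x - y)) *\<^sub>R \<psi> y)))"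
      unfolding cutoff_at_identity by (rule norm_triangle_ineq4)
    also have "\<dots> \<le> (\<Sum>l\<in>UNIV. norm (LINT y|lborel. (cutoff_at m y * kernel_at n l (x - y)) *\<^sub>R f y)) + err m"
      unfolding err_def by (intro add_mono sum_norm_le) (auto simp: norm_B)
    finally have "ennreal (norm (LINT y|lborel. (cutoff_at m y * mollifier n (x - y)) *\<^sub>R \<psi> y))
      \<le> ennreal ((\<Sum>l\<in>UNIV. norm (LINT y|lborel. (cutoff_at m y * kernel_at n l (x - y)) *\<^sub>R f y)) + err m)" by (rule ennreal_leI)
    also have "\<dots> = (\<Sum>l\<in>UNIV. ennreal (norm (LINT y|lborel. (cutoff_at m y * kernel_at n l (x - y)) *\<^sub>R f y))) + ennreal (err m)"
      using err_nn by (simp add: sum_nonneg)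
    also have "\<dots> \<le> (\<Sum>l\<in>(UNIV::3 set). ennreal (1 / kernel_mass) * riesz (\<lambda>y. norm (f y)) x) + ennreal (err m)"
      by (intro add_mono sum_mono fb order_refl)
    also have "(\<Sum>l\<in>(UNIV::3 set). ennreal (1 / kernel_mass) * riesz (\<lambda>y. norm (f y)) x) = ennreal (3 / kernel_mass) * riesz (\<lambda>y. norm (f y)) x"
    proof -
      have "ennreal (3 / kernel_mass) = of_nat 3 * ennreal (1 / kernel_mass)" using kernel_mass_pos by (simp add: ennreal_mult[symmetric] flip: ennreal_numeral)
      then show ?thesis by (simp add: mult.assoc)
    qed
    finally show ?thesis .
  qed
  have lim: "(\<lambda>m. LINT y|lborel. (cutoff_at m y * mollifier n (x - y)) *\<^sub>R \<psi> y) \<longlonglongrightarrow> convolution (mollifier n) \<psi> x"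
    unfolding convolution_def
  proof (rule integral_dominated_convergence[where w="\<lambda>y. norm (mollifier n (x - y) *\<^sub>R \<psi> y)"])
    show "integrable lborel (\<lambda>y. norm (mollifier n (x - y) *\<^sub>R \<psi> y))" by (intro integrable_norm convolution_integrable mollifier_test loc_psi)
    show "AE y in lborel. (\<lambda>m. (cutoff_at m y * mollifier n (x - y)) *\<^sub>R \<psi> y) \<longlonglongrightarrow> mollifier n (x - y) *\<^sub>R \<psi> y"
    proof (rule AE_I2)
      fix y
      have "(\<lambda>m. (cutoff_at m y * mollifier n (x - y)) *\<^sub>R \<psi> y) \<longlonglongrightarrow> (1 * mollifier n (x - y)) *\<^sub>R \<psi> y" by (intro tendsto_intros cutoff_at_tendsto)
      then show "(\<lambda>m. (cutoff_at m y * mollifier n (x - y)) *\<^sub>R \<psi> y) \<longlonglongrightarrow> mollifier n (x - y) *\<^sub>R \<psi> y" by simp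
    qed
    show "AE y in lborel. norm ((cutoff_at m y * mollifier n (x - y)) *\<^sub>R \<psi> y) \<le> norm (mollifier n (x - y) *\<^sub>R \<psi> y)" for m
    proof (rule AE_I2)
      fix y
      have "\<bar>cutoff_at m y\<bar> * (\<bar>mollifier n (x - y)\<bar> * norm (\<psi> y)) \<le> 1 * (\<bar>mollifier n (x - y)\<bar> * norm (\<psi> y))"
        using cutoff_at_bounds[of m y] by (intro mult_right_mono) auto
      then show "norm ((cutoff_at m y * mollifier n (x - y)) *\<^sub>R \<psi> y) \<le> norm (mollifier n (x - y) *\<^sub>R \<psi> y)" by (simp add: abs_mult mult.assoc)
    qed
  qed measurable
  have "(\<lambda>m. ennreal (norm (LINT y|lborel. (cutoff_at m y * mollifier n (x - y)) *\<^sub>R \<psi> y))) \<longlonglongrightarrow> ennreal (norm (convolution (mollifier n) \<psi> x))"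
    by (intro tendsto_ennrealI tendsto_norm lim)
  moreover have "(\<lambda>m. ennreal (3 / kernel_mass) * riesz (\<lambda>y. norm (f y)) x + ennreal (err m)) \<longlonglongrightarrow> ennreal (3 / kernel_mass) * riesz (\<lambda>y. norm (f y)) x + ennreal 0"
    by (intro tendsto_add tendsto_const tendsto_ennrealI err0)
  ultimately have "ennreal (norm (convolution (mollifier n) \<psi> x)) \<le> ennreal (3 / kernel_mass) * riesz (\<lambda>y. norm (f y)) x + ennreal 0"
    by (rule LIMSEQ_le) (use main in blast)
  then show ?thesis by simp
qed

text \<open>The bound for the mollifications does not depend on n, so it passes to the limit along
  an almost everywhere convergent subsequence.\<close>

theorem norm_le_riesz:
  assumes \<psi>p: "Lr p \<psi>" and p: "p > 1"
  shows "AE x in lborel. ennreal (norm (\<psi> x)) \<le> ennreal (3 / kernel_mass) * riesz (\<lambda>y. norm (f y)) x"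
proof -
  note [measurable] = loc_integrable_measurable[OF loc_psi] test_measurable[OF mollifier_test]
  have m: "convolution (mollifier n) \<psi> \<in> borel_measurable borel" for n by measurable
  have p0: "p > 0" using p by simp
  obtain \<sigma> w where "AE x in lborel. (\<lambda>k. convolution (mollifier (\<sigma> k)) \<psi> x) \<longlonglongrightarrow> \<psi> x"
    using Lr_convergent_subseq[of "\<lambda>n. convolution (mollifier n) \<psi>", OF m \<psi>p p0 convolution_mollifier_Lr[OF \<psi>p p]] by blast
  then show ?thesis
  proof eventually_elim
    case (elim x)
    have "(\<lambda>k. ennreal (norm (convolution (mollifier (\<sigma> k)) \<psi> x))) \<longlonglongrightarrow> ennreal (norm (\<psi> x))"
      by (intro tendsto_ennrealI tendsto_norm elim)
    then show ?case by (rule LIMSEQ_le_const2) (use convolution_mollifier_bound[OF \<psi>p p] in blast)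
  qed
qed

end

subsection \<open>The gradient estimate in $L^2$\<close>

lemma L2_integrable:
  assumes "Lr 2 f" shows "integrable lborel (\<lambda>x. (norm (f x))\<^sup>2)"
proof -
  have "integrable lborel (\<lambda>x. norm (f x) powr 2)"
    using assms integrable_powr_iff[of f lborel 2] by (simp add: Lr_def)
  then show ?thesis by simp
qed

lemma L2_mult_integrable:
  assumes f: "Lr 2 f" and g: "Lr 2 g"
  shows "integrable lborel (\<lambda>x. norm (f x) * norm (g x))"
proof (rule integrable_dominated)
  note [measurable] = Lr_measurable[OF f] Lr_measurable[OF g]
  show "integrable lborel (\<lambda>x. (norm (f x))\<^sup>2 + (norm (g x))\<^sup>2)"
    by (intro Bochner_Integration.integrable_add L2_integrable f g)
  show "(\<lambda>x. norm (f x) * norm (g x)) \<in> borel_measurable lborel" by measurable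
  fix x
  show "norm (norm (f x) * norm (g x)) \<le> (norm (f x))\<^sup>2 + (norm (g x))\<^sup>2"
  proof -
    have "0 \<le> norm (f x) * norm (g x)" by simp
    then show ?thesis using sum_squares_bound[of "norm (f x)" "norm (g x)"] by (simp only: real_norm_def abs_of_nonneg)
  qed
qed

lemma L2_inner_integrable:
  fixes f g :: "'a::euclidean_space \<Rightarrow> 'b::euclidean_space"
  assumes f: "Lr 2 f" and g: "Lr 2 g"
  shows "integrable lborel (\<lambda>x. f x \<bullet> g x)"
proof (rule integrable_dominated[OF L2_mult_integrable[OF f g]])
  note [measurable] = Lr_measurable[OF f] Lr_measurable[OF g]
  show "(\<lambda>x. f x \<bullet> g x) \<in> borel_measurable lborel" by measurable
  show "norm (f x \<bullet> g x) \<le> norm (f x) * norm (g x)" for x by (simp add: Cauchy_Schwarz_ineq2)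
qed

lemma Lr_mono:
  assumes "Lr r g" "f \<in> borel_measurable borel" "\<And>x. norm (f x) \<le> norm (g x)" "r > 0"
  shows "Lr r f"
proof -
  have "(\<integral>\<^sup>+x. ennreal (norm (f x) powr r) \<partial>lborel) \<le> (\<integral>\<^sup>+x. ennreal (norm (g x) powr r) \<partial>lborel)"
    using assms by (intro nn_integral_mono ennreal_leI powr_mono2) auto
  then show ?thesis using assms by (auto simp: Lr_def)
qed

lemma Lr_cmult:
  fixes f :: "'a::euclidean_space \<Rightarrow> real"
  assumes f: "Lr r f" and "r > 0" shows "Lr r (\<lambda>x. c * f x)"
proof -
  note [measurable] = Lr_measurable[OF f]
  have "(\<integral>\<^sup>+x. ennreal (norm (c * f x) powr r) \<partial>lborel) = (\<integral>\<^sup>+x. ennreal ((\<bar>c\<bar> * norm (f x)) powr r) \<partial>lborel)"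
    by (simp add: abs_mult)
  also have "\<dots> = ennreal (\<bar>c\<bar> powr r) * (\<integral>\<^sup>+x. ennreal (norm (f x) powr r) \<partial>lborel)"
    by (intro nn_integral_powr_cmult) auto
  also have "\<dots> < \<infinity>" using f by (simp add: Lr_def ennreal_mult_less_top)
  finally show ?thesis by (simp add: Lr_def)
qed

lemma Lr_linear:
  fixes f :: "'a::euclidean_space \<Rightarrow> 'b::euclidean_space" and C :: "'b \<Rightarrow> 'c::euclidean_space"
  assumes f: "Lr r f" and C: "linear C" and r: "r > 0" shows "Lr r (\<lambda>x. C (f x))"
proof -
  obtain K where K: "K > 0" "\<And>v. norm (C v) \<le> K * norm v" using linear_bounded_pos[OF C] by blast
  have [measurable]: "f \<in> borel_measurable borel" "C \<in> borel_measurable borel"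
    using Lr_measurable[OF f] C by (auto intro!: borel_measurable_continuous_onI linear_continuous_on simp: linear_conv_bounded_linear)
  have "Lr r (\<lambda>x. norm (f x))" using f by (simp add: Lr_def)
  then have "Lr r (\<lambda>x. K * norm (f x))" using r by (intro Lr_cmult)
  then show ?thesis by (rule Lr_mono) (use K r in \<open>auto intro: order_trans[OF _ abs_ge_self]\<close>)
qed

lemma Lr_shift:
  fixes f :: "'a::euclidean_space \<Rightarrow> 'b::euclidean_space"
  assumes f: "Lr r f" shows "Lr r (\<lambda>x. f (x + a))"
proof -
  note [measurable] = Lr_measurable[OF f]
  have "(\<integral>\<^sup>+x. ennreal (norm (f (x + a)) powr r) \<partial>lborel) = (\<integral>\<^sup>+x. ennreal (norm (f x) powr r) \<partial>lborel)"
    by (subst (2) lborel_distr_plus[of a, symmetric]) (simp add: nn_integral_distr add.commute)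
  then show ?thesis using f by (simp add: Lr_def)
qed

lemma integral_shift:
  fixes f :: "'a::euclidean_space \<Rightarrow> 'b::{banach,second_countable_topology}"
  assumes [measurable]: "f \<in> borel_measurable borel"
  shows "(LINT x|lborel. f (x + a)) = (LINT x|lborel. f x)"
  by (subst (2) lborel_distr_plus[of a, symmetric]) (simp add: integral_distr add.commute)

text \<open>\<open>\<Phi> d = \<integral> v(x) \<bullet> C v(x + d) dx\<close> is odd because \<open>C\<close> is skew; for central differences the four
  terms cancel without any differentiability of \<open>v\<close>.\<close>

lemma null_lagrangian_discrete:
  fixes v :: "'a::euclidean_space \<Rightarrow> 'b::euclidean_space"
  assumes v: "Lr 2 v" and C: "linear C" and skew: "\<And>u w. C u \<bullet> w = - (u \<bullet> C w)"
  shows "(LINT x|lborel. (v (x + a) - v (x - a)) \<bullet> C (v (x + b) - v (x - b))) = 0"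
proof -
  note [measurable] = Lr_measurable[OF v]
  have [measurable]: "C \<in> borel_measurable borel"
    using C by (auto intro!: borel_measurable_continuous_onI linear_continuous_on simp: linear_conv_bounded_linear)
  define \<Phi> where "\<Phi> d = (LINT x|lborel. v x \<bullet> C (v (x + d)))" for d
  have i: "integrable lborel (\<lambda>x. v (x + c) \<bullet> C (v (x + d)))" for c d
    by (intro L2_inner_integrable Lr_linear[OF _ C] Lr_shift v) simp
  have shift: "(LINT x|lborel. v (x + c) \<bullet> C (v (x + d))) = \<Phi> (d - c)" for c d
    using integral_shift[of "\<lambda>x. v x \<bullet> C (v (x + (d - c)))" c] by (simp add: \<Phi>_def algebra_simps)
  have odd: "\<Phi> (- d) = - \<Phi> d" for d
  proof -
    have "\<Phi> (- d) = (LINT x|lborel. v (x + d) \<bullet> C (v (x + 0)))" using shift[of d 0] by simp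
    also have "\<dots> = (LINT x|lborel. - (v (x + 0) \<bullet> C (v (x + d))))"
      using skew by (intro Bochner_Integration.integral_cong refl) (simp add: inner_commute)
    also have "\<dots> = - \<Phi> d" using shift[of 0 d] by simp
    finally show ?thesis .
  qed
  have "(LINT x|lborel. (v (x + a) - v (x - a)) \<bullet> C (v (x + b) - v (x - b)))
      = (LINT x|lborel. v (x + a) \<bullet> C (v (x + b)) - v (x + a) \<bullet> C (v (x + - b))
          - v (x + - a) \<bullet> C (v (x + b)) + v (x + - a) \<bullet> C (v (x + - b)))"
    by (intro Bochner_Integration.integral_cong refl) (simp add: linear_diff[OF C] inner_diff_left inner_diff_right)
  also have "\<dots> = \<Phi> (b - a) - \<Phi> (- b - a) - \<Phi> (b - - a) + \<Phi> (- b - - a)"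
    using i by (simp add: shift[symmetric] del: diff_minus_eq_add add_uminus_conv_diff)
  also have "\<dots> = \<Phi> (b - a) - \<Phi> (- (b + a)) - \<Phi> (b + a) + \<Phi> (- (b - a))"
  proof -
    have "- b - a = - (b + a)" "b - - a = b + a" "- b - - a = - (b - a)" by simp_all
    then show ?thesis by (simp only:)
  qed
  also have "\<dots> = 0" by (simp only: odd)
  finally show ?thesis .
qed

text \<open>A central quotient is the average of a forward and a backward one. Central differences
  are those for which the discrete identity holds.\<close>

lemma central_quotient_tendsto:
  fixes g :: "real \<Rightarrow> 'a::real_normed_vector"
  assumes "(g has_vector_derivative d) (at 0)"
  shows "((\<lambda>t. (g t - g (- t)) /\<^sub>R (2 * t)) \<longlongrightarrow> d) (at 0)"
proof -
  have q: "((\<lambda>t. (g t - g 0) /\<^sub>R t) \<longlongrightarrow> d) (at 0)" by (rule has_vector_derivative_quotientD[OF assms])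
  have "filterlim uminus (at (0::real)) (at 0)"
    by (auto simp: filterlim_at eventually_at_filter intro!: tendsto_eq_intros)
  from filterlim_compose[OF q this] have q': "((\<lambda>t. (g (- t) - g 0) /\<^sub>R (- t)) \<longlongrightarrow> d) (at 0)" .
  have "((\<lambda>t. (1/2) *\<^sub>R ((g t - g 0) /\<^sub>R t + (g (- t) - g 0) /\<^sub>R (- t))) \<longlongrightarrow> (1/2) *\<^sub>R (d + d)) (at 0)"
    by (intro tendsto_intros q q')
  moreover have "(1/2) *\<^sub>R ((g t - g 0) /\<^sub>R t + (g (- t) - g 0) /\<^sub>R (- t)) = (g t - g (- t)) /\<^sub>R (2 * t)" for t
    by (simp add: scaleR_diff_right scaleR_add_right)
  moreover have "(1/2) *\<^sub>R (d + d) = d" by (simp flip: scaleR_2)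
  ultimately show ?thesis by simp
qed

text \<open>The quotient is dominated, uniformly in t, by the convolution of |\<psi>| with M times
  the indicator of an enlarged support of k; Young's inequality places this in L^2.\<close>

lemma convolution_central_bound:
  fixes \<psi> :: "real^'n::finite \<Rightarrow> 'b::euclidean_space"
  assumes k: "k \<in> test_functions" and \<psi>: "Lr 2 \<psi>"
  obtains H :: "real^'n \<Rightarrow> real" where "Lr 2 H"
    "\<And>x t. 0 < \<bar>t\<bar> \<Longrightarrow> \<bar>t\<bar> \<le> 1 \<Longrightarrow>
       norm ((convolution k \<psi> (x + t *\<^sub>R axis j 1) - convolution k \<psi> (x - t *\<^sub>R axis j 1)) /\<^sub>R (2 * t)) \<le> H x"
proof -
  let ?e = "axis j 1 :: real^'n"
  have loc_integrable: "loc_integrable \<psi>" by (rule Lr_imp_loc_integrable[OF \<psi>]) simp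
  note [measurable] = loc_integrable_measurable[OF loc_integrable] test_measurable[OF k]
  obtain M where M: "M > 0" "\<And>z (t::real). \<bar>k (z + t *\<^sub>R ?e) - k z\<bar> \<le> M * \<bar>t\<bar>" using test_increment_bound[OF k] by blast
  obtain R where R: "R > 0" "\<And>x. norm x > R \<Longrightarrow> k x = 0" using test_support[OF k] by blast
  have [measurable]: "cball (0::real^'n) (R + 1) \<in> sets borel" by (rule borel_closed) simp
  define k0 where "k0 z = M * indicator (cball 0 (R + 1)) z" for z :: "real^'n"
  have [measurable]: "k0 \<in> borel_measurable borel" unfolding k0_def[abs_def] by measurable
  have ik0: "integrable lborel k0" unfolding k0_def
    using emeasure_compact_finite[of "cball (0::real^'n) (R + 1)"] by (intro integrable_mult_right integrable_real_indicator) auto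
  define H where "H = convolution k0 (\<lambda>y. norm (\<psi> y))"
  have "Lr 2 (\<lambda>y. norm (\<psi> y))" using \<psi> by (simp add: Lr_def)
  then have HL: "Lr 2 H" unfolding H_def using ik0 by (intro Lr_convolution) auto
  have "norm ((convolution k \<psi> (x + t *\<^sub>R ?e) - convolution k \<psi> (x - t *\<^sub>R ?e)) /\<^sub>R (2 * t)) \<le> H x" if t: "0 < \<bar>t\<bar>" "\<bar>t\<bar> \<le> 1" for x and t :: real
  proof -
    have i: "integrable lborel (\<lambda>y. k (z - y) *\<^sub>R \<psi> y)" for z by (rule convolution_integrable[OF k loc_integrable])
    have "(convolution k \<psi> (x + t *\<^sub>R ?e) - convolution k \<psi> (x - t *\<^sub>R ?e)) /\<^sub>R (2 * t)
       = (LINT y|lborel. (k (x + t *\<^sub>R ?e - y) *\<^sub>R \<psi> y - k (x - t *\<^sub>R ?e - y) *\<^sub>R \<psi> y) /\<^sub>R (2 * t))"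
      unfolding convolution_def using i by simp
    also have "norm \<dots> \<le> (LINT y|lborel. k0 (x - y) *\<^sub>R norm (\<psi> y))"
    proof (rule order_trans[OF integral_norm_bound Bochner_Integration.integral_mono])
      show "integrable lborel (\<lambda>y. norm ((k (x + t *\<^sub>R ?e - y) *\<^sub>R \<psi> y - k (x - t *\<^sub>R ?e - y) *\<^sub>R \<psi> y) /\<^sub>R (2 * t)))"
        using i by (intro integrable_norm integrable_scaleR_right Bochner_Integration.integrable_diff)
      have "bounded {y. norm (x - y) \<le> R + 1}"
        by (rule bounded_subset[of "cball x (R + 1)"]) (auto simp: dist_norm)
      moreover have "{y. norm (x - y) \<le> R + 1} = cball x (R + 1)" by (auto simp: dist_norm)
      ultimately have "integrable lborel (\<lambda>y. indicator (cball x (R + 1)) y *\<^sub>R \<psi> y)"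
        by (intro loc_integrable_bounded_set_integrable loc_integrable) auto
      then have "integrable lborel (\<lambda>y. norm (indicator (cball x (R + 1)) y *\<^sub>R \<psi> y))" by (rule integrable_norm)
      then have "integrable lborel (\<lambda>y. M * norm (indicator (cball x (R + 1)) y *\<^sub>R \<psi> y))" by (rule integrable_mult_right)
      moreover have "M * norm (indicator (cball x (R + 1)) y *\<^sub>R \<psi> y) = k0 (x - y) *\<^sub>R norm (\<psi> y)" for y
        by (simp add: k0_def dist_norm norm_minus_commute indicator_def)
      ultimately show "integrable lborel (\<lambda>y. k0 (x - y) *\<^sub>R norm (\<psi> y))" by (simp only:)
      fix y
      show "norm ((k (x + t *\<^sub>R ?e - y) *\<^sub>R \<psi> y - k (x - t *\<^sub>R ?e - y) *\<^sub>R \<psi> y) /\<^sub>R (2 * t)) \<le> k0 (x - y) *\<^sub>R norm (\<psi> y)"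
      proof -
        have e: "norm ((k (x + t *\<^sub>R ?e - y) *\<^sub>R \<psi> y - k (x - t *\<^sub>R ?e - y) *\<^sub>R \<psi> y) /\<^sub>R (2 * t))
            = (\<bar>k (x + t *\<^sub>R ?e - y) - k (x - t *\<^sub>R ?e - y)\<bar> / \<bar>2 * t\<bar>) * norm (\<psi> y)"
        proof -
          have g: "\<bar>inverse s\<bar> * (\<bar>d\<bar> * N) = (\<bar>d\<bar> / \<bar>s\<bar>) * N" for s d N :: real by (simp add: divide_inverse)
          show ?thesis unfolding scaleR_diff_left[symmetric] norm_scaleR by (rule g)
        qed
        have "\<bar>k (x + t *\<^sub>R ?e - y) - k (x - t *\<^sub>R ?e - y)\<bar> / \<bar>2 * t\<bar> \<le> k0 (x - y)"
        proof (cases "norm (x - y) > R + 1")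
          case True
          have te: "norm (t *\<^sub>R ?e) \<le> 1" using t by simp
          have "norm (x - y) \<le> norm (x + t *\<^sub>R ?e - y) + norm (t *\<^sub>R ?e)"
            using norm_triangle_ineq4[of "x + t *\<^sub>R ?e - y" "t *\<^sub>R ?e"] by (simp add: algebra_simps)
          moreover have "norm (x - y) \<le> norm (x - t *\<^sub>R ?e - y) + norm (t *\<^sub>R ?e)"
            using norm_triangle_ineq[of "x - t *\<^sub>R ?e - y" "t *\<^sub>R ?e"] by (simp add: algebra_simps)
          ultimately have "norm (x + t *\<^sub>R ?e - y) > R" "norm (x - t *\<^sub>R ?e - y) > R" using True te by linarith+
          then show ?thesis using R(2) M(1) by (simp add: k0_def)
        next
          case False
          \<comment> \<open>The central difference is a single increment of length 2 t, so the
            Lipschitz bound yields M after division by 2 |t|.\<close>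
          have "\<bar>k ((x - t *\<^sub>R ?e - y) + (2 * t) *\<^sub>R ?e) - k (x - t *\<^sub>R ?e - y)\<bar> \<le> M * \<bar>2 * t\<bar>" by (rule M(2))
          moreover have "(x - t *\<^sub>R ?e - y) + (2 * t) *\<^sub>R ?e = x + t *\<^sub>R ?e - y"
            by (simp add: algebra_simps flip: scaleR_2)
          ultimately have "\<bar>k (x + t *\<^sub>R ?e - y) - k (x - t *\<^sub>R ?e - y)\<bar> / \<bar>2 * t\<bar> \<le> M"
            using t by (simp add: pos_divide_le_eq)
          then show ?thesis using False by (simp add: k0_def)
        qed
        then show ?thesis unfolding e real_scaleR_def by (rule mult_right_mono) simp
      qed
    qed
    finally show ?thesis by (simp add: H_def convolution_def)
  qed
  with HL show thesis by (rule that)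
qed

lemma Lr_convolution_test:
  fixes \<psi> :: "real^'n::finite \<Rightarrow> 'b::euclidean_space"
  shows "k \<in> test_functions \<Longrightarrow> Lr r \<psi> \<Longrightarrow> r > 1 \<Longrightarrow> Lr r (convolution k \<psi>)"
  by (intro Lr_convolution test_measurable test_integrable)

text \<open>The limit t -> 0 of the discrete identity with a and b equal to t times the i-th and
  j-th unit vectors; the product of the two L^2 bounds on the quotients dominates.\<close>

lemma null_lagrangian:
  fixes \<psi> :: "real^'n::finite \<Rightarrow> 'b::euclidean_space"
  assumes k: "k \<in> test_functions" and \<psi>: "Lr 2 \<psi>" and C: "linear C" and skew: "\<And>u w. C u \<bullet> w = - (u \<bullet> C w)"
  shows "(LINT x|lborel. convolution (partial_deriv i k) \<psi> x \<bullet> C (convolution (partial_deriv j k) \<psi> x)) = 0"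
proof -
  have loc_integrable: "loc_integrable \<psi>" by (rule Lr_imp_loc_integrable[OF \<psi>]) simp
  let ?v = "convolution k \<psi>"
  have vL: "Lr 2 ?v" by (rule Lr_convolution_test[OF k \<psi>]) simp
  note [measurable] = loc_integrable_measurable[OF loc_integrable] test_measurable[OF k] test_measurable[OF test_partial[OF k]]
  have [measurable]: "C \<in> borel_measurable borel"
    using C by (auto intro!: borel_measurable_continuous_onI linear_continuous_on simp: linear_conv_bounded_linear)
  obtain K where K: "K > 0" "\<And>v. norm (C v) \<le> K * norm v" using linear_bounded_pos[OF C] by blast
  define T where "T i t x = (?v (x + t *\<^sub>R axis i 1) - ?v (x - t *\<^sub>R axis i 1)) /\<^sub>R (2 * t)" for i and t :: real and x
  obtain Hi where Hi: "Lr 2 Hi" "\<And>x t. 0 < \<bar>t\<bar> \<Longrightarrow> \<bar>t\<bar> \<le> 1 \<Longrightarrow> norm (T i t x) \<le> Hi x"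
    using convolution_central_bound[OF k \<psi>, of i] unfolding T_def by metis
  obtain Hj where Hj: "Lr 2 Hj" "\<And>x t. 0 < \<bar>t\<bar> \<Longrightarrow> \<bar>t\<bar> \<le> 1 \<Longrightarrow> norm (T j t x) \<le> Hj x"
    using convolution_central_bound[OF k \<psi>, of j] unfolding T_def by metis
  have [measurable]: "T i t \<in> borel_measurable borel" for i t unfolding T_def[abs_def] by measurable
  have Tlim: "((\<lambda>t. T i t x) \<longlongrightarrow> convolution (partial_deriv i k) \<psi> x) (at 0)" for i x
    using central_quotient_tendsto[OF convolution_has_derivative[OF k loc_integrable, of x i]] by (simp add: T_def)
  have "((\<lambda>t. LINT x|lborel. T i t x \<bullet> C (T j t x)) \<longlongrightarrow> (LINT x|lborel. convolution (partial_deriv i k) \<psi> x \<bullet> C (convolution (partial_deriv j k) \<psi> x))) (at 0)"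
  proof (rule dominated_filter_at[where w="\<lambda>x. K * (norm (Hi x) * norm (Hj x))"])
    show "integrable lborel (\<lambda>x. K * (norm (Hi x) * norm (Hj x)))" using L2_mult_integrable[OF Hi(1) Hj(1)] by simp
    show "((\<lambda>t. T i t x \<bullet> C (T j t x)) \<longlongrightarrow> convolution (partial_deriv i k) \<psi> x \<bullet> C (convolution (partial_deriv j k) \<psi> x)) (at 0)" for x
      using C by (intro tendsto_inner Tlim bounded_linear.tendsto[OF _ Tlim]) (simp add: linear_conv_bounded_linear)
    fix t :: real and x :: "real^'n" assume t: "0 < \<bar>t\<bar>" "\<bar>t\<bar> \<le> 1"
    have "norm (T i t x \<bullet> C (T j t x)) \<le> norm (T i t x) * norm (C (T j t x))" by (simp add: Cauchy_Schwarz_ineq2)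
    also have "\<dots> \<le> norm (T i t x) * (K * norm (T j t x))" by (intro mult_left_mono K) simp
    also have "\<dots> = K * (norm (T i t x) * norm (T j t x))" by simp
    also have "\<dots> \<le> K * (norm (Hi x) * norm (Hj x))"
      using K Hi(2)[OF t, of x] Hj(2)[OF t, of x] by (intro mult_left_mono mult_mono) auto
    finally show "norm (T i t x \<bullet> C (T j t x)) \<le> K * (norm (Hi x) * norm (Hj x))" .
  qed measurable
  moreover have "(LINT x|lborel. T i t x \<bullet> C (T j t x)) = 0" for t
  proof -
    have "(LINT x|lborel. T i t x \<bullet> C (T j t x)) = (LINT x|lborel. inverse (2 * t) * inverse (2 * t) * ((?v (x + t *\<^sub>R axis i 1) - ?v (x - t *\<^sub>R axis i 1)) \<bullet> C (?v (x + t *\<^sub>R axis j 1) - ?v (x - t *\<^sub>R axis j 1))))"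
      by (intro Bochner_Integration.integral_cong refl) (simp add: T_def linear_scale[OF C])
    then show ?thesis using null_lagrangian_discrete[OF vL C skew] by simp
  qed
  ultimately have "((\<lambda>t::real. 0) \<longlongrightarrow> (LINT x|lborel. convolution (partial_deriv i k) \<psi> x \<bullet> C (convolution (partial_deriv j k) \<psi> x))) (at 0)"
    by (simp only:)
  then show ?thesis by (simp add: tendsto_const_iff)
qed

section \<open>Energy identity and convergence of mollified gradients\<close>

definition grad_convolution :: "(real^'n::finite \<Rightarrow> real) \<Rightarrow> (real^'n \<Rightarrow> 'b::euclidean_space) \<Rightarrow> real^'n \<Rightarrow> 'b^'n" where
  "grad_convolution k \<psi> x = (\<chi> j. convolution (partial_deriv j k) \<psi> x)"

lemma norm_vec_sq: "(norm (v :: 'b::euclidean_space^'n::finite))\<^sup>2 = (\<Sum>j\<in>UNIV. (norm (v $ j))\<^sup>2)"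
  by (simp add: power2_norm_eq_inner inner_vec_def)

context clifford
begin

lemma energy_identity:
  fixes \<psi> :: "real^'n \<Rightarrow> 'b"
  assumes k: "k \<in> test_functions" and \<psi>: "Lr 2 \<psi>"
  shows "(LINT x|lborel. (norm (grad_convolution k \<psi> x))\<^sup>2) = (LINT x|lborel. (norm (\<Sum>j\<in>UNIV. B j (convolution (partial_deriv j k) \<psi> x)))\<^sup>2)"
proof -
  let ?v = "\<lambda>j. convolution (partial_deriv j k) \<psi>"
  have vL: "Lr 2 (?v j)" for j by (intro Lr_convolution_test test_partial k \<psi>) simp
  have i: "integrable lborel (\<lambda>x. B i (?v i x) \<bullet> B j (?v j x))" for i j
    by (intro L2_inner_integrable Lr_linear[OF vL lin]) simp_all
  have "(LINT x|lborel. (norm (\<Sum>j\<in>UNIV. B j (?v j x)))\<^sup>2) = (LINT x|lborel. (\<Sum>i\<in>UNIV. \<Sum>j\<in>UNIV. B i (?v i x) \<bullet> B j (?v j x)))"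
    by (simp only: power2_norm_eq_inner inner_sum_left, simp only: inner_sum_right)
  also have "\<dots> = (\<Sum>i\<in>UNIV. \<Sum>j\<in>UNIV. LINT x|lborel. B i (?v i x) \<bullet> B j (?v j x))"
    using i by (simp add: Bochner_Integration.integral_sum)
  also have "\<dots> = (\<Sum>i\<in>UNIV. \<Sum>j\<in>UNIV. if j = i then LINT x|lborel. (norm (?v i x))\<^sup>2 else 0)"
  proof (intro sum.cong refl)
    fix i j
    show "(LINT x|lborel. B i (?v i x) \<bullet> B j (?v j x)) = (if j = i then LINT x|lborel. (norm (?v i x))\<^sup>2 else 0)"
    proof (cases "j = i")
      case True
      then show ?thesis by (simp add: power2_norm_eq_inner[symmetric] norm_B)
    next
      case False
      have C: "linear (\<lambda>v. B i (B j v))" using linear_compose[OF lin[of j] lin[of i]] by (simp add: o_def)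
      \<comment> \<open>The product of two anticommuting skew maps is skew, so the off-diagonal
        integrals are null Lagrangians.\<close>
      have sk: "B i (B j u) \<bullet> w = - (u \<bullet> B i (B j w))" for u w
        using anti[of i j w] False by (simp add: skew inner_minus_right)
      have "(LINT x|lborel. B i (?v i x) \<bullet> B j (?v j x)) = (LINT x|lborel. - (?v i x \<bullet> B i (B j (?v j x))))"
        by (simp add: skew)
      also have "\<dots> = 0" using null_lagrangian[OF k \<psi> C sk, of i j] by simp
      finally show ?thesis using False by simp
    qed
  qed
  also have "\<dots> = (\<Sum>i\<in>UNIV. LINT x|lborel. (norm (?v i x))\<^sup>2)" by simp
  also have "\<dots> = (LINT x|lborel. (norm (grad_convolution k \<psi> x))\<^sup>2)"
    by (simp add: norm_vec_sq grad_convolution_def Bochner_Integration.integral_sum L2_integrable[OF vL])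
  finally show ?thesis ..
qed

end

lemma grad_convolution_L2:
  fixes \<psi> :: "real^'n::finite \<Rightarrow> 'b::euclidean_space"
  assumes k: "k \<in> test_functions" and \<psi>: "Lr 2 \<psi>"
  shows "Lr 2 (grad_convolution k \<psi>)"
proof -
  have vL: "Lr 2 (convolution (partial_deriv j k) \<psi>)" for j by (intro Lr_convolution_test test_partial k \<psi>) simp
  have m: "grad_convolution k \<psi> \<in> borel_measurable borel"
    unfolding grad_convolution_def[abs_def] using Lr_measurable[OF vL]
    by (subst borel_measurable_euclidean_space) (auto simp: Basis_vec_def inner_axis)
  have "integrable lborel (\<lambda>x. \<Sum>j\<in>UNIV. (norm (convolution (partial_deriv j k) \<psi> x))\<^sup>2)" by (intro Bochner_Integration.integrable_sum L2_integrable vL)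
  then have "integrable lborel (\<lambda>x. norm (grad_convolution k \<psi> x) powr 2)" by (simp add: norm_vec_sq grad_convolution_def)
  then show ?thesis using m integrable_powr_iff[of "grad_convolution k \<psi>" lborel 2] by (simp add: Lr_def)
qed

lemma L2_nn_integral:
  assumes "Lr 2 f"
  shows "(\<integral>\<^sup>+x. ennreal (norm (f x) powr 2) \<partial>lborel) = ennreal (LINT x|lborel. (norm (f x))\<^sup>2)"
proof -
  have "(\<integral>\<^sup>+x. ennreal (norm (f x) powr 2) \<partial>lborel) = (\<integral>\<^sup>+x. ennreal ((norm (f x))\<^sup>2) \<partial>lborel)" by simp
  also have "\<dots> = ennreal (LINT x|lborel. (norm (f x))\<^sup>2)" by (rule nn_integral_eq_integral[OF L2_integrable[OF assms]]) simp
  finally show ?thesis .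
qed

context dirac
begin

text \<open>The equation tested with y -> k (x - y): mollification commutes with an operator with
  constant coefficients.\<close>

lemma convolution_pde:
  assumes k: "k \<in> test_functions"
  shows "(\<Sum>j\<in>UNIV. B j (convolution (partial_deriv j k) \<psi> x)) = - convolution k f x"
proof -
  have t: "(\<lambda>y. k (x + (-1) *\<^sub>R y)) \<in> test_functions" by (intro test_affine k) simp
  have p: "partial_deriv j (\<lambda>y. k (x + (-1) *\<^sub>R y)) = (\<lambda>y. - partial_deriv j k (x - y))" for j
    using partial_deriv_affine(1)[OF smooth_differentiable[OF test_smooth[OF k]], of j x "-1"] by simp
  have "(\<Sum>j\<in>UNIV. B j (- convolution (partial_deriv j k) \<psi> x)) = convolution k f x"
    using pde[OF t] unfolding p convolution_def by simp
  then have "- (\<Sum>j\<in>UNIV. B j (convolution (partial_deriv j k) \<psi> x)) = convolution k f x"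
    by (simp only: linear_neg[OF lin] sum_negf)
  from arg_cong[OF this, of uminus] show ?thesis by simp
qed

lemma grad_convolution_norm:
  assumes k: "k \<in> test_functions" and \<psi>: "Lr 2 \<psi>" and f: "Lr 2 f"
  shows "(\<integral>\<^sup>+x. ennreal (norm (grad_convolution k \<psi> x) powr 2) \<partial>lborel) = (\<integral>\<^sup>+x. ennreal (norm (convolution k f x) powr 2) \<partial>lborel)"
proof -
  have "Lr 2 (convolution k f)" by (rule Lr_convolution_test[OF k f]) simp
  from L2_nn_integral[OF this] L2_nn_integral[OF grad_convolution_L2[OF k \<psi>]] show ?thesis
    using energy_identity[OF k \<psi>] by (simp only: convolution_pde[OF k] norm_minus_cancel)
qed

text \<open>The difference of two mollifiers is again a test function, so the energy identity turns
  differences of gradients into differences of mollifications of f, and these converge in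
  L^2.\<close>

lemma grad_convolution_Cauchy:
  assumes \<psi>: "Lr 2 \<psi>" and f: "Lr 2 f" and e: "e > 0"
  shows "\<exists>N. \<forall>m\<ge>N. \<forall>n\<ge>N. (\<integral>\<^sup>+x. ennreal (norm (grad_convolution (mollifier m) \<psi> x - grad_convolution (mollifier n) \<psi> x) powr 2) \<partial>lborel) \<le> ennreal e"
proof -
  note [measurable] = loc_integrable_measurable[OF loc_psi] loc_integrable_measurable[OF loc_f] test_measurable[OF mollifier_test]
  \<comment> \<open>Two terms e/8 times the factor 2^2 of the triangle inequality give e.\<close>
  have ev: "\<forall>\<^sub>F n in sequentially. (\<integral>\<^sup>+x. ennreal (norm (convolution (mollifier n) f x - f x) powr 2) \<partial>lborel) \<le> ennreal (e / 8)"
    using e by (intro convolution_mollifier_Lr f) auto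
  have two: "(0::real) < 2" by simp
  obtain N where N: "\<And>n. n \<ge> N \<Longrightarrow> (\<integral>\<^sup>+x. ennreal (norm (convolution (mollifier n) f x - f x) powr 2) \<partial>lborel) \<le> ennreal (e / 8)"
    using ev by (auto simp: eventually_sequentially)
  show ?thesis
  proof (intro exI allI impI)
    fix m n assume mn: "m \<ge> N" "n \<ge> N"
    let ?k = "\<lambda>x. mollifier m x - mollifier n x"
    have kt: "?k \<in> test_functions" by (intro test_diff mollifier_test)
    have pk: "partial_deriv j ?k = (\<lambda>x. partial_deriv j (mollifier m) x - partial_deriv j (mollifier n) x)" for j
      unfolding partial_deriv_def[of _ "mollifier m"] partial_deriv_def[of _ "mollifier n"]
      by (subst partial_deriv_eqI[where f'="\<lambda>x h. frechet_derivative (mollifier m) (at x) h - frechet_derivative (mollifier n) (at x) h"])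
         (auto intro!: derivative_eq_intros has_derivative_frechet smooth_differentiable test_smooth mollifier_test simp: test_smooth[OF mollifier_test])
    have cd: "convolution (\<lambda>x. a x - b x) g x = convolution a g x - convolution b g x" if "a \<in> test_functions" "b \<in> test_functions" "loc_integrable g" for a b and g :: "real^3 \<Rightarrow> 'b" and x
      unfolding convolution_def using convolution_integrable[OF that(1,3), of x] convolution_integrable[OF that(2,3), of x] by (simp add: scaleR_diff_left)
    have g: "grad_convolution ?k \<psi> x = grad_convolution (mollifier m) \<psi> x - grad_convolution (mollifier n) \<psi> x" for x
      by (simp add: grad_convolution_def vec_eq_iff pk cd[OF test_partial[OF mollifier_test] test_partial[OF mollifier_test] loc_psi])
    have cf: "convolution ?k f x = convolution (mollifier m) f x - convolution (mollifier n) f x" for x by (rule cd[OF mollifier_test mollifier_test loc_f])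
    have "(\<integral>\<^sup>+x. ennreal (norm (grad_convolution (mollifier m) \<psi> x - grad_convolution (mollifier n) \<psi> x) powr 2) \<partial>lborel)
      = (\<integral>\<^sup>+x. ennreal (norm (convolution (mollifier m) f x - convolution (mollifier n) f x) powr 2) \<partial>lborel)"
      using grad_convolution_norm[OF kt \<psi> f] by (simp only: g cf)
    also have "\<dots> \<le> ennreal (2 powr 2) * ((\<integral>\<^sup>+x. ennreal (norm (convolution (mollifier m) f x - f x) powr 2) \<partial>lborel)
        + (\<integral>\<^sup>+x. ennreal (norm (convolution (mollifier n) f x - f x) powr 2) \<partial>lborel))"
    proof (rule nn_powr_triangle)
      fix x show "norm (convolution (mollifier m) f x - convolution (mollifier n) f x) \<le> norm (convolution (mollifier m) f x - f x) + norm (convolution (mollifier n) f x - f x)"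
        using norm_triangle_ineq4[of "convolution (mollifier m) f x - f x" "convolution (mollifier n) f x - f x"] by simp
    qed (use two in measurable)
    also have "\<dots> \<le> ennreal (2 powr 2) * (ennreal (e / 8) + ennreal (e / 8))"
      using mn by (intro mult_left_mono add_mono N) auto
    also have "\<dots> = ennreal (2 powr 2 * (e / 8 + e / 8))"
    proof -
      have 1: "ennreal (e / 8) + ennreal (e / 8) = ennreal (e / 8 + e / 8)" by (rule ennreal_plus[symmetric]) (use e in auto)
      have 2: "ennreal (2 powr 2) * ennreal (e / 8 + e / 8) = ennreal (2 powr 2 * (e / 8 + e / 8))" by (rule ennreal_mult'[symmetric]) simp
      show ?thesis by (simp only: 1 2)
    qed
    also have "2 powr 2 * (e / 8 + e / 8) = e" by simp
    finally show "(\<integral>\<^sup>+x. ennreal (norm (grad_convolution (mollifier m) \<psi> x - grad_convolution (mollifier n) \<psi> x) powr 2) \<partial>lborel) \<le> ennreal e" .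
  qed
qed

text \<open>Two successive extractions, first for the gradients and then for the functions, with the
  sum of both bounds as a common dominating function.\<close>

theorem H1_approximation:
  assumes \<psi>: "Lr 2 \<psi>" and f: "Lr 2 f"
  obtains \<sigma> :: "nat \<Rightarrow> nat" and D w where "Lr 2 D" "Lr 2 (w :: real^3 \<Rightarrow> real)"
    "AE x in lborel. (\<lambda>k. convolution (mollifier (\<sigma> k)) \<psi> x) \<longlonglongrightarrow> \<psi> x"
    "AE x in lborel. (\<lambda>k. grad_convolution (mollifier (\<sigma> k)) \<psi> x) \<longlonglongrightarrow> D x"
    "\<And>k. AE x in lborel. norm (convolution (mollifier (\<sigma> k)) \<psi> x) \<le> w x"
    "\<And>k. AE x in lborel. norm (grad_convolution (mollifier (\<sigma> k)) \<psi> x) \<le> w x"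
proof -
  note [measurable] = loc_integrable_measurable[OF loc_psi] test_measurable[OF mollifier_test]
  obtain \<sigma>1 D w1 where 1: "strict_mono \<sigma>1" "Lr 2 D" "AE x in lborel. (\<lambda>k. grad_convolution (mollifier (\<sigma>1 k)) \<psi> x) \<longlonglongrightarrow> D x"
    "Lr 2 (w1 :: real^3 \<Rightarrow> real)" "\<And>k. AE x in lborel. norm (grad_convolution (mollifier (\<sigma>1 k)) \<psi> x) \<le> w1 x"
    using L2_Cauchy_subseq[of "\<lambda>n. grad_convolution (mollifier n) \<psi>", OF grad_convolution_L2[OF mollifier_test \<psi>] grad_convolution_Cauchy[OF \<psi> f]] by blast
  have two: "(0::real) < 2" by simp
  have m: "convolution (mollifier (\<sigma>1 n)) \<psi> \<in> borel_measurable borel" for n by measurable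
  have ev: "\<forall>\<^sub>F n in sequentially. (\<integral>\<^sup>+x. ennreal (norm (convolution (mollifier (\<sigma>1 n)) \<psi> x - \<psi> x) powr 2) \<partial>lborel) \<le> ennreal e" if "e > 0" for e
    using eventually_subseq[OF 1(1) convolution_mollifier_Lr[OF \<psi> _ that]] by simp
  obtain \<sigma>2 w2 where 2: "strict_mono \<sigma>2" "AE x in lborel. (\<lambda>k. convolution (mollifier (\<sigma>1 (\<sigma>2 k))) \<psi> x) \<longlonglongrightarrow> \<psi> x"
    "Lr 2 (w2 :: real^3 \<Rightarrow> real)" "\<And>k. AE x in lborel. norm (convolution (mollifier (\<sigma>1 (\<sigma>2 k))) \<psi> x) \<le> w2 x"
    using Lr_convergent_subseq[of "\<lambda>n. convolution (mollifier (\<sigma>1 n)) \<psi>", OF m \<psi> two ev] by blast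
  show thesis
  proof (rule that[of D "\<lambda>x. norm (w1 x) + norm (w2 x)" "\<lambda>k. \<sigma>1 (\<sigma>2 k)"])
    show "Lr 2 D" by fact
    show "Lr 2 (\<lambda>x. norm (w1 x) + norm (w2 x))" using 1(4) 2(3) by (intro Lr_add) (auto simp: Lr_def)
    show "AE x in lborel. (\<lambda>k. convolution (mollifier (\<sigma>1 (\<sigma>2 k))) \<psi> x) \<longlonglongrightarrow> \<psi> x" by fact
    show "AE x in lborel. (\<lambda>k. grad_convolution (mollifier (\<sigma>1 (\<sigma>2 k))) \<psi> x) \<longlonglongrightarrow> D x"
      using 1(3)
    proof eventually_elim
      case (elim x)
      show ?case using LIMSEQ_subseq_LIMSEQ[OF elim 2(1)] by (simp add: o_def)
    qed
    show "AE x in lborel. norm (convolution (mollifier (\<sigma>1 (\<sigma>2 k))) \<psi> x) \<le> norm (w1 x) + norm (w2 x)" for k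
      using 2(4)[of k] by eventually_elim (simp add: abs_le_iff add_increasing)
    show "AE x in lborel. norm (grad_convolution (mollifier (\<sigma>1 (\<sigma>2 k))) \<psi> x) \<le> norm (w1 x) + norm (w2 x)" for k
      using 1(5)[of "\<sigma>2 k"] by eventually_elim (simp add: add_increasing2)
  qed
qed

end

subsection \<open>Weak gradients of a solution and of its modulus\<close>

lemma loc_integrable_add:
  assumes "loc_integrable f" "loc_integrable g" shows "loc_integrable (\<lambda>x. f x + g x)"
  using assms by (auto simp: loc_integrable_def scaleR_add_right)

lemma loc_integrable_const: "loc_integrable (\<lambda>x::'a::euclidean_space. c :: 'b::euclidean_space)"
proof -
  have "integrable lborel (\<lambda>x. indicator (cball (0::'a) R) x *\<^sub>R c)" for R
    using emeasure_compact_finite[of "cball (0::'a) R"]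
    by (intro integrable_scaleR_left integrable_real_indicator) auto
  then show ?thesis by (simp add: loc_integrable_def)
qed

lemma loc_integrable_norm:
  assumes "loc_integrable f" shows "loc_integrable (\<lambda>x. norm (f x))"
proof -
  note [measurable] = loc_integrable_measurable[OF assms]
  have "(\<lambda>x. norm (f x)) \<in> borel_measurable borel" by measurable
  then show ?thesis using loc_integrable_norm_integrable[OF assms] by (simp add: loc_integrable_def)
qed

lemma test_dominated_convergence:
  fixes u :: "nat \<Rightarrow> real^'n::finite \<Rightarrow> 'b::euclidean_space"
  assumes \<phi>: "\<phi> \<in> test_functions" and w: "loc_integrable (w :: real^'n \<Rightarrow> real)"
    and [measurable]: "\<And>k. u k \<in> borel_measurable borel" "v \<in> borel_measurable borel"
    and lim: "AE x in lborel. (\<lambda>k. u k x) \<longlonglongrightarrow> v x" and bound: "\<And>k. AE x in lborel. norm (u k x) \<le> w x"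
  shows "(\<lambda>k. LINT x|lborel. \<phi> x *\<^sub>R u k x) \<longlonglongrightarrow> (LINT x|lborel. \<phi> x *\<^sub>R v x)"
proof (rule integral_dominated_convergence[where w="\<lambda>x. norm (\<phi> x *\<^sub>R w x)"])
  note [measurable] = test_measurable[OF \<phi>]
  show "integrable lborel (\<lambda>x. norm (\<phi> x *\<^sub>R w x))" by (intro integrable_norm test_times_integrable \<phi> w)
  show "AE x in lborel. (\<lambda>k. \<phi> x *\<^sub>R u k x) \<longlonglongrightarrow> \<phi> x *\<^sub>R v x"
    using lim by eventually_elim (intro tendsto_intros)
  show "AE x in lborel. norm (\<phi> x *\<^sub>R u k x) \<le> norm (\<phi> x *\<^sub>R w x)" for k
    using bound[of k]
  proof eventually_elim
    case (elim x)
    then have "norm (u k x) \<le> \<bar>w x\<bar>" by linarith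
    then show ?case by (simp add: abs_mult mult_left_mono)
  qed
  show "(\<lambda>x. \<phi> x *\<^sub>R v x) \<in> borel_measurable lborel" "(\<lambda>x. \<phi> x *\<^sub>R u k x) \<in> borel_measurable lborel" for k by measurable
qed

text \<open>The product rule for \<phi> u, which inherits compact support from \<phi>, together with
  the vanishing integral of a directional derivative.\<close>

lemma test_integration_by_parts:
  fixes u u' :: "real^'n::finite \<Rightarrow> 'b::euclidean_space"
  assumes \<phi>: "\<phi> \<in> test_functions"
    and D: "\<And>x. ((\<lambda>t. u (x + t *\<^sub>R axis j 1)) has_vector_derivative u' x) (at 0)"
    and c: "continuous_on UNIV u" "continuous_on UNIV u'"
  shows "(LINT x|lborel. partial_deriv j \<phi> x *\<^sub>R u x) = - (LINT x|lborel. \<phi> x *\<^sub>R u' x)"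
proof -
  obtain R where R: "R > 0" "\<And>x. norm x > R \<Longrightarrow> \<phi> x = 0" using test_support[OF \<phi>] by blast
  have loc_integrable: "loc_integrable g" if g: "continuous_on UNIV g" for g :: "real^'n \<Rightarrow> 'b"
  proof -
    have "integrable lborel (\<lambda>y. indicator (cball 0 R) y *\<^sub>R g y)" for R
      by (rule borel_integrable_compact) (auto intro: continuous_on_subset[OF g])
    then show ?thesis using g by (simp add: loc_integrable_def borel_measurable_continuous_onI)
  qed
  have "(LINT x|lborel. \<phi> x *\<^sub>R u' x + partial_deriv j \<phi> x *\<^sub>R u x) = 0"
  proof (rule integral_directional_derivative_zero[where F="\<lambda>x. \<phi> x *\<^sub>R u x" and R=R])
    fix x
    have "((\<lambda>t. \<phi> (x + t *\<^sub>R axis j 1)) has_real_derivative partial_deriv j \<phi> x) (at 0)"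
      using has_vector_derivative_partial[OF smooth_differentiable[OF test_smooth[OF \<phi>]], of x j]
      by (simp add: has_real_derivative_iff_has_vector_derivative)
    from has_vector_derivative_scaleR[OF this D[of x]]
    show "((\<lambda>t. \<phi> (x + t *\<^sub>R axis j 1) *\<^sub>R u (x + t *\<^sub>R axis j 1)) has_vector_derivative
        \<phi> x *\<^sub>R u' x + partial_deriv j \<phi> x *\<^sub>R u x) (at 0)" by simp
  next
    show "continuous_on UNIV (\<lambda>x. \<phi> x *\<^sub>R u x)"
      using c smooth_continuous[OF test_smooth[OF \<phi>]] by (intro continuous_intros)
    show "continuous_on UNIV (\<lambda>x. \<phi> x *\<^sub>R u' x + partial_deriv j \<phi> x *\<^sub>R u x)"
      using c smooth_continuous[OF test_smooth[OF \<phi>]] smooth_continuous[OF test_smooth[OF test_partial[OF \<phi>]]] by (intro continuous_intros)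
  qed (simp add: R)
  moreover have "integrable lborel (\<lambda>x. \<phi> x *\<^sub>R u' x)" "integrable lborel (\<lambda>x. partial_deriv j \<phi> x *\<^sub>R u x)"
    using c by (auto intro!: test_times_integrable \<phi> test_partial loc_integrable)
  ultimately have "(LINT x|lborel. \<phi> x *\<^sub>R u' x) + (LINT x|lborel. partial_deriv j \<phi> x *\<^sub>R u x) = 0" by simp
  then show ?thesis by (simp add: eq_neg_iff_add_eq_0 add.commute)
qed

lemma norm_vec_component: "norm (v $ j) \<le> norm (v :: 'b::euclidean_space^'n::finite)"
  by (rule power2_le_imp_le) (auto simp: norm_vec_sq intro: member_le_sum[of j UNIV "\<lambda>j. (norm (v $ j))\<^sup>2"])

text \<open>Cauchy--Schwarz, uniformly in e. The case e = 0 is included and covers (v \<bullet> d) /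
  norm v, with value 0 at v = 0 by the convention on division.\<close>

lemma inner_div_sqrt_bound:
  fixes v d :: "'b::real_inner"
  shows "\<bar>(v \<bullet> d) / sqrt (v \<bullet> v + e\<^sup>2)\<bar> \<le> norm d"
proof (cases "v \<bullet> v + e\<^sup>2 = 0")
  case False
  then have pos: "v \<bullet> v + e\<^sup>2 > 0" by (smt (verit) inner_ge_zero zero_le_power2)
  have "norm v \<le> sqrt (v \<bullet> v + e\<^sup>2)" by (simp add: norm_eq_sqrt_inner)
  then have "\<bar>v \<bullet> d\<bar> \<le> norm d * sqrt (v \<bullet> v + e\<^sup>2)"
    using Cauchy_Schwarz_ineq2[of v d] by (smt (verit) mult.commute mult_left_mono norm_ge_zero)
  then show ?thesis using pos by (simp add: pos_divide_le_eq)
qed simp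

lemma sqrt_reg_bound:
  fixes v :: "'b::real_inner"
  shows "0 \<le> sqrt (v \<bullet> v + e\<^sup>2)" "sqrt (v \<bullet> v + e\<^sup>2) \<le> norm v + \<bar>e\<bar>"
proof -
  show "0 \<le> sqrt (v \<bullet> v + e\<^sup>2)" by simp
  have "v \<bullet> v + e\<^sup>2 \<le> (norm v + \<bar>e\<bar>)\<^sup>2" by (simp add: power2_sum power2_norm_eq_inner)
  then show "sqrt (v \<bullet> v + e\<^sup>2) \<le> norm v + \<bar>e\<bar>" by (simp add: real_le_lsqrt)
qed

context dirac
begin

text \<open>Integration by parts is exact for the mollifications. For the modulus it is applied to
  sqrt (|u|^2 + e^2), which is differentiable; first the mollification is removed with e fixed, then
  e tends to 0. At zeros of \<psi> the resulting gradient is 0 by the convention on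
  division.\<close>

theorem weak_gradients:
  assumes \<psi>: "Lr 2 \<psi>" and f: "Lr 2 f"
  obtains D where "Lr 2 D"
    "\<And>\<phi> j. \<phi> \<in> test_functions \<Longrightarrow> (LINT x|lborel. partial_deriv j \<phi> x *\<^sub>R \<psi> x) = - (LINT x|lborel. \<phi> x *\<^sub>R (D x $ j))"
    "\<And>\<phi> j. \<phi> \<in> test_functions \<Longrightarrow> (LINT x|lborel. partial_deriv j \<phi> x *\<^sub>R norm (\<psi> x)) =
        - (LINT x|lborel. \<phi> x *\<^sub>R ((\<psi> x \<bullet> D x $ j) / norm (\<psi> x)))"
proof -
  show thesis
  proof (rule H1_approximation[OF \<psi> f])
  fix \<sigma> :: "nat \<Rightarrow> nat" and D and w :: "real^3 \<Rightarrow> real"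
  assume D: "Lr 2 D" and w: "Lr 2 w"
    and lim1: "AE x in lborel. (\<lambda>k. convolution (mollifier (\<sigma> k)) \<psi> x) \<longlonglongrightarrow> \<psi> x"
    and lim2: "AE x in lborel. (\<lambda>k. grad_convolution (mollifier (\<sigma> k)) \<psi> x) \<longlonglongrightarrow> D x"
    and b1: "\<And>k. AE x in lborel. norm (convolution (mollifier (\<sigma> k)) \<psi> x) \<le> w x"
    and b2: "\<And>k. AE x in lborel. norm (grad_convolution (mollifier (\<sigma> k)) \<psi> x) \<le> w x"
  define u where "u k = convolution (mollifier (\<sigma> k)) \<psi>" for k
  define g where "g j k = convolution (partial_deriv j (mollifier (\<sigma> k))) \<psi>" for j k
  note Dm[measurable] = Lr_measurable[OF D]
  note [measurable] = loc_integrable_measurable[OF loc_psi] test_measurable[OF mollifier_test] test_measurable[OF test_partial[OF mollifier_test]]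
  have [measurable]: "u k \<in> borel_measurable borel" "g j k \<in> borel_measurable borel" for j k
    unfolding u_def g_def by measurable
  have Dj[measurable]: "(\<lambda>x. D x $ j) \<in> borel_measurable borel" for j
    using borel_measurable_continuous_on[OF linear_continuous_on[OF bounded_linear_vec_nth] Dm] by simp
  have wl: "loc_integrable w" by (rule Lr_imp_loc_integrable[OF w]) simp
  have Dl: "loc_integrable D" by (rule Lr_imp_loc_integrable[OF D]) simp
  have der: "((\<lambda>t. u k (x + t *\<^sub>R axis j 1)) has_vector_derivative g j k x) (at 0)" for j k x
    unfolding u_def g_def by (rule convolution_has_derivative[OF mollifier_test loc_psi])
  have cu: "continuous_on UNIV (u k)" and cg: "continuous_on UNIV (g j k)" for j k
    unfolding u_def g_def by (intro convolution_continuous mollifier_test test_partial loc_psi)+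
  have ul: "AE x in lborel. (\<lambda>k. u k x) \<longlonglongrightarrow> \<psi> x" using lim1 by (simp add: u_def)
  have ub: "AE x in lborel. norm (u k x) \<le> w x" for k using b1[of k] by (simp add: u_def)
  have gl: "AE x in lborel. (\<lambda>k. g j k x) \<longlonglongrightarrow> D x $ j" for j
    using lim2
  proof eventually_elim
    case (elim x)
    from tendsto_vec_nth[OF this, of j] show ?case by (simp add: grad_convolution_def g_def)
  qed
  have gb: "AE x in lborel. norm (g j k x) \<le> w x" for j k
    using b2[of k]
  proof eventually_elim
    case (elim x)
    then show ?case using norm_vec_component[of "grad_convolution (mollifier (\<sigma> k)) \<psi> x" j] by (simp add: grad_convolution_def g_def)
  qed
  have W1: "(LINT x|lborel. partial_deriv j \<phi> x *\<^sub>R \<psi> x) = - (LINT x|lborel. \<phi> x *\<^sub>R (D x $ j))"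
    if \<phi>: "\<phi> \<in> test_functions" for \<phi> j
  proof -
    have "(\<lambda>k. LINT x|lborel. partial_deriv j \<phi> x *\<^sub>R u k x) \<longlonglongrightarrow> (LINT x|lborel. partial_deriv j \<phi> x *\<^sub>R \<psi> x)"
      by (rule test_dominated_convergence[OF test_partial[OF \<phi>] wl _ _ ul ub]) measurable
    moreover have "(LINT x|lborel. partial_deriv j \<phi> x *\<^sub>R u k x) = - (LINT x|lborel. \<phi> x *\<^sub>R g j k x)" for k
      by (rule test_integration_by_parts[OF \<phi> der cu cg])
    moreover have "(\<lambda>k. - (LINT x|lborel. \<phi> x *\<^sub>R g j k x)) \<longlonglongrightarrow> - (LINT x|lborel. \<phi> x *\<^sub>R (D x $ j))"
      by (intro tendsto_minus test_dominated_convergence[OF \<phi> wl _ _ gl gb]) measurable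
    ultimately show ?thesis using LIMSEQ_unique by (simp only:) blast
  qed
  have W2: "(LINT x|lborel. partial_deriv j \<phi> x *\<^sub>R sqrt (\<psi> x \<bullet> \<psi> x + e\<^sup>2)) =
        - (LINT x|lborel. \<phi> x *\<^sub>R ((\<psi> x \<bullet> D x $ j) / sqrt (\<psi> x \<bullet> \<psi> x + e\<^sup>2)))"
    if \<phi>: "\<phi> \<in> test_functions" and e: "e > 0" for \<phi> j e
  proof -
    have pos: "v \<bullet> v + e\<^sup>2 > 0" for v :: 'b using e by (simp add: add_nonneg_pos)
    let ?s = "\<lambda>k x. sqrt (u k x \<bullet> u k x + e\<^sup>2)"
    let ?d = "\<lambda>k x. (u k x \<bullet> g j k x) / sqrt (u k x \<bullet> u k x + e\<^sup>2)"
    have "(\<lambda>k. LINT x|lborel. partial_deriv j \<phi> x *\<^sub>R ?s k x) \<longlonglongrightarrow> (LINT x|lborel. partial_deriv j \<phi> x *\<^sub>R sqrt (\<psi> x \<bullet> \<psi> x + e\<^sup>2))"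
    proof (rule test_dominated_convergence[OF test_partial[OF \<phi>] loc_integrable_add[OF wl loc_integrable_const[of e]]])
      show "AE x in lborel. (\<lambda>k. ?s k x) \<longlonglongrightarrow> sqrt (\<psi> x \<bullet> \<psi> x + e\<^sup>2)"
        using ul by eventually_elim (intro tendsto_intros)
      show "AE x in lborel. norm (?s k x) \<le> w x + e" for k
        using ub[of k]
      proof eventually_elim
        case (elim x)
        then show ?case using sqrt_reg_bound[of "u k x" e] e by simp
      qed
    qed measurable
    moreover have "(LINT x|lborel. partial_deriv j \<phi> x *\<^sub>R ?s k x) = - (LINT x|lborel. \<phi> x *\<^sub>R ?d k x)" for k
    proof (rule test_integration_by_parts[OF \<phi>])
      fix x
      define U where "U t = u k (x + t *\<^sub>R axis j 1)" for t
      have U0: "U 0 = u k x" by (simp add: U_def)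
      have N: "(U has_derivative (\<lambda>h. h *\<^sub>R g j k x)) (at 0)"
        using der[of k x j] by (simp add: has_vector_derivative_def U_def[abs_def])
      have I: "((\<lambda>t. U t \<bullet> U t + e\<^sup>2) has_derivative (\<lambda>h. (U 0 \<bullet> (h *\<^sub>R g j k x) + (h *\<^sub>R g j k x) \<bullet> U 0) + 0)) (at 0)"
        by (rule has_derivative_add[OF has_derivative_inner[OF N N] has_derivative_const])
      have "(\<lambda>h. (U 0 \<bullet> (h *\<^sub>R g j k x) + (h *\<^sub>R g j k x) \<bullet> U 0) + 0) = (*) (2 * (u k x \<bullet> g j k x))"
      proof
        fix h :: real
        have "h * c + h * c + 0 = 2 * c * h" for c :: real by simp
        then show "(U 0 \<bullet> (h *\<^sub>R g j k x) + (h *\<^sub>R g j k x) \<bullet> U 0) + 0 = 2 * (u k x \<bullet> g j k x) * h"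
          by (simp only: U0 inner_scaleR_left inner_scaleR_right inner_commute[of "g j k x" "u k x"])
      qed
      then have "((\<lambda>t. U t \<bullet> U t + e\<^sup>2) has_real_derivative 2 * (u k x \<bullet> g j k x)) (at 0)"
        using I by (simp only: has_field_derivative_def)
      moreover have "(sqrt has_real_derivative inverse (sqrt (U 0 \<bullet> U 0 + e\<^sup>2)) / 2) (at (U 0 \<bullet> U 0 + e\<^sup>2))"
        by (rule DERIV_real_sqrt[OF pos])
      ultimately have "((\<lambda>t. sqrt (U t \<bullet> U t + e\<^sup>2)) has_real_derivative
           inverse (sqrt (U 0 \<bullet> U 0 + e\<^sup>2)) / 2 * (2 * (u k x \<bullet> g j k x))) (at 0)"
        by (rule DERIV_chain2[rotated])
      moreover have "inverse S / 2 * (2 * c) = c / S" for S c :: real by (cases "S = 0") (auto simp: field_simps)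
      ultimately have "((\<lambda>t. sqrt (U t \<bullet> U t + e\<^sup>2)) has_vector_derivative ?d k x) (at 0)"
        by (simp only: has_real_derivative_iff_has_vector_derivative U0)
      then show "((\<lambda>t. ?s k (x + t *\<^sub>R axis j 1)) has_vector_derivative ?d k x) (at 0)" by (simp only: U_def)
    next
      show "continuous_on UNIV (?s k)" using cu by (intro continuous_intros)
      have "sqrt (u k x \<bullet> u k x + e\<^sup>2) \<noteq> 0" for x using pos[of "u k x"] by simp
      then show "continuous_on UNIV (?d k)" using cu cg by (intro continuous_intros) auto
    qed
    moreover have "(\<lambda>k. - (LINT x|lborel. \<phi> x *\<^sub>R ?d k x)) \<longlonglongrightarrow> - (LINT x|lborel. \<phi> x *\<^sub>R ((\<psi> x \<bullet> D x $ j) / sqrt (\<psi> x \<bullet> \<psi> x + e\<^sup>2)))"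
    proof (intro tendsto_minus test_dominated_convergence[OF \<phi> wl])
      show "AE x in lborel. (\<lambda>k. ?d k x) \<longlonglongrightarrow> (\<psi> x \<bullet> D x $ j) / sqrt (\<psi> x \<bullet> \<psi> x + e\<^sup>2)"
        using ul gl[of j]
      proof eventually_elim
        case (elim x)
        then show ?case using pos[of "\<psi> x"] by (intro tendsto_intros) auto
      qed
      show "AE x in lborel. norm (?d k x) \<le> w x" for k
        using gb[of j k]
      proof eventually_elim
        case (elim x)
        then show ?case using inner_div_sqrt_bound[of "u k x" "g j k x" e] by simp
      qed
    qed measurable
    ultimately show ?thesis using LIMSEQ_unique by (simp only:) blast
  qed
  have W3: "(LINT x|lborel. partial_deriv j \<phi> x *\<^sub>R norm (\<psi> x)) = - (LINT x|lborel. \<phi> x *\<^sub>R ((\<psi> x \<bullet> D x $ j) / norm (\<psi> x)))"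
    if \<phi>: "\<phi> \<in> test_functions" for \<phi> j
  proof -
    define e where "e n = 1 / real (Suc n)" for n
    have e: "e n > 0" "e n \<le> 1" for n by (simp_all add: e_def)
    have e0: "e \<longlonglongrightarrow> 0" unfolding e_def[abs_def] by (rule LIMSEQ_Suc[OF lim_1_over_n])
    have slim: "(\<lambda>n. sqrt (v \<bullet> v + (e n)\<^sup>2)) \<longlonglongrightarrow> norm v" for v :: 'b
    proof -
      have "(\<lambda>n. sqrt (v \<bullet> v + (e n)\<^sup>2)) \<longlonglongrightarrow> sqrt (v \<bullet> v + 0\<^sup>2)" by (intro tendsto_intros e0)
      then show ?thesis by (simp add: norm_eq_sqrt_inner)
    qed
    have "(\<lambda>n. LINT x|lborel. partial_deriv j \<phi> x *\<^sub>R sqrt (\<psi> x \<bullet> \<psi> x + (e n)\<^sup>2)) \<longlonglongrightarrow> (LINT x|lborel. partial_deriv j \<phi> x *\<^sub>R norm (\<psi> x))"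
    proof (rule test_dominated_convergence[OF test_partial[OF \<phi>] loc_integrable_add[OF loc_integrable_norm[OF loc_psi] loc_integrable_const[of 1]]])
      show "AE x in lborel. norm (sqrt (\<psi> x \<bullet> \<psi> x + (e n)\<^sup>2)) \<le> norm (\<psi> x) + 1" for n
      proof (rule AE_I2)
        fix x show "norm (sqrt (\<psi> x \<bullet> \<psi> x + (e n)\<^sup>2)) \<le> norm (\<psi> x) + 1"
          using sqrt_reg_bound[of "\<psi> x" "e n"] e[of n] by simp
      qed
    qed (auto intro: slim)
    moreover have "(\<lambda>n. - (LINT x|lborel. \<phi> x *\<^sub>R ((\<psi> x \<bullet> D x $ j) / sqrt (\<psi> x \<bullet> \<psi> x + (e n)\<^sup>2)))) \<longlonglongrightarrow>
        - (LINT x|lborel. \<phi> x *\<^sub>R ((\<psi> x \<bullet> D x $ j) / norm (\<psi> x)))"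
    proof (intro tendsto_minus test_dominated_convergence[OF \<phi> loc_integrable_norm[OF Dl]])
      \<comment> \<open>At zeros of \<psi> both quotients are 0, so the convergence holds at every
        point.\<close>
      show "AE x in lborel. (\<lambda>n. (\<psi> x \<bullet> D x $ j) / sqrt (\<psi> x \<bullet> \<psi> x + (e n)\<^sup>2)) \<longlonglongrightarrow> (\<psi> x \<bullet> D x $ j) / norm (\<psi> x)"
      proof (rule AE_I2)
        fix x show "(\<lambda>n. (\<psi> x \<bullet> D x $ j) / sqrt (\<psi> x \<bullet> \<psi> x + (e n)\<^sup>2)) \<longlonglongrightarrow> (\<psi> x \<bullet> D x $ j) / norm (\<psi> x)"
          by (cases "\<psi> x = 0") (auto intro!: tendsto_divide slim)
      qed
      show "AE x in lborel. norm ((\<psi> x \<bullet> D x $ j) / sqrt (\<psi> x \<bullet> \<psi> x + (e n)\<^sup>2)) \<le> norm (D x)" for n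
      proof (rule AE_I2)
        fix x show "norm ((\<psi> x \<bullet> D x $ j) / sqrt (\<psi> x \<bullet> \<psi> x + (e n)\<^sup>2)) \<le> norm (D x)"
          using inner_div_sqrt_bound[of "\<psi> x" "D x $ j" "e n"] norm_vec_component[of "D x" j] by simp
      qed
    qed measurable
    ultimately show ?thesis using LIMSEQ_unique W2[OF \<phi> e(1)] by (simp only:) blast
  qed
  show thesis using D W1 W3 by (rule that)
  qed
qed

text \<open>Once weak derivatives are functions, the distributional equation says that a locally
  integrable function annihilates all test functions.\<close>

theorem pde_AE:
  assumes D: "Lr 2 D" and W: "\<And>\<phi> j. \<phi> \<in> test_functions \<Longrightarrow>
      (LINT x|lborel. partial_deriv j \<phi> x *\<^sub>R \<psi> x) = - (LINT x|lborel. \<phi> x *\<^sub>R (D x $ j))"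
  shows "AE x in lborel. f x + (\<Sum>j\<in>UNIV. B j (D x $ j)) = 0"
proof -
  note Dm[measurable] = Lr_measurable[OF D]
  have Dj: "(\<lambda>x. D x $ j) \<in> borel_measurable borel" for j
    using borel_measurable_continuous_on[OF linear_continuous_on[OF bounded_linear_vec_nth] Dm] by simp
  have "Lr 2 (\<lambda>x. B j (D x $ j))" for j
    by (intro Lr_linear[OF _ lin] Lr_mono[OF D Dj norm_vec_component]) simp_all
  then have Bl: "loc_integrable (\<lambda>x. B j (D x $ j))" for j by (rule Lr_imp_loc_integrable) simp
  have Djl: "loc_integrable (\<lambda>x. D x $ j)" for j
    by (rule Lr_imp_loc_integrable[OF Lr_mono[OF D Dj norm_vec_component]]) simp_all
  have sl: "loc_integrable (\<lambda>x. \<Sum>j\<in>UNIV. B j (D x $ j))"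
  proof -
    have "(\<lambda>x. \<Sum>j\<in>UNIV. B j (D x $ j)) \<in> borel_measurable borel"
      by (intro borel_measurable_sum loc_integrable_measurable Bl)
    moreover have "integrable lborel (\<lambda>x. \<Sum>j\<in>UNIV. indicator (cball 0 R) x *\<^sub>R B j (D x $ j))" for R
      using Bl by (intro Bochner_Integration.integrable_sum) (simp add: loc_integrable_def)
    ultimately show ?thesis by (simp only: loc_integrable_def scaleR_sum_right simp_thms)
  qed
  show ?thesis
  proof (rule fundamental_lemma[OF loc_integrable_add[OF loc_f sl]])
    fix \<phi> :: "real^3 \<Rightarrow> real" assume \<phi>: "\<phi> \<in> test_functions"
    have i: "integrable lborel (\<lambda>x. \<phi> x *\<^sub>R B j (D x $ j))" for j by (rule test_times_integrable[OF \<phi> Bl])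
    have "(LINT x|lborel. \<phi> x *\<^sub>R (f x + (\<Sum>j\<in>UNIV. B j (D x $ j))))
      = (LINT x|lborel. \<phi> x *\<^sub>R f x) + (\<Sum>j\<in>UNIV. LINT x|lborel. \<phi> x *\<^sub>R B j (D x $ j))"
      using i test_times_integrable[OF \<phi> loc_f] by (simp add: scaleR_add_right scaleR_sum_right)
    also have "(\<Sum>j\<in>UNIV. LINT x|lborel. \<phi> x *\<^sub>R B j (D x $ j)) = (\<Sum>j\<in>UNIV. B j (LINT x|lborel. \<phi> x *\<^sub>R (D x $ j)))"
    proof (intro sum.cong refl)
      fix j
      have "(LINT x|lborel. B j (\<phi> x *\<^sub>R (D x $ j))) = B j (LINT x|lborel. \<phi> x *\<^sub>R (D x $ j))"
        using lin by (intro integral_bounded_linear test_times_integrable \<phi> Djl) (simp add: linear_conv_bounded_linear)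
      then show "(LINT x|lborel. \<phi> x *\<^sub>R B j (D x $ j)) = B j (LINT x|lborel. \<phi> x *\<^sub>R (D x $ j))"
        by (simp add: linear_scale[OF lin])
    qed
    also have "\<dots> = - (\<Sum>j\<in>UNIV. B j (LINT x|lborel. partial_deriv j \<phi> x *\<^sub>R \<psi> x))"
      unfolding W[OF \<phi>] by (simp add: linear_neg[OF lin] sum_negf)
    also have "\<dots> = - (LINT x|lborel. \<phi> x *\<^sub>R f x)" by (simp add: pde[OF \<phi>])
    finally show "(LINT x|lborel. \<phi> x *\<^sub>R (f x + (\<Sum>j\<in>UNIV. B j (D x $ j)))) = 0" by simp
  qed
qed

end

context clifford
begin

text \<open>\<open>P\<close> is the orthogonal projection of \<open>a \<otimes> p\<close> onto the kernel of \<open>w \<mapsto> \<Sum>j. B j (w j)\<close>, where \<open>v\<close> lies.\<close>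

theorem diamagnetic_algebra:
  fixes v :: "'n \<Rightarrow> 'b" and p :: 'b
  assumes z: "(\<Sum>j\<in>UNIV. B j (v j)) = 0" and card: "CARD('n) = 3"
  shows "(\<Sum>j\<in>UNIV. (p \<bullet> v j)\<^sup>2) \<le> 2 / 3 * (norm p)\<^sup>2 * (\<Sum>j\<in>UNIV. (norm (v j))\<^sup>2)"
proof (cases "p = 0")
  case False
  define a where "a j = p \<bullet> v j" for j
  define S where "S = (\<Sum>j\<in>UNIV. (a j)\<^sup>2)"
  \<comment> \<open>X is the image of a \<otimes> p under w -> \<Sum>j. B j (w j). The adjoint of
    this map sends X to the family of all - B j X, and the map composed with its adjoint is 3,
    because each B j has square -1; this yields the 1/3 in P.\<close>
  define X where "X = (\<Sum>k\<in>UNIV. B k (a k *\<^sub>R p))"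
  define P where "P j = a j *\<^sub>R p + (1/3) *\<^sub>R B j X" for j
  have XX: "X \<bullet> X = S * (norm p)\<^sup>2"
  proof -
    have "X \<bullet> X = (\<Sum>k\<in>UNIV. X \<bullet> B k (a k *\<^sub>R p))" unfolding X_def by (rule inner_sum_right)
    also have "\<dots> = - (\<Sum>k\<in>UNIV. B k X \<bullet> (a k *\<^sub>R p))" by (simp only: skew sum_negf minus_minus)
    also have "\<dots> = - ((\<Sum>k\<in>UNIV. \<Sum>j\<in>UNIV. B k (B j ((a k * a j) *\<^sub>R p))) \<bullet> p)"
      unfolding X_def by (simp add: linear_sum[OF lin] linear_scale[OF lin] inner_sum_left sum_distrib_left mult_ac)
    also have "(\<Sum>k\<in>UNIV. \<Sum>j\<in>UNIV. B k (B j ((a k * a j) *\<^sub>R p))) = - (\<Sum>j\<in>UNIV. (a j * a j) *\<^sub>R p)"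
      by (rule sum_symmetric) (simp add: mult.commute)
    also have "- (- (\<Sum>j\<in>UNIV. (a j * a j) *\<^sub>R p) \<bullet> p) = S * (norm p)\<^sup>2"
      by (simp add: S_def power2_eq_square[of "a _"] power2_norm_eq_inner scaleR_sum_left[symmetric])
    finally show ?thesis .
  qed
  \<comment> \<open>The kernel is orthogonal to the range of the adjoint.\<close>
  have vB: "(\<Sum>j\<in>UNIV. v j \<bullet> B j w) = 0" for w
  proof -
    have "(\<Sum>j\<in>UNIV. v j \<bullet> B j w) = - ((\<Sum>j\<in>UNIV. B j (v j)) \<bullet> w)" by (simp add: inner_sum_left skew sum_negf)
    then show ?thesis by (simp add: z)
  qed
  have vP: "(\<Sum>j\<in>UNIV. v j \<bullet> P j) = S"
  proof -
    have "(\<Sum>j\<in>UNIV. v j \<bullet> P j) = (\<Sum>j\<in>UNIV. (a j)\<^sup>2) + (1/3) * (\<Sum>j\<in>UNIV. v j \<bullet> B j X)"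
      by (simp add: P_def inner_add_right sum.distrib sum_distrib_left a_def power2_eq_square inner_commute)
    then show ?thesis by (simp add: vB S_def)
  qed
  \<comment> \<open>The coefficient is 1 - 2/3 + 3 (1/9), where the last 3 is the number of
    summands.\<close>
  have PP: "(\<Sum>j\<in>UNIV. P j \<bullet> P j) = 2/3 * S * (norm p)\<^sup>2"
  proof -
    have e: "P j \<bullet> P j = (a j)\<^sup>2 * (norm p)\<^sup>2 - (2/3) * (B j (a j *\<^sub>R p) \<bullet> X) + (1/9) * (X \<bullet> X)" for j
    proof -
      have "B j X \<bullet> B j X = X \<bullet> X" by (simp add: power2_norm_eq_inner[symmetric] norm_B)
      moreover have "p \<bullet> B j X = - (B j p \<bullet> X)" by (simp add: skew)
      ultimately show ?thesis
        by (simp add: P_def inner_add_left inner_add_right inner_commute[of "B j X" p] linear_scale[OF lin] power2_norm_eq_inner power2_eq_square[of "a j"] algebra_simps)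
    qed
    have "(\<Sum>j\<in>UNIV. P j \<bullet> P j) = S * (norm p)\<^sup>2 - (2/3) * (X \<bullet> X) + (\<Sum>j\<in>(UNIV::'n set). (1/9) * (X \<bullet> X))"
      unfolding e sum.distrib sum_subtractf
      by (simp add: S_def sum_distrib_right sum_distrib_left[symmetric] inner_sum_left[symmetric] X_def[symmetric])
    then show ?thesis using card by (simp add: XX)
  qed
  \<comment> \<open>The minimiser of |v|^2 - 2 t S + t^2 (2/3) S |p|^2 in t; expanding this one
    square takes the place of Cauchy--Schwarz.\<close>
  define t where "t = 3 / (2 * (norm p)\<^sup>2)"
  have t: "t > 0" using False by (simp add: t_def)
  have "0 \<le> (\<Sum>j\<in>UNIV. (norm (v j - t *\<^sub>R P j))\<^sup>2)" by (simp add: sum_nonneg)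
  also have "\<dots> = (\<Sum>j\<in>UNIV. (norm (v j))\<^sup>2) - 2 * t * (\<Sum>j\<in>UNIV. v j \<bullet> P j) + t\<^sup>2 * (\<Sum>j\<in>UNIV. P j \<bullet> P j)"
  proof -
    have "(norm (v j - t *\<^sub>R P j))\<^sup>2 = (norm (v j))\<^sup>2 - 2 * t * (v j \<bullet> P j) + t\<^sup>2 * (P j \<bullet> P j)" for j
      unfolding power2_norm_eq_inner
      by (simp add: inner_diff_left inner_diff_right inner_commute[of "P j" "v j"] power2_eq_square algebra_simps)
    then show ?thesis by (simp add: sum.distrib sum_subtractf sum_distrib_left)
  qed
  also have "\<dots> = (\<Sum>j\<in>UNIV. (norm (v j))\<^sup>2) - t * S"
  proof -
    have "t * (norm p)\<^sup>2 = 3/2" using False by (simp add: t_def)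
    then have "t\<^sup>2 * (2/3 * S * (norm p)\<^sup>2) = t * S" by (simp add: power2_eq_square mult.assoc)
    then show ?thesis by (simp add: vP PP)
  qed
  finally have "t * S \<le> (\<Sum>j\<in>UNIV. (norm (v j))\<^sup>2)" by simp
  then have "S \<le> (\<Sum>j\<in>UNIV. (norm (v j))\<^sup>2) / t" using t by (simp add: pos_le_divide_eq mult.commute)
  also have "\<dots> = 2 / 3 * (norm p)\<^sup>2 * (\<Sum>j\<in>UNIV. (norm (v j))\<^sup>2)" by (simp add: t_def)
  finally show ?thesis by (simp add: S_def a_def)
qed simp

end

subsection \<open>Pauli matrices and the Lebesgue completion\<close>

text \<open>Multiplication by i turns the Hermitian Pauli matrices into skew maps with square -1 on
  C^2, regarded as a real inner product space.\<close>

definition pauli_B :: "3 \<Rightarrow> complex^2 \<Rightarrow> complex^2" where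
  "pauli_B j v = pauli $ j *v (\<i> *s v)"

lemma pauli_mult_vec:
  "(pauli $ 1 *v v) $ 1 = v $ 2" "(pauli $ 1 *v v) $ 2 = v $ 1"
  "(pauli $ 2 *v v) $ 1 = - \<i> * v $ 2" "(pauli $ 2 *v v) $ 2 = \<i> * v $ 1"
  "(pauli $ 3 *v v) $ 1 = v $ 1" "(pauli $ 3 *v v) $ 2 = - v $ 2"
  by (simp_all add: pauli_def matrix_vector_mult_def sum_2)

lemma pauli_scaleR: "pauli $ j *v (c *\<^sub>R v) = c *\<^sub>R (pauli $ j *v v)"
  by (simp add: vec_eq_iff matrix_vector_mult_def scaleR_sum_right)

lemma pauli_add: "pauli $ j *v (v + w) = pauli $ j *v v + pauli $ j *v w"
  by (simp add: matrix_vector_right_distrib)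

lemma linear_pauli: "linear (\<lambda>v. pauli $ j *v v)"
  by (intro linearI pauli_add pauli_scaleR)

lemma pauli_B_linear: "linear (pauli_B j)"
  unfolding pauli_B_def
  by (intro linearI) (auto simp: vec_eq_iff matrix_vector_mult_def sum_2 algebra_simps)

lemma clifford_pauli: "clifford pauli_B"
proof (rule clifford.intro)
  show "linear (pauli_B j)" for j by (rule pauli_B_linear)
  have "\<forall>j. \<forall>v. pauli_B j (pauli_B j v) = - v"
    unfolding forall_3 by (simp add: pauli_B_def vec_eq_iff forall_2 pauli_mult_vec vector_smult_component)
  then show "pauli_B j (pauli_B j v) = - v" for j v by blast
  have "\<forall>j k. j \<noteq> k \<longrightarrow> (\<forall>v. pauli_B j (pauli_B k v) = - pauli_B k (pauli_B j v))"
    unfolding forall_3 by (simp add: pauli_B_def vec_eq_iff forall_2 pauli_mult_vec vector_smult_component)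
  then show "pauli_B j (pauli_B k v) = - pauli_B k (pauli_B j v)" if "j \<noteq> k" for j k v using that by blast
  have "\<forall>j. \<forall>v w. pauli_B j v \<bullet> w = - (v \<bullet> pauli_B j w)"
    unfolding forall_3 by (simp add: pauli_B_def inner_vec_def sum_2 pauli_mult_vec vector_smult_component inner_complex_def)
  then show "pauli_B j v \<bullet> w = - (v \<bullet> pauli_B j w)" for j v w by blast
qed

text \<open>Coordinates with respect to \<open>Basis\<close> reduce the claim to real-valued
  functions on the completion.\<close>

lemma borel_version:
  fixes f :: "'a::euclidean_space \<Rightarrow> 'b::euclidean_space"
  assumes f: "f \<in> borel_measurable lebesgue"
  obtains g where "g \<in> borel_measurable borel" "AE x in lborel. f x = g x"
proof -
  have "\<exists>h. h \<in> borel_measurable lborel \<and> (AE x in lborel. f x \<bullet> b = h x)" for b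
  proof -
    have "(\<lambda>x. f x \<bullet> b) \<in> borel_measurable lebesgue" using f by measurable
    from completion_ex_borel_measurable_real[OF this] show ?thesis by blast
  qed
  then have "\<forall>b. \<exists>h. h \<in> borel_measurable lborel \<and> (AE x in lborel. f x \<bullet> b = h x)" ..
  from choice[OF this] obtain h where h: "\<forall>b. h b \<in> borel_measurable lborel \<and> (AE x in lborel. f x \<bullet> b = h b x)" ..
  then have [measurable]: "h b \<in> borel_measurable borel" for b by simp
  define g where "g x = (\<Sum>b\<in>Basis. h b x *\<^sub>R b)" for x
  have "g \<in> borel_measurable borel" unfolding g_def[abs_def] by measurable
  moreover have "AE x in lborel. \<forall>b\<in>Basis. f x \<bullet> b = h b x"
    using h by (intro AE_finite_allI) auto
  then have "AE x in lborel. f x = g x"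
  proof eventually_elim
    case (elim x)
    have "f x = (\<Sum>b\<in>Basis. (f x \<bullet> b) *\<^sub>R b)" by (rule euclidean_representation[symmetric])
    also have "\<dots> = g x" unfolding g_def using elim by (intro sum.cong) auto
    finally show ?case .
  qed
  ultimately show thesis by (rule that)
qed

section \<open>Transfer between \<open>lebesgue\<close> and \<open>lborel\<close>\<close>

lemma AE_lebesgue: "(AE x in lebesgue. P x) \<longleftrightarrow> (AE x in lborel. P x)"
  by (rule AE_completion_iff)

lemma lebesgue_borel: "f \<in> borel_measurable borel \<Longrightarrow> f \<in> borel_measurable lebesgue"
  by (rule measurable_completion) simp

lemma integrable_lebesgue_lborel:
  fixes f g :: "'a::euclidean_space \<Rightarrow> 'b::euclidean_space"
  assumes "f \<in> borel_measurable lebesgue" "g \<in> borel_measurable borel" "AE x in lborel. f x = g x"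
  shows "integrable lebesgue f \<longleftrightarrow> integrable lborel g"
proof -
  have "integrable lebesgue f \<longleftrightarrow> integrable lebesgue g"
    using assms by (intro integrable_cong_AE) (auto simp: lebesgue_borel AE_lebesgue)
  also have "\<dots> \<longleftrightarrow> integrable lborel g" using assms by (intro integrable_completion) simp
  finally show ?thesis .
qed

lemma integral_lebesgue_lborel:
  fixes f g :: "'a::euclidean_space \<Rightarrow> 'b::euclidean_space"
  assumes "f \<in> borel_measurable lebesgue" "g \<in> borel_measurable borel" "AE x in lborel. f x = g x"
  shows "integral\<^sup>L lebesgue f = integral\<^sup>L lborel g"
proof -
  have "integral\<^sup>L lebesgue f = integral\<^sup>L lebesgue g"
    using assms by (intro integral_cong_AE) (auto simp: lebesgue_borel AE_lebesgue)
  also have "\<dots> = integral\<^sup>L lborel g" using assms by (intro integral_completion) simp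
  finally show ?thesis .
qed

lemma in_Lp_iff_Lr:
  fixes f g :: "real^'n::finite \<Rightarrow> 'b::euclidean_space"
  assumes f: "f \<in> borel_measurable lebesgue" and g[measurable]: "g \<in> borel_measurable borel" and fg: "AE x in lborel. f x = g x"
  shows "in_Lp r f \<longleftrightarrow> Lr r g"
proof -
  have [measurable]: "f \<in> borel_measurable lebesgue" by (rule f)
  have "integrable lebesgue (\<lambda>x. norm (f x) powr r) \<longleftrightarrow> integrable lborel (\<lambda>x. norm (g x) powr r)"
  proof (rule integrable_lebesgue_lborel)
    show "(\<lambda>x. norm (f x) powr r) \<in> borel_measurable lebesgue" by measurable
    show "(\<lambda>x. norm (g x) powr r) \<in> borel_measurable borel" by measurable
    show "AE x in lborel. norm (f x) powr r = norm (g x) powr r" using fg by eventually_elim simp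
  qed
  then show ?thesis using f integrable_powr_iff[of g lborel r] by (simp add: in_Lp_def Lr_def)
qed

lemma locally_integrable_iff_loc_integrable:
  fixes f g :: "real^'n::finite \<Rightarrow> 'b::euclidean_space"
  assumes f: "f \<in> borel_measurable lebesgue" and g: "g \<in> borel_measurable borel" and fg: "AE x in lborel. f x = g x"
  shows "locally_integrable f \<longleftrightarrow> loc_integrable g"
proof -
  have eq: "set_integrable lebesgue K f \<longleftrightarrow> integrable lborel (\<lambda>x. indicator K x *\<^sub>R g x)" if K: "compact K" for K :: "(real^'n) set"
    unfolding set_integrable_def
  proof (rule integrable_lebesgue_lborel)
    have Kb[measurable]: "K \<in> sets borel" using K by (simp add: borel_compact)
    then have Kl[measurable]: "K \<in> sets lebesgue" by simp
    have [measurable]: "f \<in> borel_measurable lebesgue" "g \<in> borel_measurable borel" by fact+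
    show "(\<lambda>x. indicator K x *\<^sub>R f x) \<in> borel_measurable lebesgue" by measurable
    show "(\<lambda>x. indicator K x *\<^sub>R g x) \<in> borel_measurable borel" by measurable
    show "AE x in lborel. indicator K x *\<^sub>R f x = indicator K x *\<^sub>R g x" using fg by eventually_elim simp
  qed
  show ?thesis
  proof
    assume "locally_integrable f"
    then show "loc_integrable g" using g eq[OF compact_cball] by (simp add: locally_integrable_def loc_integrable_def)
  next
    assume l: "loc_integrable g"
    show "locally_integrable f" unfolding locally_integrable_def
    proof (intro allI impI)
      fix K :: "(real^'n) set" assume K: "compact K"
      then have "integrable lborel (\<lambda>x. indicator K x *\<^sub>R g x)"
        by (intro loc_integrable_bounded_set_integrable[OF l]) (auto simp: compact_imp_bounded borel_compact)
      then show "set_integrable lebesgue K f" by (simp add: eq[OF K])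
    qed
  qed
qed

lemma distr_of_eq:
  fixes f g :: "real^'n::finite \<Rightarrow> 'b::euclidean_space"
  assumes \<phi>: "\<phi> \<in> test_functions" and f: "f \<in> borel_measurable lebesgue" and g: "g \<in> borel_measurable borel" and fg: "AE x in lborel. f x = g x"
  shows "distr_of f \<phi> = (LINT x|lborel. \<phi> x *\<^sub>R g x)"
  unfolding distr_of_def
proof (rule integral_lebesgue_lborel)
  note [measurable] = test_measurable[OF \<phi>] lebesgue_borel[OF test_measurable[OF \<phi>]] f g
  show "(\<lambda>x. \<phi> x *\<^sub>R f x) \<in> borel_measurable lebesgue" by measurable
  show "(\<lambda>x. \<phi> x *\<^sub>R g x) \<in> borel_measurable borel" by measurable
  show "AE x in lborel. \<phi> x *\<^sub>R f x = \<phi> x *\<^sub>R g x" using fg by eventually_elim simp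
qed

text \<open>Local integrability gives measurability of the restrictions to balls, which converge
  pointwise to f.\<close>

lemma locally_integrable_measurable:
  fixes f :: "real^'n::finite \<Rightarrow> 'b::euclidean_space"
  assumes "locally_integrable f" shows "f \<in> borel_measurable lebesgue"
proof (rule borel_measurable_LIMSEQ_metric)
  fix n :: nat
  have "set_integrable lebesgue (cball 0 (real n)) f" using assms by (simp add: locally_integrable_def)
  then show "(\<lambda>x. indicator (cball 0 (real n)) x *\<^sub>R f x) \<in> borel_measurable lebesgue"
    by (auto simp: set_integrable_def)
next
  fix x :: "real^'n"
  obtain N where N: "norm x \<le> real N" using real_arch_simple by blast
  have "\<forall>\<^sub>F n in sequentially. indicator (cball 0 (real n)) x *\<^sub>R f x = f x"
    by (rule eventually_sequentiallyI[of N]) (use N in simp)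
  then show "(\<lambda>n. indicator (cball 0 (real n)) x *\<^sub>R f x) \<longlonglongrightarrow> f x" by (rule tendsto_eventually)
qed

lemma component_measurable:
  fixes D :: "'a::euclidean_space \<Rightarrow> 'b::euclidean_space^'n::finite"
  assumes "D \<in> borel_measurable M" shows "(\<lambda>x. D x $ j) \<in> borel_measurable M"
  using borel_measurable_continuous_on[OF linear_continuous_on[OF bounded_linear_vec_nth] assms] by simp

lemma has_weak_gradient_iff:
  fixes f f' :: "real^'n::finite \<Rightarrow> 'b::euclidean_space" and g g' :: "real^'n \<Rightarrow> 'b^'n"
  assumes f: "f \<in> borel_measurable lebesgue" "f' \<in> borel_measurable borel" "AE x in lborel. f x = f' x"
    and g: "g \<in> borel_measurable lebesgue" "g' \<in> borel_measurable borel" "AE x in lborel. g x = g' x"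
  shows "has_weak_gradient f g \<longleftrightarrow> loc_integrable f' \<and> loc_integrable g' \<and>
    (\<forall>j. \<forall>\<phi>\<in>test_functions. (LINT x|lborel. partial_deriv j \<phi> x *\<^sub>R f' x) = - (LINT x|lborel. \<phi> x *\<^sub>R (g' x $ j)))"
proof -
  have c: "(distr_deriv j (distr_of f) \<phi> = distr_of (\<lambda>x. g x $ j) \<phi>) \<longleftrightarrow>
      ((LINT x|lborel. partial_deriv j \<phi> x *\<^sub>R f' x) = - (LINT x|lborel. \<phi> x *\<^sub>R (g' x $ j)))"
    if \<phi>: "\<phi> \<in> test_functions" for j \<phi>
  proof -
    have "AE x in lborel. g x $ j = g' x $ j" using g(3) by eventually_elim simp
    then have "distr_of (\<lambda>x. g x $ j) \<phi> = (LINT x|lborel. \<phi> x *\<^sub>R (g' x $ j))"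
      by (intro distr_of_eq \<phi> component_measurable g)
    moreover have "distr_deriv j (distr_of f) \<phi> = - (LINT x|lborel. partial_deriv j \<phi> x *\<^sub>R f' x)"
      unfolding distr_deriv_def by (simp add: distr_of_eq[OF test_partial[OF \<phi>] f])
    ultimately show ?thesis by (auto simp: minus_equation_iff)
  qed
  then show ?thesis
    unfolding has_weak_gradient_def locally_integrable_iff_loc_integrable[OF f] locally_integrable_iff_loc_integrable[OF g] by auto
qed

text \<open>The final inequality is claimed for every pair of weak gradients, whereas the
  construction produces one pair.\<close>

lemma weak_gradient_unique:
  fixes g h :: "real^'n::finite \<Rightarrow> 'b::euclidean_space^'n"
  assumes g: "loc_integrable g" "loc_integrable h"
    and eq: "\<And>j \<phi>. \<phi> \<in> test_functions \<Longrightarrow> (LINT x|lborel. \<phi> x *\<^sub>R (g x $ j)) = (LINT x|lborel. \<phi> x *\<^sub>R (h x $ j))"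
  shows "AE x in lborel. g x = h x"
proof -
  have cl: "loc_integrable (\<lambda>x. g x $ j)" if "loc_integrable g" for g :: "real^'n \<Rightarrow> 'b^'n" and j
  proof -
    have m: "(\<lambda>x. g x $ j) \<in> borel_measurable borel" by (intro component_measurable loc_integrable_measurable that)
    have "integrable lborel (\<lambda>y. indicator (cball 0 R) y *\<^sub>R (g y $ j))" for R
    proof (rule integrable_dominated[OF loc_integrable_norm_integrable[OF that, of R]])
      have [measurable]: "cball (0::real^'n) R \<in> sets borel" by (rule borel_closed) simp
      note [measurable] = m
      show "(\<lambda>y. indicator (cball 0 R) y *\<^sub>R (g y $ j)) \<in> borel_measurable lborel" by measurable
      show "norm (indicator (cball 0 R) y *\<^sub>R (g y $ j)) \<le> indicator (cball 0 R) y * norm (g y)" for y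
        by (simp add: mult_left_mono norm_vec_component)
    qed
    then show ?thesis using m by (simp add: loc_integrable_def)
  qed
  have "AE x in lborel. g x $ j - h x $ j = 0" for j
  proof (rule fundamental_lemma)
    have "loc_integrable (\<lambda>x. - (h x $ j))" using cl[OF g(2), of j] by (simp add: loc_integrable_def)
    then show "loc_integrable (\<lambda>x. g x $ j - h x $ j)" using loc_integrable_add[OF cl[OF g(1), of j]] by fastforce
    fix \<phi> :: "real^'n \<Rightarrow> real" assume \<phi>: "\<phi> \<in> test_functions"
    show "(LINT x|lborel. \<phi> x *\<^sub>R (g x $ j - h x $ j)) = 0"
      using test_times_integrable[OF \<phi> cl[OF g(1), of j]] test_times_integrable[OF \<phi> cl[OF g(2), of j]] eq[OF \<phi>, of j]
      by (simp add: scaleR_diff_right)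
  qed
  then have "AE x in lborel. \<forall>j. g x $ j - h x $ j = 0" by (simp add: AE_all_countable)
  then show ?thesis by eventually_elim (simp add: vec_eq_iff)
qed

text \<open>Young's inequality with exponents 3/2 and 3 applied to a^2 and u^2; with u in L^6 it
  puts A \<psi> in L^2.\<close>

lemma mult_powr_bound:
  fixes a u :: real
  assumes "0 \<le> a" "0 \<le> u" shows "(a * u)\<^sup>2 \<le> a powr 3 + u powr 6"
proof -
  have "a\<^sup>2 * u\<^sup>2 \<le> (a\<^sup>2) powr (3/2) / (3/2) + (u\<^sup>2) powr 3 / 3"
    by (rule Youngs_inequality) auto
  also have "(a\<^sup>2) powr (3/2) = a powr 3"
  proof -
    have "a\<^sup>2 = a powr 2" using assms by (simp add: powr_numeral)
    then show ?thesis by (simp only: powr_powr) simp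
  qed
  also have "(u\<^sup>2) powr 3 = u powr 6"
  proof -
    have "u\<^sup>2 = u powr 2" using assms by (simp add: powr_numeral)
    then show ?thesis by (simp only: powr_powr) simp
  qed
  also have "a powr 3 / (3/2) + u powr 6 / 3 \<le> a powr 3 + u powr 6"
    using powr_ge_zero[of a 3] powr_ge_zero[of u 6] by (simp add: field_simps)
  finally show ?thesis by (simp add: power_mult_distrib)
qed

text \<open>Young's inequality with exponents 3 and 3/2, after which p \<ge> 3/2 absorbs u^(3/2). It
  makes A \<psi> locally integrable.\<close>

lemma mult_le_powr_bound:
  fixes a u p :: real
  assumes "0 \<le> a" "0 \<le> u" "3/2 \<le> p" shows "a * u \<le> a powr 3 + 1 + u powr p"
proof -
  have "a * u \<le> a powr 3 / 3 + u powr (3/2) / (3/2)" using assms by (intro Youngs_inequality) auto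
  also have "\<dots> \<le> a powr 3 + u powr (3/2)"
    using powr_ge_zero[of a 3] powr_ge_zero[of u "3/2"] by (simp add: field_simps)
  also have "u powr (3/2) \<le> 1 + u powr p" using assms by (intro powr_le_one_add) auto
  finally show ?thesis by simp
qed

theorem lemma3p1:
  fixes A :: "real^3 \<Rightarrow> real^3"
    and \<psi> :: "real^3 \<Rightarrow> complex^2"
    and p :: real
  assumes "in_Lp 3 A"
    and "3 / 2 < p"
    and "in_Lp p \<psi>"
    and "\<forall>\<phi>\<in>test_functions. pauli_dirac A \<psi> \<phi> = 0"
  shows "in_H1 \<psi> \<and> in_H1 (\<lambda>x. norm (\<psi> x)) \<and>
    (\<forall>D G. has_weak_gradient \<psi> D \<longrightarrow> has_weak_gradient (\<lambda>x. norm (\<psi> x)) G \<longrightarrow>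
      (AE x in lebesgue.
        (norm (G x))\<^sup>2
          \<le> 2 / 3 * (\<Sum>j\<in>UNIV. (norm ((-\<i>) *s (D x $ j) - A x $ j *\<^sub>R \<psi> x))\<^sup>2)))"
proof -
  have Am: "A \<in> borel_measurable lebesgue" and \<psi>m: "\<psi> \<in> borel_measurable lebesgue"
    using assms by (auto simp: in_Lp_def)
  \<comment> \<open>All estimates are made for Borel representatives a of A and u of \<psi>.\<close>
  obtain a where a[measurable]: "a \<in> borel_measurable borel" and Aa: "AE x in lborel. A x = a x"
    using borel_version[OF Am] by blast
  obtain u where u[measurable]: "u \<in> borel_measurable borel" and \<psi>u: "AE x in lborel. \<psi> x = u x"
    using borel_version[OF \<psi>m] by blast
  have aL: "Lr 3 a" using assms(1) in_Lp_iff_Lr[OF Am a Aa] by blast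
  have uL: "Lr p u" using assms(3) in_Lp_iff_Lr[OF \<psi>m u \<psi>u] by blast
  have p1: "p > 1" using assms(2) by simp
  have aj[measurable]: "(\<lambda>x. a x $ j) \<in> borel_measurable borel" for j by (rule component_measurable[OF a])
  \<comment> \<open>The right-hand side \<sigma> \<cdot> A \<psi> of the Dirac equation.\<close>
  define F where "F x = (\<Sum>j\<in>UNIV. a x $ j *\<^sub>R (pauli $ j *v u x))" for x
  have [measurable]: "(\<lambda>v. pauli $ j *v v) \<in> borel_measurable borel" for j
    using linear_pauli by (auto intro!: borel_measurable_continuous_onI linear_continuous_on simp: linear_conv_bounded_linear)
  have F[measurable]: "F \<in> borel_measurable borel" unfolding F_def[abs_def] by measurable
  interpret clifford pauli_B by (rule clifford_pauli)
  have npauli: "norm (pauli $ j *v v) = norm v" for j v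
  proof -
    have "pauli $ j *v v = pauli_B j ((-\<i>) *s v)" by (simp add: pauli_B_def vec_eq_iff matrix_vector_mult_def)
    then have "norm (pauli $ j *v v) = norm ((-\<i>) *s v)" by (simp add: norm_B)
    also have "\<dots> = norm v" by (simp add: norm_vec_def norm_mult)
    finally show ?thesis .
  qed
  \<comment> \<open>The Pauli matrices are isometries, so each of the three summands of F is at most
    |a| |u|; the factor 3 is absorbed into the potential.\<close>
  define b where "b x = 3 * norm (a x)" for x
  have b[measurable]: "b \<in> borel_measurable borel" unfolding b_def[abs_def] by measurable
  have b0: "b x \<ge> 0" for x by (simp add: b_def)
  have Fb: "norm (F x) \<le> b x * norm (u x)" for x
  proof -
    have "norm (F x) \<le> (\<Sum>j\<in>(UNIV::3 set). norm (a x) * norm (u x))"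
      unfolding F_def by (intro sum_norm_le) (simp add: npauli mult_right_mono component_le_norm_cart)
    then show ?thesis by (simp add: b_def)
  qed
  have b3: "(\<integral>\<^sup>+x. ennreal (b x powr 3) \<partial>lborel) < \<infinity>"
  proof -
    have "(\<integral>\<^sup>+x. ennreal (b x powr 3) \<partial>lborel) = ennreal (3 powr 3) * (\<integral>\<^sup>+x. ennreal (norm (a x) powr 3) \<partial>lborel)"
      unfolding b_def by (intro nn_integral_powr_cmult) auto
    then show ?thesis using aL by (simp add: Lr_def ennreal_mult_less_top)
  qed
  have ul: "loc_integrable u" using Lr_imp_loc_integrable[OF uL] p1 by simp
  have bul: "loc_integrable (\<lambda>x. b x * norm (u x))"
  proof -
    have l1: "loc_integrable (\<lambda>x. b x powr 3)"
    proof (rule Lr_imp_loc_integrable[of 1])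
      show "Lr 1 (\<lambda>x. b x powr 3)" using b3 by (simp add: Lr_def)
    qed simp
    have l2: "loc_integrable (\<lambda>x. norm (u x) powr p)"
    proof (rule Lr_imp_loc_integrable[of 1])
      show "Lr 1 (\<lambda>x. norm (u x) powr p)" using uL by (simp add: Lr_def)
    qed simp
    have l3: "loc_integrable (\<lambda>x. b x powr 3 + 1 + norm (u x) powr p)" by (intro loc_integrable_add l1 l2 loc_integrable_const)
    have "integrable lborel (\<lambda>x. indicator (cball 0 R) x *\<^sub>R (b x * norm (u x)))" for R
    proof (rule integrable_dominated)
      show "integrable lborel (\<lambda>x. indicator (cball 0 R) x *\<^sub>R (b x powr 3 + 1 + norm (u x) powr p))" using l3 by (simp add: loc_integrable_def)
      have [measurable]: "cball (0::real^3) R \<in> sets borel" by (rule borel_closed) simp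
      show "(\<lambda>x. indicator (cball 0 R) x *\<^sub>R (b x * norm (u x))) \<in> borel_measurable lborel" by measurable
      fix x
      have "b x * norm (u x) \<le> b x powr 3 + 1 + norm (u x) powr p"
        using b0 assms(2) by (intro mult_le_powr_bound) auto
      then show "norm (indicator (cball 0 R) x *\<^sub>R (b x * norm (u x))) \<le> indicator (cball 0 R) x *\<^sub>R (b x powr 3 + 1 + norm (u x) powr p)"
        using b0[of x] by (auto simp: abs_mult split: split_indicator)
    qed
    then show ?thesis by (simp add: loc_integrable_def)
  qed
  have loc_le: "loc_integrable g" if [measurable]: "g \<in> borel_measurable borel" and le: "\<And>x. norm (g x) \<le> b x * norm (u x)" for g :: "real^3 \<Rightarrow> complex^2"
  proof -
    have "integrable lborel (\<lambda>x. indicator (cball 0 R) x *\<^sub>R g x)" for R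
    proof (rule integrable_dominated)
      show "integrable lborel (\<lambda>x. indicator (cball 0 R) x *\<^sub>R (b x * norm (u x)))" using bul by (simp add: loc_integrable_def)
      have [measurable]: "cball (0::real^3) R \<in> sets borel" by (rule borel_closed) simp
      show "(\<lambda>x. indicator (cball 0 R) x *\<^sub>R g x) \<in> borel_measurable lborel" by measurable
      show "norm (indicator (cball 0 R) x *\<^sub>R g x) \<le> indicator (cball 0 R) x *\<^sub>R (b x * norm (u x))" for x
        using le[of x] by (auto split: split_indicator)
    qed
    then show ?thesis using that by (simp add: loc_integrable_def)
  qed
  have Fl: "loc_integrable F" by (rule loc_le[OF F Fb])
  have ajl: "loc_integrable (\<lambda>x. a x $ j *\<^sub>R u x)" for j
  proof (rule loc_le)
    show "(\<lambda>x. a x $ j *\<^sub>R u x) \<in> borel_measurable borel" by measurable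
    show "norm (a x $ j *\<^sub>R u x) \<le> b x * norm (u x)" for x
    proof -
      have "\<bar>a x $ j\<bar> \<le> b x" using component_le_norm_cart[of "a x" j] norm_ge_zero[of "a x"] unfolding b_def by linarith
      then show ?thesis by (simp add: mult_right_mono)
    qed
  qed
  \<comment> \<open>The sign of \<open>distr_deriv\<close> and the factor -i combine to i, so that
    \<open>pauli_B\<close> appears in front of the integrals of \<psi> and the term with A moves to
    the other side.\<close>
  have dirac: "dirac pauli_B u F"
  proof (intro dirac.intro clifford_pauli dirac_axioms.intro ul Fl)
    fix \<phi> :: "real^3 \<Rightarrow> real" assume \<phi>: "\<phi> \<in> test_functions"
    have d1: "distr_deriv j (distr_of \<psi>) \<phi> = - (LINT x|lborel. partial_deriv j \<phi> x *\<^sub>R u x)" for j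
      unfolding distr_deriv_def by (simp add: distr_of_eq[OF test_partial[OF \<phi>] \<psi>m u \<psi>u])
    have d2: "distr_of (\<lambda>x. A x $ j *\<^sub>R \<psi> x) \<phi> = (LINT x|lborel. \<phi> x *\<^sub>R (a x $ j *\<^sub>R u x))" for j
    proof (rule distr_of_eq[OF \<phi>])
      have [measurable]: "(\<lambda>x. A x $ j) \<in> borel_measurable lebesgue" by (rule component_measurable[OF Am])
      note [measurable] = \<psi>m
      show "(\<lambda>x. A x $ j *\<^sub>R \<psi> x) \<in> borel_measurable lebesgue" by measurable
      show "(\<lambda>x. a x $ j *\<^sub>R u x) \<in> borel_measurable borel" by measurable
      show "AE x in lborel. A x $ j *\<^sub>R \<psi> x = a x $ j *\<^sub>R u x" using Aa \<psi>u by eventually_elim simp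
    qed
    have int: "integrable lborel (\<lambda>x. \<phi> x *\<^sub>R (a x $ j *\<^sub>R u x))" for j by (rule test_times_integrable[OF \<phi> ajl])
    have bl: "bounded_linear (\<lambda>v. pauli $ j *v v)" for j using linear_pauli by (simp add: linear_conv_bounded_linear)
    have int2: "integrable lborel (\<lambda>x. pauli $ j *v (\<phi> x *\<^sub>R (a x $ j *\<^sub>R u x)))" for j
      by (rule integrable_bounded_linear[OF bl int])
    have "0 = pauli_dirac A \<psi> \<phi>" using assms(4) \<phi> by simp
    also have "\<dots> = (\<Sum>j\<in>UNIV. pauli $ j *v ((-\<i>) *s (- (LINT x|lborel. partial_deriv j \<phi> x *\<^sub>R u x)) - (LINT x|lborel. \<phi> x *\<^sub>R (a x $ j *\<^sub>R u x))))"
      unfolding pauli_dirac_def by (simp only: d1 d2)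
    also have "\<dots> = (\<Sum>j\<in>UNIV. pauli_B j (LINT x|lborel. partial_deriv j \<phi> x *\<^sub>R u x))
        - (\<Sum>j\<in>UNIV. pauli $ j *v (LINT x|lborel. \<phi> x *\<^sub>R (a x $ j *\<^sub>R u x)))"
    proof -
      have "(-\<i>) *s (- v) = \<i> *s v" for v :: "complex^2" by (simp add: vec_eq_iff)
      then show ?thesis by (simp only: matrix_vector_mult_diff_distrib sum_subtractf pauli_B_def)
    qed
    also have "(\<Sum>j\<in>UNIV. pauli $ j *v (LINT x|lborel. \<phi> x *\<^sub>R (a x $ j *\<^sub>R u x)))
      = (\<Sum>j\<in>UNIV. LINT x|lborel. pauli $ j *v (\<phi> x *\<^sub>R (a x $ j *\<^sub>R u x)))"
      by (intro sum.cong refl integral_bounded_linear[symmetric] bl int)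
    also have "\<dots> = (LINT x|lborel. (\<Sum>j\<in>UNIV. pauli $ j *v (\<phi> x *\<^sub>R (a x $ j *\<^sub>R u x))))"
      using int2 by (intro Bochner_Integration.integral_sum[symmetric]) auto
    also have "\<dots> = (LINT x|lborel. \<phi> x *\<^sub>R F x)"
      by (simp only: F_def pauli_scaleR scaleR_sum_right)
    finally show "(\<Sum>j\<in>UNIV. pauli_B j (LINT x|lborel. partial_deriv j \<phi> x *\<^sub>R u x)) = (LINT x|lborel. \<phi> x *\<^sub>R F x)" by simp
  qed
  have R: "AE x in lborel. ennreal (norm (u x)) \<le> ennreal (3 / kernel_mass) * riesz (\<lambda>y. b y * norm (u y)) x"
    using dirac.norm_le_riesz[OF dirac uL p1]
  proof eventually_elim
    case (elim x)
    also have "ennreal (3 / kernel_mass) * riesz (\<lambda>y. norm (F y)) x \<le> ennreal (3 / kernel_mass) * riesz (\<lambda>y. b y * norm (u y)) x"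
      by (intro mult_left_mono riesz_mono Fb) simp
    finally show ?case .
  qed
  have c: "3 / kernel_mass > 0" using kernel_mass_pos by simp
  have nu[measurable]: "(\<lambda>x. norm (u x)) \<in> borel_measurable borel" by measurable
  have up: "(\<integral>\<^sup>+x. ennreal (norm (u x) powr p) \<partial>lborel) < \<infinity>" using uL by (simp add: Lr_def)
  \<comment> \<open>For s = 2 the condition is 6/5 \<le> p, implied by p > 3/2. For s = 6 it is 2
    \<le> p, so the second application starts from the exponent 2 just reached.\<close>
  have u2: "(\<integral>\<^sup>+x. ennreal (norm (u x) powr 2) \<partial>lborel) < \<infinity>"
    by (rule riesz_bootstrap[OF nu b norm_ge_zero b0 assms(2) _ _ c up b3 R]) (use assms(2) in auto)
  have u6: "(\<integral>\<^sup>+x. ennreal (norm (u x) powr 6) \<partial>lborel) < \<infinity>"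
    by (rule riesz_bootstrap[OF nu b norm_ge_zero b0 _ _ _ c u2 b3 R]) auto
  have uL2: "Lr 2 u" using u u2 by (simp only: Lr_def)
  have FL2: "Lr 2 F"
  proof -
    have "(\<integral>\<^sup>+x. ennreal (norm (F x) powr 2) \<partial>lborel) \<le> (\<integral>\<^sup>+x. ennreal (b x powr 3) + ennreal (norm (u x) powr 6) \<partial>lborel)"
    proof (intro nn_integral_mono)
      fix x
      have "(norm (F x))\<^sup>2 \<le> (b x * norm (u x))\<^sup>2" by (intro power_mono Fb) simp
      also have "\<dots> \<le> b x powr 3 + norm (u x) powr 6" by (rule mult_powr_bound) (use b0 in auto)
      finally show "ennreal (norm (F x) powr 2) \<le> ennreal (b x powr 3) + ennreal (norm (u x) powr 6)"
        by (simp add: ennreal_leI flip: ennreal_plus)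
    qed
    also have "\<dots> = (\<integral>\<^sup>+x. ennreal (b x powr 3) \<partial>lborel) + (\<integral>\<^sup>+x. ennreal (norm (u x) powr 6) \<partial>lborel)"
      by (intro nn_integral_add) measurable
    also have "\<dots> < \<infinity>" using b3 u6 by simp
    finally show ?thesis using F by (simp only: Lr_def)
  qed
  show ?thesis
  proof (rule dirac.weak_gradients[OF dirac uL2 FL2])
    fix d
    assume d: "Lr 2 d"
      and W: "\<And>\<phi> j. \<phi> \<in> test_functions \<Longrightarrow> (LINT x|lborel. partial_deriv j \<phi> x *\<^sub>R u x) = - (LINT x|lborel. \<phi> x *\<^sub>R (d x $ j))"
      and Wn: "\<And>\<phi> j. \<phi> \<in> test_functions \<Longrightarrow> (LINT x|lborel. partial_deriv j \<phi> x *\<^sub>R norm (u x)) =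
        - (LINT x|lborel. \<phi> x *\<^sub>R ((u x \<bullet> d x $ j) / norm (u x)))"
    note dm[measurable] = Lr_measurable[OF d]
    have dj[measurable]: "(\<lambda>x. d x $ j) \<in> borel_measurable borel" for j by (rule component_measurable[OF dm])
    have dl: "loc_integrable d" by (rule Lr_imp_loc_integrable[OF d]) simp
    \<comment> \<open>The weak gradient of |u|, equal to 0 at zeros of u by the convention on
      division.\<close>
    define e :: "real^3 \<Rightarrow> real^3" where "e x = (\<chi> j. (u x \<bullet> d x $ j) / norm (u x))" for x
    have em[measurable]: "e \<in> borel_measurable borel"
      unfolding e_def[abs_def] by (subst borel_measurable_euclidean_space) (auto simp: Basis_vec_def inner_axis)
    have ed: "norm (e x) \<le> norm (d x)" for x
    proof (rule power2_le_imp_le)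
      have "\<bar>e x $ j\<bar> \<le> norm (d x $ j)" for j
        using inner_div_sqrt_bound[of "u x" "d x $ j" 0] by (simp add: e_def norm_eq_sqrt_inner)
      then have "(e x $ j)\<^sup>2 \<le> (norm (d x $ j))\<^sup>2" for j using abs_le_square_iff[of "e x $ j" "norm (d x $ j)"] by simp
      then show "(norm (e x))\<^sup>2 \<le> (norm (d x))\<^sup>2" unfolding norm_vec_sq by (intro sum_mono) simp
    qed simp
    have eL: "Lr 2 e" by (rule Lr_mono[OF d em ed]) simp
    have el: "loc_integrable e" by (rule Lr_imp_loc_integrable[OF eL]) simp
    have nul: "loc_integrable (\<lambda>x. norm (u x))" by (rule loc_integrable_norm[OF ul])
    have n\<psi>m: "(\<lambda>x. norm (\<psi> x)) \<in> borel_measurable lebesgue" using \<psi>m by measurable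
    have n\<psi>u: "AE x in lborel. norm (\<psi> x) = norm (u x)" using \<psi>u by eventually_elim simp
    have wg1: "has_weak_gradient \<psi> d"
      using has_weak_gradient_iff[OF \<psi>m u \<psi>u lebesgue_borel[OF dm] dm] ul dl W by simp
    have wg2: "has_weak_gradient (\<lambda>x. norm (\<psi> x)) e"
      using has_weak_gradient_iff[OF n\<psi>m nu n\<psi>u lebesgue_borel[OF em] em] nul el Wn by (simp add: e_def)
    have H1: "in_H1 \<psi>"
      unfolding in_H1_def using in_Lp_iff_Lr[OF \<psi>m u \<psi>u, of 2] uL2 wg1 in_Lp_iff_Lr[OF lebesgue_borel[OF dm] dm, of 2] d by auto
    have nuL2: "Lr 2 (\<lambda>x. norm (u x))" using uL2 by (simp add: Lr_def)
    have H1n: "in_H1 (\<lambda>x. norm (\<psi> x))"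
      unfolding in_H1_def using in_Lp_iff_Lr[OF n\<psi>m nu n\<psi>u, of 2] nuL2 wg2 in_Lp_iff_Lr[OF lebesgue_borel[OF em] em, of 2] eL by auto
    have pd: "AE x in lborel. F x + (\<Sum>j\<in>UNIV. pauli_B j (d x $ j)) = 0" by (rule dirac.pde_AE[OF dirac d W])
    have main: "AE x in lborel. (norm (e x))\<^sup>2 \<le> 2 / 3 * (\<Sum>j\<in>UNIV. (norm ((-\<i>) *s (d x $ j) - a x $ j *\<^sub>R u x))\<^sup>2)"
      using pd
    proof eventually_elim
      case (elim x)
      \<comment> \<open>The covariant gradient (\<nabla> - iA) u, which is i times (-i\<nabla> - A)
        u and so has the same norm. In terms of v the equation is the linear constraint that
        \<open>diamagnetic_algebra\<close> requires.\<close>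
      define v where "v j = d x $ j - a x $ j *\<^sub>R (\<i> *s u x)" for j
      have ii: "\<i> *s (\<i> *s w) = - w" for w :: "complex^2" by (simp add: vec_eq_iff)
      have Bi: "pauli_B j (\<i> *s w) = - (pauli $ j *v w)" for j w
        by (simp add: pauli_B_def ii) (simp add: vec_eq_iff matrix_vector_mult_def sum_negf)
      have "(\<Sum>j\<in>UNIV. pauli_B j (v j)) = (\<Sum>j\<in>UNIV. pauli_B j (d x $ j)) + F x"
        by (simp add: v_def linear_diff[OF lin] linear_scale[OF lin] Bi sum.distrib F_def)
      then have z: "(\<Sum>j\<in>UNIV. pauli_B j (v j)) = 0" using elim by (simp add: add.commute)
      have nv: "norm ((-\<i>) *s (d x $ j) - a x $ j *\<^sub>R u x) = norm (v j)" for j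
      proof -
        have "(-\<i>) *s (d x $ j) - a x $ j *\<^sub>R u x = (-\<i>) *s v j"
          by (simp add: v_def vec_eq_iff algebra_simps scaleR_conv_of_real)
        then show ?thesis by (simp add: norm_vec_def norm_mult)
      qed
      \<comment> \<open>For the real inner product u and i u are orthogonal, so A drops out of the
        pairing with u: the gradient of |u| can be computed from v.\<close>
      have "u x \<bullet> (\<i> *s u x) = 0" by (simp add: inner_vec_def inner_complex_def sum_2 mult.commute)
      then have uv: "u x \<bullet> v j = u x \<bullet> d x $ j" for j by (simp add: v_def inner_diff_right)
      have A: "(\<Sum>j\<in>UNIV. (u x \<bullet> v j)\<^sup>2) \<le> 2 / 3 * (norm (u x))\<^sup>2 * (\<Sum>j\<in>UNIV. (norm (v j))\<^sup>2)"
        by (rule diamagnetic_algebra[OF z]) simp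
      have ne: "(norm (e x))\<^sup>2 = (\<Sum>j\<in>UNIV. (u x \<bullet> v j)\<^sup>2) / (norm (u x))\<^sup>2"
        by (simp add: norm_vec_sq e_def uv power_divide sum_divide_distrib)
      show ?case
      proof (cases "u x = 0")
        case True
        then show ?thesis using ne by (simp add: sum_nonneg)
      next
        case False
        then show ?thesis using A unfolding ne nv by (simp add: pos_divide_le_eq mult_ac)
      qed
    qed
    \<comment> \<open>Any weak gradients D and G agree almost everywhere with d and e, and A and
      \<psi> with a and u.\<close>
    have "AE x in lebesgue. (norm (G x))\<^sup>2 \<le> 2 / 3 * (\<Sum>j\<in>UNIV. (norm ((-\<i>) *s (D x $ j) - A x $ j *\<^sub>R \<psi> x))\<^sup>2)"
      if hD: "has_weak_gradient \<psi> D" and hG: "has_weak_gradient (\<lambda>x. norm (\<psi> x)) G" for D G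
    proof -
      have Dm: "D \<in> borel_measurable lebesgue" and Gm: "G \<in> borel_measurable lebesgue"
        using hD hG by (auto simp: has_weak_gradient_def intro: locally_integrable_measurable)
      obtain D' where D': "D' \<in> borel_measurable borel" "AE x in lborel. D x = D' x" using borel_version[OF Dm] by blast
      obtain G' where G': "G' \<in> borel_measurable borel" "AE x in lborel. G x = G' x" using borel_version[OF Gm] by blast
      have hD': "loc_integrable D'" "\<And>j \<phi>. \<phi> \<in> test_functions \<Longrightarrow> (LINT x|lborel. partial_deriv j \<phi> x *\<^sub>R u x) = - (LINT x|lborel. \<phi> x *\<^sub>R (D' x $ j))"
        using hD has_weak_gradient_iff[OF \<psi>m u \<psi>u Dm D'] by auto
      have hG': "loc_integrable G'" "\<And>j \<phi>. \<phi> \<in> test_functions \<Longrightarrow> (LINT x|lborel. partial_deriv j \<phi> x *\<^sub>R norm (u x)) = - (LINT x|lborel. \<phi> x *\<^sub>R (G' x $ j))"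
        using hG has_weak_gradient_iff[OF n\<psi>m nu n\<psi>u Gm G'] by auto
      have Dd: "AE x in lborel. D' x = d x"
      proof (rule weak_gradient_unique[OF hD'(1) dl])
        fix j and \<phi> :: "real^3 \<Rightarrow> real" assume \<phi>: "\<phi> \<in> test_functions"
        from trans[OF sym[OF hD'(2)[OF \<phi>, of j]] W[OF \<phi>, of j]]
        show "(LINT x|lborel. \<phi> x *\<^sub>R (D' x $ j)) = (LINT x|lborel. \<phi> x *\<^sub>R (d x $ j))" by simp
      qed
      have Ge: "AE x in lborel. G' x = e x"
      proof (rule weak_gradient_unique[OF hG'(1) el])
        fix j and \<phi> :: "real^3 \<Rightarrow> real" assume \<phi>: "\<phi> \<in> test_functions"
        from trans[OF sym[OF hG'(2)[OF \<phi>, of j]] Wn[OF \<phi>, of j]]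
        show "(LINT x|lborel. \<phi> x *\<^sub>R (G' x $ j)) = (LINT x|lborel. \<phi> x *\<^sub>R (e x $ j))" by (simp add: e_def)
      qed
      show ?thesis
        unfolding AE_lebesgue using main Dd Ge D'(2) G'(2) Aa \<psi>u by eventually_elim simp
    qed
    then show ?thesis using H1 H1n by blast
  qed
qed
end
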